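(* Let $r_*$ satisfy $\frac3{5-a}<r_*<1$, $r_*\ge\frac1{2-a}$; set $\lambda_0=\frac{r_*(5-a)-3}{3r_*}$; fix $\tilde\kappa\in(1,\sqrt{1+\lambda_0})$ and $p_i,q_i$ ($i=1,\dots,4$) with $\tilde\kappa>p_1,p_2,p_3,p_4>1$ and $1/p_i+1/q_i=1$. Let $\alpha_0$ satisfy $$\alpha_0\ge\max\Big\{\frac{2p_3(1-a)}{\tilde\kappa-p_3},\frac{4(1-a)}{\tilde\kappa-1},\frac{a}{1+\lambda_0-\tilde\kappa^2}\Big\},\qquad\alpha_0>\max\Big\{2,\frac a{\lambda_0}\Big\}.$$ Define $\beta_j=\tilde\kappa^j\alpha_0$, $\tilde r_j=\beta_j-2$, $\tilde s_j=(\beta_j+4(1-a))\big(1+\frac a{\beta_j-a}\big)$ ($j\ge0$), $\tilde\mu=\prod_{j\ge0}\tilde r_j/\beta_j$, $\tilde\nu=\prod_{j\ge0}\tilde s_j/\beta_j$ (these are positive and $\tilde\mu<\tilde\nu$), and $\omega=\frac{\tilde\nu\beta_0}{\tilde s_0}\cdot\frac{\tilde\kappa^2}{\alpha_0(\tilde\kappa-1)^2}$. Let $u\ge0$ be a sufficiently regular solution of the problem below and $\bar u=u-\Psi$. Then for all $T>0$ and $\sigma\in(0,1)$, $$\|\bar u\|_{L^\infty(U\times(\sigma T,T))}\le\Big[\bar c_2\alpha_0^{\mu_3}\chi_*^{1/\hat\kappa}\Big(1+\frac1{\sigma T}\Big)^{\mu_2}(1+|Q_T|)^{\mu_3}\mathcal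 M_1^{\mu_2}E_*^{1/\hat\kappa}\Big]^\omega\max\Big\{\|\bar u\|_{L^{\tilde\kappa\alpha_0}(U\times(0,T))}^{\tilde\mu},\|\bar u\|_{L^{\tilde\kappa\alpha_0}(U\times(0,T))}^{\tilde\nu}\Big\},$$ where $\mu_2=1+\frac a{1+\lambda_0}$, $\mu_3=2+\frac a{1+\lambda_0}$, $\hat\kappa=1+\lambda_0-\frac a2$, $\bar c_2=(2\tilde\kappa)^{\mu_3}\bar A$, $\bar A=2^{4+\frac1{r_*}}\bar c_1c_{16}^2$, $\bar c_1=\max\{1,\frac1{c_{10}}(\frac{\bar c}{2-a})^{2-a}\}$, $\mathcal M_1=\mathcal M_{0,T}(q_1,q_2,q_3,q_4)$ and $$E_*=\max\Big\{1,\operatorname*{ess\,sup}_{t\in(\sigma T/2,T)}\|1+|\Psi(\cdot,t)|\|_{L^{\frac{2r_*}{1-r_*}}}^2+\operatorname*{ess\,sup}_{t\in(\sigma T/2,T)}\|\bar u(\cdot,t)\|_{L^{\frac{2r_*}{1-r_*}}}^2\Big\}.$$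
   Context: Let $N\ge1$, $0=\bar\alpha_0<\dots<\bar\alpha_N$, $a_0,\dots,a_N>0$, $g(s)=\sum_ia_is^{\bar\alpha_i}$ ($0^0=1$), $a=\bar\alpha_N/(1+\bar\alpha_N)$, $\chi_0=\sum_ia_i$. $\vec k$ unit vector in $\mathbb R^3$, $\mathbf Jx=\vec k\times x$, $F_z(v)=g(|v|)v+z\mathbf Jv$ (a bijection of $\mathbb R^3$), fix $R_*\ge0$, $X(z,y)=F_{R_*z}^{-1}(y)$. $\mathcal G>0$, $\Omega\ge0$, $e_0\in C^\infty(\mathbb R,\mathbb R^3)$ with $|e_0|=1$, $\mathcal Z(x,t)=-\mathcal Ge_0(t)+\Omega^2\mathbf J^2x$. $U\subset\mathbb R^3$ open bounded with $C^1$ boundary $\Gamma$, $r_U=\max_{\bar U}|x|$, $\chi_*=\max\{1,R_*^2,\chi_0^2,\mathcal G+\Omega^2r_U\}$. Problem: $u_t=\nabla\cdot X(u,\nabla u+u^2\mathcal Z)$ in $U\times(0,\infty)$, $u(\cdot,0)=u_0$, $u=\psi$ on $\Gamma\times(0,\infty)$; $\Psi$ an extension of $\psi$ to $\bar U\times[0,\infty)$. $Q_T=U\times(0,T)$. With $\tilde q=2\max\{2-a,3-2a\}$, $\mathcal M_{T',T}(q_1,q_2,q_3,q_4)=1+\chi_*^{1-a}\big(\int_{T'}^T\!\int_U(1+|\nabla\Psi|)^{(2-a)q_1}\big)^{1/q_1}+\chi_*^{1-a}\big(\int_{T'}^T\!\int_U(1+|\Psi|)^{2(1-a)q_2}(1+|\nabla\Psi|)^{(2-a)q_2}\big)^{1/q_2}+\chi_*^{3-a}\big(\int_{T'}^T\!\int_U(1+|\Psi|)^{\tilde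 qq_3}\big)^{1/q_3}+\big(\int_{T'}^T\!\int_U|\Psi_t|^{q_4}\big)^{1/q_4}$. Constants: $c_3=a_N^{a-1}$, $c_4=(\min\{1,a_0,a_N\}/2^{\bar\alpha_N})^{1+a}$, $c_5=2^{-a}c_4$, $c_9=c_5\chi_0^{-2}$, $c_{10}=c_4/4$, $c_{11}=4^{1-a}c_5+c_9+2c_3(32c_3/c_4)^{1-a}+c_{10}$, $c_{12}=2\cdot4^{1-a}c_3[1+(32c_3/c_4)^{1-a}]$, $c_{16}=9(1+c_{11}+c_{12})$; $\bar c>0$ depends on $U$ and $q=r_*(2-a)$ with $\|f\|_{L^{3q/(3-q)}(U)}\le\bar c\|\nabla f\|_{L^q(U)}$ for all $f\in W_0^{1,q}(U)$. *)

theory Defs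
  imports "HOL-Analysis.Analysis" "HOL-Probability.Essential_Supremum"
begin

unbundle no cross3_syntax

text \<open>g(s) = sum_{i=0..N} a_i s^(alpha_i), alpha_0 = 0, with the convention 0^0 = 1
  (so the i = 0 term is the constant a_0).\<close>
definition gfun :: "nat \<Rightarrow> (nat \<Rightarrow> real) \<Rightarrow> (nat \<Rightarrow> real) \<Rightarrow> real \<Rightarrow> real" where
  "gfun N coef alb s = coef 0 + (\<Sum>i=1..N. coef i * s powr alb i)"

definition aexp :: "nat \<Rightarrow> (nat \<Rightarrow> real) \<Rightarrow> real" where
  "aexp N alb = alb N / (1 + alb N)"

definition chi0 :: "nat \<Rightarrow> (nat \<Rightarrow> real) \<Rightarrow> real" where
  "chi0 N coef = (\<Sum>i=0..N. coef i)"

definition Jmap :: "real^3 \<Rightarrow> real^3 \<Rightarrow> real^3" where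
  "Jmap k x = cross3 k x"

definition Ffun :: "nat \<Rightarrow> (nat \<Rightarrow> real) \<Rightarrow> (nat \<Rightarrow> real) \<Rightarrow> real^3 \<Rightarrow> real \<Rightarrow> real^3 \<Rightarrow> real^3" where
  "Ffun N coef alb k z v = gfun N coef alb (norm v) *\<^sub>R v + z *\<^sub>R Jmap k v"

definition Xfun :: "nat \<Rightarrow> (nat \<Rightarrow> real) \<Rightarrow> (nat \<Rightarrow> real) \<Rightarrow> real^3 \<Rightarrow> real \<Rightarrow> real \<Rightarrow> real^3 \<Rightarrow> real^3" where
  "Xfun N coef alb k Rs z y = inv (Ffun N coef alb k (Rs * z)) y"

definition Zfun :: "real^3 \<Rightarrow> real \<Rightarrow> real \<Rightarrow> (real \<Rightarrow> real^3) \<Rightarrow> real^3 \<Rightarrow> real \<Rightarrow> real^3" where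
  "Zfun k G \<Omega> e0 x t = - (G *\<^sub>R e0 t) + \<Omega>\<^sup>2 *\<^sub>R Jmap k (Jmap k x)"

definition rU :: "(real^3) set \<Rightarrow> real" where
  "rU U = Sup (norm ` closure U)"

definition chi_star :: "real \<Rightarrow> real \<Rightarrow> real \<Rightarrow> real \<Rightarrow> (real^3) set \<Rightarrow> real" where
  "chi_star Rs c0 G \<Omega> U = max (max 1 (Rs\<^sup>2)) (max (c0\<^sup>2) (G + \<Omega>\<^sup>2 * rU U))"

definition smooth_curve :: "(real \<Rightarrow> real^3) \<Rightarrow> bool" where
  "smooth_curve f \<longleftrightarrow>
     (\<forall>n t. (((\<lambda>h s. vector_derivative h (at s)) ^^ n) f) differentiable (at t))"

definition C1_fun2 :: "(real \<times> real \<Rightarrow> real) \<Rightarrow> bool" where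
  "C1_fun2 \<gamma> \<longleftrightarrow> (\<exists>\<gamma>'. (\<forall>y. (\<gamma> has_derivative blinfun_apply (\<gamma>' y)) (at y)) \<and> continuous_on UNIV \<gamma>')"

definition C1_boundary :: "(real^3) set \<Rightarrow> bool" where
  "C1_boundary U \<longleftrightarrow>
     (\<forall>x0\<in>frontier U. \<exists>r>0. \<exists>(Q::real^3 \<Rightarrow> real^3) \<gamma>. orthogonal_transformation Q \<and> C1_fun2 \<gamma> \<and>
        U \<inter> ball x0 r = {x \<in> ball x0 r. (Q x)$3 > \<gamma> ((Q x)$1, (Q x)$2)})"

definition grad1 :: "(real^3 \<Rightarrow> real) \<Rightarrow> real^3 \<Rightarrow> real^3" where
  "grad1 f x = (\<chi> i. frechet_derivative f (at x) (axis i 1))"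

definition gradx :: "(real^3 \<Rightarrow> real \<Rightarrow> real) \<Rightarrow> real^3 \<Rightarrow> real \<Rightarrow> real^3" where
  "gradx w x t = grad1 (\<lambda>y. w y t) x"

definition dtime :: "(real^3 \<Rightarrow> real \<Rightarrow> real) \<Rightarrow> real^3 \<Rightarrow> real \<Rightarrow> real" where
  "dtime w x t = deriv (\<lambda>s. w x s) t"

definition divx :: "(real^3 \<Rightarrow> real \<Rightarrow> real^3) \<Rightarrow> real^3 \<Rightarrow> real \<Rightarrow> real" where
  "divx V x t = (\<Sum>i\<in>UNIV. frechet_derivative (\<lambda>y. V y t) (at x) (axis i 1) $ i)"

definition regular_fn :: "(real^3) set \<Rightarrow> (real^3 \<Rightarrow> real \<Rightarrow> real) \<Rightarrow> bool" where
  "regular_fn U w \<longleftrightarrow>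
     (\<forall>x\<in>U. \<forall>t>0. (\<lambda>y. w y t) differentiable (at x) \<and> (\<lambda>s. w x s) differentiable (at t)) \<and>
     continuous_on (closure U \<times> {0..}) (\<lambda>(x,t). w x t) \<and>
     (\<exists>Gr. continuous_on (closure U \<times> {0..}) Gr \<and> (\<forall>x\<in>U. \<forall>t>0. Gr (x,t) = gradx w x t)) \<and>
     (\<exists>H. continuous_on (closure U \<times> {0..}) H \<and> (\<forall>x\<in>U. \<forall>t>0. H (x,t) = dtime w x t))"

text \<open>C^1 functions with compact support in U (dense in W_0^{1,q}(U)).\<close>
definition C1c_in :: "(real^3) set \<Rightarrow> (real^3 \<Rightarrow> real) \<Rightarrow> bool" where
  "C1c_in U f \<longleftrightarrow> (\<forall>x. f differentiable (at x)) \<and> continuous_on UNIV (grad1 f) \<and>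
     compact (closure {x. f x \<noteq> 0}) \<and> closure {x. f x \<noteq> 0} \<subseteq> U"

definition flux :: "nat \<Rightarrow> (nat \<Rightarrow> real) \<Rightarrow> (nat \<Rightarrow> real) \<Rightarrow> real^3 \<Rightarrow> real \<Rightarrow> real \<Rightarrow> real
    \<Rightarrow> (real \<Rightarrow> real^3) \<Rightarrow> (real^3 \<Rightarrow> real \<Rightarrow> real) \<Rightarrow> real^3 \<Rightarrow> real \<Rightarrow> real^3" where
  "flux N coef alb k Rs G \<Omega> e0 u y s =
     Xfun N coef alb k Rs (u y s) (gradx u y s + (u y s)\<^sup>2 *\<^sub>R Zfun k G \<Omega> e0 y s)"

definition is_solution :: "nat \<Rightarrow> (nat \<Rightarrow> real) \<Rightarrow> (nat \<Rightarrow> real) \<Rightarrow> real^3 \<Rightarrow> real \<Rightarrow> real \<Rightarrow> real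
    \<Rightarrow> (real \<Rightarrow> real^3) \<Rightarrow> (real^3) set \<Rightarrow> (real^3 \<Rightarrow> real) \<Rightarrow> (real^3 \<Rightarrow> real \<Rightarrow> real)
    \<Rightarrow> (real^3 \<Rightarrow> real \<Rightarrow> real) \<Rightarrow> bool" where
  "is_solution N coef alb k Rs G \<Omega> e0 U u0 \<psi> u \<longleftrightarrow>
     regular_fn U u \<and>
     (\<forall>x\<in>U. \<forall>t>0. (\<lambda>y. flux N coef alb k Rs G \<Omega> e0 u y t) differentiable (at x) \<and>
        dtime u x t = divx (flux N coef alb k Rs G \<Omega> e0 u) x t) \<and>
     (\<forall>x\<in>U. u x 0 = u0 x) \<and>
     (\<forall>x\<in>frontier U. \<forall>t>0. u x t = \<psi> x t)"

definition Lp_on :: "real \<Rightarrow> 'a::euclidean_space set \<Rightarrow> ('a \<Rightarrow> real) \<Rightarrow> real" where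
  "Lp_on p A f = (LINT z:A|lborel. \<bar>f z\<bar> powr p) powr (1 / p)"

definition Linf_on :: "'a::euclidean_space set \<Rightarrow> ('a \<Rightarrow> real) \<Rightarrow> ereal" where
  "Linf_on A f = esssup lborel (\<lambda>z. ereal (indicator A z * \<bar>f z\<bar>))"

definition esssup_on :: "real set \<Rightarrow> (real \<Rightarrow> real) \<Rightarrow> ereal" where
  "esssup_on I h = esssup lborel (\<lambda>t. ereal (indicator I t * h t))"

definition cyl :: "(real^3) set \<Rightarrow> real \<Rightarrow> real \<Rightarrow> ((real^3) \<times> real) set" where
  "cyl U t1 t2 = U \<times> {t1<..<t2}"

definition pt :: "(real^3 \<Rightarrow> real \<Rightarrow> real) \<Rightarrow> (real^3) \<times> real \<Rightarrow> real" where
  "pt w z = w (fst z) (snd z)"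

definition Mfun :: "(real^3) set \<Rightarrow> (real^3 \<Rightarrow> real \<Rightarrow> real) \<Rightarrow> real \<Rightarrow> real \<Rightarrow> real \<Rightarrow> real
    \<Rightarrow> real \<Rightarrow> real \<Rightarrow> real \<Rightarrow> real \<Rightarrow> real" where
  "Mfun U \<Psi> chis a T' T q1 q2 q3 q4 =
    (let A = cyl U T' T; qt = 2 * max (2 - a) (3 - 2 * a);
         nG = (\<lambda>z. norm (gradx \<Psi> (fst z) (snd z))) in
     1 + chis powr (1 - a) * (LINT z:A|lborel. (1 + nG z) powr ((2 - a) * q1)) powr (1 / q1)
       + chis powr (1 - a) * (LINT z:A|lborel. (1 + \<bar>pt \<Psi> z\<bar>) powr (2 * (1 - a) * q2)
                                              * (1 + nG z) powr ((2 - a) * q2)) powr (1 / q2)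
       + chis powr (3 - a) * (LINT z:A|lborel. (1 + \<bar>pt \<Psi> z\<bar>) powr (qt * q3)) powr (1 / q3)
       + (LINT z:A|lborel. \<bar>dtime \<Psi> (fst z) (snd z)\<bar> powr q4) powr (1 / q4))"

definition c3 :: "nat \<Rightarrow> (nat \<Rightarrow> real) \<Rightarrow> (nat \<Rightarrow> real) \<Rightarrow> real" where
  "c3 N coef alb = coef N powr (aexp N alb - 1)"
definition c4 :: "nat \<Rightarrow> (nat \<Rightarrow> real) \<Rightarrow> (nat \<Rightarrow> real) \<Rightarrow> real" where
  "c4 N coef alb = (min 1 (min (coef 0) (coef N)) / 2 powr alb N) powr (1 + aexp N alb)"
definition c5 :: "nat \<Rightarrow> (nat \<Rightarrow> real) \<Rightarrow> (nat \<Rightarrow> real) \<Rightarrow> real" where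
  "c5 N coef alb = 2 powr (- aexp N alb) * c4 N coef alb"
definition c9 :: "nat \<Rightarrow> (nat \<Rightarrow> real) \<Rightarrow> (nat \<Rightarrow> real) \<Rightarrow> real" where
  "c9 N coef alb = c5 N coef alb * chi0 N coef powr (-2)"
definition c10 :: "nat \<Rightarrow> (nat \<Rightarrow> real) \<Rightarrow> (nat \<Rightarrow> real) \<Rightarrow> real" where
  "c10 N coef alb = c4 N coef alb / 4"
definition c11 :: "nat \<Rightarrow> (nat \<Rightarrow> real) \<Rightarrow> (nat \<Rightarrow> real) \<Rightarrow> real" where
  "c11 N coef alb = (let a = aexp N alb in
     4 powr (1 - a) * c5 N coef alb + c9 N coef alb
     + 2 * c3 N coef alb * (32 * c3 N coef alb / c4 N coef alb) powr (1 - a) + c10 N coef alb)"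
definition c12 :: "nat \<Rightarrow> (nat \<Rightarrow> real) \<Rightarrow> (nat \<Rightarrow> real) \<Rightarrow> real" where
  "c12 N coef alb = (let a = aexp N alb in
     2 * 4 powr (1 - a) * c3 N coef alb * (1 + (32 * c3 N coef alb / c4 N coef alb) powr (1 - a)))"
definition c16 :: "nat \<Rightarrow> (nat \<Rightarrow> real) \<Rightarrow> (nat \<Rightarrow> real) \<Rightarrow> real" where
  "c16 N coef alb = 9 * (1 + c11 N coef alb + c12 N coef alb)"

end

theory Submission
  imports Defs
begin

text \<open>
  Write \<open>w = u - \<Psi>\<close>. Testing the equation with \<open>\<bar>w\<bar>\<^sup>\<alpha>\<^sup>-\<^sup>2 w\<close> and using the coercivity of the flux,
  which degenerates like \<open>1 / (\<chi>\<^sub>* (1 + u)\<^sup>2)\<close>, bounds the \<open>L\<^sup>\<alpha>\<close> norms of \<open>w\<close> at later times and a weighted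
  integral of \<open>\<bar>w\<bar>\<^sup>\<alpha>\<^sup>-\<^sup>2 \<bar>\<nabla>w\<bar>\<^sup>2\<^sup>-\<^sup>a\<close>. Hoelder's inequality removes the weight at the price of \<open>\<chi>\<^sub>* E\<^sub>*\<close>, and the
  Sobolev inequality for \<open>\<bar>w\<bar> powr ((\<alpha> - a) / (2 - a))\<close> with interpolation yields a gain of integrability from
  \<open>\<kappa>\<alpha>\<close> to \<open>\<kappa>\<^sup>2\<alpha>\<close>, which is iterated on shrinking cylinders.

  Two points are delicate. The flux is only assumed differentiable at every point, with continuous divergence,
  so integration by parts rests on a Goursat-type bisection argument. And the term
  \<open>\<chi>\<^sub>* powr (3 - a) * \<integral>\<bar>w\<bar> powr (\<alpha> + 4 (1 - a))\<close> is controlled by the data only up to a negative power of the measure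
  of the cylinder. This costs powers of \<open>\<chi>\<^sub>*\<close> that decay geometrically along the iteration; they are absorbed
  because the exponent \<open>\<omega>\<close> carries the weights \<open>\<Sum>(j + 1) \<kappa>\<^sup>-\<^sup>j\<close> where \<open>\<Sum>\<kappa>\<^sup>-\<^sup>j\<close> would do.
\<close>

section \<open>The divergence theorem for everywhere differentiable fields\<close>

text \<open>The gain comes from the identity \<open>(2 - a) / q' = 1 - lam r\<close> for
  \<open>q = r * (2 - a)\<close> and its Sobolev exponent \<open>q' = 3 * q / (3 - q)\<close>: a
  uniform bound in L^\<alpha> and a weighted gradient bound combine, by Hoelder in space, to a bound
  in L^s with \<open>s = \<alpha> * (1 + lam r) - a\<close>. The bound
  \<open>a / (1 + lam0 - \<kappa>\<^sup>2)\<close> for \<open>\<alpha>0\<close> says that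
  \<open>\<kappa>\<^sup>2 * \<alpha> \<le> s\<close> at the first step, and then at all later ones.
  The condition \<open>p i < \<kappa>\<close> lets Hoelder split off the data while the unknown
  stays in the norm of the previous step. The superlinear term is treated at step j with a parameter
  \<open>\<kappa>\<close> to the power -j. Its product with \<open>\<beta> j\<close> is
  \<open>\<alpha>0\<close>, so the bound \<open>4 * (1 - a) / (\<kappa> - 1)\<close> for
  \<open>\<alpha>0\<close> serves every step, and the lost exponent of \<open>\<chi>\<close> is
  \<open>3 - a\<close> times the parameter. That the surplus in \<open>\<omega>\<close> pays for
  this loss reduces to \<open>5 * \<kappa> * (\<kappa> - 1) \<le> \<kappa> + 1\<close>, which
  follows from \<open>\<kappa>\<^sup>2 < 1 + lam0 < 5 / 3\<close>. Shrinking in time needs no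
  cutoff: the energy inequality is averaged over its starting time. The condition
  \<open>\<alpha> > 2\<close> makes the truncated test functions C^1.\<close>

lemma has_real_derivative_max_powr:
  fixes m x :: real
  assumes "m > 1"
  shows "((\<lambda>x. (max 0 x) powr m) has_real_derivative m * (max 0 x) powr (m - 1)) (at x)"
proof -
  consider "x > 0" | "x < 0" | "x = 0" by linarith
  then show ?thesis
  proof cases
    case 1
    have "((\<lambda>x. x powr m) has_real_derivative m * x powr (m - 1)) (at x)"
      using 1 by (auto intro!: derivative_eq_intros)
    then have "((\<lambda>x. (max 0 x) powr m) has_real_derivative m * x powr (m - 1)) (at x)"
      by (rule has_field_derivative_transform_within_open[where S="{0<..}"]) (use 1 in auto)
    then show ?thesis using 1 by simp
  next
    case 2
    have "((\<lambda>x. 0) has_real_derivative 0) (at x)" by simp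
    then have "((\<lambda>x. (max 0 x) powr m) has_real_derivative 0) (at x)"
      by (rule has_field_derivative_transform_within_open[where S="{..<0}"]) (use 2 in auto)
    then show ?thesis using 2 by simp
  next
    case 3
    have lim: "((\<lambda>y::real. \<bar>y\<bar> powr (m - 1)) \<longlongrightarrow> 0) (at 0)"
    proof -
      have "((\<lambda>y::real. \<bar>y\<bar> powr (m - 1)) \<longlongrightarrow> \<bar>0\<bar> powr (m - 1)) (at 0)"
        by (intro tendsto_powr' tendsto_rabs tendsto_ident_at tendsto_const) (use assms in auto)
      then show ?thesis using assms by simp
    qed
    have "((\<lambda>y. ((max 0 y) powr m - (max 0 (0::real)) powr m) / (y - 0)) \<longlongrightarrow> 0) (at 0)"
    proof (rule Lim_null_comparison[OF _ lim])
      have "norm (((max 0 y) powr m - (max 0 (0::real)) powr m) / (y - 0)) \<le> \<bar>y\<bar> powr (m - 1)"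
        if "y \<noteq> 0" for y :: real
        using that assms by (cases "y > 0") (auto simp: powr_diff max_def divide_le_0_iff not_less)
      then show "\<forall>\<^sub>F y in at 0. norm (((max 0 y) powr m - (max 0 (0::real)) powr m) / (y - 0)) \<le> \<bar>y\<bar> powr (m - 1)"
        by (simp add: eventually_at_filter)
    qed
    then show ?thesis using 3 by (simp add: has_field_derivative_iff)
  qed
qed

section \<open>Refinable smooth bumps in place of indicator functions of cubes\<close>

text \<open>Twice the quadratic B-spline with knots 0, 1, 2, 3, written with truncated powers. It is
  C^1 with support [0, 3] and, like an indicator function, a combination of its own half-scale
  copies; so cubes can be bisected without boundary integrals.\<close>

definition bspl :: "real \<Rightarrow> real" where
  "bspl x = (max 0 x)\<^sup>2 - 3 * (max 0 (x - 1))\<^sup>2 + 3 * (max 0 (x - 2))\<^sup>2 - (max 0 (x - 3))\<^sup>2"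

definition dbspl :: "real \<Rightarrow> real" where
  "dbspl x = 2 * max 0 x - 6 * max 0 (x - 1) + 6 * max 0 (x - 2) - 2 * max 0 (x - 3)"

lemma has_real_derivative_bspl: "(bspl has_real_derivative dbspl x) (at x)"
proof -
  have *: "((\<lambda>x. (max 0 (x - c))\<^sup>2) has_real_derivative 2 * max 0 (x - c)) (at x)" for c
  proof -
    have "((\<lambda>x. (max 0 (x - c)) powr 2) has_real_derivative (2 * (max 0 (x - c)) powr (2 - 1)) * 1) (at x)"
      by (rule DERIV_chain2[where f="\<lambda>x. (max 0 x) powr 2" and g="\<lambda>x. x - c"], rule has_real_derivative_max_powr)
        (auto intro!: derivative_eq_intros)
    then show ?thesis by simp
  qed
  show ?thesis
    unfolding bspl_def[abs_def]
    by (rule derivative_eq_intros *[of 0, simplified] * refl)+ (simp add: dbspl_def)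
qed

lemma continuous_on_bspl [continuous_intros]:
  assumes "continuous_on S f" shows "continuous_on S (\<lambda>x. bspl (f x))"
  unfolding bspl_def by (intro continuous_intros assms)

lemma continuous_on_dbspl [continuous_intros]:
  assumes "continuous_on S f" shows "continuous_on S (\<lambda>x. dbspl (f x))"
  unfolding dbspl_def by (intro continuous_intros assms)

lemma bspl_eq_0: "x \<notin> {0..3} \<Longrightarrow> bspl x = 0" "x \<notin> {0..3} \<Longrightarrow> dbspl x = 0"
  unfolding bspl_def dbspl_def by (auto simp: max_def power2_eq_square algebra_simps)

text \<open>Only finiteness matters; 60 is a crude common bound.\<close>

lemma bspl_bound: "\<bar>bspl x\<bar> \<le> 60" "\<bar>dbspl x\<bar> \<le> 60"
proof -
  have sq: "0 \<le> (max 0 (x - c))\<^sup>2 \<and> (max 0 (x - c))\<^sup>2 \<le> 9"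
    if "0 \<le> x" "x \<le> 3" "0 \<le> c" "c \<le> 3" for c
    using that power_mono[of "max 0 (x - c)" 3 2] by auto
  show "\<bar>bspl x\<bar> \<le> 60"
  proof (cases "x \<in> {0..3}")
    case True
    then have x: "0 \<le> x" "x \<le> 3" by auto
    have "\<bar>A - 3 * B + 3 * C - D\<bar> \<le> 60"
      if "0 \<le> A \<and> A \<le> 9" "0 \<le> B \<and> B \<le> 9" "0 \<le> C \<and> C \<le> 9" "0 \<le> D \<and> D \<le> 9" for A B C D :: real
      using that by linarith
    from this[OF sq[OF x, of 0] sq[OF x, of 1] sq[OF x, of 2] sq[OF x, of 3]]
    show ?thesis unfolding bspl_def by simp
  qed (simp add: bspl_eq_0)
  show "\<bar>dbspl x\<bar> \<le> 60"
    by (cases "x \<in> {0..3}") (auto simp: bspl_eq_0 dbspl_def max_def)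
qed

text \<open>The refinement mask of the quadratic B-spline, (3 choose k) / 4, with total weight
  2.\<close>

definition bwt :: "nat \<Rightarrow> real" where
  "bwt k = (if k = 0 \<or> k = 3 then 1/4 else 3/4)"

text \<open>With z for the shift by half a knot, this is (1 + z)^3 (1 - z)^3 = (1 - z^2)^3: the
  truncated powers at half-integer knots cancel.\<close>

lemma bspl_refine:
  "bspl x = (\<Sum>k<4. bwt k * bspl (2 * x - real k))"
  "dbspl x = (\<Sum>k<4. bwt k * (2 * dbspl (2 * x - real k)))"
proof -
  have e: "max 0 (2 * x - c) = 2 * max 0 (x - c / 2)" for c by (auto simp: max_def)
  have e0: "max 0 (2 * x) = 2 * max 0 x" by (auto simp: max_def)
  have l: "{..<4::nat} = {0,1,2,3}" by auto
  have s: "2 * x - 1 - 1 = 2 * x - 2" "2 * x - 1 - 2 = 2 * x - 3" "2 * x - 1 - 3 = 2 * x - 4"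
    "2 * x - 2 - 1 = 2 * x - 3" "2 * x - 2 - 2 = 2 * x - 4" "2 * x - 2 - 3 = 2 * x - 5"
    "2 * x - 3 - 1 = 2 * x - 4" "2 * x - 3 - 2 = 2 * x - 5" "2 * x - 3 - 3 = 2 * x - 6" by auto
  show "bspl x = (\<Sum>k<4. bwt k * bspl (2 * x - real k))"
    by (simp add: l bwt_def bspl_def s e e0 power_mult_distrib) (simp add: field_simps)
  show "dbspl x = (\<Sum>k<4. bwt k * (2 * dbspl (2 * x - real k)))"
    by (simp add: l bwt_def dbspl_def s e e0) (simp add: field_simps)?
qed

definition tb :: "real^3 \<Rightarrow> real^3 \<Rightarrow> real^3 \<Rightarrow> real" where
  "tb h c x = (\<Prod>i\<in>UNIV. bspl ((x$i - c$i) / h$i))"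

definition dtb :: "3 \<Rightarrow> real^3 \<Rightarrow> real^3 \<Rightarrow> real^3 \<Rightarrow> real" where
  "dtb i h c x = dbspl ((x$i - c$i) / h$i) / h$i * (\<Prod>j\<in>UNIV - {i}. bspl ((x$j - c$j) / h$j))"

lemma continuous_on_tb: "continuous_on S (tb h c)" "continuous_on S (dtb i h c)"
  unfolding tb_def[abs_def] dtb_def[abs_def]
  by (cases "h$i = 0") (auto intro!: continuous_intros simp: divide_inverse)

lemma tb_line_deriv: 
  assumes "h$i \<noteq> 0"
  shows "((\<lambda>s. tb h c (x + s *\<^sub>R axis i 1)) has_real_derivative dtb i h c x) (at 0)"
proof -
  have e: "tb h c (x + s *\<^sub>R axis i 1)
      = bspl ((x$i - c$i) / h$i + s / h$i) * (\<Prod>j\<in>UNIV - {i}. bspl ((x$j - c$j) / h$j))" for s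
    unfolding tb_def
    by (subst prod.remove[of _ i]) (auto intro!: prod.cong arg_cong2[where f="(*)"] arg_cong[where f=bspl]
        simp: axis_def add_divide_distrib diff_divide_distrib)
  have "((\<lambda>s. bspl ((x$i - c$i) / h$i + s / h$i)) has_real_derivative
      dbspl ((x$i - c$i) / h$i + 0 / h$i) * (1 / h$i)) (at 0)"
    by (rule DERIV_chain2[OF has_real_derivative_bspl]) (use assms in \<open>auto intro!: derivative_eq_intros\<close>)
  then show ?thesis unfolding e dtb_def
    by (auto intro!: derivative_eq_intros)
qed

lemma tb_outside:
  assumes "\<And>i. h$i > 0" "x \<notin> cbox c (c + 3 *\<^sub>R h)"
  shows "tb h c x = 0" "dtb i h c x = 0"
proof -
  obtain j where j: "x$j < c$j \<or> x$j > c$j + 3 * h$j"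
    using assms(2) by (auto simp: mem_box_cart not_le)
  have o: "(x$j - c$j) / h$j \<notin> {0..3}"
    using j assms(1)[of j] by (auto simp: field_simps)
  then have z: "bspl ((x$j - c$j) / h$j) = 0" "dbspl ((x$j - c$j) / h$j) = 0" by (auto simp: bspl_eq_0)
  show "tb h c x = 0" unfolding tb_def by (rule prod_zero) (use z in auto)
  show "dtb i h c x = 0"
  proof (cases "i = j")
    case True then show ?thesis using z by (simp add: dtb_def)
  next
    case False
    have "(\<Prod>j\<in>UNIV - {i}. bspl ((x$j - c$j) / h$j)) = 0"
      by (rule prod_zero) (use z False in \<open>auto intro!: bexI[of _ j]\<close>)
    then show ?thesis by (simp add: dtb_def)
  qed
qed

lemma tb_bound: "\<bar>tb h c x\<bar> \<le> 60^3" "\<bar>dtb i h c x\<bar> \<le> 60^3 / \<bar>h$i\<bar>"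
proof -
  show "\<bar>tb h c x\<bar> \<le> 60^3"
    unfolding tb_def abs_prod using prod_le_power[of UNIV "\<lambda>i. \<bar>bspl ((x$i - c$i) / h$i)\<bar>" 60 3]
    by (simp add: bspl_bound)
  have "(\<Prod>j\<in>UNIV - {i}. \<bar>bspl ((x$j - c$j) / h$j)\<bar>) \<le> 60^2"
    by (rule prod_le_power) (auto simp: bspl_bound card_Diff_singleton)
  then have "\<bar>dbspl ((x$i - c$i) / h$i)\<bar> * (\<Prod>j\<in>UNIV - {i}. \<bar>bspl ((x$j - c$j) / h$j)\<bar>) \<le> 60 * 60^2"
    by (intro mult_mono bspl_bound) (auto intro!: prod_nonneg)
  then show "\<bar>dtb i h c x\<bar> \<le> 60^3 / \<bar>h$i\<bar>"
    unfolding dtb_def abs_mult abs_prod abs_divide by (auto simp: divide_right_mono)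
qed

definition rfh :: "3 \<Rightarrow> real^3 \<Rightarrow> real^3" where
  "rfh i h = (\<chi> j. if j = i then h$j / 2 else h$j)"
definition rfc :: "3 \<Rightarrow> real^3 \<Rightarrow> real^3 \<Rightarrow> nat \<Rightarrow> real^3" where
  "rfc i h c k = (\<chi> j. if j = i then c$j + real k * h$j / 2 else c$j)"

text \<open>Only one side is halved, so the one-dimensional relation suffices. The bump and all its
  partial derivatives are refined with the same children and the same weights, which is what carries
  the relation over to \<open>dpair\<close>.\<close>

lemma tb_refine:
  assumes "\<And>i. h$i > 0"
  shows "tb h c x = (\<Sum>k<4. bwt k * tb (rfh i h) (rfc i h c k) x)"
    and "dtb l h c x = (\<Sum>k<4. bwt k * dtb l (rfh i h) (rfc i h c k) x)"
proof -
  have a: "(x$i - (c$i + real k * h$i / 2)) / (h$i / 2) = 2 * ((x$i - c$i) / h$i) - real k" for k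
    using assms[of i] by (auto simp: field_simps)
  have a': "(x$i - rfc i h c k$i) / rfh i h$i = 2 * ((x$i - c$i) / h$i) - real k" for k
    unfolding a[symmetric] by (simp add: rfc_def rfh_def)
  have ri: "rfh i h $ i = h$i / 2" by (simp add: rfh_def)
  have o: "(\<Prod>j\<in>A. bspl ((x$j - rfc i h c k$j) / rfh i h$j)) = (\<Prod>j\<in>A. bspl ((x$j - c$j) / h$j))"
    if "i \<notin> A" for A k
    using that by (intro prod.cong) (auto simp: rfc_def rfh_def)
  have t: "tb (rfh i h) (rfc i h c k) x = bspl (2 * ((x$i - c$i) / h$i) - real k) * (\<Prod>j\<in>UNIV-{i}. bspl ((x$j - c$j) / h$j))" for k
    unfolding tb_def by (subst prod.remove[of _ i]) (simp_all only: o finite UNIV_I a' insert_iff DiffE Diff_iff simp_thms)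
  show "tb h c x = (\<Sum>k<4. bwt k * tb (rfh i h) (rfc i h c k) x)"
    unfolding t unfolding tb_def
    by (subst prod.remove[of _ i], simp, simp) (subst bspl_refine(1), simp only: sum_distrib_right mult.assoc)
  show "dtb l h c x = (\<Sum>k<4. bwt k * dtb l (rfh i h) (rfc i h c k) x)"
  proof (cases "l = i")
    case True
    have "dtb l (rfh i h) (rfc i h c k) x =
        (2 * dbspl (2 * ((x$i - c$i) / h$i) - real k)) * ((\<Prod>j\<in>UNIV-{i}. bspl ((x$j - c$j) / h$j)) / h$i)" for k
      unfolding dtb_def True by (subst o, simp) (simp only: a', simp add: ri)
    moreover have "dtb i h c x = dbspl ((x$i - c$i) / h$i) * ((\<Prod>j\<in>UNIV-{i}. bspl ((x$j - c$j) / h$j)) / h$i)"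
      unfolding dtb_def by simp
    ultimately show ?thesis unfolding True
      by (simp only:) (subst bspl_refine(2), simp only: sum_distrib_right mult.assoc)
  next
    case False
    have s: "UNIV - {l} - {i} = UNIV - {l,i}" by auto
    have "dtb l (rfh i h) (rfc i h c k) x = bspl (2 * ((x$i - c$i) / h$i) - real k) *
       (dbspl ((x$l - c$l) / h$l) / h$l * (\<Prod>j\<in>UNIV-{l,i}. bspl ((x$j - c$j) / h$j)))" for k
      unfolding dtb_def using False
      by (subst prod.remove[of _ i]) (simp_all add: o s a' del: times_divide_eq_right, simp_all add: rfc_def rfh_def)
    moreover have "dtb l h c x = bspl ((x$i - c$i) / h$i) *
       (dbspl ((x$l - c$l) / h$l) / h$l * (\<Prod>j\<in>UNIV-{l,i}. bspl ((x$j - c$j) / h$j)))"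
      unfolding dtb_def using False by (subst prod.remove[of _ i]) (simp_all add: s)
    ultimately show ?thesis by (simp only:) (subst bspl_refine(1), simp only: sum_distrib_right mult.assoc)
  qed
qed

lemma integrable_continuous_cbox_support:
  fixes f :: "'a::euclidean_space \<Rightarrow> real"
  assumes "continuous_on UNIV f" "\<And>x. x \<notin> K \<Longrightarrow> f x = 0" "compact K"
  shows "integrable lborel f"
proof -
  have "integrable lborel (\<lambda>x. indicator K x *\<^sub>R f x)"
    by (intro borel_integrable_compact assms continuous_on_subset[OF assms(1)]) auto
  moreover have "(\<lambda>x. indicator K x *\<^sub>R f x) = f" using assms(2) by (auto simp: indicator_def fun_eq_iff)
  ultimately show ?thesis by simp
qed

lemma bounded_continuous_compact_support:
  fixes f :: "'a::euclidean_space \<Rightarrow> real"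
  assumes "continuous_on UNIV f" "\<And>x. x \<notin> K \<Longrightarrow> f x = 0" "compact K"
  obtains B where "B \<ge> 0" "\<And>x. \<bar>f x\<bar> \<le> B"
proof -
  have "compact (f ` K)" by (intro compact_continuous_image assms continuous_on_subset[OF assms(1)]) auto
  then obtain B where B: "\<And>y. y \<in> f ` K \<Longrightarrow> norm y \<le> B" using compact_imp_bounded bounded_iff by metis
  have "\<bar>f x\<bar> \<le> max 0 B" for x
    using B[of "f x"] assms(2)[of x] by (cases "x \<in> K") auto
  then show ?thesis using that[of "max 0 B"] by auto
qed

text \<open>Translation invariance of Lebesgue measure makes every difference quotient of
  \<open>f\<close> integrate to 0. The mean value theorem bounds the quotients, so dominated
  convergence applies.\<close>

lemma integral_directional_derivative_zero:
  fixes f D :: "'a::euclidean_space \<Rightarrow> real"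
  assumes der: "\<And>x. ((\<lambda>s. f (x + s *\<^sub>R e)) has_real_derivative D x) (at 0)"
    and cf: "continuous_on UNIV f" and cD: "continuous_on UNIV D"
    and f0: "\<And>x. x \<notin> cball 0 R \<Longrightarrow> f x = 0" and D0: "\<And>x. x \<notin> cball 0 R \<Longrightarrow> D x = 0"
  shows "(\<integral>x. D x \<partial>lborel) = 0"
proof -
  obtain K where K: "K \<ge> 0" "\<And>x. \<bar>D x\<bar> \<le> K"
    using bounded_continuous_compact_support[OF cD D0 compact_cball] by blast
  have der': "((\<lambda>s. f (x + s *\<^sub>R e)) has_real_derivative D (x + s *\<^sub>R e)) (at s)" for x s
  proof -
    have "((\<lambda>r. f ((x + s *\<^sub>R e) + (r - s) *\<^sub>R e)) has_real_derivative D (x + s *\<^sub>R e) * 1) (at s)"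
      by (rule DERIV_chain2[where f="\<lambda>r. f ((x + s *\<^sub>R e) + r *\<^sub>R e)" and g="\<lambda>r. r - s"])
        (use der[of "x + s *\<^sub>R e"] in \<open>auto intro!: derivative_eq_intros\<close>)
    then show ?thesis by (simp add: algebra_simps)
  qed
  have lip: "\<bar>f (x + s *\<^sub>R e) - f x\<bar> \<le> K * s" if "s > 0" for x s
  proof -
    have "\<exists>z>0. z < s \<and> f (x + s *\<^sub>R e) - f (x + 0 *\<^sub>R e) = (s - 0) * D (x + z *\<^sub>R e)"
      using MVT2[of 0 s "\<lambda>s. f (x + s *\<^sub>R e)" "\<lambda>s. D (x + s *\<^sub>R e)"] der' that by auto
    then obtain z where "f (x + s *\<^sub>R e) - f x = s * D (x + z *\<^sub>R e)" by auto
    then show ?thesis using K(2)[of "x + z *\<^sub>R e"] that by (simp add: abs_mult mult_ac)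
  qed
  have fi: "integrable lborel f"
    by (rule integrable_continuous_cbox_support[OF cf f0 compact_cball])
  have mf: "f \<in> borel_measurable borel" using cf by (simp add: borel_measurable_continuous_onI)
  define g where "g n x = (f (x + (1 / real (Suc n)) *\<^sub>R e) - f x) * real (Suc n)" for n x
  have gi: "(\<integral>x. g n x \<partial>lborel) = 0" for n
  proof -
    have "integrable lborel (\<lambda>x. f (t + x))" for t
      by (rule integrable_distr[where M'=borel and T="(+) t"]) (use fi in \<open>simp_all add: lborel_distr_plus\<close>)
    then have i: "integrable lborel (\<lambda>x. f (x + t))" for t by (subst add.commute)
    have "(\<integral>x. f (x + t) \<partial>lborel) = (\<integral>x. f x \<partial>lborel)" for t
    proof -
      have "(\<integral>x. f x \<partial>lborel) = (\<integral>x. f x \<partial>(distr lborel borel ((+) t)))" by (simp add: lborel_distr_plus)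
      also have "\<dots> = (\<integral>x. f (t + x) \<partial>lborel)" by (rule integral_distr) (use mf in auto)
      finally show ?thesis by (simp only: add.commute)
    qed
    then show ?thesis unfolding g_def using i fi by simp
  qed
  \<comment> \<open>The ball is enlarged by \<open>norm e\<close>, the largest possible shift,
    because the shifted point may still lie in the support of \<open>f\<close>.\<close>
  have bnd: "\<bar>g n x\<bar> \<le> K * indicator (cball 0 (R + norm e)) x" for n x
  proof (cases "x \<in> cball 0 (R + norm e)")
    case True
    have "\<bar>g n x\<bar> \<le> K * (1 / real (Suc n)) * real (Suc n)"
      unfolding g_def abs_mult using lip[of "1 / real (Suc n)" x] by (intro mult_mono) (auto simp: K)
    then show ?thesis using True by simp
  next
    case False
    have "norm x \<le> norm (x + (1 / real (Suc n)) *\<^sub>R e) + norm ((1 / real (Suc n)) *\<^sub>R e)"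
      by (metis add_diff_cancel norm_triangle_ineq4)
    also have "norm ((1 / real (Suc n)) *\<^sub>R e) \<le> norm e" by (simp add: divide_le_eq mult_left_le_one_le mult_le_cancel_left1)
    finally have "x + (1 / real (Suc n)) *\<^sub>R e \<notin> cball 0 R" "x \<notin> cball 0 R" using False
      by (auto simp: not_le) (use norm_ge_zero[of e] in linarith)
    then show ?thesis using f0 K(1) by (simp add: g_def)
  qed
  have lim: "(\<lambda>n. g n x) \<longlonglongrightarrow> D x" for x
  proof -
    have "((\<lambda>s. (f (x + s *\<^sub>R e) - f (x + 0 *\<^sub>R e)) / (s - 0)) \<longlongrightarrow> D x) (at 0)"
      using der[of x] by (simp add: has_field_derivative_iff)
    moreover have "filterlim (\<lambda>n. 1 / real (Suc n)) (at 0) sequentially"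
      by (intro filterlim_atI LIMSEQ_Suc[OF lim_1_over_n]) auto
    ultimately have "(\<lambda>n. (f (x + (1 / real (Suc n)) *\<^sub>R e) - f (x + 0 *\<^sub>R e)) / (1 / real (Suc n) - 0)) \<longlonglongrightarrow> D x"
      by (rule filterlim_compose)
    then show ?thesis by (simp add: g_def)
  qed
  have "(\<lambda>n. (\<integral>x. g n x \<partial>lborel)) \<longlonglongrightarrow> (\<integral>x. D x \<partial>lborel)"
  proof (rule integral_dominated_convergence)
    show "integrable lborel (\<lambda>x. K * indicator (cball 0 (R + norm e)) x :: real)"
      by (intro integrable_mult_right integrable_real_indicator emeasure_bounded_finite) auto
    show "D \<in> borel_measurable lborel" using cD by (simp add: borel_measurable_continuous_onI)
    show "g n \<in> borel_measurable lborel" for n unfolding g_def using mf by measurable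
  qed (use bnd lim in auto)
  then show ?thesis using gi by (simp add: LIMSEQ_const_iff)
qed

text \<open>If \<open>d\<close> is the divergence of \<open>W\<close>, the divergence theorem says that this vanishes.\<close>
definition dpair :: "(real^3 \<Rightarrow> real^3) \<Rightarrow> (real^3 \<Rightarrow> real) \<Rightarrow> real^3 \<Rightarrow> real^3 \<Rightarrow> real" where
  "dpair W d h c = (\<integral>x. ((\<Sum>i\<in>UNIV. W x $ i * dtb i h c x) + tb h c x * d x) \<partial>lborel)"

section \<open>Bisection of the defect in the divergence theorem\<close>

lemma dpair_integrable:
  assumes "continuous_on UNIV W" "continuous_on UNIV d" "\<And>i. h$i > 0"
  shows "integrable lborel (\<lambda>x. (\<Sum>i\<in>UNIV. W x $ i * dtb i h c x) + tb h c x * d x)"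
proof (rule integrable_continuous_cbox_support[where K="cbox c (c + 3 *\<^sub>R h)"])
  show "continuous_on UNIV (\<lambda>x. (\<Sum>i\<in>UNIV. W x $ i * dtb i h c x) + tb h c x * d x)"
    by (intro continuous_intros assms continuous_on_tb)
qed (simp_all add: tb_outside[OF assms(3)])

text \<open>The pairing is linear in the bump and the four children have total weight 2, so they
  cannot all lie below half of the parent.\<close>

lemma dpair_refine:
  assumes W: "continuous_on UNIV W" "continuous_on UNIV d" and h: "\<And>i. h$i > 0"
  obtains k where "k < 4" "\<bar>dpair W d (rfh i h) (rfc i h c k)\<bar> \<ge> \<bar>dpair W d h c\<bar> / 2"
proof -
  have h': "rfh i h $ j > 0" for j using h by (simp add: rfh_def)
  have "dpair W d h c = (\<integral>x. (\<Sum>k<4. bwt k * ((\<Sum>l\<in>UNIV. W x $ l * dtb l (rfh i h) (rfc i h c k) x)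
       + tb (rfh i h) (rfc i h c k) x * d x)) \<partial>lborel)"
    unfolding dpair_def
  proof (intro Bochner_Integration.integral_cong refl)
    fix x
    have "(\<Sum>l\<in>UNIV. W x $ l * dtb l h c x) = (\<Sum>k<4. bwt k * (\<Sum>l\<in>UNIV. W x $ l * dtb l (rfh i h) (rfc i h c k) x))"
      by (subst tb_refine(2)[OF h, of _ _ _ i])
        (simp add: sum_distrib_left sum.swap[of _ UNIV] mult_ac)
    moreover have "tb h c x * d x = (\<Sum>k<4. bwt k * (tb (rfh i h) (rfc i h c k) x * d x))"
      by (subst tb_refine(1)[OF h, of _ _ i]) (simp only: sum_distrib_right mult.assoc)
    ultimately show "(\<Sum>l\<in>UNIV. W x $ l * dtb l h c x) + tb h c x * d x = 
      (\<Sum>k<4. bwt k * ((\<Sum>l\<in>UNIV. W x $ l * dtb l (rfh i h) (rfc i h c k) x) + tb (rfh i h) (rfc i h c k) x * d x))"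
      by (simp add: sum.distrib distrib_left)
  qed
  also have "\<dots> = (\<Sum>k<4. bwt k * dpair W d (rfh i h) (rfc i h c k))"
    unfolding dpair_def
    by (subst Bochner_Integration.integral_sum) (auto intro!: integrable_mult_right dpair_integrable W h')
  finally have e: "dpair W d h c = (\<Sum>k<4. bwt k * dpair W d (rfh i h) (rfc i h c k))" .
  show ?thesis
  proof (rule ccontr)
    assume nt: "\<not> thesis"
    then have lt: "\<bar>dpair W d (rfh i h) (rfc i h c k)\<bar> < \<bar>dpair W d h c\<bar> / 2" if "k < 4" for k
      using that nt \<open>\<And>k. \<lbrakk>k < 4; \<bar>dpair W d (rfh i h) (rfc i h c k)\<bar> \<ge> \<bar>dpair W d h c\<bar> / 2\<rbrakk> \<Longrightarrow> thesis\<close>[of k]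
      by (meson not_le)
    have "\<bar>dpair W d h c\<bar> \<le> (\<Sum>k<4. \<bar>bwt k * dpair W d (rfh i h) (rfc i h c k)\<bar>)"
      by (subst e) (rule sum_abs)
    also have "\<dots> < (\<Sum>k<4. bwt k * (\<bar>dpair W d h c\<bar> / 2))"
    proof (rule sum_strict_mono)
      fix k :: nat assume "k \<in> {..<4}"
      then show "\<bar>bwt k * dpair W d (rfh i h) (rfc i h c k)\<bar> < bwt k * (\<bar>dpair W d h c\<bar> / 2)"
        using lt[of k] by (simp add: abs_mult bwt_def)
    qed (auto simp: lessThan_empty_iff)
    also have "\<dots> = \<bar>dpair W d h c\<bar>"
    proof -
      have "{..<4::nat} = {0,1,2,3}" by auto
      then show ?thesis by (simp add: bwt_def)
    qed
    finally show False by simp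
  qed
qed

text \<open>One refinement in each coordinate: three factors 1/2 give 1/8, which is also the factor
  by which the volume of the cube shrinks.\<close>

lemma dpair_halve:
  assumes W: "continuous_on UNIV W" "continuous_on UNIV d" and h: "\<eta> > 0"
  obtains c' where "cbox c' (c' + 3 *\<^sub>R vec (\<eta>/2)) \<subseteq> cbox c (c + 3 *\<^sub>R vec \<eta>)"
    "\<bar>dpair W d (vec (\<eta>/2)) c'\<bar> \<ge> \<bar>dpair W d (vec \<eta>) c\<bar> / 8"
proof -
  define h1 where "h1 = rfh 1 (vec \<eta>)"
  define h2 where "h2 = rfh 2 h1"
  have p: "(vec \<eta> :: real^3)$i > 0" "h1$i > 0" "h2$i > 0" for i
    using h by (auto simp: h1_def h2_def rfh_def)
  obtain k1 where k1: "k1 < 4" "\<bar>dpair W d h1 (rfc 1 (vec \<eta>) c k1)\<bar> \<ge> \<bar>dpair W d (vec \<eta>) c\<bar> / 2"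
    using dpair_refine[OF W p(1), where i=1 and c=c] unfolding h1_def by metis
  define c1 where "c1 = rfc 1 (vec \<eta>) c k1"
  obtain k2 where k2: "k2 < 4" "\<bar>dpair W d h2 (rfc 2 h1 c1 k2)\<bar> \<ge> \<bar>dpair W d h1 c1\<bar> / 2"
    using dpair_refine[OF W p(2), where i=2 and c=c1] unfolding h2_def by metis
  define c2 where "c2 = rfc 2 h1 c1 k2"
  obtain k3 where k3: "k3 < 4" "\<bar>dpair W d (rfh 3 h2) (rfc 3 h2 c2 k3)\<bar> \<ge> \<bar>dpair W d h2 c2\<bar> / 2"
    using dpair_refine[OF W p(3), where i=3 and c=c2] by metis
  have h3: "rfh 3 h2 = vec (\<eta>/2)"
    by (simp add: vec_eq_iff forall_3 h2_def h1_def rfh_def)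
  define c3 where "c3 = rfc 3 h2 c2 k3"
  have c: "c3$1 = c$1 + real k1 * \<eta> / 2" "c3$2 = c$2 + real k2 * \<eta> / 2" "c3$3 = c$3 + real k3 * \<eta> / 2"
    by (simp_all add: c3_def c2_def c1_def rfc_def h1_def h2_def rfh_def)
  \<comment> \<open>A child starts at most \<open>3 * \<eta> / 2\<close> to the right of its parent
    and has length \<open>3 * \<eta> / 2\<close>, so it stays inside.\<close>
  have k: "0 \<le> real k * \<eta> \<and> real k * \<eta> \<le> 3 * \<eta>" if "k < 4" for k
    using that h by (auto intro!: mult_right_mono)
  have "cbox c3 (c3 + 3 *\<^sub>R vec (\<eta>/2)) \<subseteq> cbox c (c + 3 *\<^sub>R vec \<eta>)"
  proof
    fix x assume "x \<in> cbox c3 (c3 + 3 *\<^sub>R vec (\<eta>/2))"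
    then have x: "c3$i \<le> x$i \<and> x$i \<le> c3$i + 3 * (\<eta>/2)" for i by (simp add: mem_box_cart)
    have "c$1 \<le> x$1" "x$1 \<le> c$1 + 3 * \<eta>" "c$2 \<le> x$2" "x$2 \<le> c$2 + 3 * \<eta>" "c$3 \<le> x$3" "x$3 \<le> c$3 + 3 * \<eta>"
      using x[of 1] x[of 2] x[of 3] k[OF k1(1)] k[OF k2(1)] k[OF k3(1)] unfolding c by linarith+
    then show "x \<in> cbox c (c + 3 *\<^sub>R vec \<eta>)" by (simp add: mem_box_cart forall_3)
  qed
  moreover have "\<bar>dpair W d (vec (\<eta>/2)) c3\<bar> \<ge> \<bar>dpair W d (vec \<eta>) c\<bar> / 8"
    using k1 k2 k3 unfolding h3 c3_def[symmetric] c2_def[symmetric] c1_def[symmetric] by linarith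
  ultimately show ?thesis by (rule that)
qed

text \<open>Each coordinate of an affine field times the bump is C^1, and the integrand is the sum
  of the corresponding directional derivatives, so the elementary case applies.\<close>

lemma dpair_affine:
  fixes L :: "real^3 \<Rightarrow> real^3"
  assumes "linear L" "\<eta> > 0"
  shows "dpair (\<lambda>x. w + L (x - x0)) (\<lambda>x. \<Sum>i\<in>UNIV. L (axis i 1) $ i) (vec \<eta>) c = 0"
proof -
  let ?W = "\<lambda>x. w + L (x - x0)"
  have hp: "(vec \<eta> :: real^3) $ i > 0" for i using assms by simp
  have cL: "continuous_on UNIV (\<lambda>x. L (x - x0))"
    by (intro linear_continuous_on_compose[OF _ assms(1)] continuous_on_diff continuous_on_id continuous_on_const)
  have cW: "continuous_on UNIV ?W" by (intro continuous_intros cL)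
  obtain R where R: "cbox c (c + 3 *\<^sub>R vec \<eta>) \<subseteq> cball 0 R"
    by (metis bounded_cbox bounded_subset_cbox_symmetric bounded_subset_ballD bounded_cbox ball_subset_cball order_trans)
  define D where "D i x = ?W x $ i * dtb i (vec \<eta>) c x + tb (vec \<eta>) c x * L (axis i 1) $ i" for i x
  have out: "tb (vec \<eta>) c x = 0" "dtb i (vec \<eta>) c x = 0" if "x \<notin> cball 0 R" for i x
    using tb_outside[OF hp, of x c] R that by blast+
  have cD: "continuous_on UNIV (D i)" for i
    unfolding D_def[abs_def] by (intro continuous_intros cW continuous_on_tb)
  have z: "(\<integral>x. D i x \<partial>lborel) = 0" for i
  proof (rule integral_directional_derivative_zero[where f="\<lambda>x. ?W x $ i * tb (vec \<eta>) c x" and e="axis i 1" and R=R])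
    fix x
    have l: "?W (x + s *\<^sub>R axis i 1) $ i = ?W x $ i + s * L (axis i 1) $ i" for s
    proof -
      have "x + s *\<^sub>R axis i 1 - x0 = (x - x0) + s *\<^sub>R axis i 1" by simp
      then show ?thesis by (simp only: linear_add[OF assms(1)] linear_cmul[OF assms(1)]) simp
    qed
    show "((\<lambda>s. ?W (x + s *\<^sub>R axis i 1) $ i * tb (vec \<eta>) c (x + s *\<^sub>R axis i 1)) has_real_derivative D i x) (at 0)"
      unfolding l D_def
      by (rule derivative_eq_intros tb_line_deriv refl)+ (use assms in auto)
  next
    show "continuous_on UNIV (\<lambda>x. ?W x $ i * tb (vec \<eta>) c x)" by (intro continuous_intros cW continuous_on_tb)
    show "continuous_on UNIV (D i)" by (rule cD)
    fix x :: "real^3" assume "x \<notin> cball 0 R"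
    then show "?W x $ i * tb (vec \<eta>) c x = 0" "D i x = 0"
      using out[OF \<open>x \<notin> cball 0 R\<close>] by (simp_all add: D_def)
  qed
  have iD: "integrable lborel (D i)" for i
    by (rule integrable_continuous_cbox_support[OF cD _ compact_cball[of 0 R]]) (simp add: D_def out del: mem_cball)
  have "dpair ?W (\<lambda>x. \<Sum>i\<in>UNIV. L (axis i 1) $ i) (vec \<eta>) c = (\<integral>x. (\<Sum>i\<in>UNIV. D i x) \<partial>lborel)"
    unfolding dpair_def D_def by (simp add: sum.distrib sum_distrib_left)
  also have "\<dots> = 0" by (subst Bochner_Integration.integral_sum) (auto simp: z iD)
  finally show ?thesis .
qed

text \<open>By \<open>dpair_affine\<close> the first-order Taylor polynomial at \<open>x0\<close>
  may be subtracted. Differentiability at this single point makes the remainder o(\<eta>), which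
  beats the size 1/\<eta> of the gradient of the bump; continuity of \<open>d\<close> handles the
  other term.\<close>

lemma dpair_small:
  fixes W L :: "real^3 \<Rightarrow> real^3"
  assumes W: "continuous_on UNIV W" "continuous_on UNIV d" and der: "(W has_derivative L) (at x0)"
    and d: "d x0 = (\<Sum>i\<in>UNIV. L (axis i 1) $ i)" and "\<epsilon> > 0"
  shows "\<exists>\<delta>>0. \<forall>\<eta> c. 0 < \<eta> \<longrightarrow> \<eta> < \<delta> \<longrightarrow> x0 \<in> cbox c (c + 3 *\<^sub>R vec \<eta>) \<longrightarrow>
     \<bar>dpair W d (vec \<eta>) c\<bar> \<le> \<epsilon> * (60^3 * 28 * 27) * \<eta>^3"
proof -
  have lin: "linear L" using der by (rule has_derivative_linear)
  obtain \<delta>1 where d1: "\<delta>1 > 0" "\<And>y. norm (y - x0) < \<delta>1 \<Longrightarrow> norm (W y - W x0 - L (y - x0)) \<le> \<epsilon> * norm (y - x0)"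
    using der \<open>\<epsilon> > 0\<close> unfolding has_derivative_at_alt by blast
  have "isCont d x0" using W(2) by (simp add: continuous_on_eq_continuous_at)
  then obtain \<delta>2 where d2: "\<delta>2 > 0" "\<And>y. norm (y - x0) < \<delta>2 \<Longrightarrow> norm (d y - d x0) < \<epsilon>"
    using \<open>\<epsilon> > 0\<close> unfolding isCont_def LIM_eq by (metis diff_self norm_zero)
  show ?thesis
  \<comment> \<open>The cubes have side \<open>3 * \<eta>\<close>, so in the l1 norm their points
    are within \<open>9 * \<eta>\<close> of \<open>x0\<close>.\<close>
  proof (intro exI[of _ "min \<delta>1 \<delta>2 / 9"] conjI allI impI)
    show "min \<delta>1 \<delta>2 / 9 > 0" using d1 d2 by simp
    fix \<eta> c assume eta: "0 < \<eta>" "\<eta> < min \<delta>1 \<delta>2 / 9" and x0: "x0 \<in> cbox c (c + 3 *\<^sub>R vec \<eta>)"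
    let ?K = "cbox c (c + 3 *\<^sub>R vec \<eta>)"
    let ?h = "vec \<eta> :: real^3"
    have hp: "?h $ i > 0" for i using eta by simp
    have near: "norm (x - x0) \<le> 9 * \<eta>" if "x \<in> ?K" for x
    proof -
      have b: "c$i \<le> y$i \<and> y$i \<le> c$i + 3 * \<eta>" if "y \<in> ?K" for y i
        using that by (simp add: mem_box_cart)
      have "\<bar>(x - x0) $ i\<bar> \<le> 3 * \<eta>" for i
        using b[OF that, of i] b[OF x0, of i] by (simp add: abs_le_iff)
      then have "(\<Sum>i\<in>UNIV. \<bar>(x - x0) $ i\<bar>) \<le> (\<Sum>i\<in>(UNIV::3 set). 3 * \<eta>)" by (intro sum_mono)
      then show ?thesis using norm_le_l1_cart[of "x - x0"] by simp
    qed
    let ?A = "\<lambda>x. W x0 + L (x - x0)"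
    have cA: "continuous_on UNIV ?A"
      by (intro continuous_on_add continuous_on_const
          linear_continuous_on_compose[OF _ lin] continuous_on_diff continuous_on_id)
    have i1: "integrable lborel (\<lambda>x. (\<Sum>i\<in>UNIV. W x $ i * dtb i ?h c x) + tb ?h c x * d x)"
      by (rule dpair_integrable[OF W hp])
    have i2: "integrable lborel (\<lambda>x. (\<Sum>i\<in>UNIV. ?A x $ i * dtb i ?h c x) + tb ?h c x * d x0)"
      by (rule dpair_integrable[OF cA continuous_on_const hp])
    have pw: "((\<Sum>i\<in>UNIV. W x $ i * dtb i ?h c x) + tb ?h c x * d x) - ((\<Sum>i\<in>UNIV. ?A x $ i * dtb i ?h c x) + tb ?h c x * d x0)
       = (\<Sum>i\<in>UNIV. (W x - ?A x) $ i * dtb i ?h c x) + tb ?h c x * (d x - d x0)" for x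
      by (simp only: vector_minus_component left_diff_distrib right_diff_distrib sum_subtractf)
    have "dpair W d ?h c = dpair W d ?h c - dpair ?A (\<lambda>x. d x0) ?h c"
      using dpair_affine[OF lin eta(1), of "W x0" x0 c] d by simp
    also have "\<dots> = (\<integral>x. ((\<Sum>i\<in>UNIV. W x $ i * dtb i ?h c x) + tb ?h c x * d x)
        - ((\<Sum>i\<in>UNIV. ?A x $ i * dtb i ?h c x) + tb ?h c x * d x0) \<partial>lborel)"
      unfolding dpair_def by (rule Bochner_Integration.integral_diff[symmetric, OF i1 i2])
    also have "\<dots> = (\<integral>x. (\<Sum>i\<in>UNIV. (W x - ?A x) $ i * dtb i ?h c x) + tb ?h c x * (d x - d x0) \<partial>lborel)"
      by (simp only: pw)
    finally have e: "dpair W d ?h c = \<dots>" .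
    \<comment> \<open>Three gradient terms of size \<open>9 * 60^3\<close> and one of size
      \<open>60^3\<close> give the factor 28; the volume contributes the 27.\<close>
    have bnd: "norm ((\<Sum>i\<in>UNIV. (W x - ?A x) $ i * dtb i ?h c x) + tb ?h c x * (d x - d x0))
        \<le> \<epsilon> * (60^3 * 28) * indicator ?K x" for x
    proof (cases "x \<in> ?K")
      case True
      have n9: "norm (x - x0) \<le> 9 * \<eta>" by (rule near[OF True])
      have wx: "norm (W x - ?A x) \<le> \<epsilon> * (9 * \<eta>)"
      proof -
        have "norm (W x - ?A x) \<le> \<epsilon> * norm (x - x0)"
          using d1(2)[of x] n9 eta by (simp add: diff_diff_eq)
        also have "\<dots> \<le> \<epsilon> * (9 * \<eta>)" using n9 \<open>\<epsilon> > 0\<close> by (intro mult_left_mono) auto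
        finally show ?thesis .
      qed
      have "\<bar>(W x - ?A x) $ i * dtb i ?h c x\<bar> \<le> \<epsilon> * (9 * \<eta>) * (60^3 / \<eta>)" for i
        unfolding abs_mult
        using component_le_norm_cart[of "W x - ?A x" i] wx tb_bound(2)[of i ?h c x] eta
        by (intro mult_mono) auto
      then have "\<bar>(W x - ?A x) $ i * dtb i ?h c x\<bar> \<le> \<epsilon> * (9 * 60^3)" for i
        using eta by (simp add: field_simps)
      then have "\<bar>\<Sum>i\<in>UNIV. (W x - ?A x) $ i * dtb i ?h c x\<bar> \<le> (\<Sum>i\<in>(UNIV::3 set). \<epsilon> * (9 * 60^3))"
        by (intro order_trans[OF sum_abs] sum_mono)
      moreover have "\<bar>tb ?h c x * (d x - d x0)\<bar> \<le> 60^3 * \<epsilon>"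
        unfolding abs_mult using d2(2)[of x] n9 eta tb_bound(1)[of ?h c x] by (intro mult_mono) auto
      ultimately have "\<bar>(\<Sum>i\<in>UNIV. (W x - ?A x) $ i * dtb i ?h c x) + tb ?h c x * (d x - d x0)\<bar>
          \<le> (\<Sum>i\<in>(UNIV::3 set). \<epsilon> * (9 * 60^3)) + 60^3 * \<epsilon>"
        by linarith
      then show ?thesis using True by (simp del: vector_minus_component)
    next
      case False
      then show ?thesis using tb_outside[OF hp False] by simp
    qed
    have fin: "emeasure lborel ?K < \<infinity>" by (rule emeasure_bounded_finite[OF bounded_cbox])
    have ms: "measure lborel ?K = 27 * \<eta>^3"
    proof -
      have "measure lborel ?K = (\<Prod>i\<in>UNIV. (c + 3 *\<^sub>R ?h) $ i - c $ i)"
        by (rule content_cbox_cart) (use x0 in auto)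
      then show ?thesis by (simp add: power_mult_distrib)
    qed
    have "\<bar>dpair W d ?h c\<bar> \<le> (\<integral>x. \<epsilon> * (60^3 * 28) * indicator ?K x \<partial>lborel)"
      unfolding e real_norm_def[symmetric]
    proof (rule order_trans[OF integral_norm_bound], rule integral_mono')
      show "integrable lborel (\<lambda>x. \<epsilon> * (60^3 * 28) * indicator ?K x :: real)"
        by (intro integrable_mult_right integrable_real_indicator) (use fin in auto)
      show "0 \<le> \<epsilon> * (60^3 * 28) * indicator ?K x" for x using \<open>\<epsilon> > 0\<close> by simp
    qed (rule bnd)
    then show "\<bar>dpair W d ?h c\<bar> \<le> \<epsilon> * (60^3 * 28 * 27) * \<eta>^3" by (simp add: ms)
  qed
qed

text \<open>Goursat's argument. A nonzero value would survive, up to the factor 8^(-n), on nested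
  cubes of side \<open>3 * \<eta> / 2^n\<close>; but around the common point of these cubes it must
  be an arbitrarily small multiple of their volume.\<close>

lemma dpair_zero:
  fixes W :: "real^3 \<Rightarrow> real^3"
  assumes der: "\<And>x. (W has_derivative W' x) (at x)"
    and d: "continuous_on UNIV (\<lambda>x. \<Sum>i\<in>UNIV. W' x (axis i 1) $ i)" and eta: "\<eta> > 0"
  shows "dpair W (\<lambda>x. \<Sum>i\<in>UNIV. W' x (axis i 1) $ i) (vec \<eta>) c = 0"
proof (rule ccontr)
  let ?d = "\<lambda>x. \<Sum>i\<in>UNIV. W' x (axis i 1) $ i"
  let ?P = "\<lambda>n c. dpair W ?d (vec (\<eta> / 2^n)) c"
  assume nz: "dpair W ?d (vec \<eta>) c \<noteq> 0"
  have cW: "continuous_on UNIV W"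
    by (intro continuous_at_imp_continuous_on ballI has_derivative_continuous[OF der])
  have "\<exists>f. \<forall>n. (\<bar>?P n (f n)\<bar> \<ge> \<bar>dpair W ?d (vec \<eta>) c\<bar> / 8^n) \<and>
      cbox (f (Suc n)) (f (Suc n) + 3 *\<^sub>R vec (\<eta> / 2^Suc n)) \<subseteq> cbox (f n) (f n + 3 *\<^sub>R vec (\<eta> / 2^n))"
  proof (rule dependent_nat_choice)
    show "\<exists>x. \<bar>?P 0 x\<bar> \<ge> \<bar>dpair W ?d (vec \<eta>) c\<bar> / 8^0" by (intro exI[of _ c]) simp
  next
    fix x :: "real^3" and n assume a: "\<bar>?P n x\<bar> \<ge> \<bar>dpair W ?d (vec \<eta>) c\<bar> / 8^n"
    obtain c' where c': "cbox c' (c' + 3 *\<^sub>R vec (\<eta> / 2^n / 2)) \<subseteq> cbox x (x + 3 *\<^sub>R vec (\<eta> / 2^n))"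
      "\<bar>dpair W ?d (vec (\<eta> / 2^n / 2)) c'\<bar> \<ge> \<bar>?P n x\<bar> / 8"
      using dpair_halve[OF cW d, of "\<eta> / 2^n" x] eta by auto
    have "\<eta> / 2^n / 2 = \<eta> / 2^Suc n" by simp
    then show "\<exists>y. \<bar>?P (Suc n) y\<bar> \<ge> \<bar>dpair W ?d (vec \<eta>) c\<bar> / 8^Suc n \<and>
       cbox y (y + 3 *\<^sub>R vec (\<eta> / 2^Suc n)) \<subseteq> cbox x (x + 3 *\<^sub>R vec (\<eta> / 2^n))"
    proof (intro exI[of _ c'] conjI)
      have "\<bar>dpair W ?d (vec \<eta>) c\<bar> / 8^Suc n = \<bar>dpair W ?d (vec \<eta>) c\<bar> / 8^n / 8" by simp
      also have "\<dots> \<le> \<bar>?P n x\<bar> / 8" using a by (rule divide_right_mono) simp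
      also have "\<dots> \<le> \<bar>?P (Suc n) c'\<bar>" using c'(2) unfolding \<open>\<eta> / 2^n / 2 = \<eta> / 2^Suc n\<close> .
      finally show "\<bar>?P (Suc n) c'\<bar> \<ge> \<bar>dpair W ?d (vec \<eta>) c\<bar> / 8^Suc n" .
    qed (use c'(1) in \<open>simp only: \<open>\<eta> / 2^n / 2 = \<eta> / 2^Suc n\<close>\<close>)
  qed
  then obtain f where f: "\<And>n. \<bar>?P n (f n)\<bar> \<ge> \<bar>dpair W ?d (vec \<eta>) c\<bar> / 8^n"
    "\<And>n. cbox (f (Suc n)) (f (Suc n) + 3 *\<^sub>R vec (\<eta> / 2^Suc n)) \<subseteq> cbox (f n) (f n + 3 *\<^sub>R vec (\<eta> / 2^n))"
    by blast
  let ?K = "\<lambda>n. cbox (f n) (f n + 3 *\<^sub>R vec (\<eta> / 2^n))"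
  have "(\<Inter>n. ?K n) \<noteq> {}"
  proof (rule compact_nest)
    show "?K n \<noteq> {}" for n using eta by (auto simp: interval_ne_empty_cart)
    show "?K n \<subseteq> ?K m" if "m \<le> n" for m n
      using lift_Suc_antimono_le[of ?K, OF f(2) that] .
  qed auto
  then obtain x0 where x0: "\<And>n. x0 \<in> ?K n" by blast
  define A where "A = \<bar>dpair W ?d (vec \<eta>) c\<bar>"
  \<comment> \<open>Chosen so that the bound of \<open>dpair_small\<close> on the n-th cube is half
    of \<open>A / 8^n\<close>.\<close>
  define \<epsilon> where "\<epsilon> = A / (2 * (60^3 * 28 * 27) * \<eta>^3)"
  have A: "A > 0" using nz by (simp add: A_def)
  have ep: "\<epsilon> > 0" using A eta by (simp add: \<epsilon>_def)
  obtain \<delta> where del: "\<delta> > 0" "\<And>\<eta> c. 0 < \<eta> \<Longrightarrow> \<eta> < \<delta> \<Longrightarrow> x0 \<in> cbox c (c + 3 *\<^sub>R vec \<eta>) \<Longrightarrow>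
     \<bar>dpair W ?d (vec \<eta>) c\<bar> \<le> \<epsilon> * (60^3 * 28 * 27) * \<eta>^3"
    using dpair_small[OF cW d der[of x0] refl ep] by blast
  obtain n where n: "\<eta> / 2^n < \<delta>"
  proof -
    obtain n where "\<eta> / \<delta> < 2^n" using real_arch_pow[of 2 "\<eta> / \<delta>"] by auto
    then show ?thesis using that[of n] del(1) by (simp add: field_simps)
  qed
  have "A / 8^n \<le> \<epsilon> * (60^3 * 28 * 27) * (\<eta> / 2^n)^3"
    using order_trans[OF f(1)[of n] del(2)[OF _ n x0[of n]]] eta by (simp add: A_def)
  also have "\<dots> = A / 2 / 8^n"
  proof -
    have "((2::real)^n)^3 = 8^n" by (simp add: power_mult[symmetric] mult.commute[of n] power_mult)
    then show ?thesis using eta by (simp add: \<epsilon>_def power_divide)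
  qed
  finally show False using A by (simp add: field_simps)
qed

text \<open>The bumps are dilated: on a fixed ball they tend to a nonzero constant while their
  gradients are O(1/n), so only the integral of the divergence survives in the limit.\<close>

theorem integral_divergence_zero:
  fixes W :: "real^3 \<Rightarrow> real^3"
  assumes der: "\<And>x. (W has_derivative W' x) (at x)"
    and cd: "continuous_on UNIV (\<lambda>x. \<Sum>i\<in>UNIV. W' x (axis i 1) $ i)"
    and supp: "\<And>x. x \<notin> cball 0 R \<Longrightarrow> W x = 0"
  shows "(\<integral>x. (\<Sum>i\<in>UNIV. W' x (axis i 1) $ i) \<partial>lborel) = 0"
proof -
  let ?d = "\<lambda>x. \<Sum>i\<in>UNIV. W' x (axis i 1) $ i"
  have cW: "continuous_on UNIV W"
    by (intro continuous_at_imp_continuous_on ballI has_derivative_continuous[OF der])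
  have W'0: "W' x = (\<lambda>_. 0)" if "x \<notin> cball 0 R" for x
  proof -
    have "(W has_derivative (\<lambda>_. 0)) (at x)"
      by (rule has_derivative_transform_within_open[where f="\<lambda>_. 0" and s="- cball 0 R"])
        (use that supp in auto)
    then show ?thesis using has_derivative_unique der by blast
  qed
  have d0: "?d x = 0" if "x \<notin> cball 0 R" for x using W'0[OF that] by simp
  define h where "h n = (vec (real (Suc n)) :: real^3)" for n
  \<comment> \<open>Places the origin at 3/2, the midpoint of the support of \<open>bspl\<close>,
    where the value is 3/2.\<close>
  define c where "c n = (vec (- 3 / 2 * real (Suc n)) :: real^3)" for n
  let ?g = "\<lambda>n x. (\<Sum>i\<in>UNIV. W x $ i * dtb i (h n) (c n) x) + tb (h n) (c n) x * ?d x"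
  obtain B where B: "B \<ge> 0" "\<And>x. \<bar>norm (W x)\<bar> \<le> B"
    using bounded_continuous_compact_support[of "\<lambda>x. norm (W x)" "cball 0 R"] cW supp
    by (auto intro!: continuous_intros simp del: mem_cball)
  obtain C where C: "C \<ge> 0" "\<And>x. \<bar>?d x\<bar> \<le> C"
    using bounded_continuous_compact_support[OF cd d0 compact_cball] by blast
  have arg: "(x$i - c n$i) / h n$i = x$i * (1 / real (Suc n)) + 3/2" for x n i
    by (simp add: c_def h_def field_simps)
  have lim0: "(\<lambda>n. x$i * (1 / real (Suc n)) + 3/2) \<longlonglongrightarrow> x$i * 0 + 3/2" for x :: "real^3" and i
    by (intro tendsto_intros LIMSEQ_Suc[OF lim_1_over_n])
  have lb: "(\<lambda>n. bspl ((x$i - c n$i) / h n$i)) \<longlonglongrightarrow> bspl (3/2)" for x i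
    unfolding arg using isCont_tendsto_compose[where g=bspl, OF DERIV_isCont[OF has_real_derivative_bspl] lim0[of x i]]
    by simp
  have b32: "bspl (3/2) = 3/2" by (simp add: bspl_def power2_eq_square)
  have ltb: "(\<lambda>n. tb (h n) (c n) x) \<longlonglongrightarrow> (3/2)^3" for x
    unfolding tb_def using tendsto_prod[of UNIV "\<lambda>i n. bspl ((x$i - c n$i) / h n$i)" "\<lambda>i. bspl (3/2)" sequentially] lb
    by (simp add: b32)
  have ldtb: "(\<lambda>n. dtb i (h n) (c n) x) \<longlonglongrightarrow> 0" for i x
  proof (rule Lim_null_comparison[where g="\<lambda>n. 60^3 * (1 / real (Suc n))"])
    show "(\<lambda>n. 60^3 * (1 / real (Suc n))) \<longlonglongrightarrow> 0"
      by (rule tendsto_mult_right_zero, rule LIMSEQ_Suc[OF lim_1_over_n])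
    show "\<forall>\<^sub>F n in sequentially. norm (dtb i (h n) (c n) x) \<le> 60^3 * (1 / real (Suc n))"
      using tb_bound(2)[of i "h _" "c _" x] by (intro always_eventually allI) (simp add: h_def)
  qed
  have lim: "(\<lambda>n. ?g n x) \<longlonglongrightarrow> (3/2)^3 * ?d x" for x
  proof -
    have "(\<lambda>n. ?g n x) \<longlonglongrightarrow> (\<Sum>i\<in>UNIV. W x $ i * 0) + (3/2)^3 * ?d x"
      by (intro tendsto_intros ltb ldtb)
    then show ?thesis by simp
  qed
  have bnd: "norm (?g n x) \<le> (3 * (B * 60^3) + 60^3 * C) * indicator (cball 0 R) x" for n x
  proof (cases "x \<in> cball 0 R")
    case True
    have "\<bar>W x $ i * dtb i (h n) (c n) x\<bar> \<le> B * 60^3" for i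
      unfolding abs_mult
    proof (rule mult_mono)
      show "\<bar>W x $ i\<bar> \<le> B" using component_le_norm_cart[of "W x" i] B(2)[of x] by simp
      have "(60::real)^3 / \<bar>h n $ i\<bar> \<le> 60^3" by (simp add: h_def divide_le_eq)
      then show "\<bar>dtb i (h n) (c n) x\<bar> \<le> 60^3" using tb_bound(2)[of i "h n" "c n" x] by linarith
    qed (use B in auto)
    then have "\<bar>\<Sum>i\<in>UNIV. W x $ i * dtb i (h n) (c n) x\<bar> \<le> (\<Sum>i\<in>(UNIV::3 set). B * 60^3)"
      by (intro order_trans[OF sum_abs] sum_mono)
    moreover have "\<bar>tb (h n) (c n) x * ?d x\<bar> \<le> 60^3 * C"
      unfolding abs_mult by (intro mult_mono tb_bound C) auto
    ultimately show ?thesis using True by simp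
  next
    case False
    then show ?thesis using supp[OF False] d0[OF False] by simp
  qed
  have "(\<lambda>n. (\<integral>x. ?g n x \<partial>lborel)) \<longlonglongrightarrow> (\<integral>x. (3/2)^3 * ?d x \<partial>lborel)"
  proof (rule integral_dominated_convergence)
    show "integrable lborel (\<lambda>x. (3 * (B * 60^3) + 60^3 * C) * indicator (cball 0 R) x :: real)"
      by (intro integrable_mult_right integrable_real_indicator emeasure_bounded_finite) auto
    show "(\<lambda>x. (3/2)^3 * ?d x) \<in> borel_measurable lborel"
      using borel_measurable_continuous_onI[OF cd] by measurable
    show "?g n \<in> borel_measurable lborel" for n
      using dpair_integrable[OF cW cd, of "h n" "c n"] by (intro borel_measurable_integrable) (auto simp: h_def)
  qed (use bnd lim in auto)
  moreover have "(\<integral>x. ?g n x \<partial>lborel) = 0" for n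
    using dpair_zero[OF der cd, of "real (Suc n)" "c n"] unfolding dpair_def h_def by simp
  ultimately have "(\<integral>x. (3/2)^3 * ?d x \<partial>lborel) = 0" by (simp add: LIMSEQ_const_iff)
  then show ?thesis by simp
qed

section \<open>The flux\<close>

lemma powr_add_le:
  fixes x y e :: real
  assumes "x \<ge> 0" "y \<ge> 0" "0 < e" "e \<le> 1"
  shows "(x + y) powr e \<le> x powr e + y powr e"
proof (cases "x + y = 0")
  case False
  then have s: "x + y > 0" using assms by linarith
  have "t / (x + y) \<le> (t / (x + y)) powr e" if "0 \<le> t" "t \<le> x + y" for t
    using powr_mono'[of e 1 "t / (x + y)"] that s assms by simp
  from this[of x] this[of y] have "x / (x + y) + y / (x + y) \<le> (x / (x + y)) powr e + (y / (x + y)) powr e"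
    using assms by simp
  then have "1 \<le> (x powr e + y powr e) / (x + y) powr e"
    using assms s by (simp add: powr_divide add_divide_distrib[symmetric])
  then show ?thesis using s by (simp add: field_simps)
qed (use assms in auto)

lemma powr_between_le_max:
  fixes Y :: real
  assumes "Y \<ge> 0" "e1 \<le> b" "b \<le> e2" shows "Y powr b \<le> max (Y powr e1) (Y powr e2)"
proof (cases "Y \<le> 1")
  case True then show ?thesis using powr_mono'[OF assms(2) assms(1)] by simp
next
  case False
  then have "Y powr b \<le> Y powr e2" using assms by (intro powr_mono) auto
  then show ?thesis by simp
qed

text \<open>Convexity of the power function at the midpoint. It is available on the open half-line
  only, hence the separate case of a zero argument.\<close>

lemma powr_sum2_le:
  fixes x y p :: real
  assumes "x \<ge> 0" "y \<ge> 0" "p \<ge> 1"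
  shows "(x + y) powr p \<le> 2 powr (p - 1) * (x powr p + y powr p)"
proof (cases "x = 0 \<or> y = 0")
  case True
  have "1 \<le> (2::real) powr (p - 1)" using assms(3) by (simp add: ge_one_powr_ge_zero)
  then have "1 * t powr p \<le> 2 powr (p - 1) * t powr p" for t :: real
    by (intro mult_right_mono) auto
  then show ?thesis using True assms(3) by auto
next
  case False
  then have pos: "x > 0" "y > 0" using assms by auto
  have "((1 - 1/2) *\<^sub>R x + (1/2) *\<^sub>R y) powr p \<le> (1 - 1/2) * x powr p + (1/2) * y powr p"
    by (rule convex_onD[OF powr_convex[OF assms(3)]]) (use pos in auto)
  then have "((x + y) / 2) powr p \<le> (x powr p + y powr p) / 2" by (simp add: add_divide_distrib)
  then show ?thesis using pos by (simp add: powr_divide powr_diff field_simps)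
qed

lemma powr_sum3_le:
  fixes x y z p :: real
  assumes "x \<ge> 0" "y \<ge> 0" "z \<ge> 0" "p \<ge> 1"
  shows "(x + y + z) powr p \<le> 3 powr (p - 1) * (x powr p + y powr p + z powr p)"
proof (cases "x = 0 \<or> y = 0 \<or> z = 0")
  case True
  have le: "(2::real) powr (p - 1) \<le> 3 powr (p - 1)" using assms by (intro powr_mono2) auto
  have 2: "(s + t) powr p \<le> 3 powr (p - 1) * (s powr p + t powr p)" if "s \<ge> 0" "t \<ge> 0" for s t :: real
    using powr_sum2_le[OF that assms(4)] mult_right_mono[OF le, of "s powr p + t powr p"] by simp
  show ?thesis
    using True 2[OF assms(1,2)] 2[OF assms(1,3)] 2[OF assms(2,3)] assms by auto
next
  case False
  then have pos: "x > 0" "y > 0" "z > 0" using assms by auto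
  have c: "convex_on {0<..} (\<lambda>x::real. x powr p)" by (rule powr_convex[OF assms(4)])
  have "((1 - 1/2) *\<^sub>R x + (1/2) *\<^sub>R y) powr p \<le> (1 - 1/2) * x powr p + (1/2) * y powr p"
    by (rule convex_onD[OF c]) (use pos in auto)
  moreover have "((1 - 1/3) *\<^sub>R ((x + y)/2) + (1/3) *\<^sub>R z) powr p \<le> (1 - 1/3) * ((x + y)/2) powr p + (1/3) * z powr p"
    by (rule convex_onD[OF c]) (use pos in auto)
  ultimately have "((x + y + z) / 3) powr p \<le> (x powr p + y powr p + z powr p) / 3"
    by (simp add: add_divide_distrib)
  then show ?thesis using pos by (simp add: powr_divide powr_diff field_simps)
qed

text \<open>A form of Young's inequality got by comparing \<open>Y\<close> with the threshold
  \<open>(c / \<epsilon>) * w * h\<close>: below it the last term suffices, above it the first. This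
  yields \<open>(c / \<epsilon>) powr (1 - a)\<close> without further factors, the shape in which
  the power of \<open>32 * c3 / c4\<close> occurs in \<open>c11\<close> and
  \<open>c12\<close>.\<close>

lemma powr_young_weight:
  fixes c \<epsilon> w Y h a :: real
  assumes "c > 0" "\<epsilon> > 0" "w > 0" "Y \<ge> 0" "h \<ge> 0" "0 < a" "a < 1"
  shows "c * Y powr (1 - a) * h \<le> \<epsilon> / w * Y powr (2 - a) + c * (c / \<epsilon>) powr (1 - a) * (w powr (1 - a) * h powr (2 - a))"
proof -
  have e: "t * t powr (1 - a) = t powr (2 - a)" if "t \<ge> 0" for t :: real
    using that powr_add[of t 1 "1 - a"] by (cases "t = 0") auto
  show ?thesis
  proof (cases "Y \<le> (c / \<epsilon>) * w * h")
    case True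
    have "Y powr (1 - a) \<le> ((c / \<epsilon>) * w * h) powr (1 - a)" using True assms by (intro powr_mono2) auto
    also have "\<dots> = (c / \<epsilon>) powr (1 - a) * w powr (1 - a) * h powr (1 - a)"
      using assms by (simp only: powr_mult)
    finally have "c * h * Y powr (1 - a) \<le> c * h * ((c / \<epsilon>) powr (1 - a) * w powr (1 - a) * h powr (1 - a))"
      using assms by (intro mult_left_mono) auto
    also have "\<dots> = c * (c / \<epsilon>) powr (1 - a) * (w powr (1 - a) * (h * h powr (1 - a)))" by (simp add: mult_ac)
    finally show ?thesis using assms e[OF assms(5)] by (simp add: mult_ac add_increasing)
  next
    case False
    then have "c * h \<le> \<epsilon> / w * Y" using assms by (simp add: field_simps)
    then have "c * h * Y powr (1 - a) \<le> \<epsilon> / w * Y * Y powr (1 - a)" by (intro mult_right_mono) auto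
    moreover have "0 \<le> c * (c / \<epsilon>) powr (1 - a) * (w powr (1 - a) * h powr (2 - a))" using assms by auto
    moreover have "\<epsilon> / w * Y * Y powr (1 - a) = \<epsilon> / w * Y powr (2 - a)"
      using e[OF assms(4)] by (simp only: mult.assoc)
    moreover have "c * Y powr (1 - a) * h = c * h * Y powr (1 - a)" by simp
    ultimately show ?thesis by linarith
  qed
qed

section \<open>The Forchheimer law with rotation: solvability, growth and coercivity\<close>

locale forchheimer =
  fixes N :: nat and coef alb :: "nat \<Rightarrow> real" and k :: "real^3"
  assumes N_ge: "N \<ge> 1" and alb0: "alb 0 = 0"
    and alb_mono: "\<forall>i<N. alb i < alb (Suc i)"
    and coef_pos: "\<forall>i\<le>N. coef i > 0" and k_unit: "norm k = 1"
begin

abbreviation "a \<equiv> aexp N alb"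
abbreviation "g \<equiv> gfun N coef alb"
abbreviation "C3 \<equiv> c3 N coef alb"
abbreviation "C4 \<equiv> c4 N coef alb"
abbreviation "C5 \<equiv> c5 N coef alb"
abbreviation "C10 \<equiv> c10 N coef alb"

lemma alb_le: "i \<le> j \<Longrightarrow> j \<le> N \<Longrightarrow> alb i \<le> alb j"
proof (induction j)
  case (Suc j)
  then have "j < N" by simp
  then have "alb j < alb (Suc j)" using alb_mono by blast
  then show ?case using Suc by (cases "i = Suc j") auto
qed simp

lemma alb_pos: "1 \<le> i \<Longrightarrow> i \<le> N \<Longrightarrow> alb i > 0"
  using alb_le[of 1 i] alb_mono alb0 N_ge by (metis One_nat_def less_eq_Suc_le less_le_trans)

lemma a_bounds: "0 < a" "a < 1" "1 - a = 1 / (1 + alb N)" "alb N * (1 - a) = a" "(1 + alb N) * a = alb N"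
  using alb_pos[of N] N_ge by (auto simp: aexp_def field_simps)

lemma c_pos: "C3 > 0" "C4 > 0" "C5 > 0" "C10 > 0" "chi0 N coef > 0" "C4 \<le> 2 * C5" "C5 = 2 powr (- a) * C4" "C10 = C4 / 4"
proof -
  have "coef 0 > 0" "coef N > 0" using coef_pos by auto
  then show "C3 > 0" "C4 > 0" by (auto simp: c3_def c4_def min_def)
  then show "C5 > 0" "C10 > 0" "C5 = 2 powr (- a) * C4" "C10 = C4 / 4" by (auto simp: c5_def c10_def)
  have "(2::real) powr (- 1) \<le> 2 powr (- a)" using a_bounds(1,2) by (intro powr_mono) auto
  then have "1 \<le> 2 * 2 powr (- a)" by (simp add: powr_minus)
  then have "1 * C4 \<le> (2 * 2 powr (- a)) * C4" using \<open>C4 > 0\<close> by (intro mult_right_mono) auto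
  then show "C4 \<le> 2 * C5" by (simp add: c5_def)
  show "chi0 N coef > 0" unfolding chi0_def by (intro sum_pos) (use coef_pos in auto)
qed

lemma g_ge: "g s \<ge> coef 0 + coef N * s powr alb N"
proof -
  have "coef N * s powr alb N \<le> (\<Sum>i=1..N. coef i * s powr alb i)"
    by (rule member_le_sum[where f="\<lambda>i. coef i * s powr alb i"])
      (use N_ge coef_pos in \<open>auto intro!: mult_nonneg_nonneg intro: less_imp_le\<close>)
  then show ?thesis by (simp add: gfun_def)
qed

lemma g_pos: "g s > 0"
proof -
  have "coef 0 > 0" "coef N > 0" using coef_pos by auto
  then have "coef 0 + coef N * s powr alb N > 0" by (intro add_pos_nonneg) auto
  then show ?thesis using g_ge[of s] by linarith
qed

lemma g_le: 
  assumes "s \<ge> 0" shows "g s \<le> chi0 N coef * (1 + s) powr alb N"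
proof -
  have p: "s powr alb i \<le> (1 + s) powr alb N" if "1 \<le> i" "i \<le> N" for i
  proof -
    have "s powr alb i \<le> (1 + s) powr alb i" using assms alb_pos[OF that] by (intro powr_mono2) auto
    also have "\<dots> \<le> (1 + s) powr alb N" using assms alb_le[OF that(2)] by (intro powr_mono) auto
    finally show ?thesis .
  qed
  have "1 \<le> (1 + s) powr alb N" using assms alb_pos[of N] N_ge by (simp add: ge_one_powr_ge_zero)
  then have "coef 0 * 1 \<le> coef 0 * (1 + s) powr alb N" using coef_pos by (intro mult_left_mono) (auto intro: less_imp_le)
  moreover have "(\<Sum>i=1..N. coef i * s powr alb i) \<le> (\<Sum>i=1..N. coef i * (1 + s) powr alb N)"
    using coef_pos p by (intro sum_mono mult_left_mono) (auto intro: less_imp_le)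
  moreover have "chi0 N coef = coef 0 + (\<Sum>i=1..N. coef i)"
    unfolding chi0_def by (simp add: sum.atLeast_Suc_atMost)
  ultimately show ?thesis by (simp add: gfun_def sum_distrib_right distrib_right)
qed

lemma continuous_on_g: "continuous_on {0..} g"
  unfolding gfun_def[abs_def]
  by (intro continuous_intros continuous_on_powr') (use alb_pos in force)+

text \<open>The rotation term is orthogonal to \<open>v\<close> and drops out.\<close>

lemma F_inner: "Ffun N coef alb k z v \<bullet> v = g (norm v) * (norm v)\<^sup>2"
  by (simp add: Ffun_def Jmap_def inner_add_left dot_cross_self power2_norm_eq_inner)

lemma norm_J_le: "norm (Jmap k v) \<le> norm v"
proof -
  have "(norm (Jmap k v))\<^sup>2 \<le> (norm v)\<^sup>2" unfolding Jmap_def norm_cross k_unit by simp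
  then show ?thesis by (simp add: power2_le_iff_abs_le)
qed

lemma F_norm_ge: "norm (Ffun N coef alb k z v) \<ge> g (norm v) * norm v"
proof (cases "v = 0")
  case False
  have "g (norm v) * norm v * norm v = Ffun N coef alb k z v \<bullet> v" by (simp add: F_inner power2_eq_square)
  also have "\<dots> \<le> norm (Ffun N coef alb k z v) * norm v" by (rule norm_cauchy_schwarz)
  finally show ?thesis using False by simp
qed simp

lemma F_norm_le: 
  assumes "z \<ge> 0" shows "norm (Ffun N coef alb k z v) \<le> (g (norm v) + z) * norm v"
proof -
  have "norm (Ffun N coef alb k z v) \<le> norm (g (norm v) *\<^sub>R v) + norm (z *\<^sub>R Jmap k v)"
    unfolding Ffun_def by (rule norm_triangle_ineq)
  also have "\<dots> \<le> g (norm v) * norm v + z * norm v"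
    using g_pos[of "norm v"] assms norm_J_le[of v] by (auto intro!: mult_left_mono)
  finally show ?thesis by (simp add: algebra_simps)
qed

text \<open>For a prescribed value \<open>G\<close> of \<open>g\<close> the equation \<open>F v = y\<close> is linear in \<open>v\<close> and solved explicitly;
  the right \<open>G = g (norm v)\<close> is then found by the intermediate value theorem.\<close>
lemma surj_F: "\<exists>v. Ffun N coef alb k z v = y"
proof -
  \<comment> \<open>The inverse of \<open>G + z J\<close>, computed from
    \<open>J (J y) = (k \<bullet> y) k - y\<close> and \<open>J k = 0\<close>.\<close>
  define V where "V G = (1 / (G * (G\<^sup>2 + z\<^sup>2))) *\<^sub>R (G\<^sup>2 *\<^sub>R y - (z * G) *\<^sub>R Jmap k y + (z\<^sup>2 * (k \<bullet> y)) *\<^sub>R k)" for G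
  have JJ: "Jmap k (Jmap k y) = (k \<bullet> y) *\<^sub>R k - y" "Jmap k k = 0"
    using k_unit by (simp_all add: Jmap_def Lagrange dot_square_norm)
  have eq: "G *\<^sub>R V G + z *\<^sub>R Jmap k (V G) = y" if "G > 0" for G
  proof -
    let ?c = "1 / (G * (G\<^sup>2 + z\<^sup>2))"
    have p: "G * (G\<^sup>2 + z\<^sup>2) > 0" using that by (auto intro!: mult_pos_pos add_pos_nonneg)
    have J: "Jmap k (V G) = ?c *\<^sub>R (G\<^sup>2 *\<^sub>R Jmap k y - (z * G) *\<^sub>R ((k \<bullet> y) *\<^sub>R k - y))"
      unfolding V_def JJ(1)[symmetric] using JJ(2)
      by (simp add: Jmap_def Cross3.right_diff_distrib cross_add_right cross_mult_right scaleR_diff_right scaleR_add_right)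
    have "G *\<^sub>R (G\<^sup>2 *\<^sub>R y - (z * G) *\<^sub>R Jmap k y + (z\<^sup>2 * (k \<bullet> y)) *\<^sub>R k)
        + z *\<^sub>R (G\<^sup>2 *\<^sub>R Jmap k y - (z * G) *\<^sub>R ((k \<bullet> y) *\<^sub>R k - y)) = (G * (G\<^sup>2 + z\<^sup>2)) *\<^sub>R y"
      by (simp add: algebra_simps power2_eq_square)
    moreover have "G *\<^sub>R V G + z *\<^sub>R Jmap k (V G) = ?c *\<^sub>R (G *\<^sub>R (G\<^sup>2 *\<^sub>R y - (z * G) *\<^sub>R Jmap k y + (z\<^sup>2 * (k \<bullet> y)) *\<^sub>R k)
        + z *\<^sub>R (G\<^sup>2 *\<^sub>R Jmap k y - (z * G) *\<^sub>R ((k \<bullet> y) *\<^sub>R k - y)))"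
      unfolding J unfolding V_def by (simp only: scaleR_add_right[of ?c] scaleR_left_commute[of ?c])
    ultimately show ?thesis using p that by simp
  qed
  have gl: "g r \<ge> coef 0" "coef 0 > 0" for r 
    using g_ge[of r] coef_pos N_ge by (smt (verit) le_refl powr_ge_zero zero_le mult_nonneg_nonneg)+
  have Vle: "coef 0 * norm (V (g r)) \<le> norm y" for r
  proof -
    let ?G = "g r" let ?v = "V (g r)"
    have "?G * norm ?v * norm ?v = (?G *\<^sub>R ?v + z *\<^sub>R Jmap k ?v) \<bullet> ?v"
      by (simp add: Jmap_def inner_add_left dot_cross_self power2_norm_eq_inner[symmetric] power2_eq_square)
    also have "\<dots> \<le> norm y * norm ?v" unfolding eq[OF g_pos] by (rule norm_cauchy_schwarz)
    finally have "?G * norm ?v \<le> norm y" by (cases "?v = 0") auto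
    then show ?thesis using mult_right_mono[OF gl(1)[of r], of "norm ?v"] by simp
  qed
  define r1 where "r1 = norm y / coef 0 + 1"
  have "\<exists>r\<ge>0. r \<le> r1 \<and> norm (V (g r)) - r = 0"
  proof (rule IVT2')
    show "norm (V (g r1)) - r1 \<le> 0" using Vle[of r1] gl(2) by (simp add: r1_def field_simps)
    show "0 \<le> norm (V (g 0)) - 0" by simp
    show "0 \<le> r1" using gl(2) by (simp add: r1_def)
    have cg: "continuous_on {0..r1} g" by (rule continuous_on_subset[OF continuous_on_g]) auto
    have nz: "g r * ((g r)\<^sup>2 + z\<^sup>2) \<noteq> 0" for r
      using g_pos[of r] by (smt (verit) mult_pos_pos zero_less_power zero_le_power2)
    show "continuous_on {0..r1} (\<lambda>r. norm (V (g r)) - r)"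
      unfolding V_def by (intro continuous_intros cg) (use nz in auto)
  qed
  then obtain r where "norm (V (g r)) = r" by auto
  then show ?thesis using eq[OF g_pos[of r]] by (auto simp: Ffun_def intro!: exI[of _ "V (g r)"])
qed

lemma F_inv: "Ffun N coef alb k z (inv (Ffun N coef alb k z) y) = y"
  using surj_F[of z y] by (metis f_inv_into_f rangeI)

text \<open>The leading term of \<open>g\<close> alone gives
  \<open>coef N * norm v powr (1 + alb N) \<le> norm y\<close>, and \<open>1 - a\<close> is the
  reciprocal of \<open>1 + alb N\<close>.\<close>

lemma norm_F_le:
  assumes "Ffun N coef alb k z v = y"
  shows "norm v \<le> C3 * norm y powr (1 - a)"
proof (cases "v = 0")
  case False
  have cN: "coef N > 0" using coef_pos by simp
  have "coef N * norm v powr (1 + alb N) = (coef N * norm v powr alb N) * norm v"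
    using False by (simp add: powr_add)
  also have "\<dots> \<le> g (norm v) * norm v"
    using g_ge[of "norm v"] coef_pos by (intro mult_right_mono) (auto intro: order_trans[rotated] less_imp_le)
  also have "\<dots> \<le> norm y" using F_norm_ge[of v z] assms by simp
  finally have "(coef N * norm v powr (1 + alb N)) powr (1 - a) \<le> norm y powr (1 - a)"
    using cN a_bounds(1,2) by (intro powr_mono2) (auto intro: mult_nonneg_nonneg)
  then have "coef N powr (1 - a) * norm v \<le> norm y powr (1 - a)"
    using cN a_bounds(3) False alb_pos[of N] N_ge by (simp add: powr_mult powr_powr)
  then have "coef N powr (a - 1) * (coef N powr (1 - a) * norm v) \<le> coef N powr (a - 1) * norm y powr (1 - a)"
    by (intro mult_left_mono) auto
  moreover have "coef N powr (a - 1) * coef N powr (1 - a) = 1" using cN by (simp add: powr_add[symmetric])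
  ultimately show ?thesis by (simp add: c3_def mult.assoc[symmetric])
qed (use c_pos in simp)

text \<open>Put s = |v| and X = (1 + s)^A. Then |y| is at most (chi0 + z) X s and g(s) is at least b
  X, so y . v = g(s) s^2 is at least b |y|^2 / ((chi0 + z)^2 X); an upper bound for X by a power of
  |y| finishes. The -1 makes the claim trivial for |y| at most 1.\<close>

lemma F_inner_ge:
  assumes F: "Ffun N coef alb k z v = y" and z: "z \<ge> 0"
  shows "y \<bullet> v \<ge> C5 / (chi0 N coef + z)\<^sup>2 * (norm y powr (2 - a) - 1)"
proof (cases "norm y \<le> 1")
  case True
  have "norm y powr (2 - a) \<le> 1" using True a_bounds(1,2) by (intro powr_le1) auto
  then have "C5 / (chi0 N coef + z)\<^sup>2 * (norm y powr (2 - a) - 1) \<le> 0"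
    using c_pos by (intro mult_nonneg_nonpos) auto
  also have "0 \<le> y \<bullet> v" using F_inner[of z v] g_pos[of "norm v"] by (simp add: F)
  finally show ?thesis .
next
  case False
  define s where "s = norm v"
  define A where "A = alb N"
  define m where "m = min 1 (min (coef 0) (coef N))"
  \<comment> \<open>\<open>b powr (1 + a)\<close> is \<open>C4\<close>, so
    \<open>C5 = 2 powr (- a) * b powr (1 + a)\<close>.\<close>
  define b where "b = m / 2 powr A"
  define X where "X = (1 + s) powr A"
  let ?c = "chi0 N coef + z"
  have s: "s \<ge> 0" by (simp add: s_def)
  have A: "A > 0" using alb_pos[of N] N_ge by (simp add: A_def)
  have m: "m > 0" "m \<le> 1" "m \<le> coef 0" "m \<le> coef N" using coef_pos by (auto simp: m_def)
  have b: "b > 0" using m by (simp add: b_def)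
  have X: "X \<ge> 1" using s A by (simp add: X_def ge_one_powr_ge_zero)
  have y1: "norm y > 1" using False by simp
  have gm: "g s \<ge> m * (1 + s powr A)"
    using g_ge[of s] m mult_right_mono[OF m(4), of "s powr A"] by (simp add: A_def algebra_simps)
  have gb: "g s \<ge> b * X"
  proof -
    have "X \<le> (2 * max 1 s) powr A" unfolding X_def using s A by (intro powr_mono2) auto
    also have "\<dots> = 2 powr A * max 1 (s powr A)"
      using s A powr_mono2[of A s 1] powr_mono2[of A 1 s] by (auto simp: powr_mult max_def)
    also have "\<dots> \<le> 2 powr A * (1 + s powr A)" by (intro mult_left_mono) auto
    finally have "b * X \<le> b * (2 powr A * (1 + s powr A))" using b by (intro mult_left_mono) auto
    then show ?thesis using gm by (simp add: b_def)
  qed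
  have bX: "b * (1 + s) powr (1 + A) \<le> 1 + norm y"
  proof -
    have "(1 + s) powr (1 + A) \<le> 2 powr A * (1 + s powr (1 + A))"
      using powr_sum2_le[of 1 s "1 + A"] s A by simp
    then have "b * (1 + s) powr (1 + A) \<le> b * (2 powr A * (1 + s powr (1 + A)))" using b by (intro mult_left_mono) auto
    also have "\<dots> = m * (1 + s powr (1 + A))" by (simp add: b_def)
    also have "\<dots> \<le> 1 + m * s powr (1 + A)" using m by (simp add: algebra_simps)
    also have "m * s powr (1 + A) \<le> g s * s"
    proof -
      have "m * s powr (1 + A) = (m * s powr A) * s" using s by (cases "s = 0") (auto simp: powr_add)
      also have "\<dots> \<le> g s * s" using gm m s by (intro mult_right_mono) (auto simp: algebra_simps)
      finally show ?thesis .
    qed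
    also have "g s * s \<le> norm y" using F_norm_ge[of v z] F by (simp add: s_def)
    finally show ?thesis by simp
  qed
  \<comment> \<open>\<open>(1 + A) * a = A\<close> converts the bound for
    \<open>(1 + s) powr (1 + A)\<close>. Replacing \<open>1 + norm y\<close> by
    \<open>2 * norm y\<close> is the origin of the factor \<open>2 powr (- a)\<close> in
    \<open>C5\<close>.\<close>
  have XA: "X \<le> (2 * norm y / b) powr a"
  proof -
    have "X = ((1 + s) powr (1 + A)) powr a" using a_bounds(5) by (simp add: X_def powr_powr A_def)
    also have "\<dots> \<le> ((1 + norm y) / b) powr a" using bX b a_bounds(1,2) by (intro powr_mono2) (auto simp: field_simps)
    also have "\<dots> \<le> (2 * norm y / b) powr a" using y1 b a_bounds(1,2) by (intro powr_mono2) (auto intro!: divide_right_mono)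
    finally show ?thesis .
  qed
  have gz: "g s + z \<le> ?c * X"
    using g_le[OF s] mult_left_mono[OF X z] by (simp add: X_def A_def algebra_simps)
  have cp: "?c > 0" using c_pos z by simp
  have "norm y \<le> (?c * X) * s"
    using F_norm_le[OF z, of v] F mult_right_mono[OF gz s] by (simp add: s_def)
  then have "(norm y)\<^sup>2 \<le> (?c * X * s)\<^sup>2" by (intro power_mono) auto
  moreover have "(?c * X)\<^sup>2 > 0" using cp X by (intro zero_less_power mult_pos_pos) auto
  ultimately have "(norm y)\<^sup>2 / (?c * X)\<^sup>2 \<le> s\<^sup>2"
    by (simp only: power_mult_distrib[of "?c * X" s] pos_divide_le_eq mult.commute[of "s\<^sup>2"])
  then have "b * X * ((norm y)\<^sup>2 / (?c * X)\<^sup>2) \<le> g s * s\<^sup>2"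
    using gb b X g_pos[of s] by (intro mult_mono) (auto intro: less_imp_le)
  also have "g s * s\<^sup>2 = y \<bullet> v" using F_inner[of z v] F by (simp add: s_def)
  also have "b * X * ((norm y)\<^sup>2 / (?c * X)\<^sup>2) = b * (norm y)\<^sup>2 / (?c\<^sup>2 * X)"
  proof -
    have "b * X * (n / (c * X)\<^sup>2) = b * n / (c\<^sup>2 * X)" if "c > 0" for c n :: real
      using X that by (simp add: power2_eq_square field_simps)
    then show ?thesis using cp .
  qed
  finally have 1: "b * (norm y)\<^sup>2 / (?c\<^sup>2 * X) \<le> y \<bullet> v" .
  have "C5 / ?c\<^sup>2 * norm y powr (2 - a) = b * (norm y)\<^sup>2 / (?c\<^sup>2 * (2 * norm y / b) powr a)"
  proof -
    have "C5 = 2 powr (- a) * b powr (1 + a)" by (simp add: c5_def c4_def b_def m_def A_def)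
    then have C: "C5 = b * b powr a / 2 powr a" using b by (simp add: powr_add powr_minus divide_inverse)
    have "(b * B / P) / S * (n / Na) = b * n / (S * (P * Na / B))" if "B > 0" "P > 0" "Na > 0" "S > 0" for B P Na S n :: real
      using that by (simp add: field_simps)
    from this[of "b powr a" "2 powr a" "norm y powr a" "?c\<^sup>2" "(norm y)\<^sup>2"]
    show ?thesis using y1 b cp by (simp add: C powr_diff powr_mult powr_divide mult_ac)
  qed
  also have "\<dots> \<le> b * (norm y)\<^sup>2 / (?c\<^sup>2 * X)"
    using XA X b cp by (intro divide_left_mono mult_left_mono) (auto intro!: mult_pos_pos)
  finally have "C5 / ?c\<^sup>2 * norm y powr (2 - a) \<le> y \<bullet> v" using 1 by simp
  moreover have "C5 / ?c\<^sup>2 * (norm y powr (2 - a) - 1) \<le> C5 / ?c\<^sup>2 * norm y powr (2 - a)"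
    using c_pos by (intro mult_left_mono) auto
  ultimately show ?thesis by linarith
qed

text \<open>Collects the two kinds of remainder in \<open>flux_coercive\<close>: from Young's
  inequality for the cross terms, and from replacing \<open>y\<close> by
  \<open>y - D1 - D2\<close>.\<close>

definition K0 :: real where
  "K0 = C3 * (32 * C3 / C4) powr (1 - a) + 3 powr (1 - a) * C10"

lemma K0_pos: "K0 > 0"
  unfolding K0_def using c_pos by (auto intro!: add_nonneg_pos)

text \<open>In the application \<open>y - D1 - D2\<close> is the gradient of
  \<open>u - \<Psi>\<close>, with \<open>D1\<close> the gravity and centrifugal term and
  \<open>D2\<close> the gradient of \<open>\<Psi>\<close>. The coercivity of
  \<open>y \<bullet> v\<close> is spent in two portions: \<open>C4 / 16\<close> on the cross terms
  \<open>v \<bullet> D1\<close> and \<open>v \<bullet> D2\<close>, and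
  \<open>3 powr (1 - a) * C10\<close> on the passage from \<open>y\<close> to
  \<open>y - D1 - D2\<close>.\<close>

lemma flux_coercive:
  assumes F: "Ffun N coef alb k z v = y" and z: "z \<ge> 0"
    and w: "1 \<le> w" "(chi0 N coef + z)\<^sup>2 \<le> w" and D: "norm D1 \<le> h1" "norm D2 \<le> h2"
  shows "v \<bullet> (y - D1 - D2) \<ge> C10 / w * norm (y - D1 - D2) powr (2 - a) - C5 
      - K0 * (w powr (1 - a) * (h1 powr (2 - a) + h2 powr (2 - a)))"
proof -
  let ?Y = "norm y"
  define Y where "Y = ?Y powr (2 - a)"
  define H where "H = h1 powr (2 - a) + h2 powr (2 - a)"
  define W where "W = w powr (1 - a)"
  have h: "h1 \<ge> 0" "h2 \<ge> 0" using D norm_ge_zero order_trans by blast+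
  have Y: "Y \<ge> 0" and H: "H \<ge> 0" and W: "W \<ge> 1"
    using w a_bounds(1,2) by (auto simp: Y_def H_def W_def ge_one_powr_ge_zero)
  have cz: "(chi0 N coef + z)\<^sup>2 > 0" using c_pos z by (intro zero_less_power) linarith
  have l1: "y \<bullet> v \<ge> C5 / w * Y - C5"
  \<comment> \<open>Enlarging \<open>(chi0 N coef + z)\<^sup>2\<close> to \<open>w\<close> weakens
    the lower bound only if \<open>Y - 1\<close> is positive; otherwise the left side exceeds a
    nonpositive number trivially.\<close>
  proof (cases "Y \<le> 1")
    case True
    have "C5 / w * Y \<le> C5 * 1" using True Y w c_pos by (intro mult_mono) (auto simp: field_simps)
    moreover have "y \<bullet> v \<ge> 0" using F_inner[of z v] F g_pos[of "norm v"] by simp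
    ultimately show ?thesis by simp
  next
    case False
    have "C5 / w * (Y - 1) \<le> C5 / (chi0 N coef + z)\<^sup>2 * (Y - 1)"
      using False w cz c_pos by (intro mult_right_mono divide_left_mono) auto
    also have "\<dots> \<le> y \<bullet> v" using F_inner_ge[OF F z] by (simp add: Y_def)
    finally have "C5 / w * Y - C5 / w \<le> y \<bullet> v" by (simp only: right_diff_distrib mult_1_right)
    moreover have "C5 / w \<le> C5" using w c_pos by (simp add: field_simps)
    ultimately show ?thesis by simp
  qed
  have l2: "\<bar>v \<bullet> Dd\<bar> \<le> C4 / 32 / w * Y + C3 * (32 * C3 / C4) powr (1 - a) * (W * h powr (2 - a))"
    if "norm Dd \<le> h" "h \<ge> 0" for Dd h
  proof -
    have "\<bar>v \<bullet> Dd\<bar> \<le> norm v * norm Dd" by (rule Cauchy_Schwarz_ineq2)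
    also have "\<dots> \<le> (C3 * ?Y powr (1 - a)) * h"
      using norm_F_le[OF F] that c_pos by (intro mult_mono) auto
    also have "\<dots> \<le> C4 / 32 / w * ?Y powr (2 - a) + C3 * (C3 / (C4 / 32)) powr (1 - a) * (w powr (1 - a) * h powr (2 - a))"
      by (rule powr_young_weight) (use c_pos w that a_bounds(1,2) in auto)
    finally show ?thesis by (simp add: Y_def W_def mult_ac)
  qed
  have l3: "C10 / w * norm (y - D1 - D2) powr (2 - a) \<le> 3 powr (1 - a) * C10 / w * Y + 3 powr (1 - a) * C10 * (W * H)"
  proof -
    have "norm (y - D1 - D2) \<le> ?Y + h1 + h2"
      using norm_triangle_ineq4[of "y - D1" D2] norm_triangle_ineq4[of y D1] D by linarith
    then have "norm (y - D1 - D2) powr (2 - a) \<le> (?Y + h1 + h2) powr (2 - a)"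
      using a_bounds(1,2) by (intro powr_mono2) auto
    also have "\<dots> \<le> 3 powr (1 - a) * (Y + H)"
      using powr_sum3_le[of ?Y h1 h2 "2 - a"] h a_bounds(1,2) by (simp add: Y_def H_def add.assoc)
    finally have "C10 / w * norm (y - D1 - D2) powr (2 - a) \<le> C10 / w * (3 powr (1 - a) * (Y + H))"
      using c_pos w by (intro mult_left_mono) auto
    also have "\<dots> = 3 powr (1 - a) * C10 / w * Y + 3 powr (1 - a) * C10 * (1 / w * H)"
      by (simp add: algebra_simps add_divide_distrib)
    also have "\<dots> \<le> 3 powr (1 - a) * C10 / w * Y + 3 powr (1 - a) * C10 * (W * H)"
      using w W H c_pos(4) by (intro add_left_mono mult_left_mono mult_right_mono) (auto intro: order_trans[of _ 1])
    finally show ?thesis .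
  qed
  \<comment> \<open>The two portions fit into \<open>C5\<close>. Divided by \<open>C4\<close> and
    multiplied by \<open>3 powr a\<close>, this is 3/4 + 3^a / 16 \<le> (3/2)^a, and the bounds 3^a
    \<le> 1 + 2 a \<le> 3 and (3/2)^a \<ge> 1 leave room.\<close>
  have num: "3 powr (1 - a) * C10 + C4 / 16 \<le> C5"
  proof -
    have "(3::real) powr a \<le> 1 + 2 * a"
      using Youngs_inequality_0[of a "1 - a" 3 1] a_bounds(1,2) by (simp add: algebra_simps)
    moreover have "1 \<le> (3/2::real) powr a" using a_bounds(1) by (simp add: ge_one_powr_ge_zero)
    ultimately have "3/4 + 3 powr a / 16 \<le> (3/2::real) powr a" using a_bounds(1,2) by linarith
    then have "(3/4 + 3 powr a / 16) * 3 powr (- a) \<le> (3/2::real) powr a * 3 powr (- a)"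
      by (intro mult_right_mono) auto
    then have "3 powr (1 - a) / 4 + 1/16 \<le> (2::real) powr (- a)"
      by (simp add: powr_diff powr_minus powr_divide field_simps)
    then have "(3 powr (1 - a) / 4 + 1/16) * C4 \<le> 2 powr (- a) * C4" using c_pos by (intro mult_right_mono) auto
    then show ?thesis by (simp add: c_pos(7,8) algebra_simps)
  qed
  have "(3 powr (1 - a) * C10 + C4 / 16) / w * Y \<le> C5 / w * Y"
    using num w Y by (intro mult_right_mono divide_right_mono) auto
  then have l4: "3 powr (1 - a) * C10 / w * Y + C4 / 16 / w * Y \<le> C5 / w * Y"
    by (simp only: add_divide_distrib distrib_right)
  have "v \<bullet> (y - D1 - D2) = y \<bullet> v - v \<bullet> D1 - v \<bullet> D2" by (simp add: inner_diff_right inner_commute)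
  moreover have l4': "C4 / 16 / w * Y = 2 * (C4 / 32 / w * Y)" by simp
  moreover have "K0 * (W * H) = C3 * (32 * C3 / C4) powr (1 - a) * (W * h1 powr (2 - a))
     + C3 * (32 * C3 / C4) powr (1 - a) * (W * h2 powr (2 - a)) + 3 powr (1 - a) * C10 * (W * H)"
    by (simp add: K0_def H_def algebra_simps)
  ultimately show ?thesis
    using l4' l1 l2[OF D(1) h(1)] l2[OF D(2) h(2)] l3 l4 unfolding W_def[symmetric] H_def[symmetric]
    by (simp only: abs_le_iff) linarith
qed

end

section \<open>Truncated powers as test functions\<close>

text \<open>Vanishing for \<open>\<bar>s\<bar> \<le> e\<close>, these turn a function with zero boundary values into compactly supported test functions.\<close>
definition evp :: "real \<Rightarrow> real \<Rightarrow> real \<Rightarrow> real" where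
  "evp e m s = (max 0 (s - e)) powr m + (max 0 (- s - e)) powr m"
definition odp :: "real \<Rightarrow> real \<Rightarrow> real \<Rightarrow> real" where
  "odp e m s = (max 0 (s - e)) powr m - (max 0 (- s - e)) powr m"

lemma evp_deriv: "m > 1 \<Longrightarrow> (evp e m has_real_derivative m * odp e (m - 1) s) (at s)"
  and odp_deriv: "m > 1 \<Longrightarrow> (odp e m has_real_derivative m * evp e (m - 1) s) (at s)"
proof -
  assume m: "m > 1"
  have 1: "((\<lambda>s. (max 0 (s - e)) powr m) has_real_derivative m * (max 0 (s - e)) powr (m - 1) * 1) (at s)"
    by (rule DERIV_chain2[OF has_real_derivative_max_powr[OF m]]) (auto intro!: derivative_eq_intros)
  have 2: "((\<lambda>s. (max 0 (- s - e)) powr m) has_real_derivative m * (max 0 (- s - e)) powr (m - 1) * - 1) (at s)"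
    by (rule DERIV_chain2[OF has_real_derivative_max_powr[OF m]]) (auto intro!: derivative_eq_intros)
  show "(evp e m has_real_derivative m * odp e (m - 1) s) (at s)"
    unfolding evp_def[abs_def] odp_def by (rule derivative_eq_intros 1 2 refl)+ (simp add: algebra_simps)
  show "(odp e m has_real_derivative m * evp e (m - 1) s) (at s)"
    unfolding odp_def[abs_def] evp_def by (rule derivative_eq_intros 1 2 refl)+ (simp add: algebra_simps)
qed

lemma continuous_on_max_powr [continuous_intros]:
  assumes "continuous_on S f" "m > 0" 
  shows "continuous_on S (\<lambda>x. (max 0 (f x :: real)) powr m)"
  by (intro continuous_on_powr' continuous_intros assms) (use assms in auto)

lemma continuous_on_evp [continuous_intros]: "continuous_on S f \<Longrightarrow> m > 0 \<Longrightarrow> continuous_on S (\<lambda>x. evp e m (f x))"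
  and continuous_on_odp [continuous_intros]: "continuous_on S f \<Longrightarrow> m > 0 \<Longrightarrow> continuous_on S (\<lambda>x. odp e m (f x))"
  unfolding evp_def odp_def by (intro continuous_intros; assumption)+

lemma evp_zero: "\<bar>s\<bar> \<le> e \<Longrightarrow> evp e m s = 0" "\<bar>s\<bar> \<le> e \<Longrightarrow> odp e m s = 0"
  by (auto simp: evp_def odp_def max_def abs_le_iff)

lemma evp_eq: "e \<ge> 0 \<Longrightarrow> evp e m s = (max 0 (\<bar>s\<bar> - e)) powr m"
  by (auto simp: evp_def max_def abs_if)

lemma odp_eq: "e \<ge> 0 \<Longrightarrow> odp e m s = sgn s * evp e m s"
  by (auto simp: evp_def odp_def max_def sgn_if)

lemma evp_le: "e \<ge> 0 \<Longrightarrow> m \<ge> 0 \<Longrightarrow> evp e m s \<le> \<bar>s\<bar> powr m"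
  by (simp add: evp_eq powr_mono2)

lemma evp_nonneg: "evp e m s \<ge> 0"
  by (simp add: evp_def)

lemma abs_odp_le: "e \<ge> 0 \<Longrightarrow> \<bar>odp e m s\<bar> \<le> evp e m s"
  by (simp add: odp_eq abs_mult sgn_if evp_nonneg)

lemma abs_odp_eq: "e \<ge> 0 \<Longrightarrow> m > 0 \<Longrightarrow> \<bar>odp e m s\<bar> = evp e m s"
  by (auto simp: odp_eq abs_mult sgn_if evp_nonneg evp_eq max_def)

lemma evp_lim: assumes "m > 0" shows "(\<lambda>n. evp (1 / real (Suc n)) m s) \<longlonglongrightarrow> \<bar>s\<bar> powr m"
proof -
  have "(\<lambda>n. (max 0 (\<bar>s\<bar> - 1 / real (Suc n))) powr m) \<longlonglongrightarrow> (max 0 (\<bar>s\<bar> - 0)) powr m"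
    by (intro tendsto_powr' tendsto_max tendsto_intros LIMSEQ_Suc[OF lim_1_over_n]) (use assms in auto)
  then show ?thesis by (simp add: evp_eq)
qed

lemma odp_lim: assumes "m > 0" shows "(\<lambda>n. odp (1 / real (Suc n)) m s) \<longlonglongrightarrow> sgn s * \<bar>s\<bar> powr m"
  using tendsto_mult[OF tendsto_const[of "sgn s"] evp_lim[OF assms]] by (simp add: odp_eq)

lemma has_derivative_grad1:
  assumes "f differentiable (at x)"
  shows "(f has_derivative (\<lambda>v. grad1 f x \<bullet> v)) (at x)"
proof -
  have d: "(f has_derivative frechet_derivative f (at x)) (at x)" using assms frechet_derivative_works by blast
  then have lin: "linear (frechet_derivative f (at x))" by (rule has_derivative_linear)
  have "frechet_derivative f (at x) v = grad1 f x \<bullet> v" for v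
  proof -
    have "frechet_derivative f (at x) v = frechet_derivative f (at x) (\<Sum>i\<in>UNIV. v $ i *\<^sub>R axis i 1)"
      by (simp only: basis_expansion scalar_mult_eq_scaleR[symmetric])
    also have "\<dots> = (\<Sum>i\<in>UNIV. v $ i * frechet_derivative f (at x) (axis i 1))"
      by (simp add: linear_sum[OF lin] linear_cmul[OF lin])
    finally show ?thesis by (simp add: grad1_def inner_vec_def mult.commute)
  qed
  then have "frechet_derivative f (at x) = (\<lambda>v. grad1 f x \<bullet> v)" by (rule ext)
  then show ?thesis using d by simp
qed

lemma grad1_eq: 
  assumes "(f has_derivative (\<lambda>v. G \<bullet> v)) (at x)" shows "grad1 f x = G"
proof -
  have "frechet_derivative f (at x) = (\<lambda>v. G \<bullet> v)" using frechet_derivative_at[OF assms] by simp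
  then show ?thesis by (simp add: grad1_def vec_eq_iff inner_axis)
qed

section \<open>Truncations of a function with zero boundary values, and the weak form\<close>

context
  fixes U :: "(real^3) set" and h :: "real^3 \<Rightarrow> real"
  assumes U: "open U" "bounded U" and hc: "continuous_on (closure U) h" and h0: "\<And>x. x \<in> frontier U \<Longrightarrow> h x = 0"
    and hd: "\<And>x. x \<in> U \<Longrightarrow> h differentiable (at x)" and hg: "continuous_on U (grad1 h)"
begin

text \<open>A closed subset of the compact closure that avoids the frontier, since \<open>h\<close>
  vanishes there.\<close>

lemma trunc_support:
  assumes "e > 0"
  shows "compact {x \<in> closure U. \<bar>h x\<bar> \<ge> e}" "{x \<in> closure U. \<bar>h x\<bar> \<ge> e} \<subseteq> U"
proof -
  have cc: "compact (closure U)" using U by (simp add: compact_closure)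
  have "closed (closure U \<inter> (\<lambda>x. \<bar>h x\<bar>) -` {e..})"
    by (intro continuous_closed_preimage continuous_intros hc) auto
  moreover have "{x \<in> closure U. \<bar>h x\<bar> \<ge> e} = closure U \<inter> (\<lambda>x. \<bar>h x\<bar>) -` {e..}" by auto
  ultimately show "compact {x \<in> closure U. \<bar>h x\<bar> \<ge> e}"
    using cc by (metis (no_types, lifting) Int_lower1 compact_Int_closed inf.absorb2)
  show "{x \<in> closure U. \<bar>h x\<bar> \<ge> e} \<subseteq> U"
  proof
    fix x assume x: "x \<in> {x \<in> closure U. \<bar>h x\<bar> \<ge> e}"
    then have "x \<notin> frontier U" using h0[of x] assms by auto
    then show "x \<in> U" using x U by (auto simp: frontier_def interior_open)
  qed
qed

context
  fixes e :: real and \<eta> \<eta>' :: "real \<Rightarrow> real"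
  assumes e: "e > 0" and eta: "\<And>s. (\<eta> has_real_derivative \<eta>' s) (at s)" and ceta: "continuous_on UNIV \<eta>'"
    and eta0: "\<And>s. \<bar>s\<bar> \<le> e \<Longrightarrow> \<eta> s = 0" "\<And>s. \<bar>s\<bar> \<le> e \<Longrightarrow> \<eta>' s = 0"
begin

abbreviation "tf \<equiv> (\<lambda>x. if x \<in> U then \<eta> (h x) else 0)"
abbreviation "tg \<equiv> (\<lambda>x. if x \<in> U then \<eta>' (h x) *\<^sub>R grad1 h x else 0)"
abbreviation "tK \<equiv> {x \<in> closure U. \<bar>h x\<bar> \<ge> e}"

lemma tf_outside: "x \<notin> tK \<Longrightarrow> tf x = 0" "x \<notin> tK \<Longrightarrow> tg x = 0"
  using closure_subset[of U] by (auto simp: eta0 not_le)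

text \<open>On \<open>U\<close> the truncated functions are compositions with \<open>h\<close>, on
  the other open set they vanish; every gluing argument below uses this cover.\<close>

lemma open_cover: "open (- tK)" "U \<union> - tK = UNIV"
  using trunc_support[OF e] compact_imp_closed by blast+

lemma tf_deriv: "(tf has_derivative (\<lambda>v. tg x \<bullet> v)) (at x)"
proof (cases "x \<in> U")
  case True
  have "((\<lambda>x. \<eta> (h x)) has_derivative (\<lambda>v. \<eta>' (h x) * (grad1 h x \<bullet> v))) (at x)"
    using has_derivative_compose[OF has_derivative_grad1[OF hd[OF True]], of \<eta> "\<lambda>v. \<eta>' (h x) * v"] eta[of "h x"]
    by (simp add: has_field_derivative_def)
  then have "(tf has_derivative (\<lambda>v. \<eta>' (h x) * (grad1 h x \<bullet> v))) (at x)"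
    by (rule has_derivative_transform_within_open[where s=U]) (use True U in auto)
  then show ?thesis using True by simp
next
  case False
  have "(tf has_derivative (\<lambda>v. 0)) (at x)"
    by (rule has_derivative_transform_within_open[where f="\<lambda>_. 0" and s="- tK"])
      (use open_cover False tf_outside trunc_support(2)[OF e] in auto)
  then show ?thesis using False by simp
qed

lemma tg_cont: "continuous_on UNIV tg"
proof -
  have "continuous_on U tg"
  proof (rule continuous_on_eq)
    show "continuous_on U (\<lambda>x. \<eta>' (h x) *\<^sub>R grad1 h x)"
      by (intro continuous_intros hg continuous_on_compose2[OF ceta] continuous_on_subset[OF hc] closure_subset) auto
  qed auto
  moreover have "continuous_on (- tK) tg"
    by (rule continuous_on_eq[OF continuous_on_const[of _ 0]]) (rule tf_outside(2)[symmetric], simp only: Compl_iff not_False_eq_True simp_thms)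
  ultimately have "continuous_on (U \<union> - tK) tg"
    by (intro continuous_on_open_Un) (use U open_cover in auto)
  then show ?thesis using open_cover(2) by simp
qed

lemma tf_C1c: "C1c_in U tf" "grad1 tf = tg"
proof -
  show g: "grad1 tf = tg" using grad1_eq[OF tf_deriv] by blast
  have sub: "closure {x. tf x \<noteq> 0} \<subseteq> tK"
    using tf_outside(1) compact_imp_closed[OF trunc_support(1)[OF e]] by (intro closure_minimal) blast+
  have "compact (closure {x. tf x \<noteq> 0})"
  proof -
    have "{x. tf x \<noteq> 0} \<subseteq> tK" using sub closure_subset[of "{x. tf x \<noteq> 0}"] by (rule order_trans[rotated])
    then have "bounded {x. tf x \<noteq> 0}" by (rule bounded_subset[OF compact_imp_bounded[OF trunc_support(1)[OF e]]])
    then show ?thesis by (simp add: compact_closure del: mem_Collect_eq)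
  qed
  then show "C1c_in U tf"
    unfolding C1c_in_def g
  proof (intro conjI allI)
    show "tf differentiable at x" for x unfolding differentiable_def by (intro exI) (rule tf_deriv)
    show "closure {x. tf x \<noteq> 0} \<subseteq> U" using sub trunc_support(2)[OF e] by (rule order_trans)
  qed (rule tg_cont)
qed

text \<open>The product of the truncation with \<open>V\<close>, extended by 0, is differentiable
  everywhere and has continuous divergence, although the single partial derivatives of
  \<open>V\<close> may be discontinuous. This is exactly the setting of
  \<open>integral_divergence_zero\<close>.\<close>

lemma weak_form:
  fixes V :: "real^3 \<Rightarrow> real^3" and dV :: "real^3 \<Rightarrow> real"
  assumes V: "\<And>x. x \<in> U \<Longrightarrow> V differentiable (at x)" 
    and dV: "\<And>x. x \<in> U \<Longrightarrow> dV x = (\<Sum>i\<in>UNIV. frechet_derivative V (at x) (axis i 1) $ i)"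
    and cdV: "continuous_on U dV"
  shows "(LINT x:U|lborel. \<eta> (h x) * dV x + \<eta>' (h x) * (grad1 h x \<bullet> V x)) = 0"
    and "set_integrable lborel U (\<lambda>x. \<eta> (h x) * dV x + \<eta>' (h x) * (grad1 h x \<bullet> V x))"
proof -
  define W where "W x = (if x \<in> U then tf x *\<^sub>R V x else 0)" for x
  define W' where "W' x = (if x \<in> U then (\<lambda>v. tf x *\<^sub>R frechet_derivative V (at x) v + (tg x \<bullet> v) *\<^sub>R V x) else (\<lambda>_. 0))" for x
  define d where "d x = (if x \<in> U then \<eta> (h x) * dV x + \<eta>' (h x) * (grad1 h x \<bullet> V x) else 0)" for x
  have W0: "W x = 0" "d x = 0" if "x \<notin> tK" for x
    using tf_outside[OF that] that closure_subset[of U] by (auto simp: W_def d_def eta0 not_le)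
  have der: "(W has_derivative W' x) (at x)" for x
  proof (cases "x \<in> U")
    case True
    have "((\<lambda>x. tf x *\<^sub>R V x) has_derivative (\<lambda>v. tf x *\<^sub>R frechet_derivative V (at x) v + (tg x \<bullet> v) *\<^sub>R V x)) (at x)"
      by (rule has_derivative_scaleR[OF tf_deriv]) (use V[OF True] frechet_derivative_works in blast)
    then have "(W has_derivative (\<lambda>v. tf x *\<^sub>R frechet_derivative V (at x) v + (tg x \<bullet> v) *\<^sub>R V x)) (at x)"
      by (rule has_derivative_transform_within_open[where s=U]) (use True U in \<open>auto simp: W_def\<close>)
    then show ?thesis using True by (simp add: W'_def)
  next
    case False
    have "(W has_derivative (\<lambda>v. 0)) (at x)"
      by (rule has_derivative_transform_within_open[where f="\<lambda>_. 0" and s="- tK"])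
        (use open_cover False W0 trunc_support(2)[OF e] in auto)
    then show ?thesis using False by (simp add: W'_def)
  qed
  have dd: "(\<Sum>i\<in>UNIV. W' x (axis i 1) $ i) = d x" for x
  proof (cases "x \<in> U")
    case True
    have "W' x (axis i 1) $ i = \<eta> (h x) * frechet_derivative V (at x) (axis i 1) $ i + \<eta>' (h x) * (grad1 h x $ i * V x $ i)" for i
      using True by (simp add: W'_def inner_axis)
    then show ?thesis using True by (simp add: d_def dV sum.distrib sum_distrib_left inner_vec_def)
  qed (simp add: W'_def d_def)
  have cV: "continuous_on U V"
    using V by (intro differentiable_imp_continuous_on) (auto simp: differentiable_on_def intro: differentiable_at_withinI)
  have ce: "continuous_on UNIV \<eta>" by (intro continuous_at_imp_continuous_on ballI DERIV_isCont[OF eta])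
  have "continuous_on U d"
  proof (rule continuous_on_eq)
    show "continuous_on U (\<lambda>x. \<eta> (h x) * dV x + \<eta>' (h x) * (grad1 h x \<bullet> V x))"
      by (intro continuous_intros hg cdV cV continuous_on_compose2[OF ceta] continuous_on_compose2[OF ce] 
          continuous_on_subset[OF hc] closure_subset) auto
  qed (auto simp: d_def)
  moreover have "continuous_on (- tK) d"
    by (rule continuous_on_eq[OF continuous_on_const[of _ 0]]) (rule W0(2)[symmetric], simp only: Compl_iff not_False_eq_True simp_thms)
  ultimately have "continuous_on (U \<union> - tK) d"
    by (intro continuous_on_open_Un) (use U open_cover in auto)
  then have cd: "continuous_on UNIV d" using open_cover(2) by simp
  obtain R where R: "U \<subseteq> cball 0 R" using U(2) by (metis bounded_subset_ballD ball_subset_cball order_trans)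
  have "(\<integral>x. (\<Sum>i\<in>UNIV. W' x (axis i 1) $ i) \<partial>lborel) = 0"
    by (rule integral_divergence_zero[OF der]) (use cd R in \<open>auto simp: dd W_def\<close>)
  moreover have ind: "indicator U x *\<^sub>R (\<eta> (h x) * dV x + \<eta>' (h x) * (grad1 h x \<bullet> V x)) = d x" for x
    by (simp add: d_def)
  ultimately show "(LINT x:U|lborel. \<eta> (h x) * dV x + \<eta>' (h x) * (grad1 h x \<bullet> V x)) = 0"
    unfolding dd set_lebesgue_integral_def by simp
  show "set_integrable lborel U (\<lambda>x. \<eta> (h x) * dV x + \<eta>' (h x) * (grad1 h x \<bullet> V x))"
    unfolding set_integrable_def ind
    by (rule integrable_continuous_cbox_support[OF cd W0(2) trunc_support(1)[OF e]])
qed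

end
end

section \<open>Integral inequalities\<close>

text \<open>Young's inequality after division by the norms. If one of the integrals is 0, the
  product vanishes almost everywhere.\<close>

lemma Holder_inequality:
  fixes f g :: "'a \<Rightarrow> real"
  assumes pq: "p > 1" "1 / p + 1 / q = 1"
    and m: "f \<in> borel_measurable M" "g \<in> borel_measurable M"
    and nn: "\<And>x. 0 \<le> f x" "\<And>x. 0 \<le> g x"
    and fi: "integrable M (\<lambda>x. f x powr p)" and gi: "integrable M (\<lambda>x. g x powr q)"
  shows "integrable M (\<lambda>x. f x * g x)"
    and "(\<integral>x. f x * g x \<partial>M) \<le> (\<integral>x. f x powr p \<partial>M) powr (1 / p) * (\<integral>x. g x powr q \<partial>M) powr (1 / q)"
proof -
  have q: "q > 1"
  proof -
    have "1 / p < 1" using pq by simp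
    moreover have "0 < 1 / p" using pq by simp
    ultimately have "0 < 1 / q" "1 / q < 1" using pq by linarith+
    then show ?thesis by (simp add: field_simps)
  qed
  have young: "x * y \<le> x powr p / p + y powr q / q" if "x \<ge> 0" "y \<ge> 0" for x y :: real
    using Youngs_inequality[of p q x y] pq q that by simp
  show i: "integrable M (\<lambda>x. f x * g x)"
  proof (rule Bochner_Integration.integrable_bound)
    show "integrable M (\<lambda>x. f x powr p / p + g x powr q / q)" using fi gi by auto
    show "AE x in M. norm (f x * g x) \<le> norm (f x powr p / p + g x powr q / q)"
    proof (rule AE_I2)
      fix x show "norm (f x * g x) \<le> norm (f x powr p / p + g x powr q / q)"
        using young[OF nn, of x x] nn pq q by (simp add: abs_mult)
    qed
  qed (use m in measurable)
  define A where "A = (\<integral>x. f x powr p \<partial>M)"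
  define B where "B = (\<integral>x. g x powr q \<partial>M)"
  have AB: "A \<ge> 0" "B \<ge> 0" by (simp_all add: A_def B_def)
  have "(\<integral>x. f x * g x \<partial>M) \<le> A powr (1 / p) * B powr (1 / q)"
  proof (cases "A = 0 \<or> B = 0")
    case True
    have "AE x in M. f x * g x = 0"
    proof (cases "A = 0")
      case True
      then have "AE x in M. f x powr p = 0" using integral_nonneg_eq_0_iff_AE[OF fi] by (simp add: A_def)
      then show ?thesis by eventually_elim simp
    next
      case False
      then have "AE x in M. g x powr q = 0" using True integral_nonneg_eq_0_iff_AE[OF gi] by (simp add: B_def)
      then show ?thesis by eventually_elim simp
    qed
    then have "(\<integral>x. f x * g x \<partial>M) = 0" by (rule integral_eq_zero_AE)
    then show ?thesis by simp
  next
    case False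
    then have pos: "A > 0" "B > 0" using AB by auto
    define a where "a = A powr (1 / p)"
    define b where "b = B powr (1 / q)"
    have ab: "a > 0" "b > 0" "a powr p = A" "b powr q = B" using pos pq q by (auto simp: a_def b_def powr_powr)
    have "(\<integral>x. f x * g x \<partial>M) / (a * b) = (\<integral>x. (f x / a) * (g x / b) \<partial>M)" by (simp add: mult_ac)
    also have "\<dots> \<le> (\<integral>x. f x powr p / (p * A) + g x powr q / (q * B) \<partial>M)"
    proof (rule integral_mono)
      fix x
      show "f x / a * (g x / b) \<le> f x powr p / (p * A) + g x powr q / (q * B)"
        using young[of "f x / a" "g x / b"] nn[of x] ab by (simp add: powr_divide mult.commute)
    next
      show "integrable M (\<lambda>x. f x / a * (g x / b))" using i by simp
    qed (use fi gi in auto)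
    also have "\<dots> = A / (p * A) + B / (q * B)" using fi gi by (simp add: A_def B_def)
    also have "\<dots> = 1" using pos pq q by simp
    finally show ?thesis using ab by (simp add: a_def[symmetric] b_def[symmetric])
  qed
  then show "(\<integral>x. f x * g x \<partial>M) \<le> (\<integral>x. f x powr p \<partial>M) powr (1 / p) * (\<integral>x. g x powr q \<partial>M) powr (1 / q)"
    by (simp add: A_def B_def)
qed

lemma indicator_powr: "p > 0 \<Longrightarrow> (indicator A x * f x) powr p = indicator A x * (f x :: real) powr p"
  by (auto simp: indicator_def)

lemma set_Holder:
  fixes f g :: "'a \<Rightarrow> real"
  assumes pq: "p > 1" "1 / p + 1 / q = 1"
    and m: "set_borel_measurable M A f" "set_borel_measurable M A g"
    and nn: "\<And>x. x \<in> A \<Longrightarrow> 0 \<le> f x" "\<And>x. x \<in> A \<Longrightarrow> 0 \<le> g x"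
    and fi: "set_integrable M A (\<lambda>x. f x powr p)" and gi: "set_integrable M A (\<lambda>x. g x powr q)"
  shows "(LINT x:A|M. f x * g x) \<le> (LINT x:A|M. f x powr p) powr (1 / p) * (LINT x:A|M. g x powr q) powr (1 / q)"
proof -
  have q: "q > 0"
  proof -
    have "1 / p < 1" using pq by simp
    then have "0 < 1 / q" using pq by linarith
    then show ?thesis by simp
  qed
  have "(\<integral>x. (indicator A x * f x) * (indicator A x * g x) \<partial>M) \<le>
    (\<integral>x. (indicator A x * f x) powr p \<partial>M) powr (1 / p) * (\<integral>x. (indicator A x * g x) powr q \<partial>M) powr (1 / q)"
    by (rule Holder_inequality) (use assms q in \<open>auto simp: set_integrable_def set_borel_measurable_def indicator_powr split: split_indicator\<close>)
  moreover have "(indicator A x * f x) * (indicator A x * g x) = indicator A x * (f x * g x)" for x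
    by (auto split: split_indicator)
  ultimately show ?thesis using pq q by (simp add: set_lebesgue_integral_def indicator_powr)
qed

section \<open>Two classes of functions that make integrability structural\<close>

text \<open>Closed under products, absolute values and positive powers, with integrable members, so
  integrability of composite integrands is a matter of syntax.\<close>

definition bmeas :: "'a::euclidean_space set \<Rightarrow> ('a \<Rightarrow> real) \<Rightarrow> bool" where
  "bmeas A f \<longleftrightarrow> A \<in> sets lborel \<and> emeasure lborel A < \<infinity> \<and> set_borel_measurable lborel A f \<and> (\<exists>B. \<forall>x\<in>A. \<bar>f x\<bar> \<le> B)"

lemma bmeas_integrable: 
  assumes "bmeas A f" shows "set_integrable lborel A f"
proof -
  obtain B where B: "\<And>x. x \<in> A \<Longrightarrow> \<bar>f x\<bar> \<le> B" using assms by (auto simp: bmeas_def)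
  show ?thesis unfolding set_integrable_def
  proof (rule Bochner_Integration.integrable_bound[where f="\<lambda>x. indicator A x * B"])
    show "integrable lborel (\<lambda>x. indicator A x * B)" using assms by (auto simp: bmeas_def)
    show "AE x in lborel. norm (indicator A x *\<^sub>R f x) \<le> norm (indicator A x * B)"
      using B by (intro AE_I2) (force split: split_indicator)
  qed (use assms in \<open>auto simp: bmeas_def set_borel_measurable_def\<close>)
qed

lemma bmeas_powr:
  assumes "bmeas A f" "\<And>x. x \<in> A \<Longrightarrow> f x \<ge> 0" "p > 0"
  shows "bmeas A (\<lambda>x. f x powr p)"
proof -
  obtain B where B: "\<And>x. x \<in> A \<Longrightarrow> \<bar>f x\<bar> \<le> B" using assms by (auto simp: bmeas_def)
  have "(\<lambda>x. (indicator A x * f x) powr p) \<in> borel_measurable lborel"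
    using assms(1) by (auto simp: bmeas_def set_borel_measurable_def)
  moreover have "\<forall>x\<in>A. \<bar>f x powr p\<bar> \<le> B powr p"
    using B assms by (auto intro!: powr_mono2 simp: abs_of_nonneg)
  ultimately show ?thesis using assms by (auto simp: bmeas_def set_borel_measurable_def indicator_powr)
qed

lemma Lp_on_nonneg: "Lp_on p A f \<ge> 0"
  by (simp add: Lp_on_def)

lemma bmeas_mult:
  assumes "bmeas A f" "bmeas A g" shows "bmeas A (\<lambda>x. f x * g x)"
proof -
  obtain B C where B: "\<And>x. x \<in> A \<Longrightarrow> \<bar>f x\<bar> \<le> B" and C: "\<And>x. x \<in> A \<Longrightarrow> \<bar>g x\<bar> \<le> C" using assms by (auto simp: bmeas_def)
  have "(\<lambda>x. (indicator A x * f x) * (indicator A x * g x)) \<in> borel_measurable lborel"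
    using assms by (auto simp: bmeas_def set_borel_measurable_def)
  moreover have "(indicator A x * f x) * (indicator A x * g x) = indicator A x *\<^sub>R (f x * g x)" for x
    by (auto split: split_indicator)
  moreover have "\<forall>x\<in>A. \<bar>f x * g x\<bar> \<le> B * C"
    unfolding abs_mult using B C by (auto intro!: mult_mono intro: order_trans[OF abs_ge_zero])
  ultimately show ?thesis using assms by (auto simp: bmeas_def set_borel_measurable_def)
qed

lemma bmeas_abs: "bmeas A f \<Longrightarrow> bmeas A (\<lambda>x. \<bar>f x\<bar>)"
proof -
  assume a: "bmeas A f"
  have "(\<lambda>x. \<bar>indicator A x * f x\<bar>) \<in> borel_measurable lborel"
    using a by (auto simp: bmeas_def set_borel_measurable_def)
  moreover have "\<bar>indicator A x * f x\<bar> = indicator A x *\<^sub>R \<bar>f x\<bar>" for x by (auto split: split_indicator)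
  ultimately show ?thesis using a by (auto simp: bmeas_def set_borel_measurable_def)
qed

lemma bmeas_const: "A \<in> sets lborel \<Longrightarrow> emeasure lborel A < \<infinity> \<Longrightarrow> bmeas A (\<lambda>_. c)"
  by (auto simp: bmeas_def set_borel_measurable_def)

text \<open>Hoelder's inequality against the constant 1 with exponent \<open>s / b\<close>.\<close>

lemma LINT_powr_le_Lp:
  assumes f: "bmeas A f" "\<And>x. x \<in> A \<Longrightarrow> f x \<ge> 0" and b: "0 < b" "b \<le> s"
  shows "(LINT x:A|lborel. f x powr b) \<le> measure lborel A powr (1 - b / s) * Lp_on s A f powr b"
proof -
  have s: "s > 0" using b by simp
  have Lp: "Lp_on s A f powr b = (LINT x:A|lborel. f x powr s) powr (b / s)"
  proof -
    have "(LINT x:A|lborel. \<bar>f x\<bar> powr s) = (LINT x:A|lborel. f x powr s)"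
      using f by (intro set_lebesgue_integral_cong) (auto simp: bmeas_def)
    then show ?thesis unfolding Lp_on_def by (simp add: powr_powr)
  qed
  have c: "set_integrable lborel A (\<lambda>_. 1 :: real)" using f(1) by (intro bmeas_integrable bmeas_const) (auto simp: bmeas_def)
  show ?thesis
  proof (cases "b = s")
    case True
    have nn: "(LINT x:A|lborel. f x powr s) \<ge> 0" by (simp add: set_lebesgue_integral_def)
    show ?thesis
    \<comment> \<open>Since \<open>0 powr 0 = 0\<close>, the right side is 0 on a null set, so the
      left side has to be shown to vanish.\<close>
    proof (cases "measure lborel A = 0")
      case True
      then have "emeasure lborel A = 0" using f(1) by (auto simp: bmeas_def emeasure_eq_ennreal_measure)
      then have "A \<in> null_sets lborel" using f(1) by (auto simp: bmeas_def null_sets_def)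
      then have "AE x in lborel. indicator A x *\<^sub>R f x powr b = 0"
        by (rule AE_mp[OF AE_not_in]) (auto simp: indicator_def)
      then have "(LINT x:A|lborel. f x powr b) = 0" unfolding set_lebesgue_integral_def by (rule integral_eq_zero_AE)
      then show ?thesis by simp
    next
      case False
      then show ?thesis using s nn True Lp by simp
    qed
  next
    case False
    then have lt: "b < s" using b by simp
    define p where "p = s / b"
    define q where "q = s / (s - b)"
    have pq: "p > 1" "1 / p + 1 / q = 1" using lt b by (auto simp: p_def q_def field_simps)
    have bp: "b * p = s" using b by (simp add: p_def)
    have "(LINT x:A|lborel. f x powr b * 1) \<le> (LINT x:A|lborel. (f x powr b) powr p) powr (1 / p) * (LINT x:A|lborel. 1 powr q) powr (1 / q)"
    proof (rule set_Holder[OF pq])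
      show "set_borel_measurable lborel A (\<lambda>x. f x powr b)" using bmeas_powr[OF f b(1)] by (simp add: bmeas_def)
      show "set_borel_measurable lborel A (\<lambda>x. 1::real)" using f(1) by (auto simp: bmeas_def set_borel_measurable_def)
      show "set_integrable lborel A (\<lambda>x. (f x powr b) powr p)"
        using bmeas_integrable[OF bmeas_powr[OF f s]] by (simp add: powr_powr bp)
    qed (use c in auto)
    moreover have "(LINT x:A|lborel. 1 powr q) = measure lborel A"
      using f(1) by (simp add: bmeas_def set_lebesgue_integral_def)
    moreover have "1 / q = 1 - b / s" "1 / p = b / s" using lt b by (auto simp: p_def q_def field_simps)
    ultimately show ?thesis by (simp add: Lp powr_powr bp mult.commute)
  qed
qed

lemma powr_le_one_plus: "0 \<le> x \<Longrightarrow> x \<le> m \<Longrightarrow> 0 \<le> e \<Longrightarrow> e \<le> 1 \<Longrightarrow> x powr e \<le> 1 + (m::real)"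
proof -
  assume a: "0 \<le> x" "x \<le> m" "0 \<le> e" "e \<le> 1"
  have "x powr e \<le> (1 + m) powr e" using a by (intro powr_mono2) auto
  also have "\<dots> \<le> (1 + m) powr 1" using a by (intro powr_mono) auto
  finally show ?thesis using a by simp
qed

text \<open>Hoelder splits off \<open>F\<close>, then \<open>LINT_powr_le_Lp\<close> lifts
  \<open>f\<close> from exponent \<open>b * p\<close> to \<open>s\<close>. The power of the measure
  that remains has its exponent in [0, 1], so \<open>1 + m\<close> bounds it uniformly in the
  exponents.\<close>

lemma LINT_weight_powr_le:
  assumes f: "bmeas A f" "\<And>x. x \<in> A \<Longrightarrow> f x \<ge> 0" and F: "bmeas A F" "\<And>x. x \<in> A \<Longrightarrow> F x \<ge> 0"
    and pq: "p > 1" "1 / p + 1 / q = 1" and b: "0 < b" "b * p \<le> s" and m: "measure lborel A \<le> m"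
  shows "(LINT x:A|lborel. F x * f x powr b) \<le> (LINT x:A|lborel. F x powr q) powr (1 / q) * ((1 + m) * Lp_on s A f powr b)"
proof -
  have "1 / p < 1" using pq by simp
  moreover have "0 < 1 / p" using pq by simp
  ultimately have q: "0 < 1 / q" "1 / q < 1" using pq by linarith+
  then have q': "q > 1" by (simp add: field_simps)
  have bp: "b * p > 0" using b pq by simp
  have nn: "(LINT x:A|lborel. f x powr (b * p)) \<ge> 0" by (simp add: set_lebesgue_integral_def)
  have "(LINT x:A|lborel. F x * f x powr b) \<le> (LINT x:A|lborel. F x powr q) powr (1 / q) * (LINT x:A|lborel. (f x powr b) powr p) powr (1 / p)"
  proof (rule set_Holder)
    show "set_borel_measurable lborel A F" using F by (simp add: bmeas_def)
    show "set_borel_measurable lborel A (\<lambda>x. f x powr b)" using bmeas_powr[OF f b(1)] by (simp add: bmeas_def)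
    show "set_integrable lborel A (\<lambda>x. (f x powr b) powr p)"
      using bmeas_integrable[OF bmeas_powr[OF f bp]] by (simp add: powr_powr)
    show "set_integrable lborel A (\<lambda>x. F x powr q)" by (rule bmeas_integrable[OF bmeas_powr[OF F]]) (use q' in auto)
  qed (use F pq q' in auto)
  also have "(LINT x:A|lborel. (f x powr b) powr p) powr (1 / p) \<le> (1 + m) * Lp_on s A f powr b"
  proof -
    have "(LINT x:A|lborel. (f x powr b) powr p) powr (1 / p) \<le> (measure lborel A powr (1 - b * p / s) * Lp_on s A f powr (b * p)) powr (1 / p)"
      using LINT_powr_le_Lp[OF f bp b(2)] nn pq by (intro powr_mono2) (auto simp: powr_powr)
    also have "\<dots> = measure lborel A powr ((1 - b * p / s) / p) * Lp_on s A f powr b"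
      using pq by (simp add: powr_mult powr_powr)
    also have "\<dots> \<le> (1 + m) * Lp_on s A f powr b"
    proof (intro mult_right_mono powr_le_one_plus)
      have "b * p / s \<le> 1" "b * p / s \<ge> 0" using b bp by auto
      then show "0 \<le> (1 - b * p / s) / p" "(1 - b * p / s) / p \<le> 1" using pq by (auto simp: divide_le_eq)
    qed (use m in auto)
    finally show ?thesis .
  qed
  finally show ?thesis by (simp add: mult_left_mono)
qed

text \<open>Continuity is asked only at positive times, where \<open>regular_fn\<close> fixes the
  derivatives, and boundedness on bounded time intervals down to 0. Members are \<open>bmeas\<close>
  both on cylinders starting at 0 and on single time slices.\<close>

definition bcf :: "(real^3) set \<Rightarrow> ((real^3) \<times> real \<Rightarrow> real) \<Rightarrow> bool" where
  "bcf U f \<longleftrightarrow> continuous_on (U \<times> {0<..}) f \<and> (\<forall>T. \<exists>B. \<forall>x\<in>U. \<forall>t\<in>{0<..<T}. \<bar>f (x, t)\<bar> \<le> B)"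

lemma bcf_const: "bcf U (\<lambda>_. c)"
  by (auto simp: bcf_def)

lemma bcf_add: assumes "bcf U f" "bcf U g" shows "bcf U (\<lambda>z. f z + g z)"
proof -
  have "\<exists>B. \<forall>x\<in>U. \<forall>t\<in>{0<..<T}. \<bar>f (x, t) + g (x, t)\<bar> \<le> B" for T
  proof -
    obtain B C where "\<forall>x\<in>U. \<forall>t\<in>{0<..<T}. \<bar>f (x, t)\<bar> \<le> B" "\<forall>x\<in>U. \<forall>t\<in>{0<..<T}. \<bar>g (x, t)\<bar> \<le> C"
      using assms unfolding bcf_def by meson
    then show ?thesis by (intro exI[of _ "B + C"]) (auto intro: order_trans[OF abs_triangle_ineq add_mono])
  qed
  then show ?thesis using assms by (auto simp: bcf_def intro!: continuous_intros)
qed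

lemma bcf_mult: assumes "bcf U f" "bcf U g" shows "bcf U (\<lambda>z. f z * g z)"
proof -
  have "\<exists>B. \<forall>x\<in>U. \<forall>t\<in>{0<..<T}. \<bar>f (x, t) * g (x, t)\<bar> \<le> B" for T
  proof -
    obtain B C where "\<forall>x\<in>U. \<forall>t\<in>{0<..<T}. \<bar>f (x, t)\<bar> \<le> B" "\<forall>x\<in>U. \<forall>t\<in>{0<..<T}. \<bar>g (x, t)\<bar> \<le> C"
      using assms unfolding bcf_def by meson
    then show ?thesis
      by (intro exI[of _ "B * C"]) (auto simp: abs_mult intro!: mult_mono intro: order_trans[OF abs_ge_zero])
  qed
  then show ?thesis using assms by (auto simp: bcf_def intro!: continuous_intros)
qed

lemma bcf_minus: "bcf U f \<Longrightarrow> bcf U (\<lambda>z. - f z)"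
  using bcf_mult[OF bcf_const[of U "-1"], of f] by simp

lemma bcf_diff: "bcf U f \<Longrightarrow> bcf U g \<Longrightarrow> bcf U (\<lambda>z. f z - g z)"
  using bcf_add[OF _ bcf_minus, of U f g] by simp

lemma bcf_abs: "bcf U f \<Longrightarrow> bcf U (\<lambda>z. \<bar>f z\<bar>)"
  by (auto simp: bcf_def intro!: continuous_intros)

lemma bcf_powr:
  assumes "bcf U f" "\<And>x t. x \<in> U \<Longrightarrow> t > 0 \<Longrightarrow> f (x, t) \<ge> 0" "p > 0"
  shows "bcf U (\<lambda>z. f z powr p)"
proof -
  have "\<exists>B. \<forall>x\<in>U. \<forall>t\<in>{0<..<T}. \<bar>f (x, t) powr p\<bar> \<le> B" for T
  proof -
    obtain B where "\<forall>x\<in>U. \<forall>t\<in>{0<..<T}. \<bar>f (x, t)\<bar> \<le> B" using assms(1) unfolding bcf_def by meson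
    then show ?thesis using assms(2,3)
      by (intro exI[of _ "B powr p"]) (auto intro!: powr_mono2 simp: abs_of_nonneg)
  qed
  then show ?thesis using assms by (auto simp: bcf_def intro!: continuous_on_powr' continuous_on_const)
qed

lemma bcf_inverse:
  assumes "bcf U f" "\<And>x t. x \<in> U \<Longrightarrow> t > 0 \<Longrightarrow> f (x, t) \<ge> 1"
  shows "bcf U (\<lambda>z. 1 / f z)"
proof -
  have f1: "f (x, t) \<ge> 1" if "x \<in> U" "t > 0" for x t using assms(2) that .
  have "\<bar>1 / f (x, t)\<bar> \<le> 1" if "x \<in> U" "t > 0" for x t using f1[OF that] by simp
  moreover have "continuous_on (U \<times> {0<..}) (\<lambda>z. 1 / f z)"
    using assms(1) f1 by (intro continuous_intros) (force simp: bcf_def)+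
  ultimately show ?thesis unfolding bcf_def by (auto intro!: exI[of _ 1])
qed

lemma bcf_compose:
  assumes "bcf U f" "continuous_on UNIV (\<eta> :: real \<Rightarrow> real)"
  shows "bcf U (\<lambda>z. \<eta> (f z))"
proof -
  have "\<exists>B. \<forall>x\<in>U. \<forall>t\<in>{0<..<T}. \<bar>\<eta> (f (x, t))\<bar> \<le> B" for T
  proof -
    obtain B where B: "\<forall>x\<in>U. \<forall>t\<in>{0<..<T}. \<bar>f (x, t)\<bar> \<le> B" using assms(1) unfolding bcf_def by meson
    have "compact (\<eta> ` {-B..B})" by (intro compact_continuous_image continuous_on_subset[OF assms(2)]) auto
    then obtain C where "\<forall>y\<in>\<eta> ` {-B..B}. norm y \<le> C" using compact_imp_bounded bounded_iff by metis
    then have C: "\<bar>\<eta> y\<bar> \<le> C" if "\<bar>y\<bar> \<le> B" for y using that by (auto simp: abs_le_iff)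
    then show ?thesis using B by (intro exI[of _ C]) blast
  qed
  then show ?thesis using assms by (auto simp: bcf_def intro!: continuous_on_compose2[OF assms(2)])
qed

lemmas bcf_intros = bcf_const bcf_add bcf_mult bcf_minus bcf_diff bcf_abs

context
  fixes U :: "(real^3) set"
  assumes U: "open U" "bounded U"
begin

lemma cyl_sets: "cyl U s t \<in> sets lborel" "emeasure lborel (cyl U s t) < \<infinity>"
proof -
  show "cyl U s t \<in> sets lborel" using U by (auto simp: cyl_def intro!: borel_open open_Times)
  show "emeasure lborel (cyl U s t) < \<infinity>"
    unfolding cyl_def using U by (intro emeasure_bounded_finite bounded_Times) auto
qed

lemma bcf_bmeas:
  assumes "bcf U f" "0 \<le> s" shows "bmeas (cyl U s t) f"
proof -
  have "cyl U s t \<subseteq> U \<times> {0<..}" using assms by (auto simp: cyl_def)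
  then have "continuous_on (cyl U s t) f" using assms(1) continuous_on_subset by (auto simp: bcf_def)
  then have "set_borel_measurable lborel (cyl U s t) f"
    unfolding set_borel_measurable_def using borel_measurable_continuous_on_indicator[OF _ \<open>continuous_on (cyl U s t) f\<close>] cyl_sets
    by simp
  moreover obtain B where "\<forall>x\<in>U. \<forall>r\<in>{0<..<t}. \<bar>f (x, r)\<bar> \<le> B" using assms(1) unfolding bcf_def by meson
  then have "\<forall>z\<in>cyl U s t. \<bar>f z\<bar> \<le> B" using assms(2) by (auto simp: cyl_def)
  ultimately show ?thesis using cyl_sets by (auto simp: bmeas_def)
qed

lemma bcf_bmeas_slice:
  assumes "bcf U f" "t > 0" shows "bmeas U (\<lambda>x. f (x, t))"
proof -
  have "continuous_on U (\<lambda>x. f (x, t))"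
    by (rule continuous_on_compose2[of "U \<times> {0<..}" f]) (use assms in \<open>auto simp: bcf_def intro!: continuous_intros\<close>)
  then have "set_borel_measurable lborel U (\<lambda>x. f (x, t))"
    unfolding set_borel_measurable_def using borel_measurable_continuous_on_indicator[of U "\<lambda>x. f (x, t)"] U
    by (simp add: borel_open)
  moreover obtain B where "\<forall>x\<in>U. \<forall>r\<in>{0<..<t+1}. \<bar>f (x, r)\<bar> \<le> B" using assms(1) unfolding bcf_def by meson
  then have "\<forall>x\<in>U. \<bar>f (x, t)\<bar> \<le> B" using assms(2) by auto
  ultimately show ?thesis using U emeasure_bounded_finite[OF U(2)] by (auto simp: bmeas_def)
qed

lemma bcf_fubini:
  assumes "bcf U f" "0 \<le> s"
  shows "(LINT z:cyl U s t|lborel. f z) = (LINT r:{s<..<t}|lborel. LINT x:U|lborel. f (x, r))"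
    and "set_integrable lborel {s<..<t} (\<lambda>r. LINT x:U|lborel. f (x, r))"
    and "(LINT z:cyl U s t|lborel. f z) = (LINT x:U|lborel. LINT r:{s<..<t}|lborel. f (x, r))"
proof -
  define F where "F x r = indicator {s<..<t} r * (indicator U x * f (x, r))" for x r
  have F': "F x r = indicator U x * (indicator {s<..<t} r * f (x, r))" for x r by (simp add: F_def)
  have e: "(\<lambda>(x, r). F x r) = (\<lambda>z. indicator (cyl U s t) z *\<^sub>R f z)"
    by (auto simp: F_def cyl_def fun_eq_iff split: split_indicator)
  have i: "integrable (lborel \<Otimes>\<^sub>M lborel) (\<lambda>(x, r). F x r)"
    unfolding lborel_prod e using bmeas_integrable[OF bcf_bmeas[OF assms]] by (simp add: set_integrable_def)
  have l: "(LINT z:cyl U s t|lborel. f z) = (\<integral>z. (case z of (x, r) \<Rightarrow> F x r) \<partial>(lborel \<Otimes>\<^sub>M lborel))"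
    unfolding lborel_prod e by (simp add: set_lebesgue_integral_def)
  show "(LINT z:cyl U s t|lborel. f z) = (LINT r:{s<..<t}|lborel. LINT x:U|lborel. f (x, r))"
    unfolding l lborel_pair.integral_snd[OF i, symmetric] by (simp add: F_def set_lebesgue_integral_def)
  show "(LINT z:cyl U s t|lborel. f z) = (LINT x:U|lborel. LINT r:{s<..<t}|lborel. f (x, r))"
    unfolding l lborel_pair.integral_fst[OF i, symmetric]
  proof -
    have "(\<integral>r. F x r \<partial>lborel) = indicator U x * (LINT r:{s<..<t}|lborel. f (x, r))" for x
      by (simp only: F' integral_mult_right_zero set_lebesgue_integral_def real_scaleR_def)
    then show "(\<integral>x. (\<integral>r. F x r \<partial>lborel) \<partial>lborel) = (LINT x:U|lborel. LINT r:{s<..<t}|lborel. f (x, r))"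
      by (simp add: set_lebesgue_integral_def)
  qed
  show "set_integrable lborel {s<..<t} (\<lambda>r. LINT x:U|lborel. f (x, r))"
    using lborel_pair.integrable_snd[OF i] by (simp add: F_def set_lebesgue_integral_def set_integrable_def)
qed

lemma bcf_slice_mono_set:
  assumes "bcf U f" "\<And>x r. x \<in> U \<Longrightarrow> r > 0 \<Longrightarrow> f (x, r) \<ge> 0" "0 \<le> s" "s \<le> s'" "t' \<le> t"
  shows "(LINT z:cyl U s' t'|lborel. f z) \<le> (LINT z:cyl U s t|lborel. f z)"
  unfolding set_lebesgue_integral_def
proof (rule integral_mono')
  show "integrable lborel (\<lambda>z. indicator (cyl U s t) z *\<^sub>R f z)"
    using bmeas_integrable[OF bcf_bmeas[OF assms(1,3)]] by (simp add: set_integrable_def)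
qed (use assms in \<open>auto simp: cyl_def split: split_indicator\<close>)

text \<open>The fundamental theorem in time for each point of \<open>U\<close>, followed by an
  exchange of the integrals.\<close>

lemma bcf_ftc:
  assumes f: "bcf U f" and f': "bcf U f'" and st: "0 < s" "s \<le> t"
    and der: "\<And>x r. x \<in> U \<Longrightarrow> r > 0 \<Longrightarrow> ((\<lambda>r. f (x, r)) has_real_derivative f' (x, r)) (at r)"
  shows "(LINT x:U|lborel. f (x, t)) - (LINT x:U|lborel. f (x, s)) = (LINT z:cyl U s t|lborel. f' z)"
proof -
  have ftc: "(LINT r:{s<..<t}|lborel. f' (x, r)) = f (x, t) - f (x, s)" if x: "x \<in> U" for x
  proof -
    have "(LBINT r=ereal s..ereal t. f' (x, r)) = f (x, t) - f (x, s)"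
    proof (rule interval_integral_FTC_finite)
      show "continuous_on {min s t..max s t} (\<lambda>r. f' (x, r))"
        by (rule continuous_on_compose2[of "U \<times> {0<..}" f']) (use f' st x in \<open>auto simp: bcf_def intro!: continuous_intros\<close>)
      show "((\<lambda>r. f (x, r)) has_vector_derivative f' (x, r)) (at r within {min s t..max s t})"
        if "min s t \<le> r" "r \<le> max s t" for r
        using der[OF x, of r] that st
        by (auto simp: has_real_derivative_iff_has_vector_derivative[symmetric] intro: has_field_derivative_at_within)
    qed
    then show ?thesis using st by (simp add: interval_lebesgue_integral_def)
  qed
  have "(LINT x:U|lborel. f (x, t)) - (LINT x:U|lborel. f (x, s)) = (LINT x:U|lborel. f (x, t) - f (x, s))"
    using st by (intro set_integral_diff(2)[symmetric] bmeas_integrable bcf_bmeas_slice f) auto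
  also have "\<dots> = (LINT x:U|lborel. LINT r:{s<..<t}|lborel. f' (x, r))"
    using ftc U by (intro set_lebesgue_integral_cong) auto
  also have "\<dots> = (LINT z:cyl U s t|lborel. f' z)" using bcf_fubini(3)[OF f'] st by simp
  finally show ?thesis .
qed

end

section \<open>Regular solutions and the energy inequality\<close>

context
  fixes U :: "(real^3) set" and w :: "real^3 \<Rightarrow> real \<Rightarrow> real"
  assumes U: "open U" "bounded U" and reg: "regular_fn U w"
begin

lemma regular_bounded:
  fixes F :: "(real^3) \<times> real \<Rightarrow> 'b::real_normed_vector"
  assumes "continuous_on (closure U \<times> {0..}) F"
  shows "\<exists>B. \<forall>x\<in>U. \<forall>t\<in>{0<..<T}. norm (F (x, t)) \<le> B"
proof -
  have "compact (closure U \<times> {0..T})" using U by (intro compact_Times) (auto simp: compact_closure)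
  then have "compact (F ` (closure U \<times> {0..T}))"
    by (intro compact_continuous_image continuous_on_subset[OF assms]) auto
  then obtain B where "\<forall>y\<in>F ` (closure U \<times> {0..T}). norm y \<le> B" using compact_imp_bounded bounded_iff by metis
  then show ?thesis using closure_subset[of U] by (intro exI[of _ B]) auto
qed

lemma closure_sub: "U \<times> {0::real<..} \<subseteq> closure U \<times> {0..}"
  using closure_subset[of U] by auto

lemma regular_bcf: "bcf U (pt w)" "bcf U (\<lambda>z. norm (gradx w (fst z) (snd z)))" "bcf U (\<lambda>z. dtime w (fst z) (snd z))"
  and regular_grad_cont: "continuous_on (U \<times> {0<..}) (\<lambda>z. gradx w (fst z) (snd z))"
proof -
  have c: "continuous_on (closure U \<times> {0..}) (pt w)"
    using reg by (simp add: regular_fn_def pt_def[abs_def] case_prod_unfold)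
  obtain Gr H where Gr: "continuous_on (closure U \<times> {0..}) Gr" "\<forall>x\<in>U. \<forall>t>0. Gr (x, t) = gradx w x t"
    and H: "continuous_on (closure U \<times> {0..}) H" "\<forall>x\<in>U. \<forall>t>0. H (x, t) = dtime w x t"
    using reg by (auto simp: regular_fn_def)
  show "bcf U (pt w)" using regular_bounded[OF c] continuous_on_subset[OF c closure_sub] by (auto simp: bcf_def)
  show g: "continuous_on (U \<times> {0<..}) (\<lambda>z. gradx w (fst z) (snd z))"
    by (rule continuous_on_eq[OF continuous_on_subset[OF Gr(1) closure_sub]]) (use Gr in auto)
  have h: "continuous_on (U \<times> {0<..}) (\<lambda>z. dtime w (fst z) (snd z))"
    by (rule continuous_on_eq[OF continuous_on_subset[OF H(1) closure_sub]]) (use H in auto)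
  show "bcf U (\<lambda>z. norm (gradx w (fst z) (snd z)))"
    using regular_bounded[OF Gr(1)] Gr(2) g by (auto simp: bcf_def intro!: continuous_intros)
  show "bcf U (\<lambda>z. dtime w (fst z) (snd z))"
    using regular_bounded[OF H(1)] H(2) h by (auto simp: bcf_def)
qed

lemma regular_slice:
  assumes "t > 0"
  shows "continuous_on (closure U) (\<lambda>x. w x t)" "continuous_on U (grad1 (\<lambda>x. w x t))" "continuous_on U (\<lambda>x. dtime w x t)"
proof -
  have c: "continuous_on (closure U \<times> {0..}) (\<lambda>(x,t). w x t)" using reg by (simp add: regular_fn_def)
  show "continuous_on (closure U) (\<lambda>x. w x t)"
  proof -
    have "continuous_on (closure U) (\<lambda>x. (\<lambda>(x,t). w x t) (x, t))"
      by (rule continuous_on_compose2[OF c]) (use assms in \<open>auto intro!: continuous_intros\<close>)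
    then show ?thesis by simp
  qed
  have "continuous_on U (\<lambda>x. (\<lambda>z. gradx w (fst z) (snd z)) (x, t))"
    by (rule continuous_on_compose2[OF regular_grad_cont]) (use assms in \<open>auto intro!: continuous_intros\<close>)
  then show "continuous_on U (grad1 (\<lambda>x. w x t))" by (simp add: gradx_def[abs_def])
  have "continuous_on U (\<lambda>x. (\<lambda>z. dtime w (fst z) (snd z)) (x, t))"
    by (rule continuous_on_compose2[of "U \<times> {0<..}"]) (use assms regular_bcf(3) in \<open>auto simp: bcf_def intro!: continuous_intros\<close>)
  then show "continuous_on U (\<lambda>x. dtime w x t)" by simp
qed

lemma regular_diff:
  assumes "x \<in> U" "t > 0"
  shows "(\<lambda>y. w y t) differentiable (at x)" "((\<lambda>s. w x s) has_real_derivative dtime w x t) (at t)"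
proof -
  show "(\<lambda>y. w y t) differentiable (at x)" using reg assms by (simp add: regular_fn_def)
  have "(\<lambda>s. w x s) differentiable (at t)" using reg assms by (simp add: regular_fn_def)
  then have "(\<lambda>s. w x s) field_differentiable (at t)" by (simp add: field_differentiable_def real_differentiable_def)
  then show "((\<lambda>s. w x s) has_real_derivative dtime w x t) (at t)"
    by (simp add: dtime_def DERIV_deriv_iff_field_differentiable)
qed

end

lemma gradx_diff:
  assumes "(\<lambda>y. u y t) differentiable (at x)" "(\<lambda>y. w y t) differentiable (at x)"
  shows "gradx (\<lambda>x t. u x t - w x t) x t = gradx u x t - gradx w x t"
  unfolding gradx_def
proof (rule grad1_eq)
  show "((\<lambda>y. u y t - w y t) has_derivative (\<lambda>v. (grad1 (\<lambda>y. u y t) x - grad1 (\<lambda>y. w y t) x) \<bullet> v)) (at x)"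
    using has_derivative_diff[OF has_derivative_grad1[OF assms(1)] has_derivative_grad1[OF assms(2)]]
    by (simp add: inner_diff_left)
qed

lemma regular_fn_diff:
  assumes U: "open U" "bounded U" and u: "regular_fn U u" and w: "regular_fn U w"
  shows "regular_fn U (\<lambda>x t. u x t - w x t)"
    and "x \<in> U \<Longrightarrow> t > 0 \<Longrightarrow> gradx (\<lambda>x t. u x t - w x t) x t = gradx u x t - gradx w x t"
    and "x \<in> U \<Longrightarrow> t > 0 \<Longrightarrow> dtime (\<lambda>x t. u x t - w x t) x t = dtime u x t - dtime w x t"
proof -
  show g: "gradx (\<lambda>x t. u x t - w x t) x t = gradx u x t - gradx w x t" if "x \<in> U" "t > 0" for x t
    using regular_diff(1)[OF U u that] regular_diff(1)[OF U w that] by (rule gradx_diff)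
  show d: "dtime (\<lambda>x t. u x t - w x t) x t = dtime u x t - dtime w x t" if "x \<in> U" "t > 0" for x t
    using DERIV_diff[OF regular_diff(2)[OF U u that] regular_diff(2)[OF U w that]]
    unfolding dtime_def by (rule DERIV_imp_deriv)
  obtain G1 H1 where 1: "continuous_on (closure U \<times> {0..}) G1" "\<forall>x\<in>U. \<forall>t>0. G1 (x, t) = gradx u x t"
     "continuous_on (closure U \<times> {0..}) H1" "\<forall>x\<in>U. \<forall>t>0. H1 (x, t) = dtime u x t" using u by (auto simp: regular_fn_def)
  obtain G2 H2 where 2: "continuous_on (closure U \<times> {0..}) G2" "\<forall>x\<in>U. \<forall>t>0. G2 (x, t) = gradx w x t"
     "continuous_on (closure U \<times> {0..}) H2" "\<forall>x\<in>U. \<forall>t>0. H2 (x, t) = dtime w x t" using w by (auto simp: regular_fn_def)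
  have c: "continuous_on (closure U \<times> {0..}) (\<lambda>(x,t). u x t - w x t)"
  proof -
    have "continuous_on (closure U \<times> {0..}) (\<lambda>z. (\<lambda>(x,t). u x t) z - (\<lambda>(x,t). w x t) z)"
      using u w by (intro continuous_intros) (auto simp: regular_fn_def)
    then show ?thesis by (simp add: case_prod_unfold)
  qed
  show "regular_fn U (\<lambda>x t. u x t - w x t)"
    unfolding regular_fn_def
  proof (intro conjI ballI allI impI)
    fix x t assume xt: "x \<in> U" "t > (0::real)"
    show "(\<lambda>y. u y t - w y t) differentiable at x"
      by (intro differentiable_diff regular_diff(1)[OF U u xt] regular_diff(1)[OF U w xt])
    have "(\<lambda>s. u x s) differentiable (at t)" "(\<lambda>s. w x s) differentiable (at t)"
      using u w xt by (auto simp: regular_fn_def)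
    then show "(\<lambda>s. u x s - w x s) differentiable (at t)" by (rule differentiable_diff)
  next
    show "\<exists>Gr. continuous_on (closure U \<times> {0..}) Gr \<and> (\<forall>x\<in>U. \<forall>t>0. Gr (x, t) = gradx (\<lambda>x t. u x t - w x t) x t)"
      by (intro exI[of _ "\<lambda>z. G1 z - G2 z"]) (use 1 2 g in \<open>auto intro!: continuous_intros\<close>)
    show "\<exists>H. continuous_on (closure U \<times> {0..}) H \<and> (\<forall>x\<in>U. \<forall>t>0. H (x, t) = dtime (\<lambda>x t. u x t - w x t) x t)"
      by (intro exI[of _ "\<lambda>z. H1 z - H2 z"]) (use 1 2 d in \<open>auto intro!: continuous_intros\<close>)
  qed (rule c)
qed

section \<open>Energy estimates for \<open>u - \<Psi>\<close>\<close>

locale rotating_flow = forchheimer N coef alb k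
  for N :: nat and coef alb :: "nat \<Rightarrow> real" and k :: "real^3" +
  fixes Rs G \<Omega> :: real and e0 :: "real \<Rightarrow> real^3" and U :: "(real^3) set"
    and u0 :: "real^3 \<Rightarrow> real" and \<psi> \<Psi> u :: "real^3 \<Rightarrow> real \<Rightarrow> real"
  assumes Rs_nonneg: "Rs \<ge> 0" and G_pos: "G > 0" and Om_nonneg: "\<Omega> \<ge> 0"
    and e0_unit: "\<forall>t. norm (e0 t) = 1"
    and U_open: "open U" and U_bounded: "bounded U"
    and Psi_reg: "regular_fn U \<Psi>"
    and Psi_ext: "\<forall>x\<in>frontier U. \<forall>t\<ge>0. \<Psi> x t = \<psi> x t"
    and u_sol: "is_solution N coef alb k Rs G \<Omega> e0 U u0 \<psi> u"
    and u_nonneg: "\<forall>x\<in>closure U. \<forall>t\<ge>0. u x t \<ge> 0"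
begin

abbreviation "chi \<equiv> chi_star Rs (chi0 N coef) G \<Omega> U"
abbreviation "ub \<equiv> (\<lambda>x t. u x t - \<Psi> x t)"
abbreviation "Q \<equiv> cyl U"
definition "v = (\<lambda>z. \<bar>pt ub z\<bar>)"
definition "P = (\<lambda>z. 1 + \<bar>pt \<Psi> z\<bar>)"
text \<open>A majorant of the degenerating factor \<open>(chi0 N coef + Rs * u)\<^sup>2\<close> of
  the coercivity bound that is also at least 1; it plays the role of \<open>w\<close> in
  \<open>flux_coercive\<close>.\<close>

definition "wt = (\<lambda>z. chi * (1 + pt u z)\<^sup>2)"
definition "gu = (\<lambda>z. norm (gradx ub (fst z) (snd z)))"
definition "gP = (\<lambda>z. norm (gradx \<Psi> (fst z) (snd z)))"
definition "dP = (\<lambda>z. \<bar>dtime \<Psi> (fst z) (snd z)\<bar>)"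
text \<open>The part of \<open>flux_coercive\<close> without the gradient of
  \<open>u - \<Psi>\<close>: there \<open>h1\<close> becomes the bound
  \<open>chi * u\<^sup>2\<close> for the gravity and centrifugal term and \<open>h2\<close> the norm
  of the gradient of \<open>\<Psi>\<close>.\<close>

definition "src = (\<lambda>z. C5 + K0 * (wt z powr (1 - a) * ((chi * (pt u z)\<^sup>2) powr (2 - a) + gP z powr (2 - a))))"

lemmas UO = U_open U_bounded

lemma u_reg: "regular_fn U u" using u_sol by (simp add: is_solution_def)
lemmas ub_reg = regular_fn_diff[OF UO u_reg Psi_reg]

lemma chi_ge: "chi \<ge> 1" "Rs\<^sup>2 \<le> chi" "(chi0 N coef)\<^sup>2 \<le> chi" "G + \<Omega>\<^sup>2 * rU U \<le> chi"
  by (auto simp: chi_star_def)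

lemma u_ge0: "x \<in> U \<Longrightarrow> t > 0 \<Longrightarrow> pt u (x, t) \<ge> 0"
  using u_nonneg closure_subset[of U] by (auto simp: pt_def)

lemma wt_ge1: "x \<in> U \<Longrightarrow> t > 0 \<Longrightarrow> wt (x, t) \<ge> 1"
proof -
  assume "x \<in> U" "t > 0"
  then have "1 \<le> (1 + pt u (x, t))\<^sup>2" using u_ge0[of x t] by (simp add: one_le_power)
  then have "1 * 1 \<le> chi * (1 + pt u (x, t))\<^sup>2" using chi_ge by (intro mult_mono) auto
  then show "wt (x, t) \<ge> 1" by (simp add: wt_def)
qed

text \<open>Both \<open>chi0 N coef\<close> and \<open>Rs\<close> are at most
  \<open>sqrt chi\<close>.\<close>

lemma wt_ge: 
  assumes "s \<ge> 0" shows "(chi0 N coef + Rs * s)\<^sup>2 \<le> chi * (1 + s)\<^sup>2"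
proof -
  have r: "chi0 N coef \<le> sqrt chi" "Rs \<le> sqrt chi"
    using chi_ge c_pos Rs_nonneg by (auto simp: real_le_rsqrt)
  have "chi0 N coef + Rs * s \<le> sqrt chi * (1 + s)"
    using r mult_right_mono[OF r(2) assms] by (simp add: algebra_simps)
  then have "(chi0 N coef + Rs * s)\<^sup>2 \<le> (sqrt chi * (1 + s))\<^sup>2"
    using c_pos Rs_nonneg assms by (intro power_mono) (auto intro: add_nonneg_nonneg less_imp_le)
  then show ?thesis using chi_ge by (simp add: power_mult_distrib)
qed

lemma bcfs: "bcf U (pt ub)" "bcf U v" "bcf U P" "bcf U (pt u)" "bcf U wt" "bcf U gu" "bcf U gP" "bcf U dP"
    "bcf U (\<lambda>z. dtime u (fst z) (snd z))" "bcf U (\<lambda>z. dtime ub (fst z) (snd z))"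
  and bcf_src: "bcf U src"
proof -
  show ub: "bcf U (pt ub)" and "bcf U v" unfolding v_def using regular_bcf(1)[OF UO ub_reg(1)] by (auto intro: bcf_abs)
  show "bcf U P" unfolding P_def by (intro bcf_intros regular_bcf(1)[OF UO Psi_reg])
  show u: "bcf U (pt u)" by (rule regular_bcf(1)[OF UO u_reg])
  show w: "bcf U wt" unfolding wt_def power2_eq_square by (intro bcf_intros u)
  show "bcf U gu" unfolding gu_def by (rule regular_bcf(2)[OF UO ub_reg(1)])
  show g: "bcf U gP" unfolding gP_def by (rule regular_bcf(2)[OF UO Psi_reg])
  show "bcf U dP" unfolding dP_def by (intro bcf_abs regular_bcf(3)[OF UO Psi_reg])
  show "bcf U (\<lambda>z. dtime u (fst z) (snd z))" "bcf U (\<lambda>z. dtime ub (fst z) (snd z))"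
    by (rule regular_bcf(3)[OF UO u_reg], rule regular_bcf(3)[OF UO ub_reg(1)])
  have "wt (x, t) \<ge> 0" if "x \<in> U" "t > 0" for x t using wt_ge1[OF that] by linarith
  then show "bcf U src" unfolding src_def power2_eq_square
    by (intro bcf_intros bcf_powr w u g) (use a_bounds(1,2) chi_ge(1) in \<open>auto simp: gP_def\<close>)
qed

lemma norm_Z_le:
  assumes "x \<in> U" shows "norm (Zfun k G \<Omega> e0 x t) \<le> chi"
proof -
  have "norm x \<le> rU U" unfolding rU_def
  proof (rule cSup_upper)
    show "norm x \<in> norm ` closure U" using assms closure_subset by auto
    have "bounded (norm ` closure U)" using U_bounded by (simp add: bounded_norm_comp bounded_closure)
    then show "bdd_above (norm ` closure U)" by (rule bounded_imp_bdd_above)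
  qed
  moreover have "norm (Jmap k (Jmap k x)) \<le> norm x" using norm_J_le order_trans by blast
  ultimately have "\<Omega>\<^sup>2 * norm (Jmap k (Jmap k x)) \<le> \<Omega>\<^sup>2 * rU U" by (intro mult_left_mono) auto
  moreover have "norm (Zfun k G \<Omega> e0 x t) \<le> norm (- (G *\<^sub>R e0 t)) + norm (\<Omega>\<^sup>2 *\<^sub>R Jmap k (Jmap k x))"
    unfolding Zfun_def by (rule norm_triangle_ineq)
  ultimately show ?thesis using chi_ge(4) e0_unit G_pos by simp
qed

abbreviation "fl \<equiv> flux N coef alb k Rs G \<Omega> e0 u"

lemma flux_pointwise:
  assumes x: "x \<in> U" and t: "t > 0"
  shows "gradx ub x t \<bullet> fl x t \<ge> C10 * (1 / wt (x, t) * gu (x, t) powr (2 - a)) - src (x, t)"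
proof -
  let ?z = "(x, t)"
  have u0: "u x t \<ge> 0" using u_ge0[OF x t] by (simp add: pt_def)
  let ?D1 = "(u x t)\<^sup>2 *\<^sub>R Zfun k G \<Omega> e0 x t"
  let ?y = "gradx u x t + ?D1"
  have F: "Ffun N coef alb k (Rs * u x t) (fl x t) = ?y" unfolding flux_def Xfun_def by (rule F_inv)
  have D1: "norm ?D1 \<le> chi * (u x t)\<^sup>2" using norm_Z_le[OF x, of t] by (simp add: mult_mono mult.commute)
  have y: "?y - ?D1 - gradx \<Psi> x t = gradx ub x t" using ub_reg(2)[OF x t] by simp
  show ?thesis
    using flux_coercive[OF F _ wt_ge1[OF x t] _ D1 order_refl, of "gradx \<Psi> x t"] wt_ge[OF u0] Rs_nonneg u0
    unfolding y by (simp add: wt_def src_def gu_def gP_def pt_def inner_commute)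
qed

text \<open>The weak form is tested with \<open>odp e (\<alpha> - 1)\<close> of
  \<open>u - \<Psi>\<close>, which is C^1 because \<open>\<alpha> > 2\<close>. The flux is replaced
  by its pointwise lower bound while \<open>e\<close> is still positive, so only bounded functions
  take part in the limit \<open>e\<close> to 0.\<close>

lemma energy_slice:
  assumes t: "t > 0" and al: "\<alpha> > 2"
  shows "(LINT x:U|lborel. odp 0 (\<alpha> - 1) (pt ub (x, t)) * dtime u x t
     + (\<alpha> - 1) * (v (x, t) powr (\<alpha> - 2) * (C10 * (1 / wt (x, t) * gu (x, t) powr (2 - a)) - src (x, t)))) \<le> 0"
proof -
  define S where "S x = C10 * (1 / wt (x, t) * gu (x, t) powr (2 - a)) - src (x, t)" for x
  define e where "e n = 1 / real (Suc n)" for n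
  have e: "e n > 0" for n by (simp add: e_def)
  let ?h = "\<lambda>x. ub x t"
  have bS: "bmeas U S"
  proof -
    have "bcf U (\<lambda>z. C10 * (1 / wt z * gu z powr (2 - a)) - src z)"
      by (intro bcf_intros bcf_src bcf_inverse bcf_powr bcfs) (use wt_ge1 a_bounds in \<open>auto simp: gu_def\<close>)
    from bcf_bmeas_slice[OF UO this t] show ?thesis by (simp add: S_def[abs_def])
  qed
  have bu: "bmeas U (\<lambda>x. dtime u x t)" using bcf_bmeas_slice[OF UO bcfs(9) t] by simp
  have bo: "bmeas U (\<lambda>x. odp ee m (pt ub (x, t)))" "bmeas U (\<lambda>x. evp ee m (pt ub (x, t)))" if "m > 0" for ee m
  proof -
    have "bcf U (\<lambda>z. odp ee m (pt ub z))" "bcf U (\<lambda>z. evp ee m (pt ub z))"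
      by (rule bcf_compose[OF bcfs(1)], use that in \<open>auto intro!: continuous_intros\<close>)+
    then show "bmeas U (\<lambda>x. odp ee m (pt ub (x, t)))" "bmeas U (\<lambda>x. evp ee m (pt ub (x, t)))"
      using bcf_bmeas_slice[OF UO _ t] by auto
  qed
  define gn where "gn n x = odp (e n) (\<alpha> - 1) (pt ub (x, t)) * dtime u x t + (\<alpha> - 1) * (evp (e n) (\<alpha> - 2) (pt ub (x, t)) * S x)" for n x
  define g where "g x = odp 0 (\<alpha> - 1) (pt ub (x, t)) * dtime u x t + (\<alpha> - 1) * (v (x, t) powr (\<alpha> - 2) * S x)" for x
  have v: "v (x, t) powr m = evp 0 m (pt ub (x, t))" for x m by (simp add: evp_eq v_def)
  have gi: "set_integrable lborel U (gn n)" for n unfolding gn_def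
    using al by (intro set_integral_add(1) set_integrable_mult_right bmeas_integrable bmeas_mult bo bu bS) auto
  have gi0: "set_integrable lborel U g" unfolding g_def v
    using al by (intro set_integral_add(1) set_integrable_mult_right bmeas_integrable bmeas_mult bo bu bS) auto
  have neg: "(LINT x:U|lborel. gn n x) \<le> 0" for n
  proof -
    have hc: "continuous_on (closure U) ?h" and hg: "continuous_on U (grad1 ?h)"
      using regular_slice[OF UO ub_reg(1) t] by auto
    have h0: "?h x = 0" if "x \<in> frontier U" for x
      using that u_sol Psi_ext t by (auto simp: is_solution_def)
    have hd: "?h differentiable (at x)" if "x \<in> U" for x using regular_diff(1)[OF UO ub_reg(1) that t] .
    have fd: "(\<lambda>y. fl y t) differentiable (at x)" if "x \<in> U" for x using u_sol that t by (auto simp: is_solution_def)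
    have fe: "dtime u x t = (\<Sum>i\<in>UNIV. frechet_derivative (\<lambda>y. fl y t) (at x) (axis i 1) $ i)" if "x \<in> U" for x
      using u_sol that t by (auto simp: is_solution_def divx_def)
    have wf: "(LINT x:U|lborel. odp (e n) (\<alpha> - 1) (?h x) * dtime u x t + ((\<alpha> - 1) * evp (e n) (\<alpha> - 1 - 1) (?h x)) * (grad1 ?h x \<bullet> fl x t)) = 0"
      "set_integrable lborel U (\<lambda>x. odp (e n) (\<alpha> - 1) (?h x) * dtime u x t + ((\<alpha> - 1) * evp (e n) (\<alpha> - 1 - 1) (?h x)) * (grad1 ?h x \<bullet> fl x t))"
    proof -
      note wf = weak_form[OF UO hc h0 hd hg e[of n] odp_deriv _ _ _ fd fe regular_slice(3)[OF UO u_reg t], of "\<alpha> - 1"]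
      have "continuous_on UNIV (\<lambda>s. (\<alpha> - 1) * evp (e n) (\<alpha> - 1 - 1) s)" using al by (intro continuous_intros) auto
      then show "(LINT x:U|lborel. odp (e n) (\<alpha> - 1) (?h x) * dtime u x t + ((\<alpha> - 1) * evp (e n) (\<alpha> - 1 - 1) (?h x)) * (grad1 ?h x \<bullet> fl x t)) = 0"
        "set_integrable lborel U (\<lambda>x. odp (e n) (\<alpha> - 1) (?h x) * dtime u x t + ((\<alpha> - 1) * evp (e n) (\<alpha> - 1 - 1) (?h x)) * (grad1 ?h x \<bullet> fl x t))"
        using wf al by (auto simp: evp_zero)
    qed
    have "(LINT x:U|lborel. gn n x) \<le> (LINT x:U|lborel. odp (e n) (\<alpha> - 1) (?h x) * dtime u x t + ((\<alpha> - 1) * evp (e n) (\<alpha> - 1 - 1) (?h x)) * (grad1 ?h x \<bullet> fl x t))"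
    proof (rule set_integral_mono[OF gi wf(2)])
      fix x assume x: "x \<in> U"
      have "(\<alpha> - 1) * evp (e n) (\<alpha> - 2) (?h x) * S x \<le> (\<alpha> - 1) * evp (e n) (\<alpha> - 2) (?h x) * (grad1 ?h x \<bullet> fl x t)"
        using flux_pointwise[OF x t] al by (intro mult_left_mono) (auto simp: S_def gradx_def evp_nonneg)
      then show "gn n x \<le> odp (e n) (\<alpha> - 1) (?h x) * dtime u x t + ((\<alpha> - 1) * evp (e n) (\<alpha> - 1 - 1) (?h x)) * (grad1 ?h x \<bullet> fl x t)"
        by (simp add: gn_def pt_def)
    qed
    then show ?thesis using wf(1) by simp
  qed
  have "(\<lambda>n. LINT x:U|lborel. gn n x) \<longlonglongrightarrow> (LINT x:U|lborel. g x)"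
    unfolding set_lebesgue_integral_def
  proof (rule integral_dominated_convergence)
    show "integrable lborel (\<lambda>x. indicator U x *\<^sub>R (v (x, t) powr (\<alpha> - 1) * \<bar>dtime u x t\<bar> + (\<alpha> - 1) * (v (x, t) powr (\<alpha> - 2) * \<bar>S x\<bar>)))"
      unfolding set_integrable_def[symmetric] v
      using al by (intro set_integral_add(1) set_integrable_mult_right bmeas_integrable bmeas_mult bo bmeas_abs bu bS) auto
    show "AE x in lborel. (\<lambda>n. indicator U x *\<^sub>R gn n x) \<longlonglongrightarrow> indicator U x *\<^sub>R g x"
    proof (intro AE_I2 tendsto_scaleR tendsto_const)
      fix x show "(\<lambda>n. gn n x) \<longlonglongrightarrow> g x"
        unfolding gn_def g_def e_def v_def 
        using al evp_lim[of "\<alpha> - 2" "pt ub (x, t)"] odp_lim[of "\<alpha> - 1" "pt ub (x, t)"]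
        by (intro tendsto_intros) (auto simp: odp_eq evp_eq)
    qed
    show "AE x in lborel. norm (indicator U x *\<^sub>R gn n x) \<le> indicator U x *\<^sub>R (v (x, t) powr (\<alpha> - 1) * \<bar>dtime u x t\<bar> + (\<alpha> - 1) * (v (x, t) powr (\<alpha> - 2) * \<bar>S x\<bar>))" for n
    proof (rule AE_I2)
      fix x
      have o: "\<bar>odp (e n) (\<alpha> - 1) (pt ub (x, t))\<bar> \<le> v (x, t) powr (\<alpha> - 1)"
        using abs_odp_le[of "e n" "\<alpha> - 1" "pt ub (x, t)"] evp_le[of "e n" "\<alpha> - 1" "pt ub (x, t)"] al e[of n] by (simp add: v_def)
      have q: "\<bar>evp (e n) (\<alpha> - 2) (pt ub (x, t))\<bar> \<le> v (x, t) powr (\<alpha> - 2)"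
        using evp_le[of "e n" "\<alpha> - 2" "pt ub (x, t)"] al e[of n] evp_nonneg[of "e n" "\<alpha> - 2" "pt ub (x, t)"] by (simp add: v_def)
      have "\<bar>gn n x\<bar> \<le> \<bar>odp (e n) (\<alpha> - 1) (pt ub (x, t))\<bar> * \<bar>dtime u x t\<bar> + (\<alpha> - 1) * (\<bar>evp (e n) (\<alpha> - 2) (pt ub (x, t))\<bar> * \<bar>S x\<bar>)"
        unfolding gn_def using al by (simp add: abs_mult order_trans[OF abs_triangle_ineq])
      also have "\<dots> \<le> v (x, t) powr (\<alpha> - 1) * \<bar>dtime u x t\<bar> + (\<alpha> - 1) * (v (x, t) powr (\<alpha> - 2) * \<bar>S x\<bar>)"
        using o q al by (intro add_mono mult_left_mono mult_right_mono) auto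
      finally show "norm (indicator U x *\<^sub>R gn n x) \<le> indicator U x *\<^sub>R (v (x, t) powr (\<alpha> - 1) * \<bar>dtime u x t\<bar> + (\<alpha> - 1) * (v (x, t) powr (\<alpha> - 2) * \<bar>S x\<bar>))"
        by (auto split: split_indicator)
    qed
    show "(\<lambda>x. indicator U x *\<^sub>R g x) \<in> borel_measurable lborel" 
      using gi0 by (intro borel_measurable_integrable) (simp add: set_integrable_def)
    show "(\<lambda>x. indicator U x *\<^sub>R gn n x) \<in> borel_measurable lborel" for n
      using gi[of n] by (intro borel_measurable_integrable) (simp add: set_integrable_def)
  qed
  then have "(LINT x:U|lborel. g x) \<le> 0" using neg by (intro LIMSEQ_le_const2) auto
  then show ?thesis by (simp add: g_def S_def)
qed

definition "J \<alpha> t = (LINT x:U|lborel. v (x, t) powr \<alpha>)"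
definition "dsp \<alpha> = (\<lambda>z. v z powr (\<alpha> - 2) * (1 / wt z * gu z powr (2 - a)))"
definition "rhs \<alpha> = (\<lambda>z. \<alpha> * (\<alpha> - 1) * (v z powr (\<alpha> - 2) * src z) + \<alpha> * (v z powr (\<alpha> - 1) * dP z))"

lemma nonneg: "v z \<ge> 0" "gu z \<ge> 0" "gP z \<ge> 0" "dP z \<ge> 0" "P z \<ge> 1" "src z \<ge> 0" "J \<alpha> t \<ge> 0"
proof -
  have "0 \<le> wt z powr (1 - a) * ((chi * (pt u z)\<^sup>2) powr (2 - a) + gP z powr (2 - a))" by simp
  then show "src z \<ge> 0" using c_pos(3) K0_pos by (simp add: src_def)
qed (auto simp: v_def gu_def gP_def dP_def P_def J_def set_lebesgue_integral_def)

lemma bcf_v_powr: "m > 0 \<Longrightarrow> bcf U (\<lambda>z. v z powr m)"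
  by (intro bcf_powr bcfs) (auto simp: nonneg)

lemma bcf_dsp: "\<alpha> > 2 \<Longrightarrow> bcf U (dsp \<alpha>)" and bcf_rhs: "\<alpha> > 2 \<Longrightarrow> bcf U (rhs \<alpha>)"
  unfolding dsp_def rhs_def
  by (intro bcf_intros bcf_inverse bcf_powr bcfs bcf_src; use wt_ge1 a_bounds(1,2) in \<open>auto simp: nonneg\<close>)+

text \<open>The time derivative of the power of \<open>v\<close> is \<open>\<alpha>\<close> times
  the odd power times \<open>dtime u - dtime \<Psi>\<close>: \<open>energy_slice\<close> handles the
  first part, the second is moved into \<open>rhs\<close>. Starting times are positive because
  differentiability in time is assumed only there.\<close>

lemma energy_integrated:
  assumes st: "0 < s" "s \<le> t" and al: "\<alpha> > 2"
  shows "J \<alpha> t + \<alpha> * (\<alpha> - 1) * C10 * (LINT z:Q s t|lborel. dsp \<alpha> z) \<le> J \<alpha> s + (LINT z:Q s t|lborel. rhs \<alpha> z)"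
proof -
  let ?du = "\<lambda>z. dtime u (fst z) (snd z)" and ?dub = "\<lambda>z. dtime ub (fst z) (snd z)"
  let ?o = "\<lambda>z. odp 0 (\<alpha> - 1) (pt ub z)"
  define f' where "f' z = \<alpha> * (?o z * ?dub z)" for z
  define g where "g z = ?o z * ?du z + (\<alpha> - 1) * (v z powr (\<alpha> - 2) * (C10 * (1 / wt z * gu z powr (2 - a)) - src z))" for z
  have bo: "bcf U ?o" by (rule bcf_compose[OF bcfs(1)]) (use al in \<open>auto intro!: continuous_intros\<close>)
  have bf: "bcf U f'" unfolding f'_def by (intro bcf_intros bo bcfs)
  have bg: "bcf U g" unfolding g_def
    by (intro bcf_intros bo bcfs bcf_inverse bcf_powr bcf_src) (use wt_ge1 al a_bounds(1,2) in \<open>auto simp: nonneg\<close>)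
  have e: "J \<alpha> t - J \<alpha> s = (LINT z:Q s t|lborel. f' z)"
    unfolding J_def
  proof (rule bcf_ftc[OF UO bcf_v_powr bf st])
    fix x r assume x: "x \<in> U" and r: "r > (0::real)"
    have "((\<lambda>r. evp 0 \<alpha> (ub x r)) has_real_derivative (\<alpha> * odp 0 (\<alpha> - 1) (ub x r)) * dtime ub x r) (at r)"
      by (rule DERIV_chain2[OF evp_deriv regular_diff(2)[OF UO ub_reg(1) x r]]) (use al in auto)
    then show "((\<lambda>r. v (x, r) powr \<alpha>) has_real_derivative f' (x, r)) (at r)"
      by (simp add: f'_def v_def pt_def evp_eq mult.assoc)
  qed (use al in auto)
  have g0: "(LINT z:Q s t|lborel. g z) \<le> 0"
  proof -
    have sl: "(LINT x:U|lborel. g (x, r)) \<le> 0" if "r > 0" for r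
      using energy_slice[OF that al] by (simp add: g_def)
    have "(LINT r:{s<..<t}|lborel. LINT x:U|lborel. g (x, r)) \<le> (LINT r:{s<..<t}|lborel. 0)"
      by (rule set_integral_mono) (use bcf_fubini(2)[OF UO bg, of s t] st sl in \<open>auto simp: set_integrable_def\<close>)
    then show ?thesis using bcf_fubini(1)[OF UO bg, of s t] st by (simp add: set_lebesgue_integral_def)
  qed
  have i: "set_integrable lborel (Q s t) h" if "bcf U h" for h
    using bmeas_integrable[OF bcf_bmeas[OF UO that, of s t]] st by simp
  let ?c = "\<alpha> * (\<alpha> - 1) * C10"
  have "(LINT z:Q s t|lborel. f' z) + ?c * (LINT z:Q s t|lborel. dsp \<alpha> z) = (LINT z:Q s t|lborel. f' z + ?c * dsp \<alpha> z)"
    by (subst set_integral_add(2)) (auto intro!: i bf bcf_mult bcf_const bcf_dsp[OF al])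
  also have "\<dots> \<le> (LINT z:Q s t|lborel. \<alpha> * g z + rhs \<alpha> z)"
  proof (rule set_integral_mono)
    fix z assume "z \<in> Q s t"
    then obtain x r where z: "z = (x, r)" "x \<in> U" "r > 0" using st by (auto simp: cyl_def)
    have d: "?dub z = ?du z - dtime \<Psi> x r" using ub_reg(3) z by simp
    have "\<bar>?o z\<bar> = v z powr (\<alpha> - 1)" using al by (simp add: abs_odp_eq evp_eq v_def)
    then have "- (?o z * dtime \<Psi> x r) \<le> v z powr (\<alpha> - 1) * dP z"
      using abs_ge_minus_self[of "?o z * dtime \<Psi> x r"] by (simp add: abs_mult dP_def z)
    then have "\<alpha> * - (?o z * dtime \<Psi> x r) \<le> \<alpha> * (v z powr (\<alpha> - 1) * dP z)" using al by (intro mult_left_mono) auto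
    then show "f' z + ?c * dsp \<alpha> z \<le> \<alpha> * g z + rhs \<alpha> z"
      unfolding f'_def d g_def dsp_def rhs_def by (simp add: algebra_simps)
  qed (intro i bcf_intros bf bcf_dsp[OF al] bg bcf_rhs[OF al])+
  also have "\<dots> = \<alpha> * (LINT z:Q s t|lborel. g z) + (LINT z:Q s t|lborel. rhs \<alpha> z)"
    by (subst set_integral_add(2)) (auto intro!: i bg bcf_mult bcf_const bcf_rhs[OF al])
  also have "\<dots> \<le> (LINT z:Q s t|lborel. rhs \<alpha> z)" using g0 al by (simp add: mult_nonneg_nonpos)
  finally show ?thesis using e by simp
qed

lemma rhs_nonneg: "\<alpha> > 2 \<Longrightarrow> rhs \<alpha> z \<ge> 0" and dsp_nonneg: "x \<in> U \<Longrightarrow> t > 0 \<Longrightarrow> dsp \<alpha> (x, t) \<ge> 0"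
  using wt_ge1[of x t] by (auto simp: rhs_def dsp_def nonneg intro!: add_nonneg_nonneg mult_nonneg_nonneg)

lemma LINT_nonneg: "(\<And>z. z \<in> A \<Longrightarrow> f z \<ge> 0) \<Longrightarrow> (LINT z:A|lborel. f z) \<ge> (0::real)"
  unfolding set_lebesgue_integral_def by (intro integral_nonneg_AE AE_I2) (auto split: split_indicator)

text \<open>The starting time of \<open>energy_integrated\<close> is averaged over (T1, T2). This
  costs the factor \<open>1 / (T2 - T1)\<close>, replaces the norm on one slice by a space-time
  integral and admits \<open>T1 = 0\<close>.\<close>

lemma energy_averaged:
  assumes T: "0 \<le> T1" "T1 < T2" "T2 \<le> T" and al: "\<alpha> > 2"
  defines "B \<equiv> 1 / (T2 - T1) * (LINT z:Q T1 T|lborel. v z powr \<alpha>) + (LINT z:Q T1 T|lborel. rhs \<alpha> z)"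
  shows "\<And>t. T2 \<le> t \<Longrightarrow> t \<le> T \<Longrightarrow> J \<alpha> t \<le> B"
    and "\<alpha> * (\<alpha> - 1) * C10 * (LINT z:Q T2 T|lborel. dsp \<alpha> z) \<le> B"
proof -
  let ?R = "LINT z:Q T1 T|lborel. rhs \<alpha> z"
  \<comment> \<open>The averaging is done once for a quantity \<open>X\<close> that does not depend
    on the starting time; it is used both for the norm at a later time and for the
    dissipation.\<close>
  have main: "X \<le> B" if X: "\<And>s. T1 < s \<Longrightarrow> s < T2 \<Longrightarrow> X \<le> J \<alpha> s + ?R" for X
  proof -
    have bv: "bcf U (\<lambda>z. v z powr \<alpha>)" using al by (intro bcf_v_powr) auto
    have ci: "set_integrable lborel {T1<..<T2} (\<lambda>_. c :: real)" for c
      by (intro bmeas_integrable bmeas_const) (use T in simp_all)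
    have si: "set_integrable lborel {T1<..<T2} (\<lambda>s. J \<alpha> s)"
      unfolding J_def using bcf_fubini(2)[OF UO bv T(1)] .
    have "(LINT s:{T1<..<T2}|lborel. X - ?R) \<le> (LINT s:{T1<..<T2}|lborel. J \<alpha> s)"
    proof (rule set_integral_mono[OF ci si])
      fix s assume "s \<in> {T1<..<T2}" then show "X - ?R \<le> J \<alpha> s" using X[of s] by simp
    qed
    also have "\<dots> = (LINT z:Q T1 T2|lborel. v z powr \<alpha>)"
      unfolding J_def using bcf_fubini(1)[OF UO bv T(1)] by simp
    also have "\<dots> \<le> (LINT z:Q T1 T|lborel. v z powr \<alpha>)"
      by (rule bcf_slice_mono_set[OF UO bv]) (use T in \<open>auto simp: nonneg\<close>)
    finally have "(T2 - T1) * (X - ?R) \<le> (LINT z:Q T1 T|lborel. v z powr \<alpha>)"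
      using T by (simp add: set_lebesgue_integral_def)
    then show ?thesis using T by (simp add: B_def field_simps)
  qed
  have R: "(LINT z:Q s t|lborel. rhs \<alpha> z) \<le> ?R" if "T1 < s" "t \<le> T" for s t
    by (rule bcf_slice_mono_set[OF UO bcf_rhs[OF al]]) (use T that rhs_nonneg[OF al] in auto)
  have c: "\<alpha> * (\<alpha> - 1) * C10 \<ge> 0" using al c_pos by simp
  have dn: "(LINT z:Q s t|lborel. dsp \<alpha> z) \<ge> 0" if "s > 0" for s t
    by (rule LINT_nonneg) (use that dsp_nonneg in \<open>auto simp: cyl_def\<close>)
  show "J \<alpha> t \<le> B" if t: "T2 \<le> t" "t \<le> T" for t
  proof (rule main)
    fix s assume s: "T1 < s" "s < T2"
    then have "s > 0" "s \<le> t" using t T by auto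
    from energy_integrated[OF this al] R[of s t] s t mult_nonneg_nonneg[OF c dn[OF \<open>s > 0\<close>, of t]]
    show "J \<alpha> t \<le> J \<alpha> s + ?R" by linarith
  qed
  show "\<alpha> * (\<alpha> - 1) * C10 * (LINT z:Q T2 T|lborel. dsp \<alpha> z) \<le> B"
  proof (rule main)
    fix s assume s: "T1 < s" "s < T2"
    then have s0: "s > 0" "s \<le> T" using T by auto
    have "(LINT z:Q T2 T|lborel. dsp \<alpha> z) \<le> (LINT z:Q s T|lborel. dsp \<alpha> z)"
      by (rule bcf_slice_mono_set[OF UO bcf_dsp[OF al]]) (use s s0 dsp_nonneg in auto)
    then have "\<alpha> * (\<alpha> - 1) * C10 * (LINT z:Q T2 T|lborel. dsp \<alpha> z) \<le> \<alpha> * (\<alpha> - 1) * C10 * (LINT z:Q s T|lborel. dsp \<alpha> z)"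
      using c by (rule mult_left_mono)
    with energy_integrated[OF s0 al] R[of s T] s nonneg(7)[of \<alpha> T]
    show "\<alpha> * (\<alpha> - 1) * C10 * (LINT z:Q T2 T|lborel. dsp \<alpha> z) \<le> J \<alpha> s + ?R" by linarith
  qed
qed

section \<open>Controlling the right-hand side by the data\<close>

text \<open>The factor of the data in \<open>energy_bound\<close>: 1 for the time derivative of
  \<open>\<Psi>\<close>, the rest from \<open>src\<close>.\<close>

definition "CR = 1 + C5 + 4 * 16 powr (1 - a) * K0"

text \<open>With h = 2^(1 - a) in [1, 2] all constants become comparable: 16^(1 - a) = h^4,
  \<open>C5 = 2 * h * C10\<close> and 3^(1 - a) \<le> h^2. The factor 9 in \<open>c16\<close> then
  leaves room. The 2 on the right is absorbed by the powers of 2 in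
  \<open>moser_constant\<close>.\<close>

lemma CR_le: "1 + CR \<le> 2 * c16 N coef alb"
proof -
  define h where "h = (2::real) powr (1 - a)"
  define E where "E = C3 * (32 * C3 / C4) powr (1 - a)"
  have h: "1 \<le> h" "h \<le> 2"
    using a_bounds(1,2) powr_mono[of "1 - a" 1 "2::real"] by (auto simp: h_def ge_one_powr_ge_zero)
  have p4: "(4::real) powr (1 - a) = h^2" 
    using powr_powr[of "2::real" 2 "1 - a"] by (simp add: h_def power2_eq_square powr_add[symmetric])
  have p16: "(16::real) powr (1 - a) = h^4"
    using powr_mult[of "4::real" 4 "1 - a"] p4 by (simp add: power2_eq_square power4_eq_xxxx)
  have p3: "(3::real) powr (1 - a) \<le> h^2" unfolding p4[symmetric] using a_bounds(1,2) by (intro powr_mono2) auto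
  have C5: "C5 = 2 * h * C10"
  proof -
    have "C5 = 2 powr (- a) * C4" by (rule c_pos)
    also have "2 powr (- a) = h / 2" by (simp add: h_def powr_diff powr_minus field_simps)
    finally show ?thesis by (simp add: c_pos(8))
  qed
  have E: "E > 0" using c_pos by (simp add: E_def)
  have pos: "C10 > 0" "C3 > 0" using c_pos by auto
  have c9: "c9 N coef alb \<ge> 0" using c_pos by (simp add: c9_def)
  define x where "x = h^3"
  have x: "1 \<le> x" "x \<le> 8" using h power_mono[of h 2 3] by (auto simp: x_def one_le_power)
  have h2: "h^2 \<ge> 1" "h^2 \<le> 4" using h power_mono[of h 2 2] by (auto simp: one_le_power)
  have c11: "c11 N coef alb \<ge> 2 * x * C10 + 2 * E + C10"
    using c9 by (simp add: c11_def p4 E_def C5 x_def power2_eq_square power3_eq_cube mult_ac)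
  have c12: "c12 N coef alb \<ge> 2 * h^2 * E"
    using pos by (simp add: c12_def p4 E_def algebra_simps)
  have 1: "4 * h^4 * E \<le> 36 * E + 36 * h^2 * E"
  proof -
    have "h^4 = h^2 * h^2" by simp
    then have "4 * h^4 \<le> 16 * h^2" using h2 mult_right_mono[of "h^2" 4 "h^2"] by simp
    then have "4 * h^4 * E \<le> (36 + 36 * h^2) * E" using E h2 by (intro mult_right_mono) auto
    then show ?thesis by (simp add: algebra_simps)
  qed
  have 2: "4 * h^4 * (3 powr (1 - a) * C10) + C5 \<le> 36 * x * C10 + 18 * C10"
  proof -
    have "4 * h^4 * (3 powr (1 - a) * C10) \<le> 4 * h^4 * (h^2 * C10)"
      using p3 pos by (intro mult_left_mono mult_right_mono) auto
    also have "h^4 * h^2 = x * x" by (simp add: x_def power_add[symmetric])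
    then have "4 * h^4 * (h^2 * C10) = 4 * x * x * C10" by (simp add: mult.assoc[symmetric])
    also have "\<dots> \<le> 4 * 8 * x * C10" using x pos by (intro mult_right_mono) auto
    finally have "4 * h^4 * (3 powr (1 - a) * C10) + C5 \<le> (32 * x + 2 * h) * C10" by (simp add: C5 algebra_simps)
    also have "\<dots> \<le> (36 * x + 18) * C10" using x h pos by (intro mult_right_mono) auto
    finally show ?thesis by (simp add: algebra_simps)
  qed
  have "1 + CR = 2 + C5 + 4 * h^4 * E + 4 * h^4 * (3 powr (1 - a) * C10)"
    by (simp add: CR_def p16 K0_def E_def algebra_simps)
  then show ?thesis using 1 2 c11 c12 unfolding c16_def by (simp add: algebra_simps)
qed

lemma Q_measure_mono: 
  assumes "T1 \<le> s" "t \<le> T" shows "measure lborel (Q s t) \<le> measure lborel (Q T1 T)"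
proof -
  have sub: "Q s t \<subseteq> Q T1 T" using assms by (auto simp: cyl_def)
  show ?thesis
    by (rule measure_mono_fmeasurable[OF sub])
      (use cyl_sets[OF UO] in \<open>auto simp: fmeasurable_def\<close>)
qed

lemma pt_u_le: "pt u z + 1 \<le> P z + v z"
  by (simp add: P_def v_def pt_def)

text \<open>Since \<open>1 + u \<le> P + v\<close>, each power of \<open>u\<close> splits into data
  and unknown. The exponents 2 (1 - a) and 2 (2 - a) add up to 6 - 4 a, the exponent in the third
  integral of \<open>Mfun\<close>; the accompanying power 3 - 2 a of \<open>chi\<close> is enlarged
  to 3 - a.\<close>

lemma src_le:
  assumes "x \<in> U" "t > 0"
  defines "z \<equiv> (x, t)"
  shows "src z \<le> C5 + K0 * (2 * 16 powr (1 - a) * (chi powr (3 - a) * (P z powr (6 - 4 * a) + v z powr (6 - 4 * a)))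
     + 4 powr (1 - a) * (chi powr (1 - a) * (P z powr (2 * (1 - a)) * (1 + gP z) powr (2 - a) + (1 + gP z) powr (2 - a) * v z powr (2 * (1 - a)))))"
proof -
  define s where "s = pt u z"
  have s: "s \<ge> 0" using u_ge0[OF assms(1,2)] by (simp add: s_def z_def)
  have sP: "1 + s \<le> P z + v z" using pt_u_le[of z] by (simp add: s_def)
  have aa: "0 < a" "a < 1" by (rule a_bounds)+
  have chi: "chi > 0" using chi_ge by linarith
  have w: "wt z powr (1 - a) = chi powr (1 - a) * (1 + s) powr (2 * (1 - a))"
  proof -
    have "(1 + s)\<^sup>2 = (1 + s) powr 2" using s by simp
    then have "wt z = chi * (1 + s) powr 2" by (simp add: wt_def s_def)
    then have "wt z powr (1 - a) = chi powr (1 - a) * ((1 + s) powr 2) powr (1 - a)" by (simp only: powr_mult)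
    then show ?thesis by (simp only: powr_powr)
  qed
  have 1: "wt z powr (1 - a) * (chi * (pt u z)\<^sup>2) powr (2 - a) \<le> 2 * 16 powr (1 - a) * (chi powr (3 - a) * (P z powr (6 - 4 * a) + v z powr (6 - 4 * a)))"
  proof -
    have "(chi * s\<^sup>2) powr (2 - a) \<le> (chi * (1 + s) powr 2) powr (2 - a)"
      using s chi aa by (intro powr_mono2 mult_left_mono) (auto intro!: power_mono)
    also have "\<dots> = chi powr (2 - a) * (1 + s) powr (2 * (2 - a))" by (simp only: powr_mult powr_powr)
    finally have "wt z powr (1 - a) * (chi * s\<^sup>2) powr (2 - a) \<le> (chi powr (1 - a) * (1 + s) powr (2 * (1 - a))) * (chi powr (2 - a) * (1 + s) powr (2 * (2 - a)))"
      unfolding w by (intro mult_left_mono) auto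
    also have "\<dots> = chi powr (3 - 2 * a) * (1 + s) powr (6 - 4 * a)"
    proof -
      have "chi powr (1 - a) * chi powr (2 - a) = chi powr (3 - 2 * a)" by (simp add: powr_add[symmetric])
      moreover have "(1 + s) powr (2 * (1 - a)) * (1 + s) powr (2 * (2 - a)) = (1 + s) powr (6 - 4 * a)"
        by (simp add: powr_add[symmetric] algebra_simps)
      moreover have "(chi powr (1 - a) * (1 + s) powr (2 * (1 - a))) * (chi powr (2 - a) * (1 + s) powr (2 * (2 - a)))
        = (chi powr (1 - a) * chi powr (2 - a)) * ((1 + s) powr (2 * (1 - a)) * (1 + s) powr (2 * (2 - a)))"
        by (simp only: mult_ac)
      ultimately show ?thesis by (simp only:)
    qed
    also have "\<dots> \<le> chi powr (3 - a) * (2 * 16 powr (1 - a) * (P z powr (6 - 4 * a) + v z powr (6 - 4 * a)))"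
    proof (rule mult_mono)
      show "chi powr (3 - 2 * a) \<le> chi powr (3 - a)" using chi_ge aa by (intro powr_mono) auto
      have "(1 + s) powr (6 - 4 * a) \<le> (P z + v z) powr (6 - 4 * a)" using sP s aa by (intro powr_mono2) auto
      also have "\<dots> \<le> 2 powr ((6 - 4 * a) - 1) * (P z powr (6 - 4 * a) + v z powr (6 - 4 * a))"
        using nonneg(5)[of z] nonneg(1)[of z] aa by (intro powr_sum2_le) auto
      also have "(2::real) powr ((6 - 4 * a) - 1) = 2 * 16 powr (1 - a)"
      proof -
        have "(16::real) powr (1 - a) = (2 powr 4) powr (1 - a)" by simp
        also have "\<dots> = 2 powr (4 * (1 - a))" by (simp only: powr_powr)
        finally have "2 * (16::real) powr (1 - a) = 2 powr 1 * 2 powr (4 * (1 - a))" by simp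
        also have "\<dots> = 2 powr (1 + 4 * (1 - a))" by (simp only: powr_add)
        finally show ?thesis by (simp add: algebra_simps)
      qed
      finally show "(1 + s) powr (6 - 4 * a) \<le> 2 * 16 powr (1 - a) * (P z powr (6 - 4 * a) + v z powr (6 - 4 * a))" .
    qed auto
    finally show ?thesis by (simp add: s_def mult.left_commute)
  qed
  have 2: "wt z powr (1 - a) * gP z powr (2 - a) \<le> 4 powr (1 - a) * (chi powr (1 - a) * (P z powr (2 * (1 - a)) * (1 + gP z) powr (2 - a) + (1 + gP z) powr (2 - a) * v z powr (2 * (1 - a))))"
  proof -
    have "(1 + s) powr (2 * (1 - a)) \<le> (2 * max (P z) (v z)) powr (2 * (1 - a))"
      using sP s aa by (intro powr_mono2) auto
    also have "\<dots> \<le> 4 powr (1 - a) * (P z powr (2 * (1 - a)) + v z powr (2 * (1 - a)))"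
    proof -
      have "(4::real) powr (1 - a) = (2 powr 2) powr (1 - a)" by simp
      also have "\<dots> = 2 powr (2 * (1 - a))" by (simp only: powr_powr)
      finally show ?thesis using nonneg(5)[of z] nonneg(1)[of z] by (auto simp: powr_mult max_def)
    qed
    finally have "chi powr (1 - a) * (1 + s) powr (2 * (1 - a)) * gP z powr (2 - a)
        \<le> chi powr (1 - a) * (4 powr (1 - a) * (P z powr (2 * (1 - a)) + v z powr (2 * (1 - a)))) * (1 + gP z) powr (2 - a)"
    proof (intro mult_mono mult_left_mono)
      show "gP z powr (2 - a) \<le> (1 + gP z) powr (2 - a)" using nonneg(3)[of z] aa by (intro powr_mono2) auto
    qed (auto intro!: mult_nonneg_nonneg)
    then show ?thesis unfolding w by (simp add: algebra_simps)
  qed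
  have "src z = C5 + K0 * (wt z powr (1 - a) * (chi * (pt u z)\<^sup>2) powr (2 - a) + wt z powr (1 - a) * gP z powr (2 - a))"
    by (simp add: src_def distrib_left)
  also have "\<dots> \<le> C5 + K0 * (2 * 16 powr (1 - a) * (chi powr (3 - a) * (P z powr (6 - 4 * a) + v z powr (6 - 4 * a)))
     + 4 powr (1 - a) * (chi powr (1 - a) * (P z powr (2 * (1 - a)) * (1 + gP z) powr (2 - a) + (1 + gP z) powr (2 - a) * v z powr (2 * (1 - a)))))"
    using 1 2 K0_pos by (intro add_left_mono mult_left_mono add_mono) auto
  finally show ?thesis .
qed

definition "M1 T q1 = chi powr (1 - a) * (LINT z:Q 0 T|lborel. (1 + gP z) powr ((2 - a) * q1)) powr (1 / q1)"
definition "M2 T q2 = chi powr (1 - a) * (LINT z:Q 0 T|lborel. P z powr (2 * (1 - a) * q2) * (1 + gP z) powr ((2 - a) * q2)) powr (1 / q2)"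
definition "M3 T q3 = chi powr (3 - a) * (LINT z:Q 0 T|lborel. P z powr ((6 - 4 * a) * q3)) powr (1 / q3)"
definition "M4 T q4 = (LINT z:Q 0 T|lborel. dP z powr q4) powr (1 / q4)"

lemma Mfun_eq: "Mfun U \<Psi> chi a 0 T q1 q2 q3 q4 = 1 + M1 T q1 + M2 T q2 + M3 T q3 + M4 T q4"
proof -
  have "2 * max (2 - a) (3 - 2 * a) = 6 - 4 * a" using a_bounds by (simp add: max_def)
  then show ?thesis by (simp add: Mfun_def Let_def M1_def M2_def M3_def M4_def gP_def P_def dP_def)
qed

lemma M_nonneg: "M1 T q \<ge> 0" "M2 T q \<ge> 0" "M3 T q \<ge> 0" "M4 T q \<ge> 0"
  by (auto simp: M1_def M2_def M3_def M4_def)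

text \<open>From \<open>p < \<kappa>\<close> and \<open>b \<le> \<alpha>\<close> one gets
  \<open>b * p \<le> \<kappa> * \<alpha>\<close>, so after Hoelder the unknown is measured in the
  norm known from the previous step.\<close>

lemma weight_term:
  assumes F: "bcf U F" "\<And>z. F z \<ge> 0" and T: "0 \<le> T1" and pq: "1 < p" "p < \<kappa>" "1 / p + 1 / q = 1"
    and b: "0 < b" "b \<le> \<alpha>" 
  shows "(LINT z:Q T1 T|lborel. F z * v z powr b) \<le> (LINT z:Q 0 T|lborel. F z powr q) powr (1 / q) *
       ((1 + measure lborel (Q 0 T)) * Lp_on (\<kappa> * \<alpha>) (Q T1 T) v powr b)"
proof -
  let ?m = "measure lborel (Q 0 T)"
  have q: "q > 0"
  proof -
    have "1 / p < 1" using pq by simp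
    then have "0 < 1 / q" using pq by linarith
    then show ?thesis by simp
  qed
  have "(LINT z:Q T1 T|lborel. F z * v z powr b) \<le> (LINT z:Q T1 T|lborel. F z powr q) powr (1 / q) *
       ((1 + ?m) * Lp_on (\<kappa> * \<alpha>) (Q T1 T) v powr b)"
  proof (rule LINT_weight_powr_le[OF _ _ _ _ pq(1,3) b(1)])
    have "b * p \<le> \<alpha> * \<kappa>" using b pq by (intro mult_mono) auto
    then show "b * p \<le> \<kappa> * \<alpha>" by (simp add: mult.commute)
  qed (use bcf_bmeas[OF UO _ T] bcfs F T Q_measure_mono[of 0 T1 T T] nonneg in auto)
  also have "\<dots> \<le> (LINT z:Q 0 T|lborel. F z powr q) powr (1 / q) * ((1 + ?m) * Lp_on (\<kappa> * \<alpha>) (Q T1 T) v powr b)"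
  proof (intro mult_right_mono powr_mono2)
    show "(LINT z:Q T1 T|lborel. F z powr q) \<le> (LINT z:Q 0 T|lborel. F z powr q)"
      by (rule bcf_slice_mono_set[OF UO bcf_powr[OF F(1)]]) (use T q F in auto)
    show "0 \<le> (LINT z:Q T1 T|lborel. F z powr q)" by (rule LINT_nonneg) simp
  qed (use q in auto)
  finally show ?thesis .
qed

text \<open>The exponent of \<open>chi\<close> in \<open>E\<close> is what is lost because \<open>M3\<close> controls \<open>chi powr (3 - a)\<close> only
  together with a power of the measure of the cylinder, which may be small.\<close>
lemma superlinear_term:
  assumes T: "0 \<le> T1" and pq: "1 < p" "p < \<kappa>" "1 / p + 1 / q = 1" and al: "\<alpha> > 2"
    and th: "0 < \<theta>" "\<theta> \<le> 1" "4 * (1 - a) \<le> (\<kappa> - 1) * \<theta> * \<alpha>"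
  defines "E \<equiv> chi powr ((3 - a) * \<theta>)"
  shows "chi powr (3 - a) * (LINT z:Q T1 T|lborel. v z powr (\<alpha> + 4 * (1 - a)))
      \<le> (1 + M3 T q) * E * ((1 + measure lborel (Q 0 T)) * Lp_on (\<kappa> * \<alpha>) (Q T1 T) v powr (\<alpha> + 4 * (1 - a)))"
proof -
  let ?m = "measure lborel (Q 0 T)" and ?X = "chi powr (3 - a)"
  define b where "b = \<alpha> + 4 * (1 - a)"
  define Y where "Y = Lp_on (\<kappa> * \<alpha>) (Q T1 T) v"
  have aa: "0 < a" "a < 1" by (rule a_bounds)+
  have kap: "\<kappa> > 1" using pq by simp
  have E1: "E \<ge> 1" unfolding E_def using chi_ge aa th by (intro ge_one_powr_ge_zero) auto
  have X1: "?X \<ge> 1" using chi_ge aa by (intro ge_one_powr_ge_zero) auto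
  have th1: "(\<kappa> - 1) * \<theta> * \<alpha> \<le> (\<kappa> - 1) * 1 * \<alpha>" using th kap al by (intro mult_right_mono mult_left_mono) auto
  have b: "0 < b" "b \<le> \<kappa> * \<alpha>" using al aa th th1 by (auto simp: b_def algebra_simps)
  define \<delta> where "\<delta> = 1 - b / (\<kappa> * \<alpha>)"
  have dl: "0 \<le> \<delta>" "\<delta> \<le> 1" using b kap al by (auto simp: \<delta>_def)
  \<comment> \<open>\<open>\<delta>\<close> is the power of the measure that Hoelder leaves.
    Together with \<open>1 / q \<le> 1 - 1 / \<kappa>\<close> this yields
    \<open>\<delta> \<ge> (1 - \<theta>) / q\<close>.\<close>
  have dlow: "(1 - 1 / \<kappa>) * (1 - \<theta>) \<le> \<delta>"
  proof -
    have "b \<le> (1 + (\<kappa> - 1) * \<theta>) * \<alpha>" using th by (simp add: b_def algebra_simps)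
    then have "b / (\<kappa> * \<alpha>) \<le> (1 + (\<kappa> - 1) * \<theta>) / \<kappa>" using kap al by (simp add: field_simps)
    then show ?thesis using kap unfolding \<delta>_def by (simp add: field_simps)
  qed
  have q1: "0 < 1 / q" "1 / q \<le> 1 - 1 / \<kappa>"
  proof -
    have "1 / \<kappa> < 1 / p" "1 / p < 1" using pq by (auto simp: field_simps)
    then show "0 < 1 / q" "1 / q \<le> 1 - 1 / \<kappa>" using pq(3) by linarith+
  qed
  then have q0: "q > 0" by simp
  have Y: "Y \<ge> 0" unfolding Y_def by (rule Lp_on_nonneg)
  have "(LINT z:Q T1 T|lborel. v z powr b) \<le> measure lborel (Q T1 T) powr \<delta> * Y powr b"
    unfolding \<delta>_def Y_def using bcf_bmeas[OF UO bcfs(2) T] b nonneg by (intro LINT_powr_le_Lp) auto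
  also have "\<dots> \<le> ?m powr \<delta> * Y powr b"
    using Q_measure_mono[of 0 T1 T T] T dl by (intro mult_right_mono powr_mono2) auto
  finally have 1: "?X * (LINT z:Q T1 T|lborel. v z powr b) \<le> (?X * ?m powr \<delta>) * Y powr b"
    using X1 mult_left_mono by (fastforce simp: mult.assoc)
  have M3: "?X * ?m powr (1 / q) \<le> M3 T q"
    unfolding M3_def
  proof (intro mult_left_mono powr_mono2)
    have "(LINT z:Q 0 T|lborel. 1) \<le> (LINT z:Q 0 T|lborel. P z powr ((6 - 4 * a) * q))"
    proof (rule set_integral_mono)
      show "set_integrable lborel (Q 0 T) (\<lambda>z. 1::real)" "set_integrable lborel (Q 0 T) (\<lambda>z. P z powr ((6 - 4 * a) * q))"
        using aa q0 nonneg(5) by (intro bmeas_integrable bcf_bmeas[OF UO] bcf_const bcf_powr bcfs; force intro: order_trans[of 0 1])+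
      show "1 \<le> P z powr ((6 - 4 * a) * q)" for z :: "(real^3) \<times> real" using aa q0 nonneg(5)[of z] by (intro ge_one_powr_ge_zero) auto
    qed
    then show "?m \<le> (LINT z:Q 0 T|lborel. P z powr ((6 - 4 * a) * q))"
      using cyl_sets[OF UO] by (simp add: set_lebesgue_integral_def)
  qed (use q1 in auto)
  have "?X * ?m powr \<delta> \<le> (1 + M3 T q) * E * (1 + ?m)"
  proof (cases "?m \<le> 1")
    case False
    have "?X \<le> M3 T q"
      using M3 False q1 mult_left_mono[of 1 "?m powr (1 / q)" ?X] X1 by (simp add: ge_one_powr_ge_zero)
    then have "?X \<le> (1 + M3 T q) * E" using E1 M_nonneg(3)[of T q] mult_mono[of ?X "1 + M3 T q" 1 E] X1 by simp
    moreover have "?m powr \<delta> \<le> 1 + ?m" using dl by (intro powr_le_one_plus) auto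
    ultimately show ?thesis using X1 by (intro mult_mono) auto
  next
    case True
    have "?m powr \<delta> \<le> ?m powr (1 / q * (1 - \<theta>))"
    proof (rule powr_mono')
      have "1 / q * (1 - \<theta>) \<le> (1 - 1 / \<kappa>) * (1 - \<theta>)" using q1 th by (intro mult_right_mono) auto
      then show "1 / q * (1 - \<theta>) \<le> \<delta>" using dlow by linarith
    qed (use True in auto)
    then have "?X * ?m powr \<delta> \<le> ?X * ?m powr (1 / q * (1 - \<theta>))" using X1 by (intro mult_left_mono) auto
    \<comment> \<open>The factor \<open>?X\<close> is split with weights \<open>\<theta>\<close> and
      \<open>1 - \<theta>\<close>: the first part is the loss \<open>E\<close>, the second joins the
      measure and is bounded through \<open>M3\<close>.\<close>
    also have "\<dots> = E * (?X * ?m powr (1 / q)) powr (1 - \<theta>)"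
    proof -
      have "?X = E * ?X powr (1 - \<theta>)"
        unfolding E_def by (simp add: powr_powr powr_add[symmetric] algebra_simps) 
      then have "?X * ?m powr (1 / q * (1 - \<theta>)) = E * ?X powr (1 - \<theta>) * ?m powr (1 / q * (1 - \<theta>))"
        by (rule arg_cong[where f="\<lambda>t. t * ?m powr (1 / q * (1 - \<theta>))"])
      moreover have "(?X * ?m powr (1 / q)) powr (1 - \<theta>) = ?X powr (1 - \<theta>) * ?m powr (1 / q * (1 - \<theta>))"
        by (simp only: powr_mult powr_powr)
      ultimately show ?thesis by (simp only: mult.assoc)
    qed
    also have "\<dots> \<le> E * (1 + M3 T q)"
    proof (rule mult_left_mono)
      have "(?X * ?m powr (1 / q)) powr (1 - \<theta>) \<le> (1 + M3 T q) powr (1 - \<theta>)"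
        using M3 th by (intro powr_mono2) auto
      also have "\<dots> \<le> (1 + M3 T q) powr 1" using th M_nonneg(3)[of T q] by (intro powr_mono) auto
      finally show "(?X * ?m powr (1 / q)) powr (1 - \<theta>) \<le> 1 + M3 T q" using M_nonneg(3)[of T q] by simp
    qed (use E1 in auto)
    also have "\<dots> \<le> (1 + M3 T q) * E * (1 + ?m)"
    proof -
      have "(1 + M3 T q) * E * 1 \<le> (1 + M3 T q) * E * (1 + ?m)"
        using E1 M_nonneg(3)[of T q] by (intro mult_left_mono mult_nonneg_nonneg) auto
      then show ?thesis by (simp add: mult.commute)
    qed
    finally show ?thesis .
  qed
  then have "(?X * ?m powr \<delta>) * Y powr b \<le> (1 + M3 T q) * E * (1 + ?m) * Y powr b" by (intro mult_right_mono) auto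
  with 1 show ?thesis by (simp add: b_def Y_def mult.assoc)
qed

lemma LINT_lin:
  assumes T: "0 \<le> T1"
  shows "bcf U f \<Longrightarrow> bcf U h \<Longrightarrow> (LINT z:Q T1 T|lborel. f z + h z) = (LINT z:Q T1 T|lborel. f z) + (LINT z:Q T1 T|lborel. h z)"
  by (intro set_integral_add(2) bmeas_integrable bcf_bmeas[OF UO _ T])

lemma LINT_lin2:
  assumes T: "0 \<le> T1" and f: "bcf U f" "bcf U h"
  shows "(LINT z:Q T1 T|lborel. c * f z + d * h z) = c * (LINT z:Q T1 T|lborel. f z) + d * (LINT z:Q T1 T|lborel. h z)"
  using LINT_lin[OF T bcf_mult[OF bcf_const f(1)] bcf_mult[OF bcf_const f(2)]]
  by (simp only: set_integral_mult_right)

lemma LINT_comb5: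
  assumes T: "0 \<le> T1" and f: "bcf U f1" "bcf U f2" "bcf U f3" "bcf U f4" "bcf U f5"
  shows "(LINT z:Q T1 T|lborel. b0 * f1 z + b1 * (b2 * (b3 * f2 z + b3 * f3 z) + b4 * (b5 * f4 z + b5 * f5 z)))
    = b0 * (LINT z:Q T1 T|lborel. f1 z) + b1 * (b2 * (b3 * (LINT z:Q T1 T|lborel. f2 z) + b3 * (LINT z:Q T1 T|lborel. f3 z))
       + b4 * (b5 * (LINT z:Q T1 T|lborel. f4 z) + b5 * (LINT z:Q T1 T|lborel. f5 z)))"
proof -
  have A: "bcf U (\<lambda>z. b3 * f2 z + b3 * f3 z)" "bcf U (\<lambda>z. b5 * f4 z + b5 * f5 z)"
    by (intro bcf_add bcf_mult bcf_const f)+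
  have B: "bcf U (\<lambda>z. b2 * (b3 * f2 z + b3 * f3 z) + b4 * (b5 * f4 z + b5 * f5 z))"
    by (intro bcf_add bcf_mult bcf_const A)
  show ?thesis
    by (simp only: LINT_lin2[OF T f(1) B] LINT_lin2[OF T A] LINT_lin2[OF T f(2,3)] LINT_lin2[OF T f(4,5)])
qed

lemma v_powr_le:
  assumes T: "0 \<le> T1" and b: "0 < b" "b \<le> s"
  shows "(LINT z:Q T1 T|lborel. v z powr b) \<le> (1 + measure lborel (Q 0 T)) * Lp_on s (Q T1 T) v powr b"
proof -
  have "(LINT z:Q T1 T|lborel. v z powr b) \<le> measure lborel (Q T1 T) powr (1 - b / s) * Lp_on s (Q T1 T) v powr b"
    using bcf_bmeas[OF UO bcfs(2) T] b nonneg by (intro LINT_powr_le_Lp) auto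
  also have "\<dots> \<le> (1 + measure lborel (Q 0 T)) * Lp_on s (Q T1 T) v powr b"
    using Q_measure_mono[of 0 T1 T T] T b by (intro mult_right_mono powr_le_one_plus) auto
  finally show ?thesis .
qed

text \<open>Every power of \<open>v\<close> on the left has its exponent between
  \<open>\<alpha> - 2\<close> and \<open>\<alpha> + 4 * (1 - a)\<close>, so the larger of the two
  extreme powers of \<open>Y\<close> dominates them all.\<close>

lemma energy_bound:
  fixes p q :: "nat \<Rightarrow> real"
  assumes T: "0 \<le> T1" "T1 < T2" "T2 \<le> T" and al: "\<alpha> > 2" and kap: "\<kappa> > 1"
    and p: "\<And>i. i \<in> {1..4} \<Longrightarrow> 1 < p i \<and> p i < \<kappa>" and pq: "\<And>i. i \<in> {1..4} \<Longrightarrow> 1 / p i + 1 / q i = 1"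
    and th: "0 < \<theta>" "\<theta> \<le> 1" "4 * (1 - a) \<le> (\<kappa> - 1) * \<theta> * \<alpha>"
  defines "Y \<equiv> Lp_on (\<kappa> * \<alpha>) (Q T1 T) v" and "M \<equiv> Mfun U \<Psi> chi a 0 T (q 1) (q 2) (q 3) (q 4)"
    and "m \<equiv> measure lborel (Q 0 T)" and "E \<equiv> chi powr ((3 - a) * \<theta>)"
  shows "1 / (T2 - T1) * (LINT z:Q T1 T|lborel. v z powr \<alpha>) + (LINT z:Q T1 T|lborel. rhs \<alpha> z)
     \<le> (1 + m) * (\<alpha> * (\<alpha> - 1)) * (1 / (T2 - T1) / 2 + CR * (M * E)) * max (Y powr (\<alpha> - 2)) (Y powr (\<alpha> + 4 * (1 - a)))"
proof -
  have aa: "0 < a" "a < 1" by (rule a_bounds)+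
  define X where "X = max (Y powr (\<alpha> - 2)) (Y powr (\<alpha> + 4 * (1 - a)))"
  have Y: "Y \<ge> 0" unfolding Y_def by (rule Lp_on_nonneg)
  have m: "m \<ge> 0" by (simp add: m_def)
  have X0: "X \<ge> 0" by (simp add: X_def le_max_iff_disj)
  have YX: "Y powr b \<le> X" if "\<alpha> - 2 \<le> b" "b \<le> \<alpha> + 4 * (1 - a)" for b
    unfolding X_def using powr_between_le_max[OF Y that] .
  have mX: "c * ((1 + m) * Y powr b) \<le> c * ((1 + m) * X)" if "\<alpha> - 2 \<le> b" "b \<le> \<alpha> + 4 * (1 - a)" "c \<ge> 0" for b c
    using YX[OF that(1,2)] m that(3) by (intro mult_left_mono) auto
  define Z where "Z = (1 + m) * X"
  have Z: "Z \<ge> 0" using m X0 by (simp add: Z_def)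
  have E1: "E \<ge> 1" unfolding E_def using chi_ge aa th by (intro ge_one_powr_ge_zero) auto
  have ka: "\<alpha> \<le> \<kappa> * \<alpha>" using kap al by simp
  define m1 m2 m3 m4 where "m1 = M1 T (q 1)" and "m2 = M2 T (q 2)" and "m3 = M3 T (q 3)" and "m4 = M4 T (q 4)"
  note mdefs = m1_def m2_def m3_def m4_def
  have mn: "m1 \<ge> 0" "m2 \<ge> 0" "m3 \<ge> 0" "m4 \<ge> 0" by (simp_all add: mdefs M_nonneg)
  have M: "M = 1 + m1 + m2 + m3 + m4" by (simp add: M_def Mfun_eq mdefs)
  have g1: "bcf U (\<lambda>z. (1 + gP z) powr (2 - a))" using aa
    by (intro bcf_powr bcf_intros bcfs) (auto simp: nonneg)
  have pe: "bcf U (\<lambda>z. P z powr e)" if "e > 0" for e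
    by (intro bcf_powr bcfs) (use nonneg(5) that in \<open>auto intro: order_trans[of 0 1]\<close>)
  have P0: "P z \<ge> 0" for z using nonneg(5)[of z] by linarith
  have PQ: "1 < p i" "p i < \<kappa>" "1 / p i + 1 / q i = 1" if "i \<in> {1..4}" for i using p[OF that] pq[OF that] by auto
  have in4: "1 \<in> {1..4::nat}" "2 \<in> {1..4::nat}" "3 \<in> {1..4::nat}" "4 \<in> {1..4::nat}" by auto
  have t0: "(LINT z:Q T1 T|lborel. v z powr b) \<le> Z" if "0 < b" "\<alpha> - 2 \<le> b" "b \<le> \<alpha>" for b
    using v_powr_le[OF T(1) that(1), of "\<kappa> * \<alpha>" T] that ka mX[of b 1] aa unfolding Z_def Y_def[symmetric] m_def[symmetric] by simp
  have t1: "chi powr (1 - a) * (LINT z:Q T1 T|lborel. (1 + gP z) powr (2 - a) * v z powr (\<alpha> - 2 * a)) \<le> m1 * Z"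
  proof -
    have "(LINT z:Q T1 T|lborel. (1 + gP z) powr (2 - a) * v z powr (\<alpha> - 2 * a)) \<le>
      (LINT z:Q 0 T|lborel. ((1 + gP z) powr (2 - a)) powr (q 1)) powr (1 / q 1) * ((1 + m) * Y powr (\<alpha> - 2 * a))"
      unfolding m_def Y_def by (rule weight_term[OF g1 _ T(1) PQ[OF in4(1)]]) (use al aa in auto)
    also have "\<dots> \<le> (LINT z:Q 0 T|lborel. ((1 + gP z) powr (2 - a)) powr (q 1)) powr (1 / q 1) * Z"
      unfolding Z_def by (rule mX) (use aa in auto)
    finally have "chi powr (1 - a) * (LINT z:Q T1 T|lborel. (1 + gP z) powr (2 - a) * v z powr (\<alpha> - 2 * a))
      \<le> chi powr (1 - a) * ((LINT z:Q 0 T|lborel. ((1 + gP z) powr (2 - a)) powr (q 1)) powr (1 / q 1) * Z)"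
      by (rule mult_left_mono) simp
    then show ?thesis by (simp add: mdefs M1_def powr_powr mult.assoc)
  qed
  have t2: "chi powr (1 - a) * (LINT z:Q T1 T|lborel. (P z powr (2 * (1 - a)) * (1 + gP z) powr (2 - a)) * v z powr (\<alpha> - 2)) \<le> m2 * Z"
  proof -
    have b: "bcf U (\<lambda>z. P z powr (2 * (1 - a)) * (1 + gP z) powr (2 - a))" using aa by (intro bcf_mult pe g1) auto
    have "(LINT z:Q T1 T|lborel. (P z powr (2 * (1 - a)) * (1 + gP z) powr (2 - a)) * v z powr (\<alpha> - 2)) \<le>
      (LINT z:Q 0 T|lborel. (P z powr (2 * (1 - a)) * (1 + gP z) powr (2 - a)) powr (q 2)) powr (1 / q 2) * ((1 + m) * Y powr (\<alpha> - 2))"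
      unfolding m_def Y_def by (rule weight_term[OF b _ T(1) PQ[OF in4(2)]]) (use al aa in auto)
    also have "\<dots> \<le> (LINT z:Q 0 T|lborel. (P z powr (2 * (1 - a)) * (1 + gP z) powr (2 - a)) powr (q 2)) powr (1 / q 2) * Z"
      unfolding Z_def by (rule mX) (use aa in auto)
    finally have "chi powr (1 - a) * (LINT z:Q T1 T|lborel. (P z powr (2 * (1 - a)) * (1 + gP z) powr (2 - a)) * v z powr (\<alpha> - 2))
      \<le> chi powr (1 - a) * ((LINT z:Q 0 T|lborel. (P z powr (2 * (1 - a)) * (1 + gP z) powr (2 - a)) powr (q 2)) powr (1 / q 2) * Z)"
      by (rule mult_left_mono) simp
    then show ?thesis by (simp add: mdefs M2_def powr_powr powr_mult mult.assoc)
  qed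
  have t3: "chi powr (3 - a) * (LINT z:Q T1 T|lborel. P z powr (6 - 4 * a) * v z powr (\<alpha> - 2)) \<le> m3 * Z"
  proof -
    have b: "bcf U (\<lambda>z. P z powr (6 - 4 * a))" using aa by (intro pe) auto
    have "(LINT z:Q T1 T|lborel. P z powr (6 - 4 * a) * v z powr (\<alpha> - 2)) \<le>
      (LINT z:Q 0 T|lborel. (P z powr (6 - 4 * a)) powr (q 3)) powr (1 / q 3) * ((1 + m) * Y powr (\<alpha> - 2))"
      unfolding m_def Y_def by (rule weight_term[OF b _ T(1) PQ[OF in4(3)]]) (use al aa in auto)
    also have "\<dots> \<le> (LINT z:Q 0 T|lborel. (P z powr (6 - 4 * a)) powr (q 3)) powr (1 / q 3) * Z"
      unfolding Z_def by (rule mX) (use aa in auto)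
    finally have "chi powr (3 - a) * (LINT z:Q T1 T|lborel. P z powr (6 - 4 * a) * v z powr (\<alpha> - 2))
      \<le> chi powr (3 - a) * ((LINT z:Q 0 T|lborel. (P z powr (6 - 4 * a)) powr (q 3)) powr (1 / q 3) * Z)"
      by (rule mult_left_mono) simp
    then show ?thesis by (simp add: mdefs M3_def powr_powr mult.assoc)
  qed
  have t3': "chi powr (3 - a) * (LINT z:Q T1 T|lborel. v z powr (\<alpha> + 4 * (1 - a))) \<le> (1 + m3) * E * Z"
  proof -
    have "chi powr (3 - a) * (LINT z:Q T1 T|lborel. v z powr (\<alpha> + 4 * (1 - a))) \<le> (1 + m3) * E * ((1 + m) * Y powr (\<alpha> + 4 * (1 - a)))"
      unfolding m3_def E_def m_def Y_def by (rule superlinear_term[OF T(1) PQ[OF in4(3)] al th])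
    also have "\<dots> \<le> (1 + m3) * E * Z" unfolding Z_def by (rule mX) (use mn E1 aa in auto)
    finally show ?thesis .
  qed
  have t4: "(LINT z:Q T1 T|lborel. dP z * v z powr (\<alpha> - 1)) \<le> m4 * Z"
  proof -
    have "(LINT z:Q T1 T|lborel. dP z * v z powr (\<alpha> - 1)) \<le>
      (LINT z:Q 0 T|lborel. dP z powr (q 4)) powr (1 / q 4) * ((1 + m) * Y powr (\<alpha> - 1))"
      unfolding m_def Y_def by (rule weight_term[OF bcfs(8) _ T(1) PQ[OF in4(4)]]) (use al aa in \<open>auto simp: nonneg\<close>)
    also have "\<dots> \<le> (LINT z:Q 0 T|lborel. dP z powr (q 4)) powr (1 / q 4) * Z"
      unfolding Z_def by (rule mX) (use aa in auto)
    finally show ?thesis by (simp add: mdefs M4_def)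
  qed
  define w where "w = (16::real) powr (1 - a)"
  define w4 where "w4 = (4::real) powr (1 - a)"
  have w: "0 \<le> w4" "w4 \<le> w" using aa by (auto simp: w_def w4_def intro!: powr_mono2)
  define IF where "IF z = C5 * v z powr (\<alpha> - 2) + K0 * (2 * w * (chi powr (3 - a) * (P z powr (6 - 4 * a) * v z powr (\<alpha> - 2)) + chi powr (3 - a) * v z powr (\<alpha> + 4 * (1 - a)))
     + w4 * (chi powr (1 - a) * ((P z powr (2 * (1 - a)) * (1 + gP z) powr (2 - a)) * v z powr (\<alpha> - 2)) + chi powr (1 - a) * ((1 + gP z) powr (2 - a) * v z powr (\<alpha> - 2 * a))))" for z
  have i: "set_integrable lborel (Q T1 T) h" if "bcf U h" for h
    using bmeas_integrable[OF bcf_bmeas[OF UO that T(1)]] .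
  have bs: "bcf U (\<lambda>z. v z powr (\<alpha> - 2))" "bcf U (\<lambda>z. v z powr (\<alpha> - 1))" "bcf U (\<lambda>z. v z powr (\<alpha> - 2 * a))" "bcf U (\<lambda>z. v z powr (\<alpha> + 4 * (1 - a)))"
    "bcf U (\<lambda>z. P z powr (2 * (1 - a)))" "bcf U (\<lambda>z. P z powr (6 - 4 * a))"
    using al aa by (auto intro!: bcf_v_powr pe)
  have src: "(LINT z:Q T1 T|lborel. v z powr (\<alpha> - 2) * src z) \<le> (C5 + K0 * (2 * w * (m3 + (1 + m3) * E) + w4 * (m2 + m1))) * Z"
  proof -
    have "(LINT z:Q T1 T|lborel. v z powr (\<alpha> - 2) * src z) \<le> (LINT z:Q T1 T|lborel. IF z)"
    proof (rule set_integral_mono)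
      fix z assume "z \<in> Q T1 T"
      then obtain x t where z: "z = (x, t)" "x \<in> U" "t > 0" using T by (auto simp: cyl_def)
      have e: "v z powr (\<alpha> - 2) * v z powr (6 - 4 * a) = v z powr (\<alpha> + 4 * (1 - a))"
        "v z powr (\<alpha> - 2) * v z powr (2 * (1 - a)) = v z powr (\<alpha> - 2 * a)"
        by (simp_all add: powr_add[symmetric] algebra_simps)
      have "v z powr (\<alpha> - 2) * src z \<le> v z powr (\<alpha> - 2) * (C5 + K0 * (2 * w * (chi powr (3 - a) * (P z powr (6 - 4 * a) + v z powr (6 - 4 * a)))
       + w4 * (chi powr (1 - a) * (P z powr (2 * (1 - a)) * (1 + gP z) powr (2 - a) + (1 + gP z) powr (2 - a) * v z powr (2 * (1 - a))))))"
        unfolding w_def w4_def using src_le[OF z(2,3)] by (intro mult_left_mono) (simp_all add: z)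
      also have "\<dots> = IF z" unfolding IF_def e[symmetric] by (simp add: algebra_simps)
      finally show "v z powr (\<alpha> - 2) * src z \<le> IF z" .
    next
      show "set_integrable lborel (Q T1 T) (\<lambda>z. v z powr (\<alpha> - 2) * src z)" by (intro i bcf_mult bs bcf_src)
      show "set_integrable lborel (Q T1 T) IF" unfolding IF_def by (intro i bcf_add bcf_mult bcf_const bs g1)
    qed
    also have "\<dots> = C5 * (LINT z:Q T1 T|lborel. v z powr (\<alpha> - 2)) + K0 * (2 * w * (chi powr (3 - a) * (LINT z:Q T1 T|lborel. P z powr (6 - 4 * a) * v z powr (\<alpha> - 2)) + chi powr (3 - a) * (LINT z:Q T1 T|lborel. v z powr (\<alpha> + 4 * (1 - a))))
     + w4 * (chi powr (1 - a) * (LINT z:Q T1 T|lborel. (P z powr (2 * (1 - a)) * (1 + gP z) powr (2 - a)) * v z powr (\<alpha> - 2)) + chi powr (1 - a) * (LINT z:Q T1 T|lborel. (1 + gP z) powr (2 - a) * v z powr (\<alpha> - 2 * a))))"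
      unfolding IF_def by (rule LINT_comb5[OF T(1)]) (intro bcf_mult bs g1)+
    also have "\<dots> \<le> C5 * Z + K0 * (2 * w * (m3 * Z + (1 + m3) * E * Z) + w4 * (m2 * Z + m1 * Z))"
      using t0[of "\<alpha> - 2"] al t1 t2 t3 t3' c_pos(3) K0_pos w by (intro add_mono mult_left_mono) auto
    also have "\<dots> = (C5 + K0 * (2 * w * (m3 + (1 + m3) * E) + w4 * (m2 + m1))) * Z" by (simp add: algebra_simps)
    finally show ?thesis .
  qed
  define al2 where "al2 = \<alpha> * (\<alpha> - 1)"
  have al2: "al2 \<ge> 2" "al2 \<ge> \<alpha>" using al mult_mono[of 2 \<alpha> 1 "\<alpha> - 1"] mult_left_mono[of 1 "\<alpha> - 1" \<alpha>] by (auto simp: al2_def)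
  have tr: "(LINT z:Q T1 T|lborel. rhs \<alpha> z) \<le> al2 * (CR * (M * E)) * Z"
  proof -
    have "(LINT z:Q T1 T|lborel. rhs \<alpha> z) = al2 * (LINT z:Q T1 T|lborel. v z powr (\<alpha> - 2) * src z) + \<alpha> * (LINT z:Q T1 T|lborel. v z powr (\<alpha> - 1) * dP z)"
      unfolding rhs_def al2_def
      by (rule LINT_lin2[OF T(1)]) (intro bcf_mult bs bcf_src bcfs)+
    also have "\<dots> \<le> al2 * ((C5 + K0 * (2 * w * (m3 + (1 + m3) * E) + w4 * (m2 + m1))) * Z) + al2 * (m4 * Z)"
    proof (rule add_mono)
      show "al2 * (LINT z:Q T1 T|lborel. v z powr (\<alpha> - 2) * src z) \<le> al2 * ((C5 + K0 * (2 * w * (m3 + (1 + m3) * E) + w4 * (m2 + m1))) * Z)"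
        using src al2 by (intro mult_left_mono) auto
      have "\<alpha> * (LINT z:Q T1 T|lborel. v z powr (\<alpha> - 1) * dP z) \<le> \<alpha> * (m4 * Z)"
        using t4 al by (intro mult_left_mono) (auto simp: mult.commute)
      also have "\<dots> \<le> al2 * (m4 * Z)" using al2 mn Z by (intro mult_right_mono) auto
      finally show "\<alpha> * (LINT z:Q T1 T|lborel. v z powr (\<alpha> - 1) * dP z) \<le> al2 * (m4 * Z)" .
    qed
    also have "\<dots> = al2 * (C5 + K0 * (2 * w * (m3 + (1 + m3) * E) + w4 * (m2 + m1)) + m4) * Z" by (simp add: algebra_simps)
    also have "\<dots> \<le> al2 * (CR * (M * E)) * Z"
    proof (intro mult_right_mono mult_left_mono)
      define N where "N = 1 + m1 + m2 + m3"
      have N: "N \<ge> 1" "M = N + m4" using mn by (auto simp: N_def M)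
      have NE: "N \<le> N * E" "m4 \<le> m4 * E" "1 \<le> N * E" using N E1 mn mult_mono[of 1 N 1 E] by (auto simp: mult_le_cancel_left1)
      have ME: "M * E = N * E + m4 * E" by (simp add: N(2) distrib_right)
      have "1 + m3 \<le> (1 + m3) * E" using E1 mn by (simp add: mult_le_cancel_left1)
      then have h3: "m3 + (1 + m3) * E \<le> 2 * ((1 + m3) * E)" by linarith
      have "w4 * (m2 + m1) \<le> w * (m2 + m1)" using w mn by (intro mult_right_mono) auto
      also have "\<dots> \<le> w * ((m2 + m1) * E)" using w mn E1 by (intro mult_left_mono) (auto simp: mult_le_cancel_left1)
      finally have h4: "w4 * (m2 + m1) \<le> w * ((m2 + m1) * E)" .
      have "2 * w * (m3 + (1 + m3) * E) \<le> 2 * w * (2 * ((1 + m3) * E))" using h3 w by (intro mult_left_mono) auto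
      then have "2 * w * (m3 + (1 + m3) * E) + w4 * (m2 + m1) \<le> 4 * (w * ((1 + m3) * E)) + w * ((m2 + m1) * E)"
      proof -
        assume "2 * w * (m3 + (1 + m3) * E) \<le> 2 * w * (2 * ((1 + m3) * E))"
        moreover have "2 * w * (2 * ((1 + m3) * E)) = 4 * (w * ((1 + m3) * E))" by simp
        ultimately show ?thesis using h4 by linarith
      qed
      also have "\<dots> \<le> 4 * (w * (N * E))"
      proof -
        have "0 \<le> w * ((m2 + m1) * E)" using w mn E1 by (intro mult_nonneg_nonneg) auto
        then show ?thesis by (simp add: N_def algebra_simps)
      qed
      finally have "K0 * (2 * w * (m3 + (1 + m3) * E) + w4 * (m2 + m1)) \<le> K0 * (4 * (w * (N * E)))"
        using K0_pos by (intro mult_left_mono) auto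
      moreover have "C5 * 1 \<le> C5 * (N * E)" using NE c_pos(3) by (intro mult_left_mono) auto
      ultimately have "C5 + K0 * (2 * w * (m3 + (1 + m3) * E) + w4 * (m2 + m1)) + m4 \<le> C5 * (N * E) + K0 * (4 * (w * (N * E))) + m4 * E"
        using NE by simp
      also have "\<dots> \<le> (1 + C5 + 4 * w * K0) * (N * E + m4 * E)"
      proof -
        have "0 \<le> C5 * (m4 * E)" "0 \<le> 4 * w * K0 * (m4 * E)" "0 \<le> N * E"
          using c_pos(3) mn E1 w K0_pos N by (auto intro!: mult_nonneg_nonneg)
        then show ?thesis by (simp add: algebra_simps)
      qed
      finally show "C5 + K0 * (2 * w * (m3 + (1 + m3) * E) + w4 * (m2 + m1)) + m4 \<le> CR * (M * E)"
        by (simp add: CR_def w_def ME)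
    qed (use Z al2 in auto)
    finally show ?thesis .
  qed
  have "1 / (T2 - T1) * (LINT z:Q T1 T|lborel. v z powr \<alpha>) \<le> 1 / (T2 - T1) * Z"
    using t0[of \<alpha>] al T by (intro mult_left_mono) auto
  \<comment> \<open>\<open>\<alpha> * (\<alpha> - 1) \<ge> 2\<close> buys a factor 1/2 here; it
    later cancels one factor 2 of the reciprocal time step.\<close>
  also have "\<dots> \<le> al2 / 2 * (1 / (T2 - T1) * Z)"
    using mult_right_mono[of 1 "al2 / 2" "1 / (T2 - T1) * Z"] al2 Z T by simp
  finally have "1 / (T2 - T1) * (LINT z:Q T1 T|lborel. v z powr \<alpha>) + (LINT z:Q T1 T|lborel. rhs \<alpha> z)
     \<le> al2 / 2 * (1 / (T2 - T1) * Z) + al2 * (CR * (M * E)) * Z" using tr by simp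
  also have "\<dots> = (1 + m) * al2 * (1 / (T2 - T1) / 2 + CR * (M * E)) * X"
    by (simp add: Z_def algebra_simps add_divide_distrib)
  finally show ?thesis by (simp only: X_def al2_def)
qed

end

section \<open>The parabolic Sobolev inequality\<close>

context rotating_flow begin

definition "lam r = (r * (5 - a) - 3) / (3 * r)"
text \<open>The norm of the weight in L^(r / (1 - r)), the factor that Hoelder with exponents 1 / r
  and 1 / (1 - r) splits off.\<close>

definition "Wn r t = (LINT x:U|lborel. wt (x, t) powr (r / (1 - r))) powr ((1 - r) / r)"

context
  fixes r cbar :: real
  assumes r: "3 / (5 - a) < r" "r < 1" "r \<ge> 1 / (2 - a)" and cbar: "cbar > 0"
    and sob: "\<And>f. C1c_in U f \<Longrightarrow> Lp_on (3 * (r * (2 - a)) / (3 - r * (2 - a))) U f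
          \<le> cbar * Lp_on (r * (2 - a)) U (\<lambda>x. norm (grad1 f x))"
begin

lemma lam_bounds: "r > 1/2" "0 < lam r" "lam r < (2 - a) / 3" "lam r = (5 - a) / 3 - 1 / r" "lam r < 1"
proof -
  have aa: "0 < a" "a < 1" by (rule a_bounds)+
  have "1 / 2 < 1 / (2 - a)" using aa by (simp add: field_simps)
  then show r2: "r > 1/2" using r by linarith
  show e: "lam r = (5 - a) / 3 - 1 / r" using r2 by (simp add: lam_def field_simps)
  have "3 < r * (5 - a)" using r(1) aa by (simp add: field_simps)
  then show "0 < lam r" unfolding lam_def using r2 by (intro divide_pos_pos) auto
  have "1 / r > 1" using r r2 by simp
  then show l: "lam r < (2 - a) / 3" unfolding e by (simp add: diff_divide_distrib)
  have "(2 - a) / 3 < 1" using aa by simp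
  with l show "lam r < 1" by (rule less_trans)
qed

text \<open>The Sobolev inequality is applied to the compactly supported truncations
  \<open>evp (e n) m\<close>, then \<open>e n\<close> tends to 0. The choice of \<open>m\<close>
  makes \<open>(m - 1) * (2 - a) = \<alpha> - 2\<close>, the power of \<open>v\<close> in the
  dissipation.\<close>

lemma sobolev_power:
  assumes t: "t > 0" and al: "\<alpha> > 2"
  defines "m \<equiv> (\<alpha> - a) / (2 - a)" and "q \<equiv> r * (2 - a)"
  defines "q' \<equiv> 3 * q / (3 - q)"
  shows "(LINT x:U|lborel. v (x, t) powr (m * q')) powr (1 / q') \<le>
     cbar * (LINT x:U|lborel. (m * (v (x, t) powr (m - 1) * gu (x, t))) powr q) powr (1 / q)"
proof -
  have aa: "0 < a" "a < 1" by (rule a_bounds)+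
  have m: "m > 1" using al aa by (simp add: m_def field_simps)
  have q: "q \<ge> 1" "q < 2" 
  proof -
    show "q \<ge> 1" using r(3) aa by (simp add: q_def field_simps)
    have "r * (2 - a) < 1 * (2 - a)" using r aa by (intro mult_strict_right_mono) auto
    also have "1 * (2 - a) < 2" using aa by simp
    finally show "q < 2" unfolding q_def .
  qed
  have q': "q' > 0" using q by (simp add: q'_def)
  define e where "e n = 1 / real (Suc n)" for n
  have e: "e n > 0" for n by (simp add: e_def)
  let ?h = "\<lambda>x. ub x t"
  have hc: "continuous_on (closure U) ?h" and hg: "continuous_on U (grad1 ?h)"
    using regular_slice[OF UO ub_reg(1) t] by auto
  have h0: "?h x = 0" if "x \<in> frontier U" for x
    using that u_sol Psi_ext t by (auto simp: is_solution_def)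
  have hd: "?h differentiable (at x)" if "x \<in> U" for x using regular_diff(1)[OF UO ub_reg(1) that t] .
  define f where "f n x = (if x \<in> U then evp (e n) m (?h x) else 0)" for n x
  have C: "C1c_in U (f n)" "\<And>x. x \<in> U \<Longrightarrow> grad1 (f n) x = (m * odp (e n) (m - 1) (?h x)) *\<^sub>R grad1 ?h x" for n
  proof -
    have c: "continuous_on UNIV (\<lambda>s. m * odp (e n) (m - 1) s)" using m by (intro continuous_intros) auto
    have z: "m * odp (e n) (m - 1) s = 0" if "\<bar>s\<bar> \<le> e n" for s using evp_zero(2)[OF that] by simp
    note tf = tf_C1c[OF UO hc h0 hd hg e[of n] evp_deriv[OF m] c evp_zero(1) z]
    show "C1c_in U (f n)" unfolding f_def by (rule tf(1))
    show "grad1 (f n) x = (m * odp (e n) (m - 1) (?h x)) *\<^sub>R grad1 ?h x" if "x \<in> U" for x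
      unfolding f_def using fun_cong[OF tf(2), of x] that by simp
  qed
  have bE: "bmeas U (\<lambda>x. v (x, t) powr b)" if "b > 0" for b
    using bcf_bmeas_slice[OF UO bcf_v_powr[OF that] t] .
  have bq: "bmeas U (\<lambda>x. (m * (v (x, t) powr (m - 1) * gu (x, t))) powr q)"
  proof -
    have "bcf U (\<lambda>z. (m * (v z powr (m - 1) * gu z)) powr q)"
      using m q by (intro bcf_powr[OF _ _] bcf_mult bcf_const bcf_v_powr bcfs) (auto simp: nonneg)
    from bcf_bmeas_slice[OF UO this t] show ?thesis by simp
  qed
  define Rr where "Rr = cbar * (LINT x:U|lborel. (m * (v (x, t) powr (m - 1) * gu (x, t))) powr q) powr (1 / q)"
  have be: "bcf U (\<lambda>z. evp ee mm (pt ub z))" if "mm > 0" for ee mm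
    by (rule bcf_compose[OF bcfs(1)]) (use that in \<open>auto intro!: continuous_intros\<close>)
  have step: "(LINT x:U|lborel. evp (e n) m (?h x) powr q') powr (1 / q') \<le> Rr" for n
  proof -
    have "(LINT x:U|lborel. evp (e n) m (?h x) powr q') powr (1 / q') = Lp_on q' U (f n)"
      unfolding Lp_on_def using U_open
      by (intro arg_cong[where f="\<lambda>s. s powr (1 / q')"] set_lebesgue_integral_cong) (auto simp: f_def evp_nonneg)
    also have "\<dots> \<le> cbar * Lp_on q U (\<lambda>x. norm (grad1 (f n) x))"
      unfolding q'_def q_def using sob[OF C(1)] by simp
    also have "\<dots> \<le> Rr"
      unfolding Rr_def Lp_on_def
    proof (intro mult_left_mono powr_mono2)
      have eq: "(LINT x:U|lborel. \<bar>norm (grad1 (f n) x)\<bar> powr q) = (LINT x:U|lborel. (m * (evp (e n) (m - 1) (pt ub (x, t)) * gu (x, t))) powr q)"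
        using U_open m e[of n]
        by (intro set_lebesgue_integral_cong) (auto simp: C(2) abs_mult abs_odp_eq less_imp_le gu_def gradx_def pt_def evp_nonneg mult.assoc)
      also have "\<dots> \<le> (LINT x:U|lborel. (m * (v (x, t) powr (m - 1) * gu (x, t))) powr q)"
      proof (rule set_integral_mono)
        have "bcf U (\<lambda>z. (m * (evp (e n) (m - 1) (pt ub z) * gu z)) powr q)"
          using m q by (intro bcf_powr[OF _ _] bcf_mult bcf_const be bcfs) (auto simp: nonneg evp_nonneg)
        from bmeas_integrable[OF bcf_bmeas_slice[OF UO this t]]
        show "set_integrable lborel U (\<lambda>x. (m * (evp (e n) (m - 1) (pt ub (x, t)) * gu (x, t))) powr q)" by simp
        show "set_integrable lborel U (\<lambda>x. (m * (v (x, t) powr (m - 1) * gu (x, t))) powr q)" by (rule bmeas_integrable[OF bq])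
        fix x
        have "evp (e n) (m - 1) (pt ub (x, t)) \<le> v (x, t) powr (m - 1)"
          unfolding v_def using m e[of n] by (intro evp_le) auto
        then show "(m * (evp (e n) (m - 1) (pt ub (x, t)) * gu (x, t))) powr q \<le> (m * (v (x, t) powr (m - 1) * gu (x, t))) powr q"
          using m q by (intro powr_mono2 mult_left_mono mult_right_mono) (auto simp: nonneg evp_nonneg)
      qed
      finally show "(LINT x:U|lborel. \<bar>norm (grad1 (f n) x)\<bar> powr q) \<le> (LINT x:U|lborel. (m * (v (x, t) powr (m - 1) * gu (x, t))) powr q)" .
      show "0 \<le> (LINT x:U|lborel. \<bar>norm (grad1 (f n) x)\<bar> powr q)" by (rule LINT_nonneg) simp
    qed (use q cbar in auto)
    finally show ?thesis .
  qed
  have "(\<lambda>n. LINT x:U|lborel. evp (e n) m (?h x) powr q') \<longlonglongrightarrow> (LINT x:U|lborel. v (x, t) powr (m * q'))"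
    unfolding set_lebesgue_integral_def
  proof (rule integral_dominated_convergence)
    show "integrable lborel (\<lambda>x. indicator U x *\<^sub>R v (x, t) powr (m * q'))"
      unfolding set_integrable_def[symmetric] using m q' by (intro bmeas_integrable bE) auto
    then show "(\<lambda>x. indicator U x *\<^sub>R v (x, t) powr (m * q')) \<in> borel_measurable lborel" by (rule borel_measurable_integrable)
    have "bcf U (\<lambda>z. evp (e n) m (pt ub z) powr q')" for n
      using m q' by (intro bcf_powr be) (auto simp: evp_nonneg)
    from bmeas_integrable[OF bcf_bmeas_slice[OF UO this t]]
    show "(\<lambda>x. indicator U x *\<^sub>R evp (e n) m (?h x) powr q') \<in> borel_measurable lborel" for n
      by (intro borel_measurable_integrable) (simp add: set_integrable_def pt_def)
    show "AE x in lborel. (\<lambda>n. indicator U x *\<^sub>R evp (e n) m (?h x) powr q') \<longlonglongrightarrow> indicator U x *\<^sub>R v (x, t) powr (m * q')"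
    proof (intro AE_I2 tendsto_scaleR tendsto_const)
      fix x
      have "(\<lambda>n. evp (e n) m (?h x) powr q') \<longlonglongrightarrow> (\<bar>?h x\<bar> powr m) powr q'"
        unfolding e_def using m q' by (intro tendsto_powr' evp_lim tendsto_const) (auto simp: evp_nonneg)
      then show "(\<lambda>n. evp (e n) m (?h x) powr q') \<longlonglongrightarrow> v (x, t) powr (m * q')" by (simp add: v_def pt_def powr_powr)
    qed
    show "AE x in lborel. norm (indicator U x *\<^sub>R evp (e n) m (?h x) powr q') \<le> indicator U x *\<^sub>R v (x, t) powr (m * q')" for n
    proof (rule AE_I2)
      fix x
      have "evp (e n) m (?h x) powr q' \<le> (\<bar>?h x\<bar> powr m) powr q'"
        using m q' e[of n] by (intro powr_mono2 evp_le) (auto simp: evp_nonneg)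
      then show "norm (indicator U x *\<^sub>R evp (e n) m (?h x) powr q') \<le> indicator U x *\<^sub>R v (x, t) powr (m * q')"
        by (auto simp: v_def pt_def powr_powr split: split_indicator)
    qed
  qed
  then have "(\<lambda>n. (LINT x:U|lborel. evp (e n) m (?h x) powr q') powr (1 / q')) \<longlonglongrightarrow> (LINT x:U|lborel. v (x, t) powr (m * q')) powr (1 / q')"
    using q' by (intro tendsto_powr' tendsto_const) (auto intro!: LINT_nonneg always_eventually)
  then have "(LINT x:U|lborel. v (x, t) powr (m * q')) powr (1 / q') \<le> Rr"
    using step by (intro LIMSEQ_le_const2) auto
  then show ?thesis by (simp add: Rr_def)
qed

text \<open>The gradient integrand without weight is the product of \<open>dsp \<alpha>\<close> and
  \<open>wt\<close>, both to the power \<open>r\<close>; Hoelder with exponents 1 / r and 1 / (1 -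
  r) separates them.\<close>

lemma sobolev_weighted:
  assumes t: "t > 0" and al: "\<alpha> > 2"
  defines "\<gamma> \<equiv> (\<alpha> - a) / (1 - lam r)"
  shows "(LINT x:U|lborel. v (x, t) powr \<gamma>) powr (1 - lam r)
     \<le> (cbar / (2 - a)) powr (2 - a) * (\<alpha> - a) powr (2 - a) * Wn r t * (LINT x:U|lborel. dsp \<alpha> (x, t))"
proof -
  have aa: "0 < a" "a < 1" by (rule a_bounds)+
  note lb = lam_bounds
  define m where "m = (\<alpha> - a) / (2 - a)"
  define q where "q = r * (2 - a)"
  define q' where "q' = 3 * q / (3 - q)"
  have m: "m > 1" using al aa by (simp add: m_def field_simps)
  have "r * (2 - a) < 1 * (2 - a)" using r aa by (intro mult_strict_right_mono) auto
  also have "1 * (2 - a) < 2" using aa by simp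
  finally have "q < 2" unfolding q_def .
  moreover have "0 < q" unfolding q_def using aa lb(1) by (intro mult_pos_pos) auto
  ultimately have q: "0 < q" "q < 2" by auto
  have q': "q' > 0" using q by (simp add: q'_def)
  \<comment> \<open>The origin of \<open>lam\<close>: the Sobolev exponent, rescaled by the power
    \<open>2 - a\<close> of the gradient.\<close>
  have l1: "(2 - a) / q' = 1 - lam r"
  proof -
    have "(2 - a) / q' = (2 - a) * (3 - q) / (3 * q)" by (simp add: q'_def)
    also have "\<dots> = (3 - r * (2 - a)) / (3 * r)" using aa lb by (simp add: q_def)
    also have "\<dots> = 1 - lam r" unfolding lb(4) using lb(1) by (simp add: field_simps)
    finally show ?thesis .
  qed
  have g: "m * q' = \<gamma>"
  proof -
    have "1 - lam r \<noteq> 0" using lb(2,5) by simp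
    then have "q' = (2 - a) / (1 - lam r)" using l1 q' by (simp add: field_simps)
    then show ?thesis using aa by (simp add: m_def \<gamma>_def)
  qed
  define V where "V = (LINT x:U|lborel. v (x, t) powr \<gamma>)"
  define I1 where "I1 = (LINT x:U|lborel. (v (x, t) powr (\<alpha> - 2) * gu (x, t) powr (2 - a)) powr r)"
  have V0: "V \<ge> 0" and I0: "I1 \<ge> 0" unfolding V_def I1_def by (intro LINT_nonneg; simp)+
  have "V powr (1 / q') \<le> cbar * (LINT x:U|lborel. (m * (v (x, t) powr (m - 1) * gu (x, t))) powr q) powr (1 / q)"
    using sobolev_power[OF t al] unfolding m_def[symmetric] q_def[symmetric] q'_def[symmetric] g V_def .
  also have "(LINT x:U|lborel. (m * (v (x, t) powr (m - 1) * gu (x, t))) powr q) = m powr q * I1"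
  proof -
    have "(m * (v (x, t) powr (m - 1) * gu (x, t))) powr q = m powr q * (v (x, t) powr (\<alpha> - 2) * gu (x, t) powr (2 - a)) powr r" for x
    proof -
      have "(m - 1) * q = (\<alpha> - 2) * r" using aa by (simp add: m_def q_def field_simps)
      then show ?thesis by (simp only: powr_mult powr_powr q_def) (simp only: mult.commute[of r])
    qed
    then show ?thesis by (simp add: I1_def)
  qed
  also have "cbar * (m powr q * I1) powr (1 / q) = cbar * m * I1 powr (1 / q)"
    using m q by (simp add: powr_mult powr_powr)
  finally have "(V powr (1 / q')) powr (2 - a) \<le> (cbar * m * I1 powr (1 / q)) powr (2 - a)"
    using aa by (intro powr_mono2) auto
  also have "(V powr (1 / q')) powr (2 - a) = V powr (1 - lam r)" using l1 by (simp add: powr_powr)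
  also have "(cbar * m * I1 powr (1 / q)) powr (2 - a) = (cbar * m) powr (2 - a) * I1 powr (1 / r)"
    using aa lb by (simp add: powr_mult powr_powr q_def)
  also have "(cbar * m) powr (2 - a) = (cbar / (2 - a)) powr (2 - a) * (\<alpha> - a) powr (2 - a)"
    by (simp only: m_def powr_mult[symmetric]) simp
  finally have 1: "V powr (1 - lam r) \<le> (cbar / (2 - a)) powr (2 - a) * (\<alpha> - a) powr (2 - a) * I1 powr (1 / r)" .
  have w0: "wt (x, t) > 0" if "x \<in> U" for x using wt_ge1[OF that t] by linarith
  have bd: "bcf U (\<lambda>z. dsp \<alpha> z powr r)" using al lb dsp_nonneg by (intro bcf_powr bcf_dsp) auto
  have bw: "bcf U (\<lambda>z. wt z powr e)" if "e > 0" for e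
    using that wt_ge1 by (intro bcf_powr bcfs) (auto intro: order_trans[of 0 1])
  have D0: "(LINT x:U|lborel. dsp \<alpha> (x, t)) \<ge> 0" using dsp_nonneg t by (intro LINT_nonneg) auto
  have "I1 = (LINT x:U|lborel. dsp \<alpha> (x, t) powr r * wt (x, t) powr r)"
    unfolding I1_def using U_open
  proof (intro set_lebesgue_integral_cong allI impI)
    fix x assume "x \<in> U"
    then show "(v (x, t) powr (\<alpha> - 2) * gu (x, t) powr (2 - a)) powr r = dsp \<alpha> (x, t) powr r * wt (x, t) powr r"
      using w0[of x] by (simp add: dsp_def powr_mult[symmetric])
  qed auto
  also have "\<dots> \<le> (LINT x:U|lborel. (dsp \<alpha> (x, t) powr r) powr (1 / r)) powr (1 / (1 / r)) * (LINT x:U|lborel. (wt (x, t) powr r) powr (1 / (1 - r))) powr (1 / (1 / (1 - r)))"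
  proof (rule set_Holder)
    have r0: "r > 0" using lb by simp
    show "set_borel_measurable lborel U (\<lambda>x. dsp \<alpha> (x, t) powr r)" "set_borel_measurable lborel U (\<lambda>x. wt (x, t) powr r)"
      using bcf_bmeas_slice[OF UO bd t] bcf_bmeas_slice[OF UO bw[OF r0] t] by (auto simp: bmeas_def)
    have "set_integrable lborel U (\<lambda>x. dsp \<alpha> (x, t))" by (rule bmeas_integrable[OF bcf_bmeas_slice[OF UO bcf_dsp[OF al] t]])
    moreover have "(dsp \<alpha> (x, t) powr r) powr (1 / r) = dsp \<alpha> (x, t)" if "x \<in> U" for x
      using r0 dsp_nonneg[OF that t, of \<alpha>] by (simp add: powr_powr)
    ultimately show "set_integrable lborel U (\<lambda>x. (dsp \<alpha> (x, t) powr r) powr (1 / r))"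
      by (subst set_integrable_cong[OF refl refl]) auto
    have "r / (1 - r) > 0" using r0 r by simp
    from bmeas_integrable[OF bcf_bmeas_slice[OF UO bw[OF this] t]]
    show "set_integrable lborel U (\<lambda>x. (wt (x, t) powr r) powr (1 / (1 - r)))" by (simp add: powr_powr)
  qed (use r lb in auto)
  also have "(LINT x:U|lborel. (dsp \<alpha> (x, t) powr r) powr (1 / r)) = (LINT x:U|lborel. dsp \<alpha> (x, t))"
    using U_open lb dsp_nonneg t by (intro set_lebesgue_integral_cong) (auto simp: powr_powr)
  also have "(LINT x:U|lborel. (wt (x, t) powr r) powr (1 / (1 - r))) = (LINT x:U|lborel. wt (x, t) powr (r / (1 - r)))"
    by (simp add: powr_powr)
  finally have "I1 powr (1 / r) \<le> ((LINT x:U|lborel. dsp \<alpha> (x, t)) powr r * (LINT x:U|lborel. wt (x, t) powr (r / (1 - r))) powr (1 - r)) powr (1 / r)"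
    using I0 lb by (intro powr_mono2) auto
  also have "\<dots> = (LINT x:U|lborel. dsp \<alpha> (x, t)) * Wn r t"
    using D0 lb by (simp add: Wn_def powr_mult powr_powr)
  finally have "(cbar / (2 - a)) powr (2 - a) * (\<alpha> - a) powr (2 - a) * I1 powr (1 / r) \<le> (cbar / (2 - a)) powr (2 - a) * (\<alpha> - a) powr (2 - a) * ((LINT x:U|lborel. dsp \<alpha> (x, t)) * Wn r t)"
    by (intro mult_left_mono) auto
  with 1 show ?thesis unfolding V_def by (simp add: mult_ac)
qed

text \<open>The exponent is split as \<open>(\<alpha> - a) + \<alpha> * lam r\<close>, with Hoelder
  exponents \<open>1 / (1 - lam r)\<close> and \<open>1 / lam r\<close>. The dissipation then enters
  linearly and can be integrated in time, the other factor being uniformly bounded.\<close>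

lemma interpolation:
  assumes t: "t > 0" and al: "\<alpha> > 2"
  shows "(LINT x:U|lborel. v (x, t) powr (\<alpha> * (1 + lam r) - a))
     \<le> J \<alpha> t powr lam r * ((cbar / (2 - a)) powr (2 - a) * (\<alpha> - a) powr (2 - a) * Wn r t * (LINT x:U|lborel. dsp \<alpha> (x, t)))"
proof -
  have aa: "0 < a" "a < 1" by (rule a_bounds)+
  note lb = lam_bounds
  define \<gamma> where "\<gamma> = (\<alpha> - a) / (1 - lam r)"
  have l1: "0 < 1 - lam r" "1 - lam r < 1" using lb(2,5) by simp_all
  have g: "\<gamma> > 0" "\<gamma> * (1 - lam r) = \<alpha> - a" using l1 al aa by (auto simp: \<gamma>_def)
  have bE: "bmeas U (\<lambda>x. v (x, t) powr b)" if "b > 0" for b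
    using bcf_bmeas_slice[OF UO bcf_v_powr[OF that] t] .
  have e1: "v (x, t) powr (\<alpha> - a) * v (x, t) powr (\<alpha> * lam r) = v (x, t) powr (\<alpha> * (1 + lam r) - a)" for x
    by (simp add: powr_add[symmetric] algebra_simps)
  have e2: "(v (x, t) powr (\<alpha> - a)) powr (1 / (1 - lam r)) = v (x, t) powr \<gamma>" "(v (x, t) powr (\<alpha> * lam r)) powr (1 / lam r) = v (x, t) powr \<alpha>" for x
    using lb(2) by (simp_all add: powr_powr \<gamma>_def)
  have "(LINT x:U|lborel. v (x, t) powr (\<alpha> - a) * v (x, t) powr (\<alpha> * lam r)) \<le>
    (LINT x:U|lborel. (v (x, t) powr (\<alpha> - a)) powr (1 / (1 - lam r))) powr (1 / (1 / (1 - lam r))) * (LINT x:U|lborel. (v (x, t) powr (\<alpha> * lam r)) powr (1 / lam r)) powr (1 / (1 / lam r))"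
  proof (rule set_Holder)
    show "set_borel_measurable lborel U (\<lambda>x. v (x, t) powr (\<alpha> - a))" "set_borel_measurable lborel U (\<lambda>x. v (x, t) powr (\<alpha> * lam r))"
      using bE[of "\<alpha> - a"] bE[of "\<alpha> * lam r"] al aa lb by (auto simp: bmeas_def)
    show "set_integrable lborel U (\<lambda>x. (v (x, t) powr (\<alpha> - a)) powr (1 / (1 - lam r)))" "set_integrable lborel U (\<lambda>x. (v (x, t) powr (\<alpha> * lam r)) powr (1 / lam r))"
      unfolding e2 using g al by (auto intro!: bmeas_integrable bE)
  qed (use l1 in auto)
  also have "\<dots> = (LINT x:U|lborel. v (x, t) powr \<gamma>) powr (1 - lam r) * J \<alpha> t powr lam r"
    unfolding e2 J_def by simp
  also have "\<dots> \<le> ((cbar / (2 - a)) powr (2 - a) * (\<alpha> - a) powr (2 - a) * Wn r t * (LINT x:U|lborel. dsp \<alpha> (x, t))) * J \<alpha> t powr lam r"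
    using sobolev_weighted[OF t al] by (intro mult_right_mono) (auto simp: \<gamma>_def)
  finally show ?thesis unfolding e1 by (simp add: mult.commute)
qed

end
end

section \<open>The weight in terms of \<open>Estar\<close>, and integration in time\<close>

text \<open>\<open>real_of_ereal\<close> maps infinity to 0, so the real number bounds the slices
  only once the essential supremum is known to be finite. Boundedness of \<open>f\<close> on the
  cylinder provides this.\<close>

lemma Lp_slice_esssup:
  assumes U: "open U" "bounded U" and f: "bcf U f" and s: "0 \<le> s" and p: "p > 0"
  defines "h \<equiv> \<lambda>t. (Lp_on p U (\<lambda>x. f (x, t)))\<^sup>2"
  shows "AE t in lborel. t \<in> {s<..<T} \<longrightarrow> h t \<le> real_of_ereal (esssup_on {s<..<T} h)"
proof -
  have bf: "bcf U (\<lambda>z. \<bar>f z\<bar> powr p)" using f p by (intro bcf_powr bcf_abs) auto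
  define I where "I t = (LINT x:U|lborel. \<bar>f (x, t)\<bar> powr p)" for t
  have h: "h t = (I t powr (1 / p))\<^sup>2" for t by (simp add: h_def Lp_on_def I_def)
  have I0: "I t \<ge> 0" for t unfolding I_def set_lebesgue_integral_def by simp
  have mI: "(\<lambda>t. indicator {s<..<T} t * I t) \<in> borel_measurable lborel"
    using bcf_fubini(2)[OF U bf s, of T] unfolding set_integrable_def I_def by (auto dest: borel_measurable_integrable)
  have "(\<lambda>t. ((indicator {s<..<T} t * I t) powr (1 / p))\<^sup>2) \<in> borel_measurable lborel" using mI by measurable
  moreover have "((indicator {s<..<T} t * I t) powr (1 / p))\<^sup>2 = indicator {s<..<T} t * h t" for t
    using p by (auto simp: h split: split_indicator)
  ultimately have m: "(\<lambda>t. ereal (indicator {s<..<T} t * h t)) \<in> borel_measurable lborel" by simp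
  obtain B where B: "\<forall>x\<in>U. \<forall>t\<in>{0<..<T}. \<bar>\<bar>f (x, t)\<bar> powr p\<bar> \<le> B" using bf unfolding bcf_def by meson
  define C where "C = ((max B 0 * measure lborel U) powr (1 / p))\<^sup>2"
  have le: "indicator {s<..<T} t * h t \<le> C" for t
  proof (cases "t \<in> {s<..<T}")
    case True
    then have t: "t > 0" "t < T" using s by auto
    have "I t \<le> (LINT x:U|lborel. max B 0)"
      unfolding I_def
    proof (rule set_integral_mono)
      show "set_integrable lborel U (\<lambda>x. \<bar>f (x, t)\<bar> powr p)" using bmeas_integrable[OF bcf_bmeas_slice[OF U bf t(1)]] .
      show "set_integrable lborel U (\<lambda>x. max B 0)" using U emeasure_bounded_finite[OF U(2)] by (intro bmeas_integrable bmeas_const) auto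
    qed (use B t in \<open>force simp: le_max_iff_disj\<close>)
    also have "\<dots> = max B 0 * measure lborel U"
      using U emeasure_bounded_finite[OF U(2)] by (simp add: set_lebesgue_integral_def mult.commute)
    finally have "h t \<le> C" unfolding h C_def using I0 p by (intro power_mono powr_mono2) auto
    then show ?thesis using True by simp
  qed (simp add: C_def)
  have E: "esssup_on {s<..<T} h \<le> ereal C"
    unfolding esssup_on_def by (rule esssup_I[OF m]) (use le in auto)
  have "AE t in lborel. ereal (indicator {s<..<T} t * h t) \<le> esssup_on {s<..<T} h"
    unfolding esssup_on_def by (rule esssup_AE)
  then show ?thesis
  proof eventually_elim
    case (elim t)
    show ?case
    proof
      assume "t \<in> {s<..<T}"
      then have "ereal (h t) \<le> esssup_on {s<..<T} h" using elim by simp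
      then show "h t \<le> real_of_ereal (esssup_on {s<..<T} h)"
        using E by (cases "esssup_on {s<..<T} h") auto
    qed
  qed
qed

context rotating_flow begin

definition "cb1 cbar = max 1 (1 / C10 * (cbar / (2 - a)) powr (2 - a))"

context
  fixes r cbar :: real
  assumes r: "3 / (5 - a) < r" "r < 1" "r \<ge> 1 / (2 - a)" and cbar: "cbar > 0"
    and sob: "\<And>f. C1c_in U f \<Longrightarrow> Lp_on (3 * (r * (2 - a)) / (3 - r * (2 - a))) U f
          \<le> cbar * Lp_on (r * (2 - a)) U (\<lambda>x. norm (grad1 f x))"
begin

lemmas lmb = lam_bounds[OF r cbar sob]

text \<open>Since \<open>r > 1/2\<close>, the outer exponent \<open>e = (1 - r) / r\<close> is at
  most 1 and its power is subadditive. The 4 is \<open>(2 powr r2) powr e\<close>, because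
  \<open>r2 * e = 2\<close>.\<close>

lemma Wn_le:
  assumes t: "t > 0"
  defines "r2 \<equiv> 2 * r / (1 - r)"
  shows "Wn r t \<le> 4 * chi * ((Lp_on r2 U (\<lambda>x. 1 + \<bar>\<Psi> x t\<bar>))\<^sup>2 + (Lp_on r2 U (\<lambda>x. ub x t))\<^sup>2)"
proof -
  define e where "e = (1 - r) / r"
  have r0: "r > 1/2" "r < 1" using lmb(1) r by auto
  have r2: "r2 > 0" "r2 * e = 2" using r0 by (auto simp: r2_def e_def)
  then have r2': "2 / r2 = e" by (simp add: field_simps)
  have e: "0 < e" "e \<le> 1" using r0 by (auto simp: e_def field_simps)
  have re: "r / (1 - r) * e = 1" "r / (1 - r) > 0" "2 * (r / (1 - r)) = r2" using r0 by (auto simp: e_def r2_def)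
  have chi: "chi > 0" using chi_ge by linarith
  define A where "A = (LINT x:U|lborel. P (x, t) powr r2)"
  define B where "B = (LINT x:U|lborel. v (x, t) powr r2)"
  have AB: "A \<ge> 0" "B \<ge> 0" unfolding A_def B_def by (intro LINT_nonneg; simp)+
  have iP: "set_integrable lborel U (\<lambda>x. P (x, t) powr r2)" "set_integrable lborel U (\<lambda>x. v (x, t) powr r2)"
  proof -
    have "bcf U (\<lambda>z. P z powr r2)" using r2 nonneg(5) by (intro bcf_powr bcfs) (auto intro: order_trans[of 0 1])
    from bmeas_integrable[OF bcf_bmeas_slice[OF UO this t]] show "set_integrable lborel U (\<lambda>x. P (x, t) powr r2)" .
    from bmeas_integrable[OF bcf_bmeas_slice[OF UO bcf_v_powr[OF r2(1)] t]] show "set_integrable lborel U (\<lambda>x. v (x, t) powr r2)" .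
  qed
  let ?c = "chi powr (r / (1 - r)) * 2 powr r2"
  have "(LINT x:U|lborel. wt (x, t) powr (r / (1 - r))) \<le> (LINT x:U|lborel. ?c * (P (x, t) powr r2 + v (x, t) powr r2))"
  proof (rule set_integral_mono)
    have "bcf U (\<lambda>z. wt z powr (r / (1 - r)))" 
      using re(2) wt_ge1 by (intro bcf_powr bcfs) (auto intro: order_trans[of 0 1])
    from bmeas_integrable[OF bcf_bmeas_slice[OF UO this t]]
    show "set_integrable lborel U (\<lambda>x. wt (x, t) powr (r / (1 - r)))" .
    show "set_integrable lborel U (\<lambda>x. ?c * (P (x, t) powr r2 + v (x, t) powr r2))"
      by (intro set_integrable_mult_right set_integral_add(1) iP)
    fix x assume x: "x \<in> U"
    define s where "s = pt u (x, t)"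
    have s: "s \<ge> 0" "1 + s \<le> P (x, t) + v (x, t)" using u_ge0[OF x t] pt_u_le[of "(x, t)"] by (auto simp: s_def)
    have "wt (x, t) powr (r / (1 - r)) = chi powr (r / (1 - r)) * (1 + s) powr r2"
    proof -
      have "wt (x, t) = chi * (1 + s) powr 2" using s by (simp add: wt_def s_def)
      then show ?thesis by (simp only: powr_mult powr_powr re(3))
    qed
    also have "\<dots> \<le> chi powr (r / (1 - r)) * (2 * max (P (x, t)) (v (x, t))) powr r2"
      using s r2 by (intro mult_left_mono powr_mono2) auto
    also have "(2 * max (P (x, t)) (v (x, t))) powr r2 \<le> 2 powr r2 * (P (x, t) powr r2 + v (x, t) powr r2)"
      by (simp add: powr_mult max_def)
    finally show "wt (x, t) powr (r / (1 - r)) \<le> ?c * (P (x, t) powr r2 + v (x, t) powr r2)"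
      by (simp add: mult.assoc mult_left_mono)
  qed
  also have "\<dots> = ?c * (A + B)"
    unfolding A_def B_def using iP by (simp only: set_integral_mult_right set_integral_add(2))
  finally have "Wn r t \<le> (?c * (A + B)) powr e"
    unfolding Wn_def e_def[symmetric] using e by (intro powr_mono2) (auto intro!: LINT_nonneg)
  also have "\<dots> = 4 * chi * (A + B) powr e"
    using chi by (simp only: powr_mult powr_powr re(1) r2(2)) simp
  also have "\<dots> \<le> 4 * chi * (A powr e + B powr e)"
    using powr_add_le[OF AB e] chi by (intro mult_left_mono) auto
  also have "A powr e = (Lp_on r2 U (\<lambda>x. 1 + \<bar>\<Psi> x t\<bar>))\<^sup>2"
  proof -
    have "(LINT x:U|lborel. \<bar>1 + \<bar>\<Psi> x t\<bar>\<bar> powr r2) = A" by (simp add: A_def P_def pt_def)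
    then show ?thesis using r2' by (simp add: Lp_on_def power2_eq_square powr_add[symmetric])
  qed
  also have "B powr e = (Lp_on r2 U (\<lambda>x. ub x t))\<^sup>2"
  proof -
    have "(LINT x:U|lborel. \<bar>ub x t\<bar> powr r2) = B" by (simp add: B_def v_def pt_def)
    then show ?thesis using r2' by (simp add: Lp_on_def power2_eq_square powr_add[symmetric])
  qed
  finally show ?thesis .
qed

text \<open>\<open>B\<close> bounds both the slices and the dissipation, whence the exponent
  \<open>1 + lam r\<close>. The Sobolev factor \<open>(\<alpha> - a) powr (2 - a)\<close> is at most
  \<open>2 * (\<alpha> * (\<alpha> - 1))\<close> and is cancelled by the coefficient of the
  dissipation; its 2 and the 4 of the weight make 8.\<close>

lemma space_time_sobolev:
  assumes T: "0 < T2" "T2 < T" and al: "\<alpha> > 2" and B: "B \<ge> 0"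
    and J: "\<And>t. T2 \<le> t \<Longrightarrow> t \<le> T \<Longrightarrow> J \<alpha> t \<le> B"
    and D: "\<alpha> * (\<alpha> - 1) * C10 * (LINT z:Q T2 T|lborel. dsp \<alpha> z) \<le> B"
    and W: "AE t in lborel. t \<in> {T2<..<T} \<longrightarrow> Wn r t \<le> 4 * chi * Es" and Es: "Es \<ge> 1"
  shows "(LINT z:Q T2 T|lborel. v z powr (\<alpha> * (1 + lam r) - a)) \<le> 8 * chi * Es * (cb1 cbar) * B powr (1 + lam r)"
proof -
  have aa: "0 < a" "a < 1" by (rule a_bounds)+
  have chi: "chi > 0" using chi_ge by linarith
  let ?s = "\<alpha> * (1 + lam r) - a"
  have s: "?s > 0"
  proof -
    have "\<alpha> * 1 \<le> \<alpha> * (1 + lam r)" using al lmb(2) by (intro mult_left_mono) auto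
    then show ?thesis using al aa by linarith
  qed
  define k1 where "k1 = (cbar / (2 - a)) powr (2 - a)"
  define k2 where "k2 = (\<alpha> - a) powr (2 - a)"
  define dd where "dd = (LINT z:Q T2 T|lborel. dsp \<alpha> z)"
  have kk: "k1 \<ge> 0" "k2 \<ge> 0" by (simp_all add: k1_def k2_def)
  have dd0: "dd \<ge> 0" unfolding dd_def by (rule LINT_nonneg) (use T dsp_nonneg in \<open>auto simp: cyl_def\<close>)
  let ?K = "B powr lam r * (k1 * k2 * (4 * chi * Es))"
  have "(LINT z:Q T2 T|lborel. v z powr ?s) = (LINT t:{T2<..<T}|lborel. LINT x:U|lborel. v (x, t) powr ?s)"
    using bcf_fubini(1)[OF UO bcf_v_powr[OF s], of T2 T] T by simp
  also have "\<dots> \<le> (LINT t:{T2<..<T}|lborel. ?K * (LINT x:U|lborel. dsp \<alpha> (x, t)))"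
    unfolding set_lebesgue_integral_def[where A="{T2<..<T}"]
  proof (rule integral_mono_AE)
    show "integrable lborel (\<lambda>t. indicator {T2<..<T} t *\<^sub>R (LINT x:U|lborel. v (x, t) powr ?s))"
      using bcf_fubini(2)[OF UO bcf_v_powr[OF s], of T2 T] T by (simp add: set_integrable_def)
    have "set_integrable lborel {T2<..<T} (\<lambda>t. ?K * (LINT x:U|lborel. dsp \<alpha> (x, t)))"
      using bcf_fubini(2)[OF UO bcf_dsp[OF al], of T2 T] T by (intro set_integrable_mult_right) auto
    then show "integrable lborel (\<lambda>t. indicator {T2<..<T} t *\<^sub>R (?K * (LINT x:U|lborel. dsp \<alpha> (x, t))))"
      by (simp only: set_integrable_def)
    show "AE t in lborel. indicator {T2<..<T} t *\<^sub>R (LINT x:U|lborel. v (x, t) powr ?s) \<le> indicator {T2<..<T} t *\<^sub>R (?K * (LINT x:U|lborel. dsp \<alpha> (x, t)))"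
      using W
    proof eventually_elim
      case (elim t)
      show ?case
      proof (cases "t \<in> {T2<..<T}")
        case True
        then have t: "t > 0" and Wt: "Wn r t \<le> 4 * chi * Es" and Jt: "J \<alpha> t \<le> B" using elim T J[of t] by auto
        have d0: "(LINT x:U|lborel. dsp \<alpha> (x, t)) \<ge> 0" using dsp_nonneg t by (intro LINT_nonneg) auto
        have W0: "Wn r t \<ge> 0" by (simp add: Wn_def)
        have "(LINT x:U|lborel. v (x, t) powr ?s) \<le> J \<alpha> t powr lam r * (k1 * k2 * Wn r t * (LINT x:U|lborel. dsp \<alpha> (x, t)))"
          unfolding k1_def k2_def by (rule interpolation[OF r cbar sob t al])
        also have "\<dots> \<le> B powr lam r * (k1 * k2 * (4 * chi * Es) * (LINT x:U|lborel. dsp \<alpha> (x, t)))"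
          using Jt Wt kk d0 W0 chi Es lmb(2) nonneg(7)[of \<alpha> t] by (intro mult_mono powr_mono2) (auto intro!: mult_nonneg_nonneg)
        finally show ?thesis using True by (simp add: mult.assoc)
      qed simp
    qed
  qed
  also have "\<dots> = ?K * dd" using bcf_fubini(1)[OF UO bcf_dsp[OF al], of T2 T] T by (simp add: dd_def)
  also have "\<dots> \<le> 8 * chi * Es * (cb1 cbar) * B powr (1 + lam r)"
  proof -
    have c10: "C10 > 0" using c_pos by simp
    have al2: "\<alpha> * (\<alpha> - 1) > 0" using al by simp
    have k2: "k2 \<le> 2 * (\<alpha> * (\<alpha> - 1))"
    proof -
      have "k2 \<le> \<alpha> powr (2 - a)" unfolding k2_def using al aa by (intro powr_mono2) auto
      also have "\<dots> \<le> \<alpha> powr 2" using al aa by (intro powr_mono) auto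
      also have "\<dots> = \<alpha> * \<alpha>" using al by (simp add: power2_eq_square)
      also have "\<dots> \<le> \<alpha> * (2 * (\<alpha> - 1))" using al by (intro mult_left_mono) auto
      finally show ?thesis by (simp only: mult.left_commute)
    qed
    have cb: "k1 \<le> C10 * (cb1 cbar)"
    proof -
      have "1 / C10 * k1 \<le> (cb1 cbar)" by (simp add: cb1_def k1_def)
      then show ?thesis using c10 by (simp add: field_simps)
    qed
    have cb0: "(cb1 cbar) \<ge> 1" by (simp add: cb1_def)
    have "k1 * k2 * dd \<le> (C10 * (cb1 cbar)) * (2 * (\<alpha> * (\<alpha> - 1))) * dd"
      using cb k2 kk dd0 c10 cb0 by (intro mult_right_mono mult_mono) auto
    also have "\<dots> = 2 * (cb1 cbar) * (\<alpha> * (\<alpha> - 1) * C10 * dd)" by simp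
    also have "\<dots> \<le> 2 * (cb1 cbar) * B" using D cb0 by (intro mult_left_mono) (auto simp: dd_def)
    finally have "k1 * k2 * dd \<le> 2 * (cb1 cbar) * B" .
    then have "B powr lam r * (4 * chi * Es) * (k1 * k2 * dd) \<le> B powr lam r * (4 * chi * Es) * (2 * (cb1 cbar) * B)"
      using chi Es by (intro mult_left_mono) auto
    also have "\<dots> = 8 * chi * Es * (cb1 cbar) * (B * B powr lam r)" by simp
    also have "B * B powr lam r = B powr (1 + lam r)" using B by (cases "B = 0") (auto simp: powr_add)
    finally show ?thesis by (simp add: mult_ac)
  qed
  finally show ?thesis .
qed

end
end

section \<open>Moser iteration\<close>

text \<open>Used to bound \<open>\<alpha> powr (2 * a / s)\<close> by 8, where
  \<open>s \<ge> ln \<alpha>\<close>.\<close>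

lemma exp_2_le_8: "exp 2 \<le> (8::real)"
proof -
  have "exp (1/16 :: real) \<le> 1 + 1/16 + (1/16)\<^sup>2" by (rule exp_bound) auto
  then have "exp (1/16 :: real) \<le> 273/256" by (simp add: power2_eq_square)
  then have "exp (1/16 :: real) ^ 32 \<le> (273/256)^32" by (intro power_mono) auto
  moreover have "exp (1/16 :: real) ^ 32 = exp 2" by (simp add: exp_of_nat_mult[symmetric])
  moreover have "(273/256 :: real)^32 \<le> 8" by (simp add: power_divide)
  ultimately show ?thesis by simp
qed

text \<open>The inequality is proved for the \<open>\<alpha>\<close>-th powers. There the exponents
  are \<open>\<alpha> / s \<le> 1 / kh\<close> and \<open>e = 1 + a / s \<le> \<mu>2\<close>, and
  all dependence on \<open>j\<close> is confined to \<open>E\<close> and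
  \<open>(2 * \<kappa>) powr (real j * \<mu>3)\<close>; the rest is \<open>B\<close>.\<close>

lemma moser_constant:
  fixes a L \<alpha> m chi Es cb C CR M E d \<kappa> \<alpha>0 r :: real and j :: nat
  assumes a: "0 < a" "a < 1" and L: "1 < L" "L < 2" and al: "\<alpha> > 2" "\<alpha> * (L - 1) \<ge> a"
    and ge: "m \<ge> 0" "chi \<ge> 1" "Es \<ge> 1" "cb \<ge> 1" "C \<ge> 1" "CR \<ge> 0" "M \<ge> 1" "E \<ge> 1" "d > 0"
    and CR: "1 + CR \<le> 2 * C" and al0: "\<alpha> = \<kappa>^j * \<alpha>0" "\<kappa> > 1" "\<alpha>0 > 2" and r: "0 < r" "r < 1"
  defines "s \<equiv> \<alpha> * L - a" and "\<mu>2 \<equiv> 1 + a / L" and "\<mu>3 \<equiv> 2 + a / L" and "kh \<equiv> L - a / 2"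
  defines "B \<equiv> ((2 * \<kappa>) powr \<mu>3 * (2 powr (4 + 1 / r) * cb * C\<^sup>2)) * \<alpha>0 powr \<mu>3 * chi powr (1 / kh) * (1 + 1 / d) powr \<mu>2
                   * (1 + m) powr \<mu>3 * M powr \<mu>2 * Es powr (1 / kh)"
  shows "(1 + m) powr (1 / \<alpha>) * (8 * chi * Es * cb) powr (1 / s) *
      ((1 + m) * (\<alpha> * (\<alpha> - 1)) * (2 ^ (j + 1) / d / 2 + CR * (M * E))) powr (L / s)
      \<le> (E powr \<mu>2 * (2 * \<kappa>) powr (real j * \<mu>3) * B) powr (1 / \<alpha>)"
proof -
  define e where "e = L * \<alpha> / s"
  \<comment> \<open>Uses \<open>\<alpha> * (L - 1) \<ge> a\<close>, which the lower bound
    \<open>a / lam0\<close> for \<open>\<alpha>0\<close> guarantees.\<close>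
  have sa: "s \<ge> \<alpha>" using al by (simp add: s_def algebra_simps)
  have s0: "s > 0" using sa al by simp
  have aL: "a / L > 0" "a / L < 1" using a L by (auto simp: field_simps)
  have es: "e = 1 + a / s" using s0 by (simp add: e_def s_def field_simps)
  have sL: "s \<ge> L"
  proof -
    have "2 * L \<le> \<alpha> * L" using al L by (intro mult_right_mono) auto
    then show ?thesis unfolding s_def using a L by linarith
  qed
  have e1: "e \<ge> 1" "e \<le> \<mu>2" "e \<le> 2" "\<mu>2 \<le> 2" "\<mu>3 = 1 + \<mu>2" "\<mu>2 \<ge> 1"
  proof -
    have "a / s \<le> a / L" using sL a L by (intro divide_left_mono) auto
    then show "e \<le> \<mu>2" by (simp add: es \<mu>2_def)
    then show "e \<le> 2" "\<mu>2 \<le> 2" "\<mu>2 \<ge> 1" using aL by (auto simp: \<mu>2_def)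
    show "e \<ge> 1" using a s0 by (simp add: es)
    show "\<mu>3 = 1 + \<mu>2" by (simp add: \<mu>3_def \<mu>2_def)
  qed
  have kh: "kh > 0" "\<alpha> / s \<le> 1 / kh" "\<alpha> / s \<le> 1" "\<alpha> / s > 0"
  proof -
    show k: "kh > 0" using a L by (simp add: kh_def)
    have "a * 2 \<le> a * \<alpha>" using a al by (intro mult_left_mono) auto
    then have "\<alpha> * kh \<le> s" by (simp add: kh_def s_def algebra_simps)
    then show "\<alpha> / s \<le> 1 / kh" using k s0 by (simp add: field_simps)
    show "\<alpha> / s \<le> 1" "\<alpha> / s > 0" using sa s0 al by auto
  qed
  define S where "S = 1 + 1 / d"
  have S: "S \<ge> 1" using ge by (simp add: S_def)
  have T1: "(8 * chi * Es * cb) powr (\<alpha> / s) \<le> 8 * cb * chi powr (1 / kh) * Es powr (1 / kh)"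
  proof -
    have "(8 * chi * Es * cb) powr (\<alpha> / s) = (8 * cb) powr (\<alpha> / s) * chi powr (\<alpha> / s) * Es powr (\<alpha> / s)"
      by (simp only: powr_mult mult_ac)
    also have "\<dots> \<le> (8 * cb) powr 1 * chi powr (1 / kh) * Es powr (1 / kh)"
      using kh ge by (intro mult_mono powr_mono) auto
    finally show ?thesis using ge by simp
  qed
  define R0 where "R0 = (1 + m) * (\<alpha> * (\<alpha> - 1)) * (2 ^ (j + 1) / d / 2 + CR * (M * E))"
  have ME: "M * E \<ge> 1" using ge mult_mono[of 1 M 1 E] by simp
  have R0: "R0 \<le> (1 + m) * (\<alpha> * \<alpha>) * (2 ^ (j + 1) * S * C * M * E)"
  proof -
    have "1 \<le> (2::real) ^ j" by simp
    then have "CR * (M * E) \<le> 2 ^ j * (CR * (M * E))" using ge ME mult_right_mono[of 1 "2^j" "CR * (M * E)"] by simp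
    moreover have "2 ^ (j + 1) / d / 2 \<le> 2 ^ j * (1 / d * (M * E))"
      using ge ME mult_left_mono[of 1 "M * E" "2 ^ j / d"] by simp
    ultimately have "2 ^ (j + 1) / d / 2 + CR * (M * E) \<le> 2 ^ j * ((1 / d + CR) * (M * E))" by (simp add: algebra_simps)
    also have "\<dots> \<le> 2 ^ j * ((S * (1 + CR)) * (M * E))"
    proof (intro mult_left_mono mult_right_mono)
      have "CR / d \<ge> 0" using ge by simp
      then show "1 / d + CR \<le> S * (1 + CR)" by (simp add: S_def algebra_simps add_divide_distrib)
    qed (use ME in auto)
    also have "\<dots> \<le> 2 ^ j * ((S * (2 * C)) * (M * E))"
      using CR S ME by (intro mult_left_mono mult_right_mono) auto
    finally have "2 ^ (j + 1) / d / 2 + CR * (M * E) \<le> 2 ^ (j + 1) * S * C * M * E" by (simp add: mult_ac)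
    moreover have "\<alpha> * (\<alpha> - 1) \<le> \<alpha> * \<alpha>" using al by (intro mult_left_mono) auto
    moreover have "0 \<le> 2 ^ (j + 1) / d / 2 + CR * (M * E)" using ge ME by (intro add_nonneg_nonneg) auto
    ultimately show ?thesis unfolding R0_def using ge al S by (intro mult_mono) auto
  qed
  have R00: "R0 \<ge> 0" unfolding R0_def using ge ME al by (intro mult_nonneg_nonneg add_nonneg_nonneg) auto
  have al2: "(\<alpha> * \<alpha>) powr e \<le> 8 * \<alpha> powr \<mu>3"
  proof -
    have "(\<alpha> * \<alpha>) powr e = \<alpha> powr (e + e)" by (simp only: powr_mult powr_add)
    also have "\<dots> = \<alpha> powr 2 * \<alpha> powr (2 * a / s)" by (simp add: es powr_add[symmetric])
    also have "\<alpha> powr (2 * a / s) \<le> 8"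
    proof -
      have "ln \<alpha> \<le> \<alpha> - 1" using al by (intro ln_le_minus_one) auto
      moreover have "\<alpha> - 1 \<le> s" using sa by simp
      ultimately have l: "ln \<alpha> \<le> s" by simp
      have "2 * a / s * ln \<alpha> \<le> 2 * 1 / s * s" using a s0 l al by (intro mult_mono divide_right_mono) auto
      then have "exp (2 * a / s * ln \<alpha>) \<le> exp 2" using s0 by simp
      then have "exp (2 * a / s * ln \<alpha>) \<le> 8" using exp_2_le_8 by linarith
      then show ?thesis using al by (simp add: powr_def)
    qed
    also have "\<alpha> powr 2 \<le> \<alpha> powr \<mu>3" using al aL by (intro powr_mono) (auto simp: \<mu>3_def)
    finally show ?thesis by (simp add: mult.commute mult_left_mono mult_right_mono)
  qed
  have T2: "R0 powr e \<le> (1 + m) powr \<mu>2 * (8 * \<alpha> powr \<mu>3) * (2 powr (real (j + 1) * \<mu>2) * S powr \<mu>2 * C\<^sup>2 * M powr \<mu>2 * E powr \<mu>2)"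
  proof -
    have "R0 powr e \<le> ((1 + m) * (\<alpha> * \<alpha>) * (2 ^ (j + 1) * S * C * M * E)) powr e" using R0 R00 e1 by (intro powr_mono2) auto
    also have "\<dots> = (1 + m) powr e * (\<alpha> * \<alpha>) powr e * ((2 ^ (j + 1)) powr e * S powr e * C powr e * M powr e * E powr e)"
      by (simp only: powr_mult)
    also have "\<dots> \<le> (1 + m) powr \<mu>2 * (8 * \<alpha> powr \<mu>3) * (2 powr (real (j + 1) * \<mu>2) * S powr \<mu>2 * C powr 2 * M powr \<mu>2 * E powr \<mu>2)"
    proof (intro mult_mono powr_mono al2)
      have "((2::real) ^ (j + 1)) powr e = 2 powr (real (j + 1) * e)" by (simp only: powr_realpow[symmetric] powr_powr zero_less_numeral)
      also have "\<dots> \<le> 2 powr (real (j + 1) * \<mu>2)" using e1 by (intro powr_mono mult_left_mono) auto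
      finally show "((2::real) ^ (j + 1)) powr e \<le> 2 powr (real (j + 1) * \<mu>2)" .
    qed (use e1 ge S in auto)
    finally show ?thesis using ge by simp
  qed
  have al3: "\<alpha> powr \<mu>3 \<le> \<kappa> powr (real (j + 1) * \<mu>3) * \<alpha>0 powr \<mu>3"
  proof -
    have "\<alpha> powr \<mu>3 = \<kappa> powr (real j * \<mu>3) * \<alpha>0 powr \<mu>3"
      using al0 by (simp add: powr_mult powr_realpow[symmetric] powr_powr)
    also have "\<dots> \<le> \<kappa> powr (real (j + 1) * \<mu>3) * \<alpha>0 powr \<mu>3"
      using al0 e1 by (intro mult_right_mono powr_mono) auto
    finally show ?thesis .
  qed
  \<comment> \<open>64 = 8 * 8 comes from \<open>T1\<close> and \<open>al2\<close>. As
    \<open>\<mu>3 = 1 + \<mu>2\<close>, the claim is 6 \<le> (j + 1) + 4 + 1 / r, true since 1 / r >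
    1.\<close>
  have p2: "64 * 2 powr (real (j + 1) * \<mu>2) \<le> 2 powr (real (j + 1) * \<mu>3) * 2 powr (4 + 1 / r)"
  proof -
    have "(64::real) = 2 powr 6" by simp
    then have "64 * 2 powr (real (j + 1) * \<mu>2) = 2 powr (6 + real (j + 1) * \<mu>2)" by (simp only: powr_add)
    also have "\<dots> \<le> 2 powr (real (j + 1) * \<mu>3 + (4 + 1 / r))"
    proof (rule powr_mono)
      have "1 / r > 1" using r by simp
      then show "6 + real (j + 1) * \<mu>2 \<le> real (j + 1) * \<mu>3 + (4 + 1 / r)" by (simp add: e1(5) algebra_simps)
    qed simp
    finally show ?thesis by (simp only: powr_add)
  qed
  have main: "(1 + m) * (8 * chi * Es * cb) powr (\<alpha> / s) * R0 powr e \<le> E powr \<mu>2 * (2 * \<kappa>) powr (real j * \<mu>3) * B"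
  proof -
    have "(1 + m) * (8 * chi * Es * cb) powr (\<alpha> / s) * R0 powr e \<le> 
      (1 + m) * (8 * cb * chi powr (1 / kh) * Es powr (1 / kh)) * ((1 + m) powr \<mu>2 * (8 * \<alpha> powr \<mu>3) * (2 powr (real (j + 1) * \<mu>2) * S powr \<mu>2 * C\<^sup>2 * M powr \<mu>2 * E powr \<mu>2))"
      using T1 T2 ge by (intro mult_mono) auto
    also have "\<dots> = ((1 + m) * (1 + m) powr \<mu>2) * (64 * 2 powr (real (j + 1) * \<mu>2)) * \<alpha> powr \<mu>3 *
       (cb * chi powr (1 / kh) * Es powr (1 / kh) * S powr \<mu>2 * C\<^sup>2 * M powr \<mu>2 * E powr \<mu>2)" by simp
    also have "\<dots> \<le> ((1 + m) * (1 + m) powr \<mu>2) * (2 powr (real (j + 1) * \<mu>3) * 2 powr (4 + 1 / r)) * (\<kappa> powr (real (j + 1) * \<mu>3) * \<alpha>0 powr \<mu>3) *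
       (cb * chi powr (1 / kh) * Es powr (1 / kh) * S powr \<mu>2 * C\<^sup>2 * M powr \<mu>2 * E powr \<mu>2)"
    proof (rule mult_right_mono, rule mult_mono, rule mult_left_mono)
      show "64 * 2 powr (real (j + 1) * \<mu>2) \<le> 2 powr (real (j + 1) * \<mu>3) * 2 powr (4 + 1 / r)" by (rule p2)
      show "\<alpha> powr \<mu>3 \<le> \<kappa> powr (real (j + 1) * \<mu>3) * \<alpha>0 powr \<mu>3" by (rule al3)
    qed (use ge in \<open>simp_all\<close>)
    also have "(1 + m) * (1 + m) powr \<mu>2 = (1 + m) powr \<mu>3" using ge by (simp add: e1(5) powr_add)
    also have "(1 + m) powr \<mu>3 * (2 powr (real (j + 1) * \<mu>3) * 2 powr (4 + 1 / r)) * (\<kappa> powr (real (j + 1) * \<mu>3) * \<alpha>0 powr \<mu>3) *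
       (cb * chi powr (1 / kh) * Es powr (1 / kh) * S powr \<mu>2 * C\<^sup>2 * M powr \<mu>2 * E powr \<mu>2) = E powr \<mu>2 * (2 * \<kappa>) powr (real j * \<mu>3) * B"
    proof -
      have "2 powr (real (j + 1) * \<mu>3) * \<kappa> powr (real (j + 1) * \<mu>3) = (2 * \<kappa>) powr (real j * \<mu>3) * (2 * \<kappa>) powr \<mu>3"
        by (simp add: powr_mult[symmetric] powr_add[symmetric] algebra_simps)
      note pk = this
      have gen: "a1 * (p * t) * (k * z) * (b * x1 * x2 * y1 * y2 * y3 * y4) = y4 * g * ((h * (t * b * y2)) * z * x1 * y1 * a1 * y3 * x2)"
        if "p * k = g * h" for a1 p t k z b x1 x2 y1 y2 y3 y4 g h :: real
      proof -
        have "a1 * (p * t) * (k * z) * (b * x1 * x2 * y1 * y2 * y3 * y4) = (p * k) * (a1 * t * z * b * x1 * x2 * y1 * y2 * y3 * y4)"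
          by (simp only: mult_ac)
        then show ?thesis unfolding that by (simp only: mult_ac)
      qed
      show ?thesis unfolding B_def S_def[symmetric] by (rule gen[OF pk])
    qed
    finally show ?thesis .
  qed
  have "(1 + m) powr (1 / \<alpha>) * (8 * chi * Es * cb) powr (1 / s) * R0 powr (L / s) = ((1 + m) * (8 * chi * Es * cb) powr (\<alpha> / s) * R0 powr e) powr (1 / \<alpha>)"
    using al by (simp only: powr_mult powr_powr) (simp add: e_def)
  also have "\<dots> \<le> (E powr \<mu>2 * (2 * \<kappa>) powr (real j * \<mu>3) * B) powr (1 / \<alpha>)"
    using main ge al by (intro powr_mono2) auto
  finally show ?thesis by (simp add: R0_def)
qed

text \<open>From \<open>s \<le> \<alpha> * L\<close> follows
  \<open>L / s \<ge> 1 / \<alpha>\<close>, which gives the lower exponent; from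
  \<open>s > \<alpha> - a\<close> follows
  \<open>\<alpha> * L / s = 1 + a / s \<le> 1 + a / (\<alpha> - a)\<close>, the factor in the upper
  one.\<close>

lemma moser_exponents:
  fixes a L \<alpha> Y b :: real
  assumes a: "0 < a" "a < 1" and L: "1 < L" and al: "\<alpha> > 2" and Y: "Y \<ge> 0" and b: "\<alpha> \<le> b"
  defines "s \<equiv> \<alpha> * L - a"
  shows "(max (Y powr (\<alpha> - 2)) (Y powr b)) powr (L / s) \<le> max (Y powr ((\<alpha> - 2) / \<alpha>)) (Y powr (b * (1 + a / (\<alpha> - a)) / \<alpha>))"
proof -
  have sa: "s > \<alpha> - a" using al L by (simp add: s_def)
  have s0: "s > 0" using sa al a by linarith
  have lo: "1 / \<alpha> \<le> L / s"
    using s0 al a by (simp add: s_def field_simps)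
  have hi: "L / s \<le> (1 + a / (\<alpha> - a)) / \<alpha>"
  proof -
    have "L * \<alpha> / s = 1 + a / s" using s0 by (simp add: s_def field_simps)
    also have "\<dots> \<le> 1 + a / (\<alpha> - a)" using sa a al by (intro add_left_mono divide_left_mono) auto
    finally show ?thesis using al s0 by (simp add: field_simps)
  qed
  have Ls: "L / s \<ge> 0" using L s0 by simp
  have g: "Y powr (t * (L / s)) \<le> max (Y powr ((\<alpha> - 2) / \<alpha>)) (Y powr (b * (1 + a / (\<alpha> - a)) / \<alpha>))" if "\<alpha> - 2 \<le> t" "t \<le> b" for t
  proof (rule powr_between_le_max)
    show "0 \<le> Y" by (rule Y)
    have "(\<alpha> - 2) * (1 / \<alpha>) \<le> t * (L / s)" using that al lo by (intro mult_mono) auto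
    then show "(\<alpha> - 2) / \<alpha> \<le> t * (L / s)" by simp
    have "t * (L / s) \<le> b * ((1 + a / (\<alpha> - a)) / \<alpha>)" using that hi Ls b al by (intro mult_mono) auto
    then show "t * (L / s) \<le> b * (1 + a / (\<alpha> - a)) / \<alpha>" by simp
  qed
  have "(max (Y powr (\<alpha> - 2)) (Y powr b)) powr (L / s) = max (Y powr ((\<alpha> - 2) * (L / s))) (Y powr (b * (L / s)))"
  proof (cases "Y powr (\<alpha> - 2) \<le> Y powr b")
    case True
    then have "(Y powr (\<alpha> - 2)) powr (L / s) \<le> (Y powr b) powr (L / s)" using Ls by (intro powr_mono2) auto
    then show ?thesis using True by (simp add: powr_powr max_absorb2)
  next
    case False
    then have "(Y powr b) powr (L / s) \<le> (Y powr (\<alpha> - 2)) powr (L / s)" using Ls by (intro powr_mono2) auto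
    then show ?thesis using False by (simp add: powr_powr max_def)
  qed
  then show ?thesis using g[of "\<alpha> - 2"] g[of b] b by simp
qed

text \<open>The constant of a step is raised only to the upper exponents of later steps. All factors
  being at least 1, the product over 1, ..., n - 1 serves as one exponent for all of them; the
  missing index 0 is the origin of \<open>\<beta> 0 / st 0\<close> in
  \<open>\<omega>\<close>.\<close>

lemma moser_iterate:
  fixes Y A \<beta> rt st :: "nat \<Rightarrow> real"
  assumes Y0: "\<And>j. Y j \<ge> 0" and A: "\<And>j. A j \<ge> 1" and b: "\<And>j. \<beta> j > 0" "\<And>j. 0 < rt j" "\<And>j. rt j \<le> \<beta> j" "\<And>j. \<beta> j \<le> st j"
    and step: "\<And>j. Y (Suc j) \<le> A j powr (1 / \<beta> j) * max (Y j powr (rt j / \<beta> j)) (Y j powr (st j / \<beta> j))"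
  shows "Y n \<le> (\<Prod>j<n. A j powr (1 / \<beta> j)) powr (\<Prod>j=1..<n. st j / \<beta> j) * 
      max (Y 0 powr (\<Prod>j<n. rt j / \<beta> j)) (Y 0 powr (\<Prod>j<n. st j / \<beta> j))"
proof (induction n)
  case 0
  then show ?case using Y0[of 0] by simp
next
  case (Suc n)
  define D where "D = (\<Prod>j<n. A j powr (1 / \<beta> j)) powr (\<Prod>j=1..<n. st j / \<beta> j)"
  define \<rho> where "\<rho> = (\<Prod>j<n. rt j / \<beta> j)"
  define \<sigma> where "\<sigma> = (\<Prod>j<n. st j / \<beta> j)"
  define \<rho>' where "\<rho>' = rt n / \<beta> n"
  define \<sigma>' where "\<sigma>' = st n / \<beta> n"
  have rs: "0 < \<rho>'" "\<rho>' \<le> 1" "1 \<le> \<sigma>'" using b[of n] by (auto simp: \<rho>'_def \<sigma>'_def)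
  have st1: "1 \<le> st j / \<beta> j" for j using b[of j] by auto
  have A1: "A j powr (1 / \<beta> j) \<ge> 1" for j using A[of j] b(1)[of j] by (intro ge_one_powr_ge_zero) auto
  have p1: "(\<Prod>j<k. A j powr (1 / \<beta> j)) \<ge> 1" for k by (rule prod_ge_1) (use A1 in auto)
  have q1: "(\<Prod>j\<in>I. st j / \<beta> j) \<ge> 1" for I by (rule prod_ge_1) (use st1 in auto)
  have rho: "0 < \<rho>" "\<rho> \<le> 1" unfolding \<rho>_def using b by (auto intro!: prod_pos prod_le_1 simp: less_imp_le)
  have sg: "\<sigma> \<ge> 1" unfolding \<sigma>_def by (rule q1)
  have D1: "D \<ge> 1" unfolding D_def using p1 q1 by (intro ge_one_powr_ge_zero) (auto intro: order_trans[of 0 1])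
  have IH: "Y n \<le> D * max (Y 0 powr \<rho>) (Y 0 powr \<sigma>)" using Suc by (simp add: D_def \<rho>_def \<sigma>_def)
  define Z where "Z = max (Y 0 powr (\<rho> * \<rho>')) (Y 0 powr (\<sigma> * \<sigma>'))"
  have rr: "\<rho> * \<rho>' \<le> \<rho>" "\<sigma> \<le> \<sigma> * \<sigma>'" using rho rs sg by (auto simp: mult_le_cancel_left1 mult_le_cancel_left2)
  have g: "Y n powr t \<le> D powr \<sigma>' * Z" if t: "\<rho>' \<le> t" "t \<le> \<sigma>'" for t
  proof -
    have t0: "t > 0" using t rs by simp
    have "Y n powr t \<le> (D * max (Y 0 powr \<rho>) (Y 0 powr \<sigma>)) powr t" using IH Y0[of n] t0 by (intro powr_mono2) auto
    also have "\<dots> = D powr t * (max (Y 0 powr \<rho>) (Y 0 powr \<sigma>)) powr t" by (simp only: powr_mult)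
    also have "\<dots> \<le> D powr \<sigma>' * Z"
    proof (rule mult_mono)
      show "D powr t \<le> D powr \<sigma>'" using D1 t by (intro powr_mono) auto
      have "Y 0 powr (w * t) \<le> Z" if "\<rho> \<le> w" "w \<le> \<sigma>" for w
        unfolding Z_def
      proof (rule powr_between_le_max[OF Y0])
        show "\<rho> * \<rho>' \<le> w * t" using that t rho rs by (intro mult_mono) auto
        show "w * t \<le> \<sigma> * \<sigma>'" using that t t0 sg rho rs by (intro mult_mono) auto
      qed
      from this[of \<rho>] this[of \<sigma>] show "(max (Y 0 powr \<rho>) (Y 0 powr \<sigma>)) powr t \<le> Z"
        using rho sg by (simp add: max_def powr_powr)
    qed (auto simp: Z_def le_max_iff_disj)
    finally show ?thesis .
  qed
  have DD: "A n powr (1 / \<beta> n) * D powr \<sigma>' \<le> (\<Prod>j<Suc n. A j powr (1 / \<beta> j)) powr (\<Prod>j=1..<Suc n. st j / \<beta> j)"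
  proof (cases "n = 0")
    case True then show ?thesis by (simp add: D_def)
  next
    case False
    then have e: "(\<Prod>j=1..<Suc n. st j / \<beta> j) = (\<Prod>j=1..<n. st j / \<beta> j) * \<sigma>'" by (simp add: \<sigma>'_def prod.atLeastLessThan_Suc)
    have "A n powr (1 / \<beta> n) \<le> (A n powr (1 / \<beta> n)) powr (\<Prod>j=1..<Suc n. st j / \<beta> j)"
      using powr_mono[OF q1[of "{1..<Suc n}"] A1[of n]] A[of n] by simp
    moreover have "D powr \<sigma>' = (\<Prod>j<n. A j powr (1 / \<beta> j)) powr (\<Prod>j=1..<Suc n. st j / \<beta> j)"
      unfolding e D_def by (simp add: powr_powr)
    ultimately have "A n powr (1 / \<beta> n) * D powr \<sigma>' \<le> (A n powr (1 / \<beta> n)) powr (\<Prod>j=1..<Suc n. st j / \<beta> j) * (\<Prod>j<n. A j powr (1 / \<beta> j)) powr (\<Prod>j=1..<Suc n. st j / \<beta> j)"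
      by (simp add: mult_right_mono)
    then show ?thesis by (simp only: prod.lessThan_Suc powr_mult mult.commute)
  qed
  have "Y (Suc n) \<le> A n powr (1 / \<beta> n) * max (Y n powr \<rho>') (Y n powr \<sigma>')" using step[of n] by (simp add: \<rho>'_def \<sigma>'_def)
  also have "\<dots> \<le> A n powr (1 / \<beta> n) * (D powr \<sigma>' * Z)" using g[of \<rho>'] g[of \<sigma>'] rs by (intro mult_left_mono) auto
  also have "\<dots> = (A n powr (1 / \<beta> n) * D powr \<sigma>') * Z" by simp
  also have "\<dots> \<le> (\<Prod>j<Suc n. A j powr (1 / \<beta> j)) powr (\<Prod>j=1..<Suc n. st j / \<beta> j) * Z"
    using DD by (intro mult_right_mono) (auto simp: Z_def le_max_iff_disj)
  finally show ?case by (simp add: Z_def \<rho>_def \<sigma>_def \<rho>'_def \<sigma>'_def)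
qed

section \<open>One step of the iteration\<close>

context rotating_flow begin

context
  fixes r cbar :: real
  assumes r: "3 / (5 - a) < r" "r < 1" "r \<ge> 1 / (2 - a)" and cbar: "cbar > 0"
    and sob: "\<And>f. C1c_in U f \<Longrightarrow> Lp_on (3 * (r * (2 - a)) / (3 - r * (2 - a))) U f
          \<le> cbar * Lp_on (r * (2 - a)) U (\<lambda>x. norm (grad1 f x))"
begin

text \<open>The hypothesis relating \<open>a\<close> and \<open>\<kappa>\<close> says
  \<open>\<kappa>\<^sup>2 * \<alpha> \<le> s\<close>, so the bound in L^s from
  \<open>space_time_sobolev\<close> passes to exponent \<open>\<kappa>\<^sup>2 * \<alpha>\<close> at
  the price of a power of \<open>1 + m\<close>.\<close>

lemma moser_step:
  fixes p q :: "nat \<Rightarrow> real"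
  assumes T: "0 \<le> T1" "T1 < T2" "T2 < T" and al: "\<alpha> > 2" and kap: "\<kappa> > 1" "a \<le> (1 + lam r - \<kappa>\<^sup>2) * \<alpha>"
    and p: "\<And>i. i \<in> {1..4} \<Longrightarrow> 1 < p i \<and> p i < \<kappa>" and pq: "\<And>i. i \<in> {1..4} \<Longrightarrow> 1 / p i + 1 / q i = 1"
    and th: "0 < \<theta>" "\<theta> \<le> 1" "4 * (1 - a) \<le> (\<kappa> - 1) * \<theta> * \<alpha>"
    and W: "AE t in lborel. t \<in> {T2<..<T} \<longrightarrow> Wn r t \<le> 4 * chi * Es" and Es: "Es \<ge> 1"
  defines "Y \<equiv> Lp_on (\<kappa> * \<alpha>) (Q T1 T) v" and "M \<equiv> Mfun U \<Psi> chi a 0 T (q 1) (q 2) (q 3) (q 4)"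
    and "m \<equiv> measure lborel (Q 0 T)" and "E \<equiv> chi powr ((3 - a) * \<theta>)" and "s \<equiv> \<alpha> * (1 + lam r) - a"
  shows "Lp_on (\<kappa>\<^sup>2 * \<alpha>) (Q T2 T) v \<le> (1 + m) powr (1 / \<alpha>) * (8 * chi * Es * cb1 cbar) powr (1 / s) *
     ((1 + m) * (\<alpha> * (\<alpha> - 1)) * (1 / (T2 - T1) / 2 + CR * (M * E))) powr ((1 + lam r) / s)
     * (max (Y powr (\<alpha> - 2)) (Y powr (\<alpha> + 4 * (1 - a)))) powr ((1 + lam r) / s)"
proof -
  note lmb = lam_bounds[OF r cbar sob]
  have aa: "0 < a" "a < 1" by (rule a_bounds)+
  have chi: "chi > 0" using chi_ge by linarith
  have m: "m \<ge> 0" by (simp add: m_def)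
  define b where "b = \<kappa>\<^sup>2 * \<alpha>"
  have k2: "\<kappa>\<^sup>2 \<ge> 1" using kap by (simp add: one_le_power)
  have b: "\<alpha> \<le> b" "b \<le> s" using kap k2 al by (auto simp: b_def s_def algebra_simps mult_le_cancel_right1)
  have pos: "b > 0" "s > 0" using b al by auto
  define B where "B = 1 / (T2 - T1) * (LINT z:Q T1 T|lborel. v z powr \<alpha>) + (LINT z:Q T1 T|lborel. rhs \<alpha> z)"
  have B0: "B \<ge> 0" unfolding B_def
    using T rhs_nonneg[OF al] by (intro add_nonneg_nonneg mult_nonneg_nonneg LINT_nonneg) auto
  define X where "X = max (Y powr (\<alpha> - 2)) (Y powr (\<alpha> + 4 * (1 - a)))"
  define R0 where "R0 = (1 + m) * (\<alpha> * (\<alpha> - 1)) * (1 / (T2 - T1) / 2 + CR * (M * E))"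
  have X0: "X \<ge> 0" by (simp add: X_def le_max_iff_disj)
  have BX: "B \<le> R0 * X"
    unfolding B_def R0_def X_def Y_def M_def m_def E_def
    by (rule energy_bound[OF T(1,2) less_imp_le[OF T(3)] al kap(1) p pq th])
  note ea = energy_averaged[OF T(1,2) less_imp_le[OF T(3)] al, folded B_def]
  have T2: "0 < T2" using T by linarith
  have st: "(LINT z:Q T2 T|lborel. v z powr s) \<le> 8 * chi * Es * cb1 cbar * B powr (1 + lam r)"
    unfolding s_def by (rule space_time_sobolev[OF r cbar sob T2 T(3) al B0 ea W Es])
  have V0: "(LINT z:Q T2 T|lborel. v z powr t) \<ge> 0" for t by (rule LINT_nonneg) simp
  have Lv: "Lp_on t (Q T2 T) v = (LINT z:Q T2 T|lborel. v z powr t) powr (1 / t)" for t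
    by (simp add: Lp_on_def nonneg)
  have "(LINT z:Q T2 T|lborel. v z powr b) \<le> measure lborel (Q T2 T) powr (1 - b / s) * Lp_on s (Q T2 T) v powr b"
    using bcf_bmeas[OF UO bcfs(2), of T2 T] T2 b pos nonneg by (intro LINT_powr_le_Lp) auto
  \<comment> \<open>The generous exponent \<open>b / \<alpha> \<ge> 1\<close> turns into
    \<open>1 / \<alpha>\<close> after the b-th root, in step with the other constants.\<close>
  also have "\<dots> \<le> (1 + m) powr (b / \<alpha>) * Lp_on s (Q T2 T) v powr b"
  proof (rule mult_right_mono)
    have "measure lborel (Q T2 T) powr (1 - b / s) \<le> (1 + m) powr (1 - b / s)"
      using Q_measure_mono[of 0 T2 T T] T2 b pos by (intro powr_mono2) (auto simp: m_def)
    also have "\<dots> \<le> (1 + m) powr (b / \<alpha>)"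
    proof (rule powr_mono)
      have "1 - b / s \<le> 1" using pos by simp
      also have "1 \<le> b / \<alpha>" using b al by simp
      finally show "1 - b / s \<le> b / \<alpha>" .
    qed (use m in auto)
    finally show "measure lborel (Q T2 T) powr (1 - b / s) \<le> (1 + m) powr (b / \<alpha>)" .
  qed simp
  finally have "(LINT z:Q T2 T|lborel. v z powr b) powr (1 / b) \<le> ((1 + m) powr (b / \<alpha>) * Lp_on s (Q T2 T) v powr b) powr (1 / b)"
    using V0 pos by (intro powr_mono2) auto
  also have "\<dots> = (1 + m) powr (1 / \<alpha>) * Lp_on s (Q T2 T) v"
  proof -
    have e: "b / \<alpha> * (1 / b) = 1 / \<alpha>" "b * (1 / b) = 1" using pos by auto
    show ?thesis by (simp only: powr_mult powr_powr e) (simp add: Lp_on_nonneg)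
  qed
  also have "\<dots> \<le> (1 + m) powr (1 / \<alpha>) * ((8 * chi * Es * cb1 cbar) powr (1 / s) * (R0 powr ((1 + lam r) / s) * X powr ((1 + lam r) / s)))"
  proof (rule mult_left_mono)
    have "Lp_on s (Q T2 T) v \<le> (8 * chi * Es * cb1 cbar * B powr (1 + lam r)) powr (1 / s)"
      unfolding Lv using st V0 pos by (intro powr_mono2) auto
    also have "\<dots> = (8 * chi * Es * cb1 cbar) powr (1 / s) * B powr ((1 + lam r) / s)" by (simp add: powr_mult powr_powr)
    also have "B powr ((1 + lam r) / s) \<le> (R0 * X) powr ((1 + lam r) / s)"
      using BX B0 pos lmb(2) by (intro powr_mono2) auto
    also have "(R0 * X) powr ((1 + lam r) / s) = R0 powr ((1 + lam r) / s) * X powr ((1 + lam r) / s)" by (simp only: powr_mult)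
    finally show "Lp_on s (Q T2 T) v \<le> (8 * chi * Es * cb1 cbar) powr (1 / s) * (R0 powr ((1 + lam r) / s) * X powr ((1 + lam r) / s))"
      by (simp add: mult_left_mono)
  qed simp
  finally show ?thesis unfolding b_def[symmetric] X_def[symmetric] R0_def[symmetric] unfolding Lv[of b] by (simp only: mult.assoc)
qed

end
end

section \<open>From all exponents to the supremum, and the total constant\<close>

text \<open>If \<open>f z\<close> exceeded \<open>L\<close>, continuity would give an open set of
  positive measure on which \<open>f\<close> stays above some \<open>l > L\<close>. Its measure to
  the power \<open>1 / p n\<close> tends to 1, which forces \<open>l \<le> L\<close>.\<close>

lemma le_of_Lp_on_tendsto:
  fixes f :: "(real^3) \<times> real \<Rightarrow> real"
  assumes A: "open A" and fin: "emeasure lborel A < \<infinity>" and f: "continuous_on A f" "\<And>z. z \<in> A \<Longrightarrow> f z \<ge> 0" 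
    and int: "\<And>n. set_integrable lborel A (\<lambda>z. f z powr p n)"
    and p: "filterlim p at_top sequentially" and le: "\<And>n. Lp_on (p n) A f \<le> c n" and c: "c \<longlonglongrightarrow> L" and z: "z \<in> A"
  shows "f z \<le> L"
proof (rule ccontr)
  assume "\<not> f z \<le> L"
  have c0: "c n \<ge> 0" for n using le[of n] Lp_on_nonneg[of "p n" A f] by linarith
  then have L0: "L \<ge> 0" using c by (intro LIMSEQ_le_const) auto
  obtain l where l: "L < l" "l < f z" using \<open>\<not> f z \<le> L\<close> dense[of L "f z"] by auto
  define W where "W = A \<inter> f -` {l<..}"
  have W: "open W" "z \<in> W" "W \<subseteq> A"
    using continuous_open_preimage[OF f(1) A, of "{l<..}"] z l by (auto simp: W_def)
  define \<delta> where "\<delta> = measure lborel W"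
  have fW: "emeasure lborel W < \<infinity>" using W(3) fin A by (intro le_less_trans[OF emeasure_mono fin]) auto
  have d: "\<delta> > 0"
  proof -
    obtain e where e: "e > 0" "ball z e \<subseteq> W" using W open_contains_ball by metis
    have "0 < measure lborel (ball z e)" using e(1) by (simp add: content_ball_pos)
    also have "\<dots> \<le> \<delta>" unfolding \<delta>_def
      using e W fW by (intro measure_mono_fmeasurable) (auto simp: fmeasurable_def)
    finally show ?thesis .
  qed
  have ev: "eventually (\<lambda>n. l * \<delta> powr (1 / p n) \<le> c n) sequentially"
    using filterlim_at_top_dense[THEN iffD1, OF p, rule_format, of 0]
  proof eventually_elim
    case (elim n)
    have "(LINT w:A|lborel. \<bar>f w\<bar> powr p n) = (LINT w:A|lborel. f w powr p n)"
      using A f by (intro set_lebesgue_integral_cong) auto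
    moreover have "l powr p n * \<delta> \<le> (LINT w:A|lborel. f w powr p n)"
    proof -
      have "(\<integral>w. l powr p n * indicator W w \<partial>lborel) \<le> (LINT w:A|lborel. f w powr p n)"
        unfolding set_lebesgue_integral_def
      proof (rule integral_mono')
        show "integrable lborel (\<lambda>w. indicator A w *\<^sub>R f w powr p n)" using int by (simp add: set_integrable_def)
        show "l powr p n * indicator W w \<le> indicator A w *\<^sub>R f w powr p n" for w
          using l L0 elim by (auto simp: W_def intro!: powr_mono2 split: split_indicator)
      qed (auto split: split_indicator)
      then show ?thesis using W fW by (simp add: \<delta>_def)
    qed
    ultimately have "(l powr p n * \<delta>) powr (1 / p n) \<le> Lp_on (p n) A f"
      unfolding Lp_on_def using elim d by (intro powr_mono2) auto
    moreover have "(l powr p n * \<delta>) powr (1 / p n) = l * \<delta> powr (1 / p n)"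
      using elim l L0 by (simp add: powr_mult powr_powr)
    ultimately show ?case using le[of n] by simp
  qed
  have "(\<lambda>n. l * \<delta> powr (1 / p n)) \<longlonglongrightarrow> l * \<delta> powr 0"
    using d by (intro tendsto_intros tendsto_divide_0[OF tendsto_const] filterlim_at_top_imp_at_infinity[OF p]) auto
  then have "l \<le> L" using d tendsto_le[OF _ c _ ev] by simp
  then show False using l by simp
qed

text \<open>This pays for the powers of \<open>chi\<close> lost in \<open>superlinear_term\<close>.
  With x = 1 / \<kappa>, the left side is (3 - a) \<mu>2 times the sum of x^(2 j), the total loss;
  the right side is 1 / kh times the sum of j x^j, the surplus available. The coefficient
  \<open>(3 - a) * (1 + a / L) * (L - a / 2)\<close> is at most 5.\<close>

lemma moser_numeric:
  fixes a L \<kappa> :: real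
  assumes a: "0 < a" "a < 1" and L: "1 < L" "L < (5 - a) / 3" and k: "1 < \<kappa>" "\<kappa>\<^sup>2 < L"
  shows "(3 - a) * (1 + a / L) * (\<kappa>\<^sup>2 / (\<kappa>\<^sup>2 - 1)) \<le> 1 / (L - a / 2) * (\<kappa> / (\<kappa> - 1)\<^sup>2)"
proof -
  have kh: "L - a / 2 > 0" using a L by simp
  have "(1 + a / L) * (L - a / 2) = L + a / 2 - a\<^sup>2 / (2 * L)" using L by (simp add: field_simps power2_eq_square)
  also have "\<dots> \<le> L + a / 2" using L by simp
  also have "\<dots> \<le> 5 / 3 + a / 6" using L by (simp add: field_simps)
  finally have 1: "(1 + a / L) * (L - a / 2) \<le> 5 / 3 + a / 6" .
  have "(3 - a) * ((1 + a / L) * (L - a / 2)) \<le> (3 - a) * (5 / 3 + a / 6)" using 1 a by (intro mult_left_mono) auto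
  also have "\<dots> = 5 - (7 * a / 6 + a * a / 6)" by (simp add: field_simps)
  also have "\<dots> \<le> 5"
  proof -
    have "0 \<le> 7 * a / 6 + a * a / 6" using a by (intro add_nonneg_nonneg divide_nonneg_nonneg mult_nonneg_nonneg) auto
    then show ?thesis by simp
  qed
  finally have 5: "(3 - a) * ((1 + a / L) * (L - a / 2)) \<le> 5" .
  have "(5 - a) / 3 < 5 / 3" using a by simp
  then have k53: "\<kappa>\<^sup>2 < 5 / 3" using L k by linarith
  have k13: "\<kappa> < 13 / 10"
  proof (rule ccontr)
    assume "\<not> \<kappa> < 13 / 10"
    then have "(13 / 10)\<^sup>2 \<le> \<kappa>\<^sup>2" by (intro power_mono) auto
    then show False using k53 by (simp add: power2_eq_square)
  qed
  \<comment> \<open>Bounds \<open>\<kappa> * \<kappa>\<close> by a linear function on the interval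
    from 1 to 13/10, which suffices for
    \<open>5 * (\<kappa> * (\<kappa> - 1)) \<le> \<kappa> + 1\<close>.\<close>
  have "(\<kappa> - 1) * (\<kappa> - 13 / 10) \<le> 0" using k k13 by (intro mult_nonneg_nonpos) auto
  moreover define K where "K = \<kappa> * \<kappa>"
  have "(\<kappa> - 1) * (\<kappa> - 13 / 10) = K - 23 / 10 * \<kappa> + 13 / 10" by (simp add: K_def field_simps)
  ultimately have "5 * K - 5 * \<kappa> \<le> \<kappa> + 1" using k13 by simp
  moreover have "5 * (\<kappa> * (\<kappa> - 1)) = 5 * K - 5 * \<kappa>" by (simp add: K_def algebra_simps)
  ultimately have "5 * (\<kappa> * (\<kappa> - 1)) \<le> \<kappa> + 1" by simp
  then have "5 \<le> (\<kappa> + 1) / (\<kappa> * (\<kappa> - 1))" using k by (simp add: pos_le_divide_eq)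
  with 5 have 6: "(3 - a) * ((1 + a / L) * (L - a / 2)) \<le> (\<kappa> + 1) / (\<kappa> * (\<kappa> - 1))" by linarith
  have kk: "\<kappa>\<^sup>2 - 1 = (\<kappa> - 1) * (\<kappa> + 1)" by (simp add: power2_eq_square algebra_simps)
  have pos: "\<kappa>\<^sup>2 / (\<kappa>\<^sup>2 - 1) > 0" using k unfolding kk by (intro divide_pos_pos mult_pos_pos) auto
  have "(3 - a) * (1 + a / L) * (\<kappa>\<^sup>2 / (\<kappa>\<^sup>2 - 1)) * (L - a / 2) = (3 - a) * ((1 + a / L) * (L - a / 2)) * (\<kappa>\<^sup>2 / (\<kappa>\<^sup>2 - 1))" by simp
  also have "\<dots> \<le> (\<kappa> + 1) / (\<kappa> * (\<kappa> - 1)) * (\<kappa>\<^sup>2 / (\<kappa>\<^sup>2 - 1))" using 6 pos by (intro mult_right_mono) auto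
  also have "\<dots> = \<kappa> / (\<kappa> - 1)\<^sup>2"
  proof -
    have "w / (p * n) * (p\<^sup>2 / (n * w)) = p / n\<^sup>2" if "p > 0" "n > 0" "w > 0" for p n w :: real
      using that by (simp add: power2_eq_square)
    from this[of \<kappa> "\<kappa> - 1" "\<kappa> + 1"] show ?thesis using k unfolding kk by simp
  qed
  finally have "(3 - a) * (1 + a / L) * (\<kappa>\<^sup>2 / (\<kappa>\<^sup>2 - 1)) * (L - a / 2) \<le> \<kappa> / (\<kappa> - 1)\<^sup>2" .
  then have "(3 - a) * (1 + a / L) * (\<kappa>\<^sup>2 / (\<kappa>\<^sup>2 - 1)) \<le> \<kappa> / (\<kappa> - 1)\<^sup>2 / (L - a / 2)"
    by (simp only: pos_le_divide_eq[OF kh])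
  then show ?thesis by (simp add: mult.commute)
qed

text \<open>Logarithms turn the product into sums of x^(2 j), j x^j and x^j with x = 1 / \<kappa>,
  for the losses in \<open>chi\<close>, for \<open>(2 * \<kappa>) powr (real j * \<mu>3)\<close> and
  for \<open>B\<close>. The right side carries the sum of (j + 1) x^j; its part with j x^j absorbs
  the first two, because \<open>B\<close> contains
  \<open>(2 * \<kappa>) powr \<mu>3 * chi powr (1 / kh)\<close>.\<close>

lemma moser_product:
  fixes \<kappa> \<alpha>0 chi B c \<mu>2 \<mu>3 kh :: real
  assumes k: "\<kappa> > 1" and al: "\<alpha>0 > 0" and chi: "chi \<ge> 1" and c: "c \<ge> 0" "\<mu>2 \<ge> 0" "\<mu>3 \<ge> 0" "kh > 0"
    and H: "c * \<mu>2 * (\<kappa>\<^sup>2 / (\<kappa>\<^sup>2 - 1)) \<le> 1 / kh * (\<kappa> / (\<kappa> - 1)\<^sup>2)"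
    and B: "(2 * \<kappa>) powr \<mu>3 * chi powr (1 / kh) \<le> B"
  shows "(\<Prod>j<n. ((chi powr (c * (1 / \<kappa>)^j)) powr \<mu>2 * (2 * \<kappa>) powr (real j * \<mu>3) * B) powr (1 / (\<kappa>^j * \<alpha>0)))
     \<le> B powr (\<kappa>\<^sup>2 / (\<alpha>0 * (\<kappa> - 1)\<^sup>2))"
proof -
  define x where "x = 1 / \<kappa>"
  have x: "0 < x" "x < 1" using k by (auto simp: x_def)
  define lc where "lc = ln chi"
  define l2 where "l2 = ln (2 * \<kappa>)"
  define lb where "lb = ln B"
  have lc: "lc \<ge> 0" and l2: "l2 \<ge> 0" using chi k by (auto simp: lc_def l2_def)
  have Bpos: "B > 0" using B k chi by (smt (verit) mult_pos_pos powr_gt_zero)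
  have lb: "\<mu>3 * l2 + lc / kh \<le> lb"
  proof -
    have "ln ((2 * \<kappa>) powr \<mu>3 * chi powr (1 / kh)) \<le> ln B" using B k chi Bpos by (subst ln_le_cancel_iff) auto
    then show ?thesis using k chi by (simp add: ln_mult ln_powr lb_def l2_def lc_def)
  qed
  have lb0: "lb \<ge> 0" using lb lc l2 c by (smt (verit) divide_nonneg_pos mult_nonneg_nonneg)
  have trm: "((chi powr (c * (1 / \<kappa>)^j)) powr \<mu>2 * (2 * \<kappa>) powr (real j * \<mu>3) * B) powr (1 / (\<kappa>^j * \<alpha>0))
     = exp (x^j / \<alpha>0 * (c * \<mu>2 * lc * x^j + real j * \<mu>3 * l2 + lb))" for j
  proof -
    let ?A = "(chi powr (c * (1 / \<kappa>)^j)) powr \<mu>2 * (2 * \<kappa>) powr (real j * \<mu>3) * B"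
    have Ap: "?A > 0" using chi k Bpos by (intro mult_pos_pos) auto
    have "A powr y = exp (y * ln A)" if "A > 0" for A y :: real using that by (simp add: powr_def)
    from this[OF Ap] have "?A powr (1 / (\<kappa>^j * \<alpha>0)) = exp (1 / (\<kappa>^j * \<alpha>0) * ln ?A)" .
    moreover have "ln ?A = c * \<mu>2 * lc * x^j + real j * \<mu>3 * l2 + lb"
      using chi k Bpos by (simp add: ln_mult ln_powr powr_powr lc_def l2_def lb_def x_def)
    moreover have "1 / (\<kappa>^j * \<alpha>0) = x^j / \<alpha>0" by (simp add: x_def power_divide)
    ultimately show ?thesis by simp
  qed
  \<comment> \<open>The sum of (j + 1) x^j split into those of j x^j and x^j, in closed
    form.\<close>
  have id: "1 / (1 - x)\<^sup>2 = x / (1 - x)\<^sup>2 + 1 / (1 - x)"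
  proof -
    have "1 / (1 - x)\<^sup>2 = (x + (1 - x)) / (1 - x)\<^sup>2" by simp
    also have "\<dots> = x / (1 - x)\<^sup>2 + (1 - x) / (1 - x)\<^sup>2" by (rule add_divide_distrib)
    also have "(1 - x) / (1 - x)\<^sup>2 = 1 / (1 - x)" using x by (simp add: power2_eq_square)
    finally show ?thesis .
  qed
  have g1: "(\<Sum>j<n. x^j) \<le> 1 / (1 - x)"
    using sum_le_suminf[of "\<lambda>j. x^j" "{..<n}"] geometric_sums[of x] x by (simp add: sums_iff)
  have g2: "(\<Sum>j<n. (x\<^sup>2)^j) \<le> 1 / (1 - x\<^sup>2)"
  proof -
    have "0 \<le> x\<^sup>2" "x\<^sup>2 < 1" using x by (auto simp: power_less_one_iff)
    then show ?thesis using sum_le_suminf[of "\<lambda>j. (x\<^sup>2)^j" "{..<n}"] geometric_sums[of "x\<^sup>2"] by (simp add: sums_iff)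
  qed
  have g3: "(\<Sum>j<n. real j * x^j) \<le> x / (1 - x)\<^sup>2"
  proof -
    have "(\<lambda>j. real (Suc j) * x^j - x^j) sums (1 / (1 - x)\<^sup>2 - 1 / (1 - x))"
      using x by (intro sums_diff geometric_deriv_sums geometric_sums) auto
    moreover have "real (Suc j) * x^j - x^j = real j * x^j" for j by (simp add: algebra_simps)
    moreover have "1 / (1 - x)\<^sup>2 - 1 / (1 - x) = x / (1 - x)\<^sup>2" using id by simp
    ultimately have s: "(\<lambda>j. real j * x^j) sums (x / (1 - x)\<^sup>2)" by simp
    then show ?thesis using sum_le_suminf[of "\<lambda>j. real j * x^j" "{..<n}"] x by (simp add: sums_iff)
  qed
  have xk: "1 / (1 - x\<^sup>2) = \<kappa>\<^sup>2 / (\<kappa>\<^sup>2 - 1)" "x / (1 - x)\<^sup>2 = \<kappa> / (\<kappa> - 1)\<^sup>2" "1 / (1 - x)\<^sup>2 = \<kappa>\<^sup>2 / (\<kappa> - 1)\<^sup>2"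
  proof -
    have "1 - x\<^sup>2 = (\<kappa>\<^sup>2 - 1) / \<kappa>\<^sup>2" "1 - x = (\<kappa> - 1) / \<kappa>" using k by (auto simp: x_def power_divide diff_divide_distrib)
    then show "1 / (1 - x\<^sup>2) = \<kappa>\<^sup>2 / (\<kappa>\<^sup>2 - 1)" "x / (1 - x)\<^sup>2 = \<kappa> / (\<kappa> - 1)\<^sup>2" "1 / (1 - x)\<^sup>2 = \<kappa>\<^sup>2 / (\<kappa> - 1)\<^sup>2"
      using k by (auto simp: x_def power_divide power2_eq_square)
  qed
  have "(\<Sum>j<n. x^j / \<alpha>0 * (c * \<mu>2 * lc * x^j + real j * \<mu>3 * l2 + lb))
    = (c * \<mu>2 * lc * (\<Sum>j<n. (x\<^sup>2)^j) + \<mu>3 * l2 * (\<Sum>j<n. real j * x^j) + lb * (\<Sum>j<n. x^j)) / \<alpha>0"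
    by (simp add: sum_distrib_left sum.distrib[symmetric] sum_divide_distrib power_mult[symmetric] mult_2 power_add algebra_simps add_divide_distrib power2_eq_square power_mult_distrib)
  also have "\<dots> \<le> (c * \<mu>2 * lc * (1 / (1 - x\<^sup>2)) + \<mu>3 * l2 * (x / (1 - x)\<^sup>2) + lb * (1 / (1 - x))) / \<alpha>0"
    using g1 g2 g3 c lc l2 lb0 al by (intro divide_right_mono add_mono mult_left_mono) auto
  also have "\<dots> \<le> (lb * (1 / (1 - x)\<^sup>2)) / \<alpha>0"
  proof (rule divide_right_mono)
    have "lc * (c * \<mu>2 * (1 / (1 - x\<^sup>2))) \<le> lc * (1 / kh * (x / (1 - x)\<^sup>2))"
      using H lc unfolding xk by (intro mult_left_mono) auto
    moreover have "(\<mu>3 * l2 + lc / kh) * (x / (1 - x)\<^sup>2) \<le> lb * (x / (1 - x)\<^sup>2)" using lb x by (intro mult_right_mono) auto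
    moreover have "(\<mu>3 * l2 + lc / kh) * (x / (1 - x)\<^sup>2) = \<mu>3 * l2 * (x / (1 - x)\<^sup>2) + lc * (1 / kh * (x / (1 - x)\<^sup>2))"
      by (simp only: distrib_right) simp
    moreover have "c * \<mu>2 * lc * (1 / (1 - x\<^sup>2)) = lc * (c * \<mu>2 * (1 / (1 - x\<^sup>2)))" by simp
    moreover have "lb * (1 / (1 - x)\<^sup>2) = lb * (x / (1 - x)\<^sup>2) + lb * (1 / (1 - x))" unfolding id by (simp only: distrib_left)
    ultimately show "c * \<mu>2 * lc * (1 / (1 - x\<^sup>2)) + \<mu>3 * l2 * (x / (1 - x)\<^sup>2) + lb * (1 / (1 - x)) \<le> lb * (1 / (1 - x)\<^sup>2)"
      by linarith
  qed (use al in simp)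
  also have "\<dots> = \<kappa>\<^sup>2 / (\<alpha>0 * (\<kappa> - 1)\<^sup>2) * lb" unfolding xk by (simp add: mult_ac)
  finally have "exp (\<Sum>j<n. x^j / \<alpha>0 * (c * \<mu>2 * lc * x^j + real j * \<mu>3 * l2 + lb)) \<le> exp (\<kappa>\<^sup>2 / (\<alpha>0 * (\<kappa> - 1)\<^sup>2) * lb)" by simp
  then show ?thesis unfolding trm exp_sum[OF finite_lessThan] using Bpos by (simp add: powr_def lb_def)
qed

text \<open>The factors are 1 + O(1 / \<beta>_j) and \<beta>_j grows geometrically, so both products
  converge absolutely. The factors \<open>st j / \<beta> j\<close> are at least 1, so their partial
  products stay below the limit, and dividing by the first one gives the third claim.\<close>

lemma moser_exponent_products:
  fixes a \<kappa> \<alpha>0 :: real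
  assumes a: "0 < a" "a < 1" and k: "\<kappa> > 1" and al: "\<alpha>0 > 2"
  defines "\<beta> \<equiv> \<lambda>j::nat. \<kappa>^j * \<alpha>0"
  defines "rt \<equiv> \<lambda>j. \<beta> j - 2" and "st \<equiv> \<lambda>j. (\<beta> j + 4 * (1 - a)) * (1 + a / (\<beta> j - a))"
  shows "(\<lambda>n. \<Prod>j<n. rt j / \<beta> j) \<longlonglongrightarrow> prodinf (\<lambda>j. rt j / \<beta> j)"
    and "(\<lambda>n. \<Prod>j<n. st j / \<beta> j) \<longlonglongrightarrow> prodinf (\<lambda>j. st j / \<beta> j)"
    and "(\<Prod>j=1..<n. st j / \<beta> j) \<le> prodinf (\<lambda>j. st j / \<beta> j) * \<beta> 0 / st 0"
    and "\<beta> j > 2" "0 < rt j" "rt j \<le> \<beta> j" "\<beta> j \<le> st j"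
proof -
  have b2: "\<beta> j > 2" "\<beta> j \<ge> \<alpha>0" for j
  proof -
    have "1 * \<alpha>0 \<le> \<kappa>^j * \<alpha>0" using k al by (intro mult_right_mono) (auto intro: one_le_power)
    then show "\<beta> j \<ge> \<alpha>0" by (simp add: \<beta>_def)
    then show "\<beta> j > 2" using al by linarith
  qed
  show b: "\<beta> j > 2" "0 < rt j" "rt j \<le> \<beta> j" for j using b2[of j] by (auto simp: rt_def)
  have st: "\<beta> j \<le> st j" for j
  proof -
    have "\<beta> j * 1 \<le> st j" unfolding st_def using b2[of j] a by (intro mult_mono) auto
    then show ?thesis by simp
  qed
  then show "\<beta> j \<le> st j" .
  have sm: "summable (\<lambda>j. C / \<beta> j)" for C
  proof -
    have "summable (\<lambda>j. C / \<alpha>0 * (1 / \<kappa>)^j)" using k by (intro summable_mult summable_geometric) auto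
    moreover have "(\<lambda>j. C / \<alpha>0 * (1 / \<kappa>)^j) = (\<lambda>j. C / \<beta> j)" by (simp add: \<beta>_def power_divide mult.commute fun_eq_iff)
    ultimately show ?thesis by (simp only:)
  qed
  have lim: "(\<lambda>n. \<Prod>j<n. f j) \<longlonglongrightarrow> prodinf f" if "\<And>j. \<bar>f j - 1\<bar> \<le> C / \<beta> j" for f :: "nat \<Rightarrow> real" and C
  proof -
    have "summable (\<lambda>j. norm (f j - 1))"
      by (rule summable_comparison_test'[OF sm[of C], of 0]) (use that in auto)
    then have "convergent_prod f"
      by (intro abs_convergent_prod_imp_convergent_prod summable_imp_abs_convergent_prod)
    then have "(\<lambda>n. \<Prod>j\<le>n. f j) \<longlonglongrightarrow> prodinf f" by (rule convergent_prod_LIMSEQ)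
    then have "(\<lambda>n. \<Prod>j<Suc n. f j) \<longlonglongrightarrow> prodinf f" by (simp only: lessThan_Suc_atMost)
    then show ?thesis by (rule LIMSEQ_imp_Suc)
  qed
  show "(\<lambda>n. \<Prod>j<n. rt j / \<beta> j) \<longlonglongrightarrow> prodinf (\<lambda>j. rt j / \<beta> j)"
  proof (rule lim[where C=2])
    show "\<bar>rt j / \<beta> j - 1\<bar> \<le> 2 / \<beta> j" for j using b2[of j] by (simp add: rt_def diff_divide_distrib)
  qed
  show l: "(\<lambda>n. \<Prod>j<n. st j / \<beta> j) \<longlonglongrightarrow> prodinf (\<lambda>j. st j / \<beta> j)"
  \<comment> \<open>10 = 4 + 2 + 4, from expanding the two factors with
    \<open>a / (\<beta> j - a) \<le> 2 / \<beta> j \<le> 1\<close>.\<close>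
  proof (rule lim[where C=10])
    fix j
    have bp: "\<beta> j > 2" by (rule b2)
    have "a / (\<beta> j - a) \<le> 1 / (\<beta> j / 2)" using a bp by (intro frac_le) auto
    then have y: "0 \<le> a / (\<beta> j - a)" "a / (\<beta> j - a) \<le> 2 / \<beta> j" using a bp by auto
    have z: "0 \<le> 4 * (1 - a) / \<beta> j" "4 * (1 - a) / \<beta> j \<le> 4 / \<beta> j" using a bp by (auto intro!: divide_right_mono)
    have "2 / \<beta> j \<le> 1" using bp by simp
    then have "a / (\<beta> j - a) \<le> 1" using y(2) by linarith
    then have "(4 * (1 - a) / \<beta> j) * (a / (\<beta> j - a)) \<le> 4 / \<beta> j * 1" using y z bp by (intro mult_mono) auto
    moreover have "st j / \<beta> j - 1 = 4 * (1 - a) / \<beta> j + a / (\<beta> j - a) + (4 * (1 - a) / \<beta> j) * (a / (\<beta> j - a))"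
    proof -
      have "(B + c) * (1 + d) / B - 1 = c / B + d + c / B * d" if "B > 0" for B c d :: real using that by (simp add: field_simps)
      from this[of "\<beta> j" "4 * (1 - a)" "a / (\<beta> j - a)"] show ?thesis using bp by (simp add: st_def)
    qed
    moreover have "4 / \<beta> j + 2 / \<beta> j + 4 / \<beta> j = 10 / \<beta> j" by simp
    moreover have "0 \<le> st j / \<beta> j - 1" using st[of j] bp by simp
    ultimately show "\<bar>st j / \<beta> j - 1\<bar> \<le> 10 / \<beta> j" using y z by linarith
  qed
  have st1: "1 \<le> st j / \<beta> j" for j using st[of j] b2[of j] by simp
  have "(\<Prod>j<Suc n. st j / \<beta> j) \<le> prodinf (\<lambda>j. st j / \<beta> j)"
  proof (rule incseq_le[OF incseq_SucI l])
    fix n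
    have "0 \<le> (\<Prod>j<n. st j / \<beta> j)" using st1 by (intro prod_nonneg) (auto intro: order_trans[of 0 1])
    then show "(\<Prod>j<n. st j / \<beta> j) \<le> (\<Prod>j<Suc n. st j / \<beta> j)"
      using mult_left_mono[OF st1[of n]] by simp
  qed
  moreover have "(\<Prod>j<Suc n. st j / \<beta> j) \<ge> st 0 / \<beta> 0 * (\<Prod>j=1..<n. st j / \<beta> j)"
  proof -
    have "{..<Suc n} = insert 0 {1..<Suc n}" by auto
    then have e: "(\<Prod>j<Suc n. st j / \<beta> j) = st 0 / \<beta> 0 * (\<Prod>j=1..<Suc n. st j / \<beta> j)" by simp
    have "(\<Prod>j=1..<n. st j / \<beta> j) \<le> (\<Prod>j=1..<Suc n. st j / \<beta> j)"
    proof (cases "n = 0")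
      case False
      have "0 \<le> (\<Prod>j=1..<n. st j / \<beta> j)" using st1 by (intro prod_nonneg) (auto intro: order_trans[of 0 1])
      then show ?thesis using False mult_left_mono[OF st1[of n]] by (simp add: prod.atLeastLessThan_Suc)
    qed simp
    then show ?thesis unfolding e using st1[of 0] by (intro mult_left_mono) auto
  qed
  ultimately have "st 0 / \<beta> 0 * (\<Prod>j=1..<n. st j / \<beta> j) \<le> prodinf (\<lambda>j. st j / \<beta> j)" by linarith
  then show "(\<Prod>j=1..<n. st j / \<beta> j) \<le> prodinf (\<lambda>j. st j / \<beta> j) * \<beta> 0 / st 0"
    using st[of 0] b2[of 0] by (simp add: field_simps)
qed

section \<open>Running the iteration and assembling the theorem\<close>

context rotating_flow begin

context
  fixes r cbar :: real
  assumes r: "3 / (5 - a) < r" "r < 1" "r \<ge> 1 / (2 - a)" and cbar: "cbar > 0"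
    and sob: "\<And>f. C1c_in U f \<Longrightarrow> Lp_on (3 * (r * (2 - a)) / (3 - r * (2 - a))) U f
          \<le> cbar * Lp_on (r * (2 - a)) U (\<lambda>x. norm (grad1 f x))"
begin

text \<open>Each norm of the iteration dominates the one over the final open cylinder, where
  \<open>v\<close> is continuous, and the exponents \<open>\<kappa> * \<beta> n\<close> tend to
  infinity; hence a pointwise bound.\<close>

lemma moser_sup_bound:
  fixes p q :: "nat \<Rightarrow> real" and \<kappa> \<alpha>0 T \<sigma> Es :: real
  assumes kap: "1 < \<kappa>" "\<kappa>\<^sup>2 < 1 + lam r"
    and p: "\<And>i. i \<in> {1..4} \<Longrightarrow> 1 < p i \<and> p i < \<kappa>" and pq: "\<And>i. i \<in> {1..4} \<Longrightarrow> 1 / p i + 1 / q i = 1"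
    and al: "\<alpha>0 > 2" "4 * (1 - a) \<le> (\<kappa> - 1) * \<alpha>0" "a \<le> (1 + lam r - \<kappa>\<^sup>2) * \<alpha>0" "a \<le> \<alpha>0 * lam r"
    and T: "T > 0" and sg: "0 < \<sigma>" "\<sigma> < 1"
    and W: "AE t in lborel. t \<in> {\<sigma> * T / 2<..<T} \<longrightarrow> Wn r t \<le> 4 * chi * Es" and Es: "Es \<ge> 1"
    and z: "z \<in> Q (\<sigma> * T) T"
  defines "\<beta> \<equiv> \<lambda>j::nat. \<kappa>^j * \<alpha>0"
  defines "rt \<equiv> \<lambda>j. \<beta> j - 2" and "st \<equiv> \<lambda>j. (\<beta> j + 4 * (1 - a)) * (1 + a / (\<beta> j - a))"
  defines "M \<equiv> Mfun U \<Psi> chi a 0 T (q 1) (q 2) (q 3) (q 4)" and "m \<equiv> measure lborel (Q 0 T)"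
    and "L \<equiv> 1 + lam r"
  defines "\<mu>2 \<equiv> 1 + a / L" and "\<mu>3 \<equiv> 2 + a / L" and "kh \<equiv> L - a / 2"
  defines "B \<equiv> ((2 * \<kappa>) powr \<mu>3 * (2 powr (4 + 1 / r) * cb1 cbar * (c16 N coef alb)\<^sup>2)) * \<alpha>0 powr \<mu>3 * chi powr (1 / kh) * (1 + 1 / (\<sigma> * T)) powr \<mu>2
                   * (1 + m) powr \<mu>3 * M powr \<mu>2 * Es powr (1 / kh)"
    and "nrm \<equiv> Lp_on (\<kappa> * \<alpha>0) (Q 0 T) v"
  shows "v z \<le> B powr (prodinf (\<lambda>j. st j / \<beta> j) * \<beta> 0 / st 0 * (\<kappa>\<^sup>2 / (\<alpha>0 * (\<kappa> - 1)\<^sup>2)))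
       * max (nrm powr (prodinf (\<lambda>j. rt j / \<beta> j))) (nrm powr (prodinf (\<lambda>j. st j / \<beta> j)))"
proof -
  note lmb = lam_bounds[OF r cbar sob]
  have aa: "0 < a" "a < 1" by (rule a_bounds)+
  have L: "1 < L" "L < 2" "L < (5 - a) / 3" using lmb by (auto simp: L_def)
  have ep: "(\<lambda>n. \<Prod>j<n. rt j / \<beta> j) \<longlonglongrightarrow> prodinf (\<lambda>j. rt j / \<beta> j)"
    "(\<lambda>n. \<Prod>j<n. st j / \<beta> j) \<longlonglongrightarrow> prodinf (\<lambda>j. st j / \<beta> j)"
    "\<And>n. (\<Prod>j=1..<n. st j / \<beta> j) \<le> prodinf (\<lambda>j. st j / \<beta> j) * \<beta> 0 / st 0"
    "\<And>j. \<beta> j > 2" "\<And>j. 0 < rt j" "\<And>j. rt j \<le> \<beta> j" "\<And>j. \<beta> j \<le> st j"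
    unfolding rt_def st_def \<beta>_def by (rule moser_exponent_products[OF aa kap(1) al(1)])+
  have c16: "c16 N coef alb \<ge> 1"
  proof -
    have "CR \<ge> 1" unfolding CR_def using c_pos(3) K0_pos by simp
    then show ?thesis using CR_le by linarith
  qed
  have CR0: "CR \<ge> 0" unfolding CR_def using c_pos(3) K0_pos by simp
  have M1: "M \<ge> 1" unfolding M_def Mfun_eq using M_nonneg by (simp add: add_nonneg_nonneg)
  have m0: "m \<ge> 0" by (simp add: m_def)
  have cb: "cb1 cbar \<ge> 1" by (simp add: cb1_def)
  have d: "\<sigma> * T > 0" using sg T by simp
  have khp: "kh > 0" using L aa by (simp add: kh_def)
  have r0: "0 < r" using lmb(1) by simp
  \<comment> \<open>\<open>th j * \<beta> j = \<alpha>0\<close>, so one condition on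
    \<open>\<alpha>0\<close> validates the superlinear estimate at every step, and the losses
    \<open>E j\<close> have geometrically decaying exponents.\<close>
  define th where "th j = (1 / \<kappa>)^j" for j :: nat
  have th: "0 < th j" "th j \<le> 1" for j using kap by (auto simp: th_def power_le_one)
  define E where "E j = chi powr ((3 - a) * th j)" for j
  have E1: "E j \<ge> 1" for j unfolding E_def using chi_ge aa th[of j] by (intro ge_one_powr_ge_zero) auto
  \<comment> \<open>Runs from \<open>\<tau> 0 = 0\<close> up to \<open>\<sigma> * T\<close>. The
    weight is needed only after \<open>\<tau> (Suc j) \<ge> \<tau> 1 = \<sigma> * T / 2\<close>, the
    left end of the time interval in \<open>Estar\<close>.\<close>
  define \<tau> where "\<tau> j = \<sigma> * T * (1 - (1/2)^j)" for j :: nat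
  define Y where "Y j = Lp_on (\<kappa> * \<beta> j) (Q (\<tau> j) T) v" for j
  define A where "A j = E j powr \<mu>2 * (2 * \<kappa>) powr (real j * \<mu>3) * B" for j
  have mu: "\<mu>2 \<ge> 0" "\<mu>3 \<ge> 0" using aa L by (auto simp: \<mu>2_def \<mu>3_def)
  have b_ge: "\<beta> j \<ge> \<alpha>0" for j
  proof -
    have "1 * \<alpha>0 \<le> \<kappa>^j * \<alpha>0" using kap al by (intro mult_right_mono) (auto intro: one_le_power)
    then show ?thesis by (simp add: \<beta>_def)
  qed
  have B_ge: "(2 * \<kappa>) powr \<mu>3 * chi powr (1 / kh) \<le> B"
  proof -
    have g: "1 \<le> 2 powr (4 + 1 / r) * cb1 cbar * (c16 N coef alb)\<^sup>2"
    proof -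
      have "1 \<le> (2::real) powr (4 + 1 / r)" using r0 by (intro ge_one_powr_ge_zero) auto
      moreover have "1 \<le> (c16 N coef alb)\<^sup>2" using c16 by (simp add: one_le_power)
      ultimately have "1 * 1 * 1 \<le> 2 powr (4 + 1 / r) * cb1 cbar * (c16 N coef alb)\<^sup>2"
        using cb by (intro mult_mono) auto
      then show ?thesis by simp
    qed
    have h: "1 \<le> \<alpha>0 powr \<mu>3" "1 \<le> (1 + 1 / (\<sigma> * T)) powr \<mu>2" "1 \<le> (1 + m) powr \<mu>3" "1 \<le> M powr \<mu>2" "1 \<le> Es powr (1 / kh)"
      using al mu m0 M1 Es khp d by (auto intro!: ge_one_powr_ge_zero)
    have gen: "x * y \<le> (x * g1) * g2 * y * g3 * g4 * g5 * g6"
      if "x \<ge> 0" "y \<ge> 0" "1 \<le> g1" "1 \<le> g2" "1 \<le> g3" "1 \<le> g4" "1 \<le> g5" "1 \<le> g6" for x y g1 g2 g3 g4 g5 g6 :: real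
    proof -
      have o: "t \<le> t * u" "0 \<le> t * u" if "0 \<le> t" "1 \<le> u" for t u :: real using that by (auto simp: mult_le_cancel_left1)
      have "x * y \<le> x * y * g1" "0 \<le> x * y * g1" using o[of "x * y" g1] that by auto
      then have "x * y \<le> x * y * g1 * g2" "0 \<le> x * y * g1 * g2" using o[of "x * y * g1" g2] that by auto
      then have "x * y \<le> x * y * g1 * g2 * g3" "0 \<le> x * y * g1 * g2 * g3" using o[of "x * y * g1 * g2" g3] that by auto
      then have "x * y \<le> x * y * g1 * g2 * g3 * g4" "0 \<le> x * y * g1 * g2 * g3 * g4" using o[of "x * y * g1 * g2 * g3" g4] that by auto
      then have "x * y \<le> x * y * g1 * g2 * g3 * g4 * g5" "0 \<le> x * y * g1 * g2 * g3 * g4 * g5" using o[of "x * y * g1 * g2 * g3 * g4" g5] that by auto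
      then have "x * y \<le> x * y * g1 * g2 * g3 * g4 * g5 * g6" using o[of "x * y * g1 * g2 * g3 * g4 * g5" g6] that by auto
      then show ?thesis by (simp only: mult_ac)
    qed
    show ?thesis unfolding B_def by (rule gen[OF _ _ g h]) auto
  qed
  have B1: "B \<ge> 1"
  proof -
    have "1 \<le> (2 * \<kappa>) powr \<mu>3" "1 \<le> chi powr (1 / kh)" using kap mu chi_ge khp by (auto intro!: ge_one_powr_ge_zero)
    then have "1 * 1 \<le> (2 * \<kappa>) powr \<mu>3 * chi powr (1 / kh)" by (intro mult_mono) auto
    then show ?thesis using B_ge by linarith
  qed
  have A1: "A j \<ge> 1" for j
  proof -
    have "1 \<le> E j powr \<mu>2" "1 \<le> (2 * \<kappa>) powr (real j * \<mu>3)" using E1[of j] kap mu by (auto intro!: ge_one_powr_ge_zero)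
    then have "1 * 1 * 1 \<le> A j" unfolding A_def using B1 by (intro mult_mono) auto
    then show ?thesis by simp
  qed
  have tau: "\<tau> j \<ge> 0" "\<tau> j \<le> \<sigma> * T" "\<tau> j < \<tau> (Suc j)" "\<tau> (Suc j) < T" "\<tau> (Suc j) \<ge> \<sigma> * T / 2" "\<tau> (Suc j) - \<tau> j = \<sigma> * T / 2^(j+1)" for j
  proof -
    have h: "0 < (1/2::real)^j" "(1/2::real)^j \<le> 1" by (auto simp: power_le_one)
    show "\<tau> j \<ge> 0" "\<tau> j \<le> \<sigma> * T" unfolding \<tau>_def using h d by (auto simp: mult_le_cancel_left1 mult_le_cancel_left2 intro!: mult_nonneg_nonneg)
    show e: "\<tau> (Suc j) - \<tau> j = \<sigma> * T / 2^(j+1)" by (simp add: \<tau>_def field_simps)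
    have "\<sigma> * T / 2^(j+1) > 0" using d by simp
    then show "\<tau> j < \<tau> (Suc j)" using e by linarith
    have "(1/2::real)^Suc j \<le> 1/2" using h by simp
    then have "\<sigma> * T * (1/2) \<le> \<sigma> * T * (1 - (1/2)^Suc j)" using d by (intro mult_left_mono) auto
    then show "\<tau> (Suc j) \<ge> \<sigma> * T / 2" by (simp add: \<tau>_def)
    have "\<sigma> * T * (1 - (1/2)^Suc j) \<le> \<sigma> * T * 1" using d h by (intro mult_left_mono) auto
    also have "\<dots> < T" using sg T by simp
    finally show "\<tau> (Suc j) < T" by (simp add: \<tau>_def)
  qed
  have step: "Y (Suc j) \<le> A j powr (1 / \<beta> j) * max (Y j powr (rt j / \<beta> j)) (Y j powr (st j / \<beta> j))" for j
  proof -
    have bj: "\<beta> j > 2" by (rule ep(4))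
    have c1: "a \<le> (1 + lam r - \<kappa>\<^sup>2) * \<beta> j"
      using al(3) mult_left_mono[OF b_ge[of j], of "1 + lam r - \<kappa>\<^sup>2"] kap by linarith
    have c2: "4 * (1 - a) \<le> (\<kappa> - 1) * th j * \<beta> j"
    proof -
      have "th j * \<beta> j = \<alpha>0" using kap by (simp add: th_def \<beta>_def power_divide)
      then show ?thesis using al(2) by (simp add: mult.assoc)
    qed
    have Wj: "AE t in lborel. t \<in> {\<tau> (Suc j)<..<T} \<longrightarrow> Wn r t \<le> 4 * chi * Es"
      using W by eventually_elim (use tau(5)[of j] in auto)
    \<comment> \<open>The exponent reached by one step is the one from which the next step
      starts.\<close>
    have kk: "\<kappa>\<^sup>2 * \<beta> j = \<kappa> * \<beta> (Suc j)" by (simp add: \<beta>_def power2_eq_square)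
    define s where "s = \<beta> j * L - a"
    define C1 where "C1 = (1 + m) powr (1 / \<beta> j) * (8 * chi * Es * cb1 cbar) powr (1 / s) *
        ((1 + m) * (\<beta> j * (\<beta> j - 1)) * (2 ^ (j + 1) / (\<sigma> * T) / 2 + CR * (M * E j))) powr (L / s)"
    define C2 where "C2 = (max (Y j powr (\<beta> j - 2)) (Y j powr (\<beta> j + 4 * (1 - a)))) powr (L / s)"
    have "Y (Suc j) \<le> C1 * C2"
    proof -
      have "1 / (\<tau> (Suc j) - \<tau> j) / 2 = 2 ^ (j + 1) / (\<sigma> * T) / 2" unfolding tau(6) by simp
      with moser_step[where p=p and q=q, OF r cbar sob tau(1,3,4) bj kap(1) c1 p pq th c2 Wj Es]
      show ?thesis
        unfolding kk Y_def[symmetric] M_def[symmetric] m_def[symmetric] E_def[symmetric] L_def[symmetric] s_def[symmetric] C1_def C2_def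
        by simp
    qed
    moreover have "C1 \<le> A j powr (1 / \<beta> j)"
      unfolding C1_def s_def A_def B_def \<mu>2_def \<mu>3_def kh_def
    proof (rule moser_constant[OF aa L(1,2) bj])
      have "\<alpha>0 * lam r \<le> \<beta> j * lam r" using b_ge[of j] lmb(2) by (intro mult_right_mono) auto
      then show "a \<le> \<beta> j * (L - 1)" using al(4) by (simp add: L_def)
    qed (use m0 chi_ge Es cb c16 CR0 M1 E1 d CR_le kap al r0 r \<beta>_def in auto)
    moreover have "C2 \<le> max (Y j powr (rt j / \<beta> j)) (Y j powr (st j / \<beta> j))"
      unfolding C2_def s_def rt_def st_def
      by (rule moser_exponents[OF aa L(1) bj]) (use aa in \<open>auto simp: Y_def Lp_on_nonneg\<close>)
    moreover have "0 \<le> C2" by (simp add: C2_def)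
    ultimately show ?thesis by (meson mult_mono order_trans powr_ge_zero)
  qed
  have Y0: "Y j \<ge> 0" for j by (simp add: Y_def Lp_on_nonneg)
  have Yn: "Y 0 = nrm" by (simp add: Y_def nrm_def \<tau>_def \<beta>_def)
  have bpos: "\<beta> j > 0" for j using ep(4)[of j] by linarith
  define G where "G = prodinf (\<lambda>j. st j / \<beta> j) * \<beta> 0 / st 0"
  define \<omega> where "\<omega> = G * (\<kappa>\<^sup>2 / (\<alpha>0 * (\<kappa> - 1)\<^sup>2))"
  define mx where "mx n = max (nrm powr (\<Prod>j<n. rt j / \<beta> j)) (nrm powr (\<Prod>j<n. st j / \<beta> j))" for n
  have Yb: "Y n \<le> B powr \<omega> * mx n" for n
  proof -
    have "Y n \<le> (\<Prod>j<n. A j powr (1 / \<beta> j)) powr (\<Prod>j=1..<n. st j / \<beta> j) * mx n"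
      unfolding mx_def Yn[symmetric] by (rule moser_iterate[where Y=Y and A=A and \<beta>=\<beta> and rt=rt and st=st]) (use Y0 A1 bpos ep(5,6,7) step in auto)
    also have "\<dots> \<le> B powr \<omega> * mx n"
    proof (rule mult_right_mono)
      have P1: "(\<Prod>j<n. A j powr (1 / \<beta> j)) \<ge> 1"
        by (rule prod_ge_1) (use A1 bpos in \<open>auto intro!: ge_one_powr_ge_zero simp: less_imp_le\<close>)
      have "(\<Prod>j<n. A j powr (1 / \<beta> j)) powr (\<Prod>j=1..<n. st j / \<beta> j) \<le> (\<Prod>j<n. A j powr (1 / \<beta> j)) powr G"
        unfolding G_def using P1 ep(3)[of n] by (intro powr_mono) auto
      also have "\<dots> \<le> (B powr (\<kappa>\<^sup>2 / (\<alpha>0 * (\<kappa> - 1)\<^sup>2))) powr G"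
      proof (rule powr_mono2)
        show "(\<Prod>j<n. A j powr (1 / \<beta> j)) \<le> B powr (\<kappa>\<^sup>2 / (\<alpha>0 * (\<kappa> - 1)\<^sup>2))"
          unfolding A_def E_def th_def \<beta>_def
        proof (rule moser_product[OF kap(1) _ chi_ge(1) _ mu khp _ B_ge])
          show "(3 - a) * \<mu>2 * (\<kappa>\<^sup>2 / (\<kappa>\<^sup>2 - 1)) \<le> 1 / kh * (\<kappa> / (\<kappa> - 1)\<^sup>2)"
            unfolding \<mu>2_def kh_def by (rule moser_numeric[OF aa L(1,3) kap(1)]) (use kap in \<open>simp add: L_def\<close>)
        qed (use al aa in auto)
        have "1 \<le> (\<Prod>j=1..<1. st j / \<beta> j)" by simp
        then show "0 \<le> G" using ep(3)[of 1] by (simp add: G_def)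
      qed (use P1 in simp)
      also have "\<dots> = B powr \<omega>" by (simp add: powr_powr \<omega>_def mult.commute)
      finally show "(\<Prod>j<n. A j powr (1 / \<beta> j)) powr (\<Prod>j=1..<n. st j / \<beta> j) \<le> B powr \<omega>" .
    qed (simp add: mx_def le_max_iff_disj)
    finally show ?thesis .
  qed
  have sT: "\<sigma> * T \<ge> 0" using d by simp
  have "v z \<le> B powr \<omega> * max (nrm powr (prodinf (\<lambda>j. rt j / \<beta> j))) (nrm powr (prodinf (\<lambda>j. st j / \<beta> j)))"
  proof (rule le_of_Lp_on_tendsto[OF _ _ _ _ _ _ _ _ z, where p="\<lambda>n. \<kappa> * \<beta> n"])
    show "open (Q (\<sigma> * T) T)" using U_open by (simp add: cyl_def open_Times)
    show "emeasure lborel (Q (\<sigma> * T) T) < \<infinity>" by (rule cyl_sets[OF UO])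
    show "continuous_on (Q (\<sigma> * T) T) v"
      by (rule continuous_on_subset[of "U \<times> {0<..}"]) (use bcfs(2) d in \<open>auto simp: bcf_def cyl_def\<close>)
    have kb: "\<kappa> * \<beta> n > 0" for n using kap bpos by simp
    show "set_integrable lborel (Q (\<sigma> * T) T) (\<lambda>z. v z powr (\<kappa> * \<beta> n))" for n
      by (rule bmeas_integrable[OF bcf_bmeas[OF UO bcf_v_powr[OF kb] sT]])
    show "Lp_on (\<kappa> * \<beta> n) (Q (\<sigma> * T) T) v \<le> B powr \<omega> * mx n" for n
    proof -
      have "(LINT w:Q (\<sigma> * T) T|lborel. v w powr (\<kappa> * \<beta> n)) \<le> (LINT w:Q (\<tau> n) T|lborel. v w powr (\<kappa> * \<beta> n))"
        by (rule bcf_slice_mono_set[OF UO bcf_v_powr[OF kb]]) (use tau in auto)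
      then have "Lp_on (\<kappa> * \<beta> n) (Q (\<sigma> * T) T) v \<le> Y n"
        unfolding Y_def Lp_on_def using kb[of n] by (simp add: nonneg powr_mono2 LINT_nonneg)
      then show ?thesis using Yb[of n] by linarith
    qed
    have "filterlim (\<lambda>n. \<kappa>^n) at_top sequentially"
      by (rule filterlim_at_infinity_imp_filterlim_at_top[OF filterlim_realpow_sequentially_gt1]) (use kap in auto)
    then have "filterlim (\<lambda>n. (\<kappa> * \<alpha>0) * \<kappa>^n) at_top sequentially"
      using kap al by (intro filterlim_tendsto_pos_mult_at_top[OF tendsto_const]) auto
    then show "filterlim (\<lambda>n. \<kappa> * \<beta> n) at_top sequentially" by (simp add: \<beta>_def mult_ac)
    show "(\<lambda>n. B powr \<omega> * mx n) \<longlonglongrightarrow> B powr \<omega> * max (nrm powr (prodinf (\<lambda>j. rt j / \<beta> j))) (nrm powr (prodinf (\<lambda>j. st j / \<beta> j)))"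
    \<comment> \<open>\<open>0 powr x\<close> is 0 for every \<open>x\<close>, so this sequence is
      constant; otherwise the base is nonzero, as the limit rule for \<open>powr\<close>
      requires.\<close>
    proof (cases "nrm = 0")
      case True then show ?thesis by (simp add: mx_def)
    next
      case False
      then show ?thesis unfolding mx_def by (intro tendsto_intros ep(1,2)) auto
    qed
  qed (simp add: nonneg)
  then show ?thesis by (simp only: \<omega>_def G_def)
qed

end
end

theorem theorem4p5:
  fixes N :: nat and alb coef :: "nat \<Rightarrow> real" and k :: "real^3"
    and Rs G \<Omega> :: real and e0 :: "real \<Rightarrow> real^3" and U :: "(real^3) set"
    and u0 :: "real^3 \<Rightarrow> real" and \<psi> \<Psi> u :: "real^3 \<Rightarrow> real \<Rightarrow> real"
    and cbar rstar \<kappa> \<alpha>0 :: real and p q :: "nat \<Rightarrow> real"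
    and a lam0 \<mu>2 \<mu>3 \<kappa>hat chis cbar1 Abar cbar2 \<mu>t \<nu>t \<omega> :: real
    and \<beta> rt st :: "nat \<Rightarrow> real"
  assumes N_ge: "N \<ge> 1"
    and alb0: "alb 0 = 0"
    and alb_mono: "\<forall>i<N. alb i < alb (Suc i)"
    and coef_pos: "\<forall>i\<le>N. coef i > 0"
    and k_unit: "norm k = 1"
    and Rs_nonneg: "Rs \<ge> 0"
    and G_pos: "G > 0" and \<Omega>_nonneg: "\<Omega> \<ge> 0"
    and e0_smooth: "smooth_curve e0" and e0_unit: "\<forall>t. norm (e0 t) = 1"
    and U_open: "open U" and U_bounded: "bounded U" and U_C1: "C1_boundary U"
    and a_def: "a \<equiv> aexp N alb"
    and chis_def: "chis \<equiv> chi_star Rs (chi0 N coef) G \<Omega> U"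
    and cbar_pos: "cbar > 0"
    and sobolev: "\<forall>f. C1c_in U f \<longrightarrow>
        Lp_on (3 * (rstar * (2 - a)) / (3 - rstar * (2 - a))) U f
          \<le> cbar * Lp_on (rstar * (2 - a)) U (\<lambda>x. norm (grad1 f x))"
    and rstar_bounds: "3 / (5 - a) < rstar" "rstar < 1" "rstar \<ge> 1 / (2 - a)"
    and lam0_def: "lam0 \<equiv> (rstar * (5 - a) - 3) / (3 * rstar)"
    and \<kappa>_bounds: "1 < \<kappa>" "\<kappa> < sqrt (1 + lam0)"
    and p_bounds: "\<forall>i\<in>{1..4}. 1 < p i \<and> p i < \<kappa>"
    and pq_conj: "\<forall>i\<in>{1..4}. 1 / p i + 1 / q i = 1"
    and \<alpha>0_ge: "\<alpha>0 \<ge> Max {2 * p 3 * (1 - a) / (\<kappa> - p 3), 4 * (1 - a) / (\<kappa> - 1),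
                             a / (1 + lam0 - \<kappa>\<^sup>2)}"
    and \<alpha>0_gt: "\<alpha>0 > max 2 (a / lam0)"
    and \<beta>_def: "\<beta> \<equiv> (\<lambda>j. \<kappa> ^ j * \<alpha>0)"
    and rt_def: "rt \<equiv> (\<lambda>j. \<beta> j - 2)"
    and st_def: "st \<equiv> (\<lambda>j. (\<beta> j + 4 * (1 - a)) * (1 + a / (\<beta> j - a)))"
    and \<mu>t_def: "\<mu>t \<equiv> prodinf (\<lambda>j. rt j / \<beta> j)"
    and \<nu>t_def: "\<nu>t \<equiv> prodinf (\<lambda>j. st j / \<beta> j)"
    and \<omega>_def: "\<omega> \<equiv> \<nu>t * \<beta> 0 / st 0 * (\<kappa>\<^sup>2 / (\<alpha>0 * (\<kappa> - 1)\<^sup>2))"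
    and \<mu>2_def: "\<mu>2 \<equiv> 1 + a / (1 + lam0)"
    and \<mu>3_def: "\<mu>3 \<equiv> 2 + a / (1 + lam0)"
    and \<kappa>hat_def: "\<kappa>hat \<equiv> 1 + lam0 - a / 2"
    and cbar1_def: "cbar1 \<equiv> max 1 (1 / c10 N coef alb * (cbar / (2 - a)) powr (2 - a))"
    and Abar_def: "Abar \<equiv> 2 powr (4 + 1 / rstar) * cbar1 * (c16 N coef alb)\<^sup>2"
    and cbar2_def: "cbar2 \<equiv> (2 * \<kappa>) powr \<mu>3 * Abar"
    and Psi_reg: "regular_fn U \<Psi>"
    and Psi_ext: "\<forall>x\<in>frontier U. \<forall>t\<ge>0. \<Psi> x t = \<psi> x t"
    and u_sol: "is_solution N coef alb k Rs G \<Omega> e0 U u0 \<psi> u"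
    and u_nonneg: "\<forall>x\<in>closure U. \<forall>t\<ge>0. u x t \<ge> 0"
  shows "\<forall>T>0. \<forall>\<sigma>\<in>{0<..<1}.
    (let ubar = (\<lambda>x t. u x t - \<Psi> x t);
         M1 = Mfun U \<Psi> chis a 0 T (q 1) (q 2) (q 3) (q 4);
         r2 = 2 * rstar / (1 - rstar);
         Estar = max 1 (real_of_ereal (esssup_on {\<sigma> * T / 2<..<T}
                             (\<lambda>t. (Lp_on r2 U (\<lambda>x. 1 + \<bar>\<Psi> x t\<bar>))\<^sup>2))
                        + real_of_ereal (esssup_on {\<sigma> * T / 2<..<T}
                             (\<lambda>t. (Lp_on r2 U (\<lambda>x. ubar x t))\<^sup>2)));
         nrm = Lp_on (\<kappa> * \<alpha>0) (cyl U 0 T) (pt ubar)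
     in Linf_on (cyl U (\<sigma> * T) T) (pt ubar)
        \<le> ereal ((cbar2 * \<alpha>0 powr \<mu>3 * chis powr (1 / \<kappa>hat) * (1 + 1 / (\<sigma> * T)) powr \<mu>2
                   * (1 + measure lborel (cyl U 0 T)) powr \<mu>3 * M1 powr \<mu>2
                   * Estar powr (1 / \<kappa>hat)) powr \<omega>
                  * max (nrm powr \<mu>t) (nrm powr \<nu>t)))"
proof (intro allI ballI impI)
  fix T \<sigma> :: real
  assume T: "T > 0" and sg: "\<sigma> \<in> {0<..<1}"
  interpret rotating_flow N coef alb k Rs G \<Omega> e0 U u0 \<psi> \<Psi> u
    by unfold_locales fact+
  have aeq: "aexp N alb = a" by (simp add: a_def)
  have aa: "0 < a" "a < 1" using a_bounds(1,2) by (simp_all add: a_def)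
  have r: "3 / (5 - aexp N alb) < rstar" "rstar < 1" "rstar \<ge> 1 / (2 - aexp N alb)"
    using rstar_bounds by (simp_all add: aeq)
  have sob: "Lp_on (3 * (rstar * (2 - aexp N alb)) / (3 - rstar * (2 - aexp N alb))) U f
          \<le> cbar * Lp_on (rstar * (2 - aexp N alb)) U (\<lambda>x. norm (grad1 f x))" if "C1c_in U f" for f
    using sobolev that by (simp add: aeq)
  have lam: "lam rstar = lam0" by (simp add: lam_def lam0_def aeq)
  have lmb: "rstar > 1/2" "0 < lam0" using lam_bounds(1,2)[OF r cbar_pos sob] by (simp_all add: lam)
  have k2: "\<kappa>\<^sup>2 < 1 + lam0"
  proof -
    have "\<kappa>\<^sup>2 < (sqrt (1 + lam0))\<^sup>2" using \<kappa>_bounds by (intro power_strict_mono) auto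
    then show ?thesis using lmb by simp
  qed
  have al: "\<alpha>0 > 2" "4 * (1 - a) \<le> (\<kappa> - 1) * \<alpha>0" "a \<le> (1 + lam0 - \<kappa>\<^sup>2) * \<alpha>0" "a \<le> \<alpha>0 * lam0"
  proof -
    show "\<alpha>0 > 2" using \<alpha>0_gt by simp
    have "a / lam0 < \<alpha>0" using \<alpha>0_gt by simp
    then show "a \<le> \<alpha>0 * lam0" using lmb by (simp add: field_simps)
    have "4 * (1 - a) / (\<kappa> - 1) \<le> \<alpha>0" "a / (1 + lam0 - \<kappa>\<^sup>2) \<le> \<alpha>0" using \<alpha>0_ge by auto
    then show "4 * (1 - a) \<le> (\<kappa> - 1) * \<alpha>0" "a \<le> (1 + lam0 - \<kappa>\<^sup>2) * \<alpha>0"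
      using \<kappa>_bounds k2 by (simp_all add: pos_divide_le_eq mult.commute)
  qed
  define r2 where "r2 = 2 * rstar / (1 - rstar)"
  define hP where "hP t = (Lp_on r2 U (\<lambda>x. 1 + \<bar>\<Psi> x t\<bar>))\<^sup>2" for t
  define hu where "hu t = (Lp_on r2 U (\<lambda>x. u x t - \<Psi> x t))\<^sup>2" for t
  let ?I = "{\<sigma> * T / 2<..<T}"
  define Es where "Es = max 1 (real_of_ereal (esssup_on ?I hP) + real_of_ereal (esssup_on ?I hu))"
  have r2: "r2 > 0" unfolding r2_def using lmb r by (intro divide_pos_pos) auto
  have sT: "0 \<le> \<sigma> * T / 2" using T sg by simp
  have W: "AE t in lborel. t \<in> ?I \<longrightarrow> Wn rstar t \<le> 4 * chi_star Rs (chi0 N coef) G \<Omega> U * Es"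
  proof -
    have 1: "AE t in lborel. t \<in> ?I \<longrightarrow> hP t \<le> real_of_ereal (esssup_on ?I hP)"
      using Lp_slice_esssup[OF U_open U_bounded bcfs(3) sT r2, of T] by (simp add: hP_def[abs_def] P_def pt_def)
    have 2: "AE t in lborel. t \<in> ?I \<longrightarrow> hu t \<le> real_of_ereal (esssup_on ?I hu)"
      using Lp_slice_esssup[OF U_open U_bounded bcfs(1) sT r2, of T] by (simp add: hu_def[abs_def] pt_def)
    show ?thesis using 1 2
    proof eventually_elim
      case (elim t)
      show ?case
      proof
        assume t: "t \<in> ?I"
        then have "t > 0" using sT by auto
        then have "Wn rstar t \<le> 4 * chi_star Rs (chi0 N coef) G \<Omega> U * (hP t + hu t)"
          unfolding hP_def hu_def r2_def by (intro Wn_le[OF r cbar_pos sob])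
        also have "\<dots> \<le> 4 * chi_star Rs (chi0 N coef) G \<Omega> U * Es"
        proof (rule mult_left_mono)
          show "hP t + hu t \<le> Es" using elim t by (auto simp: Es_def)
        qed (use chi_ge(1) in simp)
        finally show "Wn rstar t \<le> 4 * chi_star Rs (chi0 N coef) G \<Omega> U * Es" .
      qed
    qed
  qed
  have Es1: "Es \<ge> 1" by (simp add: Es_def)
  define M1 where "M1 = Mfun U \<Psi> chis a 0 T (q 1) (q 2) (q 3) (q 4)"
  define nrm where "nrm = Lp_on (\<kappa> * \<alpha>0) (cyl U 0 T) (pt (\<lambda>x t. u x t - \<Psi> x t))"
  define R where "R = (cbar2 * \<alpha>0 powr \<mu>3 * chis powr (1 / \<kappa>hat) * (1 + 1 / (\<sigma> * T)) powr \<mu>2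
                   * (1 + measure lborel (cyl U 0 T)) powr \<mu>3 * M1 powr \<mu>2
                   * Es powr (1 / \<kappa>hat)) powr \<omega>
                  * max (nrm powr \<mu>t) (nrm powr \<nu>t)"
  have nv: "Lp_on (\<kappa> * \<alpha>0) (cyl U 0 T) v = nrm" by (simp add: nrm_def Lp_on_def v_def)
  \<comment> \<open>Outside the cylinder the function under the essential supremum is 0, so the
    bound must be nonnegative.\<close>
  have R0: "R \<ge> 0" unfolding R_def by (intro mult_nonneg_nonneg) (auto simp: le_max_iff_disj)
  have sup: "v z \<le> R" if z: "z \<in> cyl U (\<sigma> * T) T" for z
  proof -
    have cb: "cb1 cbar = cbar1" by (simp add: cb1_def cbar1_def aeq)
    have pp: "1 < p i \<and> p i < \<kappa>" "1 / p i + 1 / q i = 1" if "i \<in> {1..4}" for i using p_bounds pq_conj that by auto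
    have "v z \<le> R"
      using moser_sup_bound[where p=p and q=q, OF r cbar_pos sob \<kappa>_bounds(1) _ pp al(1) _ _ _ T _ _ W Es1 z] k2 al sg
      unfolding R_def lam aeq cb nv cbar2_def Abar_def \<mu>2_def \<mu>3_def \<kappa>hat_def M1_def chis_def[symmetric] \<omega>_def \<mu>t_def \<nu>t_def st_def rt_def \<beta>_def
      by simp
    then show ?thesis .
  qed
  have "Linf_on (cyl U (\<sigma> * T) T) (pt (\<lambda>x t. u x t - \<Psi> x t)) \<le> ereal R"
    unfolding Linf_on_def
  proof (rule esssup_I)
    have "bmeas (cyl U (\<sigma> * T) T) v" by (rule bcf_bmeas[OF U_open U_bounded bcfs(2)]) (use sT in simp)
    then show "(\<lambda>z. ereal (indicator (cyl U (\<sigma> * T) T) z * \<bar>pt (\<lambda>x t. u x t - \<Psi> x t) z\<bar>)) \<in> borel_measurable lborel"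
      by (intro borel_measurable_ereal) (simp add: bmeas_def set_borel_measurable_def v_def)
    show "AE z in lborel. ereal (indicator (cyl U (\<sigma> * T) T) z * \<bar>pt (\<lambda>x t. u x t - \<Psi> x t) z\<bar>) \<le> ereal R"
    proof (rule AE_I2)
      fix z
      show "ereal (indicator (cyl U (\<sigma> * T) T) z * \<bar>pt (\<lambda>x t. u x t - \<Psi> x t) z\<bar>) \<le> ereal R"
        using sup[of z] R0 by (auto simp: v_def split: split_indicator)
    qed
  qed
  then show "let ubar = (\<lambda>x t. u x t - \<Psi> x t);
         M1 = Mfun U \<Psi> chis a 0 T (q 1) (q 2) (q 3) (q 4);
         r2 = 2 * rstar / (1 - rstar);
         Estar = max 1 (real_of_ereal (esssup_on {\<sigma> * T / 2<..<T}
                             (\<lambda>t. (Lp_on r2 U (\<lambda>x. 1 + \<bar>\<Psi> x t\<bar>))\<^sup>2))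
                        + real_of_ereal (esssup_on {\<sigma> * T / 2<..<T}
                             (\<lambda>t. (Lp_on r2 U (\<lambda>x. ubar x t))\<^sup>2)));
         nrm = Lp_on (\<kappa> * \<alpha>0) (cyl U 0 T) (pt ubar)
     in Linf_on (cyl U (\<sigma> * T) T) (pt ubar)
        \<le> ereal ((cbar2 * \<alpha>0 powr \<mu>3 * chis powr (1 / \<kappa>hat) * (1 + 1 / (\<sigma> * T)) powr \<mu>2
                   * (1 + measure lborel (cyl U 0 T)) powr \<mu>3 * M1 powr \<mu>2
                   * Estar powr (1 / \<kappa>hat)) powr \<omega>
                  * max (nrm powr \<mu>t) (nrm powr \<nu>t))"
    unfolding Let_def R_def Es_def hP_def[abs_def] hu_def[abs_def] r2_def M1_def nrm_def .
qed

end
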